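(* Let $u$ be a nonnegative locally integrable function on $\mathbb{R}^n$. Let $q>2$ and let $v$ be a weight with $v\in \mathrm{RH}_\infty\cap A_q$. Let $m\in\mathbb{N}$, $b\in\mathrm{BMO}$, $\varepsilon>0$, and let $T$ be a Calderón–Zygmund operator. Then for every $p>\max\{q,\,1+(m+1)/\varepsilon\}$ there exists a constant $C>0$ such that \[ uv\left(\left\{x\in\mathbb{R}^n: \frac{|T_b^m(fv)(x)|}{v(x)}>t\right\}\right)\le C\int_{\mathbb{R}^n}\Phi_m\!\left(\|b\|_{\mathrm{BMO}}^m\frac{|f(x)|}{t}\right)M_{\Phi_m^\varepsilon,\,v^{1-q'}}u(x)\,M(\Psi\circ v)(x)\,dx \] for every $t>0$ and every function $f$ (e.g. bounded with compact support), where $\Psi$ is defined with these $p$ and $q$.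
   Context: Here $uv(E)=\int_E u(x)v(x)\,dx$. A weight is a locally integrable $w$ with $0<w<\infty$ a.e.; cubes have sides parallel to the axes. $w\in A_q$ ($1<q<\infty$) means $\sup_Q\left(\frac1{|Q|}\int_Q w\right)\left(\frac1{|Q|}\int_Q w^{1-q'}\right)^{q-1}<\infty$, where $q'=q/(q-1)$. $w\in\mathrm{RH}_\infty$ means $\sup_Q w\le \frac{C}{|Q|}\int_Q w$ for all cubes $Q$. A Calderón–Zygmund operator (CZO) is a linear operator $T$ bounded on $L^2(\mathbb{R}^n)$ such that for $f\in L^2$ with compact support, $Tf(x)=\int K(x-y)f(y)\,dy$ for $x\notin\mathrm{supp} f$, where $K:\mathbb{R}^n\setminus\{0\}\to\mathbb{C}$ satisfies $|K(x)|\lesssim |x|^{-n}$ and $|K(x-y)-K(x-z)|\lesssim |x-z|/|x-y|^{n+1}$ whenever $|x-y|>2|y-z|$. For $b\in L^1_{\rm loc}$, the commutators are $T_b^0=T$, $T_b^kf=bT_b^{k-1}f-T_b^{k-1}(bf)$. $\mathrm{BMO}$ is the space of locally integrable $b$ with $\|b\|_{\mathrm{BMO}}=\sup_Q\frac1{|Q|}\int_Q|b-b_Q|<\infty$, $b_Q$ the average of $b$ over $Q$. For $m\in\mathbb{N}$ and $\varepsilon\ge0$, $\Phi_m^\varepsilon(\lambda)=\lambda(1+\log^+\lambda)^{m+\varepsilon}$ and $\Phi_m=\Phi_m^0$. For $p>q$, $\Psi(\lambda)=\lambda^{p'+1-q'}\mathcal{X}_{[0,1)}(\lambda)+\lambda^{p'}\mathcal{X}_{[1,\infty)}(\lambda)$.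 For a Young function $\varphi$ (convex, strictly increasing, $\varphi(0)=0$, $\varphi(t)\to\infty$) and a weight $w$, $\|f\|_{\varphi,Q,w}=\inf\{\lambda>0:\frac1{w(Q)}\int_Q\varphi(|f|/\lambda)w\le1\}$ and $M_{\varphi,w}f(x)=\sup_{Q\ni x}\|f\|_{\varphi,Q,w}$; $M_\varphi=M_{\varphi,1}$ and $M$ is the Hardy–Littlewood maximal operator.
   Formalization: The smoothness condition on the kernel is taken in its standard form |K(x-y)-K(x-z)| ≲ |y-z|/|x-y|^{n+1}, since with |x-z| in the numerator it would follow from the size bound and the estimate would fail. *)

theory Defs
  imports "HOL-Analysis.Analysis"
begin

definition is_cube :: "'a::euclidean_space set \<Rightarrow> bool" where
  "is_cube Q \<longleftrightarrow> (\<exists>a r. r > 0 \<and> Q = cbox a (a + r *\<^sub>R One))"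

definition avg :: "('a::euclidean_space \<Rightarrow> real) \<Rightarrow> 'a set \<Rightarrow> real" where
  "avg f Q = (LINT x:Q|lebesgue. f x) / measure lebesgue Q"

definition locally_integrable :: "('a::euclidean_space \<Rightarrow> real) \<Rightarrow> bool" where
  "locally_integrable f \<longleftrightarrow> f \<in> borel_measurable lebesgue \<and>
     (\<forall>K. compact K \<longrightarrow> set_integrable lebesgue K f)"

definition is_weight :: "('a::euclidean_space \<Rightarrow> real) \<Rightarrow> bool" where
  "is_weight w \<longleftrightarrow> locally_integrable w \<and> (AE x in lebesgue. 0 < w x)"

definition conj_exp :: "real \<Rightarrow> real" where
  "conj_exp q = q / (q - 1)"

definition A_class :: "real \<Rightarrow> ('a::euclidean_space \<Rightarrow> real) set" where
  "A_class q = {w. is_weight w \<and>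
     (\<forall>Q. is_cube Q \<longrightarrow> set_integrable lebesgue Q (\<lambda>x. w x powr (1 - conj_exp q))) \<and>
     (\<exists>C. \<forall>Q. is_cube Q \<longrightarrow>
        avg w Q * (avg (\<lambda>x. w x powr (1 - conj_exp q)) Q) powr (q - 1) \<le> C)}"

definition RH_infty :: "('a::euclidean_space \<Rightarrow> real) set" where
  "RH_infty = {w. is_weight w \<and>
     (\<exists>C. \<forall>Q. is_cube Q \<longrightarrow> (AE x in lebesgue. x \<in> Q \<longrightarrow> w x \<le> C * avg w Q))}"

definition BMO :: "('a::euclidean_space \<Rightarrow> real) set" where
  "BMO = {b. locally_integrable b \<and>
     bdd_above {avg (\<lambda>x. \<bar>b x - avg b Q\<bar>) Q | Q. is_cube Q}}"

definition bmo_norm :: "('a::euclidean_space \<Rightarrow> real) \<Rightarrow> real" where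
  "bmo_norm b = Sup {avg (\<lambda>x. \<bar>b x - avg b Q\<bar>) Q | Q. is_cube Q}"

definition L2 :: "('a::euclidean_space \<Rightarrow> complex) \<Rightarrow> bool" where
  "L2 f \<longleftrightarrow> f \<in> borel_measurable lebesgue \<and> integrable lebesgue (\<lambda>x. (cmod (f x))\<^sup>2)"

definition L2norm :: "('a::euclidean_space \<Rightarrow> complex) \<Rightarrow> real" where
  "L2norm f = sqrt (\<integral>x. (cmod (f x))\<^sup>2 \<partial>lebesgue)"

text \<open>T is a Calderon-Zygmund operator with kernel K.  Functions are identified up to
  null sets, so linearity and the kernel representation hold almost everywhere.\<close>
definition CZO :: "(('a::euclidean_space \<Rightarrow> complex) \<Rightarrow> 'a \<Rightarrow> complex) \<Rightarrow> ('a \<Rightarrow> complex) \<Rightarrow> bool" where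
  "CZO T K \<longleftrightarrow>
     (\<forall>f g. L2 f \<longrightarrow> L2 g \<longrightarrow> (AE x in lebesgue. T (\<lambda>y. f y + g y) x = T f x + T g x)) \<and>
     (\<forall>f c. L2 f \<longrightarrow> (AE x in lebesgue. T (\<lambda>y. c * f y) x = c * T f x)) \<and>
     (\<exists>C. \<forall>f. L2 f \<longrightarrow> L2 (T f) \<and> L2norm (T f) \<le> C * L2norm f) \<and>
     K \<in> borel_measurable lebesgue \<and>
     (\<exists>C. \<forall>x. x \<noteq> 0 \<longrightarrow> cmod (K x) \<le> C / norm x ^ DIM('a)) \<and>
     (\<exists>C. \<forall>x y z. norm (x - y) > 2 * norm (y - z) \<longrightarrow>
         cmod (K (x - y) - K (x - z)) \<le> C * norm (y - z) / norm (x - y) ^ (DIM('a) + 1)) \<and>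
     (\<forall>f S. L2 f \<longrightarrow> compact S \<longrightarrow> (AE y in lebesgue. y \<notin> S \<longrightarrow> f y = 0) \<longrightarrow>
         (AE x in lebesgue. x \<notin> S \<longrightarrow> T f x = (\<integral>y. K (x - y) * f y \<partial>lebesgue)))"

fun commutator :: "(('a \<Rightarrow> complex) \<Rightarrow> 'a \<Rightarrow> complex) \<Rightarrow> ('a \<Rightarrow> real) \<Rightarrow> nat
                   \<Rightarrow> ('a \<Rightarrow> complex) \<Rightarrow> 'a \<Rightarrow> complex" where
  "commutator T b 0 f = T f"
| "commutator T b (Suc k) f =
     (\<lambda>x. of_real (b x) * commutator T b k f x - commutator T b k (\<lambda>y. of_real (b y) * f y) x)"

definition log_plus :: "real \<Rightarrow> real" where
  "log_plus t = (if t > 1 then ln t else 0)"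

definition Phi :: "nat \<Rightarrow> real \<Rightarrow> real \<Rightarrow> real" where
  "Phi m \<epsilon> t = t * (1 + log_plus t) powr (real m + \<epsilon>)"

definition Psi :: "real \<Rightarrow> real \<Rightarrow> real \<Rightarrow> real" where
  "Psi p q t = (if t < 1 then t powr (conj_exp p + 1 - conj_exp q) else t powr (conj_exp p))"

definition lux_norm :: "(real \<Rightarrow> real) \<Rightarrow> ('a::euclidean_space \<Rightarrow> real) \<Rightarrow> 'a set
                        \<Rightarrow> ('a \<Rightarrow> real) \<Rightarrow> ennreal" where
  "lux_norm \<phi> w Q f = Inf {ennreal s | s. s > 0 \<and>
      (\<integral>\<^sup>+x\<in>Q. ennreal (\<phi> (\<bar>f x\<bar> / s) * w x) \<partial>lebesgue) \<le> ennreal (LINT x:Q|lebesgue. w x)}"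

definition orlicz_max :: "(real \<Rightarrow> real) \<Rightarrow> ('a::euclidean_space \<Rightarrow> real) \<Rightarrow> ('a \<Rightarrow> real)
                          \<Rightarrow> 'a \<Rightarrow> ennreal" where
  "orlicz_max \<phi> w f x = (SUP Q\<in>{Q. is_cube Q \<and> x \<in> Q}. lux_norm \<phi> w Q f)"

definition HL_max :: "('a::euclidean_space \<Rightarrow> real) \<Rightarrow> 'a \<Rightarrow> ennreal" where
  "HL_max f x = (SUP Q\<in>{Q. is_cube Q \<and> x \<in> Q}.
      (\<integral>\<^sup>+y\<in>Q. ennreal \<bar>f y\<bar> \<partial>lebesgue) / ennreal (measure lebesgue Q))"

end

(* The commutator is dominated in integrated form: for every G >= 0,
     int |T_b^m F| G <= C int sup_Q <B_Q |F|>_{3Q} <B_Q G>_Q,   B_Q = (1 + |b - b_Q|)^m,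
   the supremum running over the dyadic cubes Q containing the point.  This follows by iterating one
   stopping step that uses only the weak (1,1) bound of T on (b - b_Q)^i F, so there is no induction
   on m.  With G = |T_b^m F|^(r-1) w, r = p', and w split according to log(w/W_Q) ~ 2^i, Hoelder's
   inequality with exponents tending to the conjugate ones as i grows and John-Nirenberg give
     int |T_b^m F|^r w <= C int |F|^r W   if the Phi_m^eps-averages of w are controlled by W,
   which requires m + eps > (m+1) r - 1, that is p > 1 + (m+1)/eps.

   For the weak type bound let Q_j be the maximal dyadic cubes with int_Q Phi_m(|f|) v > v(Q) and
   E the union of the 3Q_j.  Outside E the strong bound applies to w = u v^(1-r) 1_{-E}; a cube Q not
   contained in E contains every Q_j that meets 3Q, and there the averages of B_Q |f| v are dominated
   by those of B_Q v, so that |f| may be replaced by 1 on the Q_j and no cancellation is needed.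
   RH_infty and A_q enter through v <= C v_Q and (v^(1-q'))_Q <= C v^(1-q') on Q and doubling. *)

theory Submission
 imports Defs
begin

text \<open>The condition on \<open>p\<close> is a balance on the level where
  \<open>log (w / W_Q)\<close> is about \<open>2^i\<close>. The factor \<open>B_Q\<close> costs
  \<open>2^(i m)\<close> there; the bump of exponent \<kappa> = m + \<epsilon> gains
  \<open>2^(-i \<kappa> / r)\<close>; the maximal theorem is used at an exponent exceeding 1 by a
  multiple of \<open>2^(-i)\<close> and costs \<open>2^(i / r')\<close>. The product decays
  geometrically exactly if \<kappa> > (m + 1) r - 1. The theorem measures \<open>u\<close> by a norm
  taken with respect to \<sigma> = v^(1 - q'), while the strong bound wants
  \<open>w = u v^(1 - r)\<close> and Lebesgue measure. Since \<open>p > q\<close>,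
  \<open>v^(1 - r)\<close> is a power \<sigma>^t with \<open>t < 1\<close>, and the gap between
  \<open>t\<close> and 1 absorbs the logarithms. The price is a factor \<open>1 + \<sigma>\<close>,
  and \<open>v^r (1 + \<sigma>)\<close> has the two branches of \<open>Psi\<close> as its dominant
  terms. On a stopping cube only the integral of \<open>Phi_m (|f|)\<close> is bounded below, so the
  maximal function of the weight must not vary there. It does not, because the weight is cut off on
  the triple of the cube, and every cube that reaches the remaining mass is coarse.\<close>

abbreviation (input) lm :: "('a::euclidean_space \<Rightarrow> 'b::topological_space) \<Rightarrow> bool" where
 "lm f \<equiv> f \<in> borel_measurable lebesgue"

abbreviation (input) leb :: "'a::euclidean_space set \<Rightarrow> ennreal" where
 "leb \<equiv> emeasure lebesgue"

abbreviation (input) enorm :: "complex \<Rightarrow> ennreal" where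
 "enorm z \<equiv> ennreal (cmod z)"

syntax
 "_csum" :: "pttrn \<Rightarrow> 'a set \<Rightarrow> ennreal \<Rightarrow> ennreal" ("(2\<Sum>\<^sup>+_\<in>_./ _)" [0,51,10] 10)
 "_lint" :: "pttrn \<Rightarrow> ennreal \<Rightarrow> ennreal" ("(2\<integral>_./ _)" [0,10] 10)
 "_sint" :: "pttrn \<Rightarrow> 'a set \<Rightarrow> ennreal \<Rightarrow> ennreal" ("(2\<integral>_\<in>_./ _)" [0,0,10] 10)
 "_lae" :: "pttrn \<Rightarrow> bool \<Rightarrow> bool" ("(2AE _./ _)" [0,10] 10)
translations
 "\<Sum>\<^sup>+x\<in>A. f" \<rightharpoonup> "CONST nn_integral (CONST count_space A) (\<lambda>x. f)"
 "\<integral>x. f" \<rightharpoonup> "CONST nn_integral (CONST lebesgue) (\<lambda>x. f)"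
 "\<integral>x\<in>A. f" \<rightharpoonup> "CONST set_nn_integral (CONST lebesgue) A (\<lambda>x. f)"
 "AE x. P" \<rightharpoonup> "CONST almost_everywhere (CONST lebesgue) (\<lambda>x. P)"

section \<open>Dyadic cubes\<close>

text \<open>A cell is addressed by a level and any of its points, not by a lattice index. Nesting
  and equality of cells then reduce to statements about floors.\<close>

definition dc :: "int \<Rightarrow> 'a::euclidean_space \<Rightarrow> 'a set" where
 "dc k x = {y. \<forall>i\<in>Basis. \<lfloor>2 powi k * (y \<bullet> i)\<rfloor> = \<lfloor>2 powi k * (x \<bullet> i)\<rfloor>}"

abbreviation cell :: "int \<times> 'a::euclidean_space \<Rightarrow> 'a set" where
 "cell \<equiv> \<lambda>(k, z). dc k z"

text \<open>The cell \<open>dc k x\<close> has side \<open>2\<close> to the power \<open>-k\<close>; \<open>trip k x\<close> is the union of that cell and its neighbours.\<close>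

definition trip :: "int \<Rightarrow> 'a::euclidean_space \<Rightarrow> 'a set" where
 "trip k x = {y. \<forall>i\<in>Basis. \<bar>\<lfloor>2 powi k * (y \<bullet> i)\<rfloor> - \<lfloor>2 powi k * (x \<bullet> i)\<rfloor>\<bar> \<le> 1}"

text \<open>The lower corner. It lies in the half-open cell and serves as its canonical point: a
  family of cells named by corners names no cell twice.\<close>

definition cn :: "int \<Rightarrow> 'a::euclidean_space \<Rightarrow> 'a" where
 "cn k x = (\<Sum>i\<in>Basis. (of_int \<lfloor>2 powi k * (x \<bullet> i)\<rfloor> * 2 powi (- k)) *\<^sub>R i)"

definition dside :: "int \<Rightarrow> real" where
 "dside k = 2 powi (- k)"

text \<open>The type argument carries the dimension, which the level alone does not
  determine.\<close>

definition dvol :: "'a::euclidean_space itself \<Rightarrow> int \<Rightarrow> real" where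
 "dvol _ k = dside k ^ DIM('a)"

lemma dside_pos [simp]: "dside k > 0" "dside k \<ge> 0" "dside k \<noteq> 0"
 by (auto simp: dside_def)

lemma dvol_pos [simp]: "dvol a k > 0" "dvol a k \<ge> 0" "dvol a k \<noteq> 0"
 by (auto simp: dvol_def)

lemma dside_minus: "dside (k - int l) = 2 ^ l * dside k"
 by (simp add: dside_def power_int_diff power_int_minus field_simps)

lemma dvol_minus: "dvol TYPE('a::euclidean_space) (k - int l) = 2 ^ (l * DIM('a)) * dvol TYPE('a) k"
 by (simp add: dvol_def dside_minus power_mult_distrib power_mult)

lemma dvol_pred: "dvol TYPE('a::euclidean_space) (k - 1) = 2 ^ DIM('a) * dvol TYPE('a) k"
 using dvol_minus[of k 1, where 'a='a] by simp

lemma cn_inner: "i \<in> Basis \<Longrightarrow> cn k x \<bullet> i = of_int \<lfloor>2 powi k * (x \<bullet> i)\<rfloor> * dside k"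
 by (simp add: cn_def dside_def inner_sum_left_Basis)

lemma dc_self [simp]: "x \<in> dc k x" by (simp add: dc_def)
lemma trip_self [simp]: "x \<in> trip k x" by (simp add: trip_def)
lemma dc_sym: "y \<in> dc k x \<longleftrightarrow> x \<in> dc k y" by (auto simp: dc_def)
lemma trip_sym: "y \<in> trip k x \<longleftrightarrow> x \<in> trip k y" by (auto simp: trip_def abs_minus_commute)
lemma dc_eq: "y \<in> dc k x \<Longrightarrow> dc k y = dc k x" by (auto simp: dc_def)
lemma trip_eq: "y \<in> dc k x \<Longrightarrow> trip k y = trip k x" by (auto simp: dc_def trip_def)
lemma cn_eq: "y \<in> dc k x \<Longrightarrow> cn k y = cn k x" by (auto simp: dc_def cn_def)
lemma dc_subset_trip: "dc k x \<subseteq> trip k x" by (auto simp: dc_def trip_def)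
lemma trip_cell: "y \<in> trip k x \<Longrightarrow> z \<in> dc k y \<Longrightarrow> z \<in> trip k x" by (auto simp: dc_def trip_def)
lemma trip_cell_subset: "y \<in> trip k x \<Longrightarrow> dc k y \<subseteq> trip k x" using trip_cell by blast

lemma dside_mult [simp]: "2 powi k * (r * dside k) = r" "2 powi k * dside k = 1"
 by (auto simp: dside_def power_int_minus)

lemma cn_in_dc [simp]: "cn k x \<in> dc k x"
 by (simp add: dc_def cn_inner)

lemma dc_cn [simp]: "dc k (cn k x) = dc k x" using cn_in_dc by (rule dc_eq)
lemma floor_scale_eq: "\<lfloor>2 powi k * t\<rfloor> = z \<longleftrightarrow> of_int z * dside k \<le> t \<and> t < (of_int z + 1) * dside k"
proof -
 have "\<lfloor>2 powi k * t\<rfloor> = z \<longleftrightarrow> of_int z \<le> 2 powi k * t \<and> 2 powi k * t < of_int z + 1"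
  by linarith
 moreover have "of_int z * dside k \<le> t \<longleftrightarrow> of_int z \<le> 2 powi k * t"
  by (simp add: dside_def power_int_minus field_simps)
 moreover have "t < (of_int z + 1) * dside k \<longleftrightarrow> 2 powi k * t < of_int z + 1"
  by (simp add: dside_def power_int_minus field_simps)
 ultimately show ?thesis by simp
qed

lemma floor_scale_le: "z \<le> \<lfloor>2 powi k * t\<rfloor> \<longleftrightarrow> of_int z * dside k \<le> t"
 by (simp add: le_floor_iff dside_def power_int_minus field_simps)

lemma floor_scale_less: "\<lfloor>2 powi k * t\<rfloor> < z \<longleftrightarrow> t < of_int z * dside k"
 by (simp add: floor_less_iff dside_def power_int_minus field_simps)

lemma dc_box: "y \<in> dc k x \<longleftrightarrow> (\<forall>i\<in>Basis. cn k x \<bullet> i \<le> y \<bullet> i \<and> y \<bullet> i < cn k x \<bullet> i + dside k)"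
 by (simp add: dc_def cn_inner floor_scale_eq distrib_right)

lemma trip_box: "y \<in> trip k x \<longleftrightarrow> (\<forall>i\<in>Basis. cn k x \<bullet> i - dside k \<le> y \<bullet> i \<and> y \<bullet> i < cn k x \<bullet> i + 2 * dside k)"
proof -
 have "\<bar>\<lfloor>2 powi k * (y \<bullet> i)\<rfloor> - z\<bar> \<le> 1 \<longleftrightarrow> z - 1 \<le> \<lfloor>2 powi k * (y \<bullet> i)\<rfloor> \<and> \<lfloor>2 powi k * (y \<bullet> i)\<rfloor> < z + 2"
  for z i by linarith
 then show ?thesis
  unfolding trip_def mem_Collect_eq
  by (simp add: cn_inner floor_scale_le floor_scale_less distrib_right left_diff_distrib)
qed

lemma floor_scale_pred: "\<lfloor>2 powi (k - 1) * t\<rfloor> = \<lfloor>2 powi k * t\<rfloor> div 2" for t :: real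
proof -
 have e: "2 powi (k - 1) * t = (2 powi k * t) / real_of_int 2"
  using power_int_diff[of "2::real" k 1] by simp
 show ?thesis unfolding e by (rule floor_divide_real_eq_div) simp
qed

lemma dc_pred: "dc k x \<subseteq> dc (k - 1) x"
 by (auto simp: dc_def floor_scale_pred)

lemma trip_pred: "trip k x \<subseteq> trip (k - 1) x"
proof
 fix y assume "y \<in> trip k x"
 then have "\<bar>\<lfloor>2 powi k * (y \<bullet> i)\<rfloor> - \<lfloor>2 powi k * (x \<bullet> i)\<rfloor>\<bar> \<le> 1" if "i \<in> Basis" for i
  using that by (auto simp: trip_def)
 moreover have "\<bar>a - b\<bar> \<le> 1 \<Longrightarrow> \<bar>a div 2 - b div 2\<bar> \<le> 1" for a b :: int by linarith
 ultimately show "y \<in> trip (k - 1) x" by (simp add: trip_def floor_scale_pred)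
qed

text \<open>Points of one triple have floors at most 2 apart, and halving the floors brings them
  within 1. So a triple lies in the triple, one level coarser, around each of its points.\<close>

lemma trip_trip_pred:
 assumes "y \<in> trip k q" "z \<in> trip k q" shows "z \<in> trip (k - 1) y"
proof -
 have "\<bar>\<lfloor>2 powi k * (z \<bullet> i)\<rfloor> - \<lfloor>2 powi k * (y \<bullet> i)\<rfloor>\<bar> \<le> 2" if "i \<in> Basis" for i
 proof -
  have "\<bar>\<lfloor>2 powi k * (z \<bullet> i)\<rfloor> - \<lfloor>2 powi k * (q \<bullet> i)\<rfloor>\<bar> \<le> 1"
   "\<bar>\<lfloor>2 powi k * (y \<bullet> i)\<rfloor> - \<lfloor>2 powi k * (q \<bullet> i)\<rfloor>\<bar> \<le> 1"
   using that assms by (auto simp: trip_def)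
  then show ?thesis by linarith
 qed
 moreover have "\<bar>a - b\<bar> \<le> 2 \<Longrightarrow> \<bar>a div 2 - b div 2\<bar> \<le> 1" for a b :: int by linarith
 ultimately show "z \<in> trip (k - 1) y" by (simp add: trip_def floor_scale_pred)
qed

lemma dc_mono: assumes "k \<le> k'" shows "dc k' x \<subseteq> dc k x"
 using assms by (induction k' rule: int_ge_induct) (use dc_pred in fastforce)+

lemma trip_mono: assumes "k \<le> k'" shows "trip k' x \<subseteq> trip k x"
 using assms by (induction k' rule: int_ge_induct) (use trip_pred in fastforce)+

lemma dc_nested: "k \<le> k' \<Longrightarrow> y \<in> dc k x \<Longrightarrow> dc k' y \<subseteq> dc k x"
 using dc_mono dc_eq by blast

lemma dc_trip_nested: "k \<le> k' \<Longrightarrow> y \<in> trip k x \<Longrightarrow> dc k' y \<subseteq> trip k x"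
 using dc_mono trip_cell_subset by blast

lemma dc_meet: "k \<le> k' \<Longrightarrow> dc k x \<inter> dc k' z \<noteq> {} \<Longrightarrow> dc k' z \<subseteq> dc k x"
 using dc_nested dc_eq by blast

lemma trip_dc_mono: "k \<le> k' \<Longrightarrow> y \<in> dc k x \<Longrightarrow> trip k' y \<subseteq> trip k x"
 using trip_mono trip_eq by blast

lemma dc_borel [measurable]: "dc k x \<in> sets borel"
 unfolding dc_def by measurable

lemma trip_borel [measurable]: "trip k x \<in> sets borel"
proof -
 have "trip k x = {y. \<forall>i\<in>Basis. cn k x \<bullet> i - dside k \<le> y \<bullet> i \<and> y \<bullet> i < cn k x \<bullet> i + 2 * dside k}"
  by (auto simp: trip_box)
 then show ?thesis by simp
qed

lemma dc_lebesgue [measurable, simp]: "dc k x \<in> sets lebesgue"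
 using dc_borel by (simp add: sets_completionI_sets)

lemma trip_lebesgue [measurable, simp]: "trip k x \<in> sets lebesgue"
 using trip_borel by (simp add: sets_completionI_sets)

lemma dc_cbox: "dc k x \<subseteq> cbox (cn k x) (cn k x + dside k *\<^sub>R One)"
 by (auto simp: dc_box mem_box inner_add_left less_imp_le)

lemma dc_box_sub: "box (cn k x) (cn k x + dside k *\<^sub>R One) \<subseteq> dc k x"
 by (auto simp: dc_box mem_box inner_add_left less_imp_le)

text \<open>The notions of the theorem speak of closed cubes. \<open>tcl\<close> and
  \<open>dcl\<close> are the closures of the half-open triple and cell; they differ from them by
  null sets, so integrals pass from one to the other.\<close>

definition tcl :: "int \<Rightarrow> 'a::euclidean_space \<Rightarrow> 'a set" where
 "tcl k x = cbox (cn k x - dside k *\<^sub>R One) ((cn k x - dside k *\<^sub>R One) + (3 * dside k) *\<^sub>R One)"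

definition dcl :: "int \<Rightarrow> 'a::euclidean_space \<Rightarrow> 'a set" where
 "dcl k x = cbox (cn k x) (cn k x + dside k *\<^sub>R One)"

lemma trip_tcl: "trip k x \<subseteq> tcl k x"
 by (auto simp: trip_box tcl_def mem_box inner_diff_left inner_add_left less_imp_le algebra_simps)

lemma trip_box_sub: "box (cn k x - dside k *\<^sub>R One) ((cn k x - dside k *\<^sub>R One) + (3 * dside k) *\<^sub>R One) \<subseteq> trip k x"
 by (auto simp: trip_box mem_box inner_diff_left inner_add_left less_imp_le algebra_simps)

lemma dc_dcl: "dc k x \<subseteq> dcl k x" unfolding dcl_def by (rule dc_cbox)

lemma is_cube_tcl: "is_cube (tcl k x)" unfolding is_cube_def tcl_def
 by (intro exI[of _ "cn k x - dside k *\<^sub>R One"] exI[of _ "3 * dside k"]) auto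

lemma is_cube_dcl: "is_cube (dcl k x)" unfolding is_cube_def dcl_def
 by (intro exI[of _ "cn k x"] exI[of _ "dside k"]) auto

lemma emeasure_cube:
 fixes a :: "'a::euclidean_space"
 assumes "r \<ge> 0"
 shows "leb (cbox a (a + r *\<^sub>R One)) = ennreal (r ^ DIM('a))"
  "leb (box a (a + r *\<^sub>R One)) = ennreal (r ^ DIM('a))"
 using assms by (auto simp: emeasure_lborel_cbox_eq emeasure_lborel_box_eq inner_add_left)

lemma emeasure_sandwich_cube:
 fixes a :: "'a::euclidean_space"
 assumes "r \<ge> 0" "box a (a + r *\<^sub>R One) \<subseteq> A" "A \<subseteq> cbox a (a + r *\<^sub>R One)" "A \<in> sets lebesgue"
 shows "leb A = ennreal (r ^ DIM('a))"
proof (rule antisym)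
 show "leb A \<le> ennreal (r ^ DIM('a))"
  using emeasure_mono[OF assms(3), of lebesgue] emeasure_cube(1)[OF assms(1), of a] by simp
 show "ennreal (r ^ DIM('a)) \<le> leb A"
  using emeasure_mono[OF assms(2,4)] emeasure_cube(2)[OF assms(1), of a] by simp
qed

lemma emeasure_dc: "leb (dc k (x::'a::euclidean_space)) = ennreal (dvol TYPE('a) k)"
 unfolding dvol_def using emeasure_sandwich_cube[OF _ dc_box_sub dc_cbox] by simp

lemma emeasure_trip: "leb (trip k (x::'a::euclidean_space)) = ennreal (3 ^ DIM('a) * dvol TYPE('a) k)"
 unfolding dvol_def using emeasure_sandwich_cube[OF _ trip_box_sub trip_tcl[unfolded tcl_def]]
 by (simp add: power_mult_distrib)

lemma emeasure_tcl: "leb (tcl k (x::'a::euclidean_space)) = ennreal (3 ^ DIM('a) * dvol TYPE('a) k)"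
 unfolding dvol_def tcl_def using emeasure_cube(1)[of "3 * dside k"] by (simp add: power_mult_distrib)

lemma emeasure_dcl: "leb (dcl k (x::'a::euclidean_space)) = ennreal (dvol TYPE('a) k)"
 unfolding dvol_def dcl_def using emeasure_cube(1)[of "dside k"] by simp

lemma cube_lebesgue [simp, measurable]: "tcl k x \<in> sets lebesgue" "dcl k x \<in> sets lebesgue"
 unfolding tcl_def dcl_def by auto

lemma subset_null:
 assumes "A \<subseteq> B" "A \<in> sets M" "B \<in> sets M" "emeasure M A = emeasure M B" "emeasure M B < \<infinity>"
 shows "B - A \<in> null_sets M"
 using emeasure_Diff[of M A B] assms by (auto simp: null_sets_def)

lemma tcl_trip_null: "tcl k x - trip k x \<in> null_sets lebesgue"
 by (rule subset_null) (auto simp: trip_tcl emeasure_trip emeasure_tcl)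

lemma dcl_dc_null: "dcl k x - dc k x \<in> null_sets lebesgue"
 by (rule subset_null) (auto simp: dc_dcl emeasure_dc emeasure_dcl)

lemma nn_integral_tcl: "(\<integral>y\<in>tcl k x. f y) = (\<integral>y\<in>trip k x. f y)"
proof (rule nn_integral_null_delta)
 have "trip k x - tcl k x = {}" using trip_tcl by blast
 then show "tcl k x - trip k x \<union> (trip k x - tcl k x) \<in> null_sets lebesgue" using tcl_trip_null[of k x] by (metis Un_empty_right)
qed auto

lemma nn_integral_dcl: "(\<integral>y\<in>dcl k x. f y) = (\<integral>y\<in>dc k x. f y)"
proof (rule nn_integral_null_delta)
 have "dc k x - dcl k x = {}" using dc_dcl by blast
 then show "dcl k x - dc k x \<union> (dc k x - dcl k x) \<in> null_sets lebesgue" using dcl_dc_null[of k x] by (metis Un_empty_right)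
qed auto

lemma countable_corners: "countable (range (cn k :: 'a::euclidean_space \<Rightarrow> 'a))"
proof -
 let ?F = "\<lambda>z::'a \<Rightarrow> int. (\<Sum>i\<in>Basis. (of_int (z i) * 2 powi (- k)) *\<^sub>R i) :: 'a"
 have "range (cn k :: 'a \<Rightarrow> 'a) \<subseteq> ?F ` (Pi\<^sub>E Basis (\<lambda>_. UNIV))"
 proof
  fix y assume "y \<in> range (cn k :: 'a \<Rightarrow> 'a)"
  then obtain x :: 'a where y: "y = cn k x" by auto
  show "y \<in> ?F ` (Pi\<^sub>E Basis (\<lambda>_. UNIV))"
   by (rule image_eqI[of _ _ "restrict (\<lambda>i. \<lfloor>2 powi k * (x \<bullet> i)\<rfloor>) Basis"])
    (auto simp: y cn_def intro!: sum.cong)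
 qed
 moreover have "countable (Pi\<^sub>E (Basis::'a set) (\<lambda>_. UNIV :: int set))"
  by (intro countable_PiE) auto
 ultimately show ?thesis by (rule countable_subset[OF _ countable_image])
qed

lemma trip_bounded: "bounded (trip k x)" using bounded_subset[OF bounded_cbox trip_tcl[unfolded tcl_def]] .

lemma dside_small: "e > 0 \<Longrightarrow> \<exists>k\<ge>k0. dside k < e"
proof -
 assume "e > 0"
 then obtain n where "(1/2) ^ n < e / dside k0"
  using real_arch_pow_inv[of "e / dside k0" "1/2"] by auto
 then have "dside (k0 + int n) < e"
  using dside_minus[of "k0 + int n" n] by (simp add: field_simps power_divide)
 then show ?thesis by (intro exI[of _ "k0 + int n"]) auto
qed

lemma dside_large: "\<exists>k. \<forall>k'\<le>k. dside k' > (e::real)"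
proof -
 obtain n where n: "2 ^ n > e" using real_arch_pow[of 2 e] by auto
 have "dside k' > e" if "k' \<le> - int n" for k'
 proof -
  have "dside k' = 2 powi (- k')" by (simp add: dside_def)
  also have "\<dots> \<ge> 2 powi (int n)" using that by (intro power_int_increasing) auto
  finally show ?thesis using n by simp
 qed
 then show ?thesis by blast
qed

lemma dc_dist:
 fixes x :: "'a::euclidean_space"
 assumes "y \<in> dc k x" "z \<in> dc k x" shows "norm (y - z) \<le> sqrt (DIM('a)) * dside k"
proof -
 have "\<bar>(y - z) \<bullet> i\<bar> \<le> dside k" if "i \<in> Basis" for i
  using assms that by (force simp: dc_box inner_diff_left)
 then have "norm (y - z) \<le> sqrt (\<Sum>i\<in>(Basis::'a set). (dside k)\<^sup>2)"
  unfolding norm_eq_sqrt_inner[of "y - z"] euclidean_inner[of "y-z" "y-z"]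
  by (intro real_sqrt_le_mono sum_mono) (use abs_le_square_iff in \<open>fastforce simp: power2_eq_square\<close>)
 also have "\<dots> = sqrt (DIM('a)) * dside k"
  by (simp add: real_sqrt_mult)
 finally show ?thesis .
qed

lemma trip_dist: assumes "y \<in> dc k x" "z \<notin> trip k x" shows "dside k \<le> norm (y - z)"
proof -
 obtain i where i: "i \<in> Basis" "\<not> (cn k x \<bullet> i - dside k \<le> z \<bullet> i \<and> z \<bullet> i < cn k x \<bullet> i + 2 * dside k)"
  using assms by (auto simp: trip_box)
 then have "dside k \<le> \<bar>(y - z) \<bullet> i\<bar>"
  using assms(1) by (force simp: dc_box inner_diff_left)
 also have "\<dots> \<le> norm (y - z)" using Basis_le_norm[OF i(1)] .
 finally show ?thesis .
qed

lemma bounded_in_trip: assumes "bounded S" shows "\<exists>K. \<forall>k\<le>K. \<forall>x\<in>S. S \<subseteq> trip k x"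
proof -
 obtain B where B: "\<And>x y. x \<in> S \<Longrightarrow> y \<in> S \<Longrightarrow> norm (x - y) < B"
 proof -
  from assms obtain C where "\<And>x. x \<in> S \<Longrightarrow> norm x \<le> C" by (auto simp: bounded_iff)
  then show ?thesis using that[of "2 * C + 1"] norm_triangle_ineq4 by (smt (verit, best))
 qed
 obtain K where K: "\<And>k. k \<le> K \<Longrightarrow> dside k > B" using dside_large by blast
 have "S \<subseteq> trip k x" if "k \<le> K" "x \<in> S" for k x
  using trip_dist[OF dc_self] K[OF that(1)] B[OF that(2)] by (meson less_le_not_le order_trans subsetI leD le_less_trans)
 then show ?thesis by blast
qed

text \<open>The cells around a point grow only to an orthant, because the coordinate hyperplanes are
  walls of every level. Their triples do fill the space, so exhaustions are made by triples.\<close>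

lemma UN_trip: "(\<Union>l. trip (k - int l) x) = UNIV"
proof -
 have "z \<in> (\<Union>l. trip (k - int l) x)" for z :: 'a
 proof -
  obtain K where K: "\<forall>k\<le>K. \<forall>x'\<in>{x,z}. {x,z} \<subseteq> trip k x'" using bounded_in_trip[of "{x,z}"] by auto
  have "k - int (nat (k - K)) \<le> K" by simp
  then show ?thesis using K by blast
 qed
 then show ?thesis by blast
qed

subsection \<open>Stopping cubes\<close>

text \<open>A family of cells is encoded by pairs of a level and one point of the cell.\<close>

lemma stopping_cubes:
 fixes P :: "int \<Rightarrow> 'a::euclidean_space \<Rightarrow> bool"
 assumes compat: "\<And>k x y. y \<in> dc k x \<Longrightarrow> P k y = P k x"
  and bnd: "\<And>x. \<exists>K. \<forall>k<K. \<not> P k x"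
 obtains J :: "(int \<times> 'a) set" where "countable J" "\<And>k z. (k, z) \<in> J \<Longrightarrow> P k z"
  "\<And>k z k'. (k, z) \<in> J \<Longrightarrow> k' < k \<Longrightarrow> \<not> P k' z"
  "disjoint_family_on cell J"
  "(\<Union>(cell ` J)) = {x. \<exists>k. P k x}"
proof -
 define \<Omega> where "\<Omega> = {x. \<exists>k. P k x}"
 have "\<exists>k. P k x \<and> (\<forall>k'<k. \<not> P k' x)" if xO: "x \<in> \<Omega>" for x
 proof -
  obtain k0 where k0: "P k0 x" using xO by (auto simp: \<Omega>_def)
  obtain K where K: "\<And>k. k < K \<Longrightarrow> \<not> P k x" using bnd by blast
  \<comment> \<open>All levels below \<open>K\<close> fail, so the least integer level is found as a
    least natural offset from \<open>K\<close>.\<close>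
  define d where "d = (LEAST d. P (K + int d) x)"
  have "P (K + int (nat (k0 - K))) x" using K[of k0] k0 by force
  then have "P (K + int d) x" unfolding d_def by (rule LeastI)
  moreover have "\<not> P k' x" if "k' < K + int d" for k'
  proof (cases "k' < K")
   case False
   then have "nat (k' - K) < d" using that by linarith
   then have "\<not> P (K + int (nat (k' - K))) x" unfolding d_def using not_less_Least by blast
   then show ?thesis using False by simp
  qed (use K in auto)
  ultimately show ?thesis by blast
 qed
 then obtain \<kappa> where \<kappa>: "\<And>x. x \<in> \<Omega> \<Longrightarrow> P (\<kappa> x) x" "\<And>x k'. x \<in> \<Omega> \<Longrightarrow> k' < \<kappa> x \<Longrightarrow> \<not> P k' x" by metis
 \<comment> \<open>Taking the corner instead of \<open>x\<close> itself lists each cell once; with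
   all points \<open>x\<close> as names the family would be neither countable nor disjoint.\<close>
 define J where "J = (\<lambda>x. (\<kappa> x, cn (\<kappa> x) x)) ` \<Omega>"
 have up: "x \<in> \<Omega>" "\<kappa> x = k" if "(k, z) \<in> J" "x \<in> dc k z" for x k z
 proof -
  from that(1) obtain y where y: "y \<in> \<Omega>" "k = \<kappa> y" "z = cn k y" by (auto simp: J_def)
  have xy: "x \<in> dc k y" using that y by simp
  have "P k x" using compat[OF xy] \<kappa>(1)[OF y(1)] y by simp
  then show xO: "x \<in> \<Omega>" by (auto simp: \<Omega>_def)
  have "\<not> P k' x" if "k' < k" for k'
   using compat[of x k' y] \<kappa>(2)[OF y(1)] y that xy dc_mono[of k' k y] by auto
  then show "\<kappa> x = k" using \<open>P k x\<close> \<kappa>[OF xO] by (metis linorder_neqE)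
 qed
 have J1: "countable J"
 proof -
  have "J \<subseteq> (\<Union>k. {k} \<times> range (cn k))" by (auto simp: J_def)
  then show "countable J" by (rule countable_subset) (auto intro!: countable_UN countable_SIGMA countable_corners)
 qed
 have J2: "P k z" if kz: "(k, z) \<in> J" for k z
  using kz up[OF kz, of z] \<kappa>(1)[of z] by auto
 have J3: "\<not> P k' z" if kz: "(k, z) \<in> J" and "k' < k" for k z k'
  using up[OF kz, of z] \<kappa>(2)[of z] that(2) by auto
 have J4: "disjoint_family_on cell J"
  unfolding disjoint_family_on_def
 proof (intro ballI impI, rule ccontr)
  fix p p' assume pp: "p \<in> J" "p' \<in> J" "p \<noteq> p'" "(cell p) \<inter> (case p' of (k, z) \<Rightarrow> dc k z) \<noteq> {}"
  obtain k z k' z' where pe: "p = (k, z)" "p' = (k', z')" by (cases p, cases p') auto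
  obtain x where x: "x \<in> dc k z" "x \<in> dc k' z'" using pp(4) pe by auto
  have kk: "k = k'" using up x pp(1,2) pe by metis
  moreover have "z = cn k z" "z' = cn k' z'" using pp(1,2) pe by (auto simp: J_def cn_eq)
  moreover have "cn k z = cn k x" "cn k' z' = cn k' x" using x cn_eq by metis+
  ultimately show False using pp(3) pe by auto
 qed
 have J5: "(\<Union>(cell ` J)) = {x. \<exists>k. P k x}"
 proof (intro set_eqI iffI)
  fix x assume "x \<in> (\<Union>(cell ` J))"
  then obtain k z where "(k, z) \<in> J" "x \<in> dc k z" by blast
  then have "x \<in> \<Omega>" using up by blast
  then show "x \<in> {x. \<exists>k. P k x}" by (simp add: \<Omega>_def)
 next
  fix x assume "x \<in> {x. \<exists>k. P k x}"
  then have "(\<kappa> x, cn (\<kappa> x) x) \<in> J" by (simp add: \<Omega>_def J_def)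
  moreover have "x \<in> dc (\<kappa> x) (cn (\<kappa> x) x)" by simp
  ultimately show "x \<in> (\<Union>(cell ` J))" by blast
 qed
 show ?thesis by (rule that[OF J1 J2 J3 J4 J5])
qed

section \<open>Countable families of cells\<close>

lemma nn_integral_UN_countable:
 assumes "countable J" "disjoint_family_on A J" "\<And>j. j \<in> J \<Longrightarrow> A j \<in> sets M" "f \<in> borel_measurable M"
 shows "(\<integral>\<^sup>+x\<in>(\<Union>j\<in>J. A j). f x \<partial>M) = (\<Sum>\<^sup>+j\<in>J. (\<integral>\<^sup>+x\<in>A j. f x \<partial>M))"
proof -
 have "emeasure (density M f) (\<Union>(A ` J)) = (\<Sum>\<^sup>+j\<in>J. emeasure (density M f) (A j))"
  by (rule emeasure_UN_countable) (use assms in auto)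
 also have "\<dots> = (\<Sum>\<^sup>+j\<in>J. (\<integral>\<^sup>+x\<in>A j. f x \<partial>M))"
  by (rule nn_integral_cong) (use assms in \<open>auto simp: emeasure_density\<close>)
 also have "emeasure (density M f) (\<Union>(A ` J)) = (\<integral>\<^sup>+x\<in>(\<Union>j\<in>J. A j). f x \<partial>M)"
  using assms by (intro emeasure_density sets.countable_UN') auto
 finally show ?thesis by simp
qed

lemma disjoint_corners: "C \<subseteq> range (cn k) \<Longrightarrow> disjoint_family_on (dc k) C"
 unfolding disjoint_family_on_def
proof (intro ballI impI, rule ccontr)
 fix p p' assume C: "C \<subseteq> range (cn k)" "p \<in> C" "p' \<in> C" "p \<noteq> p'" "dc k p \<inter> dc k p' \<noteq> {}"
 then obtain x where x: "x \<in> dc k p" "x \<in> dc k p'" by blast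
 have "cn k p = cn k x" "cn k p' = cn k x" using x cn_eq by metis+
 moreover have "cn k p = p" "cn k p' = p'" using C(1,2,3) cn_eq[OF cn_in_dc] by force+
 ultimately show False using C(4) by simp
qed

lemma trip_decompose:
 obtains C where "countable C" "disjoint_family_on (dc k) C" "(\<Union>q\<in>C. dc k q) = trip k (x::'a::euclidean_space)"
proof
 let ?C = "cn k ` trip k x"
 show "countable ?C" using countable_corners countable_subset by (metis image_mono subset_UNIV)
 show "disjoint_family_on (dc k) ?C"
  by (rule disjoint_corners) auto
 show "(\<Union>q\<in>?C. dc k q) = trip k x"
 proof (intro equalityI subsetI)
  fix y assume "y \<in> (\<Union>q\<in>?C. dc k q)"
  then show "y \<in> trip k x" using trip_cell_subset by auto
 next
  fix y assume "y \<in> trip k x"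
  then show "y \<in> (\<Union>q\<in>?C. dc k q)" by (intro UN_I[of "cn k y"]) auto
 qed
qed

lemma cover_by_cells:
 obtains C where "countable C" "disjoint_family_on (dc k) C" "(\<Union>q\<in>C. dc k q) = (UNIV::'a::euclidean_space set)"
proof
 let ?C = "range (cn k) :: 'a set"
 show "countable ?C" using countable_corners .
 show "disjoint_family_on (dc k) ?C"
  by (rule disjoint_corners) auto
 show "(\<Union>q\<in>?C. dc k q) = UNIV"
 proof -
  have "y \<in> (\<Union>q\<in>?C. dc k q)" for y by (intro UN_I[of "cn k y"]) auto
  then show ?thesis by blast
 qed
qed

text \<open>Every preimage is a union of cells of one level, hence a countable union. The maximal
  functions get their measurability from this, level by level.\<close>

lemma cell_const_measurable:
 fixes g :: "'a::euclidean_space \<Rightarrow> 'b::topological_space"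
 assumes "\<And>x y. y \<in> dc k x \<Longrightarrow> g y = g x"
 shows "lm g"
proof (rule measurableI)
 fix A :: "'b set"
 obtain C where C: "countable C" "(\<Union>q\<in>C. dc k q) = (UNIV::'a set)" by (rule cover_by_cells[where k=k])
 have "g -` A = (\<Union>q\<in>{q\<in>C. g q \<in> A}. dc k q)"
 proof safe
  fix x assume "g x \<in> A"
  moreover obtain q where "q \<in> C" "x \<in> dc k q" using C(2) by blast
  ultimately show "x \<in> (\<Union>q\<in>{q\<in>C. g q \<in> A}. dc k q)" using assms by auto
 qed (use assms in auto)
 also have "\<dots> \<in> sets lebesgue"
  using C(1) by (intro sets.countable_UN') auto
 finally show "g -` A \<inter> space lebesgue \<in> sets lebesgue" by simp
qed auto

section \<open>Dyadic differentiation of integrals\<close>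

lemma fsigma_imp_borel: "fsigma S \<Longrightarrow> S \<in> sets borel"
 by (induction rule: fsigma.induct) auto

lemma open_contains_cell:
 assumes "open U" "x \<in> U" shows "\<exists>k\<ge>k0. dc k (x::'a::euclidean_space) \<subseteq> U"
proof -
 obtain e where e: "e > 0" "ball x e \<subseteq> U" using assms by (auto simp: open_contains_ball)
 let ?s = "sqrt (DIM('a))"
 have s: "?s > 0" by simp
 obtain k where k: "k \<ge> k0" "dside k < e / ?s" using dside_small[of "e / ?s" k0] e s by auto
 have "dc k x \<subseteq> ball x e"
 proof
  fix y assume "y \<in> dc k x"
  then have "norm (x - y) \<le> ?s * dside k" using dc_dist[of x k x y] by simp
  also have "\<dots> < e" using k(2) s by (simp add: field_simps)
  finally show "y \<in> ball x e" by (simp add: dist_norm)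
 qed
 then show ?thesis using e k by blast
qed

text \<open>On the set where \<open>h\<close> exceeds \<open>v\<close>: cover an open superset,
  nearly optimal for the measure with density \<open>v\<close>, by maximal cells that meet the set,
  sum \<open>le\<close> over them and let the open set shrink. The integral of \<open>h\<close> over
  the set is then at most that of \<open>v\<close>, so the set is null.\<close>

lemma dyadic_differentiation:
 fixes h v :: "'a::euclidean_space \<Rightarrow> ennreal"
 assumes [measurable]: "lm h" "lm v" "S \<in> sets lebesgue"
  and fin: "\<And>k x. (\<integral>y\<in>dc k x. v y) < \<infinity>"
  and le: "\<And>k x. x \<in> S \<Longrightarrow> k0 \<le> k \<Longrightarrow> (\<integral>y\<in>dc k x. h y) \<le> (\<integral>y\<in>dc k x. v y)"
 shows "AE x. x \<in> S \<longrightarrow> h x \<le> v x"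
proof -
 have local: "AE x. x \<in> S \<longrightarrow> x \<in> dc k0 x0 \<longrightarrow> h x \<le> v x" for x0
 proof -
  let ?Q = "dc k0 x0"
  define A where "A = {x \<in> S \<inter> ?Q. h x > v x}"
  have A: "A \<in> sets lebesgue" unfolding A_def by measurable
  \<comment> \<open>Outer regularity concerns Borel sets, so a null set is split off first.\<close>
  obtain B N where BN: "fsigma B" "N \<in> null_sets lebesgue" "B \<union> N = A"
   using lebesgue_set_almost_fsigma[OF A] by metis
  have B: "B \<in> sets borel" using fsigma_imp_borel[OF BN(1)] .
  then have [measurable]: "B \<in> sets lebesgue" by (simp add: sets_completionI_sets)
  have BA: "B \<subseteq> A" using BN(3) by auto
  define M where "M = distr (density lebesgue (\<lambda>x. v x * indicator ?Q x)) borel (\<lambda>x. x)"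
  have idm: "(\<lambda>x. x) \<in> density lebesgue (\<lambda>x. v x * indicator ?Q x) \<rightarrow>\<^sub>M borel"
   by (simp add: measurable_density_eq1 measurable_completion)
  have eM: "emeasure M U = (\<integral>x\<in>U. v x * indicator ?Q x)" if "U \<in> sets borel" for U
  proof -
   have U: "U \<in> sets lebesgue" using that by (simp add: sets_completionI_sets)
   show ?thesis unfolding M_def using that idm U
    by (subst emeasure_distr) (auto simp: emeasure_density)
  qed
  have eMfin: "emeasure M U < \<infinity>" if "U \<in> sets borel" for U
  proof -
   have "emeasure M U \<le> (\<integral>x\<in>?Q. v x)"
    unfolding eM[OF that] by (intro nn_integral_mono) (auto simp: indicator_def)
   also have "\<dots> < \<infinity>" by (rule fin)
   finally show ?thesis .
  qed
  have "emeasure M (space M) \<noteq> \<infinity>" using eMfin[of UNIV] by (auto simp: M_def)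
  then have outer: "emeasure M B = (INF U \<in> {U. B \<subseteq> U \<and> open U}. emeasure M U)"
   by (intro outer_regular) (auto simp: M_def B)
  have key: "(\<integral>x\<in>B. h x) \<le> emeasure M U" if U: "B \<subseteq> U" "open U" for U
  proof -
   \<comment> \<open>A cell meeting \<open>B\<close> contains a point of \<open>S\<close>, at which
     \<open>le\<close> is available. The conditions on \<open>k\<close> and \<open>x\<close> keep
     the cells inside \<open>?Q\<close>, where \<open>v\<close> has finite mass.\<close>
   define P where "P = (\<lambda>k x. k0 \<le> k \<and> x \<in> ?Q \<and> dc k x \<subseteq> U \<and> dc k x \<inter> B \<noteq> {})"
   have "P k y = P k x" if "y \<in> dc k x" for k x y
    unfolding P_def using dc_eq[OF that] that dc_nested[of k0 k] dc_sym by blast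
   moreover have "\<exists>K. \<forall>k<K. \<not> P k x" for x unfolding P_def by (intro exI[of _ k0]) auto
   ultimately obtain J where J: "countable J" "\<And>k z. (k, z) \<in> J \<Longrightarrow> P k z"
    "disjoint_family_on cell J" "(\<Union>(cell ` J)) = {x. \<exists>k. P k x}"
    by (rule stopping_cubes[of P]) blast+
   have Jm: "(cell j) \<in> sets lebesgue" for j :: "int \<times> 'a" by (cases j) simp
   have BJ: "B \<subseteq> (\<Union>(cell ` J))" unfolding J(4)
   proof
    fix x assume x: "x \<in> B"
    obtain k where "k \<ge> k0" "dc k x \<subseteq> U" using open_contains_cell[OF U(2)] U(1) x by blast
    moreover have "dc k x \<inter> B \<noteq> {}" using x dc_self by blast
     ultimately show "x \<in> {x. \<exists>k. P k x}" using x BA by (auto simp: P_def A_def)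
   qed
   have JU: "(\<Union>(cell ` J)) \<subseteq> U \<inter> ?Q" unfolding J(4) P_def using dc_self by blast
   have "(\<integral>x\<in>B. h x) \<le> (\<integral>x\<in>(\<Union>(cell ` J)). h x)"
    by (intro nn_integral_mono mult_left_mono indicator_leI) (use BJ in auto)
   also have "\<dots> = (\<Sum>\<^sup>+j\<in>J. (\<integral>x\<in>cell j. h x))"
    by (rule nn_integral_UN_countable[OF J(1,3) Jm]) auto
   also have "\<dots> \<le> (\<Sum>\<^sup>+j\<in>J. (\<integral>x\<in>cell j. v x))"
   proof (rule nn_integral_mono, clarsimp)
    fix k z assume "(k, z) \<in> J"
    then have Pk: "P k z" using J(2) by auto
    then obtain y where y: "y \<in> dc k z" "y \<in> B" by (auto simp: P_def)
    show "(\<integral>x\<in>dc k z. h x) \<le> (\<integral>x\<in>dc k z. v x)"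
     using le[of y k] y BA dc_eq[OF y(1)] Pk by (auto simp: A_def P_def)
   qed
   also have "\<dots> = (\<integral>x\<in>(\<Union>(cell ` J)). v x)"
    by (rule nn_integral_UN_countable[OF J(1,3) Jm, symmetric]) auto
   also have "\<dots> \<le> (\<integral>x\<in>U. v x * indicator ?Q x)"
    by (intro nn_integral_mono) (use JU in \<open>auto simp: indicator_def\<close>)
   also have "\<dots> = emeasure M U" using U by (simp add: eM)
   finally show ?thesis .
  qed
  have "(\<integral>x\<in>B. h x) \<le> emeasure M B" unfolding outer by (rule INF_greatest) (use key in auto)
  also have "\<dots> = (\<integral>x\<in>B. v x)" unfolding eM[OF B]
   by (intro nn_integral_cong) (use BA in \<open>auto simp: indicator_def A_def\<close>)
  finally have 1: "(\<integral>x\<in>B. h x) \<le> (\<integral>x\<in>B. v x)" .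
  have "(\<integral>x\<in>B. v x) < \<infinity>"
   using eMfin[OF B] unfolding eM[OF B]
   by (rule le_less_trans[rotated]) (intro nn_integral_mono, use BA in \<open>auto simp: indicator_def A_def\<close>)
  then have fB: "(\<integral>x\<in>B. v x) \<noteq> \<infinity>" by simp
  have vh: "AE x. v x * indicator B x \<le> h x * indicator B x"
   using BA by (intro AE_I2) (auto simp: A_def indicator_def)
  \<comment> \<open>Strict monotonicity of the integral asks only that the smaller integral, that of
    \<open>v\<close>, be finite; that of \<open>h\<close> may be anything.\<close>
  have "AE x. h x * indicator B x \<le> v x * indicator B x"
  proof (rule ccontr)
   assume "\<not> (AE x. h x * indicator B x \<le> v x * indicator B x)"
   then have "(\<integral>x\<in>B. v x) < (\<integral>x\<in>B. h x)"
    by (intro nn_integral_less fB vh) auto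
   then show False using 1 by simp
  qed
  moreover have "AE x. x \<notin> N" using BN(2) AE_not_in by blast
  ultimately show ?thesis
  proof eventually_elim
   case (elim x)
   then have "x \<notin> B" using BA by (auto simp: A_def indicator_def)
   then have "x \<notin> A" using BN(3) elim by auto
   then show ?case by (auto simp: A_def)
  qed
 qed
 obtain C where C: "countable C" "(\<Union>q\<in>C. dc k0 q) = (UNIV::'a set)" by (rule cover_by_cells[where k=k0])
 have "AE x. \<forall>q\<in>C. x \<in> S \<longrightarrow> x \<in> dc k0 q \<longrightarrow> h x \<le> v x"
  unfolding AE_ball_countable[OF C(1)] using local by blast
 then show ?thesis by eventually_elim (use C(2) in blast)
qed

section \<open>Real powers of extended nonnegative reals and Hoelder's inequality\<close>

text \<open>Both \<open>0\<close> and \<open>top\<close> are fixed by every exponent, so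
  \<open>epow_mult\<close> and \<open>epow_add\<close> hold without side conditions.\<close>

definition epow :: "ennreal \<Rightarrow> real \<Rightarrow> ennreal" where
 "epow x p = (if x = top then top else ennreal (enn2real x powr p))"

lemma epow_top [simp]: "epow top p = top" by (simp add: epow_def)
lemma epow_zero [simp]: "epow 0 p = 0" by (simp add: epow_def)
lemma epow_1 [simp]: "epow x 1 = x" by (cases x) (auto simp: epow_def)
lemma epow_one [simp]: "epow 1 p = 1" by (simp add: epow_def)
lemma epow_ennreal: "x \<ge> 0 \<Longrightarrow> epow (ennreal x) p = ennreal (x powr p)" by (simp add: epow_def)

lemma epow_mono: assumes "p > 0" "x \<le> y" shows "epow x p \<le> epow y p"
proof (cases y)
 case (real r)
 then obtain s where "x = ennreal s" "s \<ge> 0" using assms(2) by (cases x) (auto simp: top_unique)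
 then show ?thesis using real assms by (auto simp: epow_ennreal intro!: powr_mono2)
qed (simp add: epow_def)

lemma epow_eq_0 [simp]: "epow z p = 0 \<longleftrightarrow> z = 0"
 by (cases z) (auto simp: epow_def ennreal_eq_0_iff)

lemma epow_mult: "epow (x * y) p = epow x p * epow y p"
proof -
 consider "x = top" | "y = top" | r s where "x = ennreal r" "r \<ge> 0" "y = ennreal s" "s \<ge> 0"
  by (cases x; cases y) auto
 then show ?thesis
 proof cases
  case 1 then show ?thesis by (cases "y = 0") (simp_all add: ennreal_top_mult)
 next
  case 2 then show ?thesis by (cases "x = 0") (simp_all add: ennreal_mult_top)
 next
  case 3 then show ?thesis by (simp add: epow_ennreal powr_mult flip: ennreal_mult)
 qed
qed

lemma epow_epow: "epow (epow x p) q = epow x (p * q)"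
 by (cases x) (auto simp: epow_def powr_powr)

lemma epow_add: "epow x (p + q) = epow x p * epow x q"
 by (cases x) (auto simp: epow_def powr_add ennreal_mult)

lemma epow_measurable [measurable]:
 assumes "f \<in> borel_measurable M" shows "(\<lambda>x. epow (f x) p) \<in> borel_measurable M"
proof -
 have [measurable]: "f \<in> borel_measurable M" by fact
 show ?thesis unfolding epow_def by measurable
qed

lemma epow_young:
 assumes "\<alpha> > 0" "\<beta> > 0" "\<alpha> + \<beta> = 1"
 shows "epow x \<alpha> * epow y \<beta> \<le> ennreal \<alpha> * x + ennreal \<beta> * y"
proof (cases "x = 0 \<or> y = 0 \<or> x = top \<or> y = top")
 case True
 then show ?thesis using assms by (auto simp: ennreal_mult_eq_top_iff ennreal_mult_top ennreal_top_mult)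
next
 case False
 then obtain r s where rs: "x = ennreal r" "r > 0" "y = ennreal s" "s > 0"
  by (metis ennreal_cases ennreal_0 less_eq_real_def)
 have "r powr \<alpha> * s powr \<beta> \<le> \<alpha> * r + \<beta> * s"
  using assms rs by (intro Youngs_inequality_0) auto
 then show ?thesis using rs assms
  by (simp add: epow_ennreal less_imp_le ennreal_mult[symmetric] ennreal_plus[symmetric] del: ennreal_plus)
qed

text \<open>Young's inequality for the functions divided by their integrals. The exponents enter
  only through \<alpha> + \<beta> = 1, so the form with three factors follows by grouping two of
  them, and exponents that depend on the level cause no bookkeeping of conjugates.\<close>

lemma holder_epow:
 assumes [measurable]: "f \<in> borel_measurable M" "g \<in> borel_measurable M"
  and ab: "\<alpha> > 0" "\<beta> > 0" "\<alpha> + \<beta> = 1"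
 shows "(\<integral>\<^sup>+x. epow (f x) \<alpha> * epow (g x) \<beta> \<partial>M) \<le> epow (\<integral>\<^sup>+x. f x \<partial>M) \<alpha> * epow (\<integral>\<^sup>+x. g x \<partial>M) \<beta>"
proof -
 let ?A = "\<integral>\<^sup>+x. f x \<partial>M" and ?B = "\<integral>\<^sup>+x. g x \<partial>M"
 show ?thesis
 proof (cases "?A = 0 \<or> ?B = 0")
  case True
  then have "AE x in M. epow (f x) \<alpha> * epow (g x) \<beta> = 0"
  proof
   assume "?A = 0"
   then have "AE x in M. f x = 0" by (simp add: nn_integral_0_iff_AE)
   then show ?thesis by eventually_elim simp
  next
   assume "?B = 0"
   then have "AE x in M. g x = 0" by (simp add: nn_integral_0_iff_AE)
   then show ?thesis by eventually_elim simp
  qed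
  then have "(\<integral>\<^sup>+x. epow (f x) \<alpha> * epow (g x) \<beta> \<partial>M) = (\<integral>\<^sup>+x. 0 \<partial>M)"
   by (rule nn_integral_cong_AE)
  then show ?thesis by simp
 next
  case n0: False
  show ?thesis
  proof (cases "?A = top \<or> ?B = top")
   case True
   then show ?thesis using n0 by (auto simp: ennreal_mult_eq_top_iff ennreal_mult_top ennreal_top_mult)
  next
   case False
   then obtain a b where a: "?A = ennreal a" "a > 0" and b: "?B = ennreal b" "b > 0"
    using n0 by (metis ennreal_cases ennreal_0 less_eq_real_def)
   let ?c = "epow (ennreal a) \<alpha> * epow (ennreal b) \<beta>"
   have pt: "epow (f x) \<alpha> * epow (g x) \<beta> \<le> ?c * (ennreal \<alpha> * (f x * ennreal (1/a)) + ennreal \<beta> * (g x * ennreal (1/b)))" for x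
   proof -
    have 1: "f x = ennreal a * (f x * ennreal (1/a))"
     using a by (simp add: mult.commute mult.left_commute[of "ennreal a"] flip: ennreal_mult)
    have 2: "g x = ennreal b * (g x * ennreal (1/b))"
     using b by (simp add: mult.commute mult.left_commute[of "ennreal b"] flip: ennreal_mult)
    have "epow (f x) \<alpha> * epow (g x) \<beta> = ?c * (epow (f x * ennreal (1/a)) \<alpha> * epow (g x * ennreal (1/b)) \<beta>)"
     by (subst 1, subst 2) (use ab in \<open>simp add: epow_mult mult_ac\<close>)
    also have "\<dots> \<le> ?c * (ennreal \<alpha> * (f x * ennreal (1/a)) + ennreal \<beta> * (g x * ennreal (1/b)))"
     by (intro mult_left_mono epow_young ab) auto
    finally show ?thesis .
   qed
   have "(\<integral>\<^sup>+x. epow (f x) \<alpha> * epow (g x) \<beta> \<partial>M) \<le>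
     (\<integral>\<^sup>+x. ?c * (ennreal \<alpha> * (f x * ennreal (1/a)) + ennreal \<beta> * (g x * ennreal (1/b))) \<partial>M)"
    by (intro nn_integral_mono pt)
   also have "\<dots> = ?c * (ennreal \<alpha> * (ennreal a * ennreal (1/a)) + ennreal \<beta> * (ennreal b * ennreal (1/b)))"
    by (simp add: nn_integral_cmult nn_integral_multc nn_integral_add a b)
   also have "\<dots> = ?c"
    using a b ab by (simp add: ennreal_mult[symmetric] ennreal_plus[symmetric] del: ennreal_plus)
   finally show ?thesis using a b by simp
  qed
 qed
qed

lemma holder_epow3:
 assumes [measurable]: "f \<in> borel_measurable M" "g \<in> borel_measurable M" "h \<in> borel_measurable M"
  and ab: "\<alpha> > 0" "\<beta> > 0" "\<gamma> > 0" "\<alpha> + \<beta> + \<gamma> = 1"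
 shows "(\<integral>\<^sup>+x. epow (f x) \<alpha> * epow (g x) \<beta> * epow (h x) \<gamma> \<partial>M)
   \<le> epow (\<integral>\<^sup>+x. f x \<partial>M) \<alpha> * epow (\<integral>\<^sup>+x. g x \<partial>M) \<beta> * epow (\<integral>\<^sup>+x. h x \<partial>M) \<gamma>"
proof -
 let ?d = "\<beta> + \<gamma>"
 have d: "?d > 0" using ab by simp
 have "(\<integral>\<^sup>+x. epow (f x) \<alpha> * epow (g x) \<beta> * epow (h x) \<gamma> \<partial>M) =
  (\<integral>\<^sup>+x. epow (f x) \<alpha> * epow (epow (g x) (\<beta>/?d) * epow (h x) (\<gamma>/?d)) ?d \<partial>M)"
  using d by (simp add: epow_mult epow_epow mult.assoc)
 also have "\<dots> \<le> epow (\<integral>\<^sup>+x. f x \<partial>M) \<alpha> * epow (\<integral>\<^sup>+x. epow (g x) (\<beta>/?d) * epow (h x) (\<gamma>/?d) \<partial>M) ?d"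
  by (rule holder_epow) (use ab in auto)
 also have "\<dots> \<le> epow (\<integral>\<^sup>+x. f x \<partial>M) \<alpha> * epow (epow (\<integral>\<^sup>+x. g x \<partial>M) (\<beta>/?d) * epow (\<integral>\<^sup>+x. h x \<partial>M) (\<gamma>/?d)) ?d"
  by (intro mult_left_mono epow_mono d holder_epow) (use ab in \<open>auto simp: add_divide_distrib[symmetric]\<close>)
 also have "\<dots> = epow (\<integral>\<^sup>+x. f x \<partial>M) \<alpha> * epow (\<integral>\<^sup>+x. g x \<partial>M) \<beta> * epow (\<integral>\<^sup>+x. h x \<partial>M) \<gamma>"
  using d by (simp add: epow_mult epow_epow mult.assoc)
 finally show ?thesis .
qed

section \<open>The dyadic maximal function\<close>

text \<open>The integral over the triple is divided by the volume of the cell, so a constant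
  \<open>c\<close> has maximal function \<open>3^n c\<close>. This explains the factors
  \<open>3 ^ DIM('a)\<close> in the thresholds below.\<close>

definition dmax :: "('a::euclidean_space \<Rightarrow> ennreal) \<Rightarrow> 'a \<Rightarrow> ennreal" where
 "dmax h x = (SUP k. (\<integral>y\<in>trip k x. h y) / ennreal (dvol TYPE('a) k))"

lemma Collect_less_lebesgue: "lm f \<Longrightarrow> {x. c < f x} \<in> sets lebesgue"
 for f :: "'a::euclidean_space \<Rightarrow> 'b::{linorder_topology}"
 using measurable_sets[of f lebesgue borel "{c<..}"] by (simp add: vimage_def)

lemma dmax_measurable [measurable]: "lm (dmax h)"
proof -
 have [measurable]: "lm (\<lambda>x. (\<integral>y\<in>trip k x. h y) / ennreal (dvol TYPE('a) k))" for k
  by (rule cell_const_measurable[where k=k]) (simp add: trip_eq)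
 show ?thesis unfolding dmax_def[abs_def] by measurable
qed

lemma ennreal_divide_le_iff: "c > 0 \<Longrightarrow> c < top \<Longrightarrow> a / c \<le> b \<longleftrightarrow> a \<le> b * c" for a b c :: ennreal
proof -
 assume c: "c > 0" "c < top"
 show ?thesis
 proof
  assume "a / c \<le> b"
  then have "a / c * c \<le> b * c" by (rule mult_right_mono) simp
  then show "a \<le> b * c" using c by (simp add: ennreal_divide_times ennreal_times_divide mult_divide_eq_ennreal)
 next
  assume "a \<le> b * c"
  then have "a / c \<le> b * c / c" by (rule divide_right_mono_ennreal)
  then show "a / c \<le> b" using c by (simp add: mult_divide_eq_ennreal)
 qed
qed

lemma dmax_le_iff:
 fixes x :: "'a::euclidean_space"
 shows "dmax h x \<le> c \<longleftrightarrow> (\<forall>k. (\<integral>y\<in>trip k x. h y) \<le> c * ennreal (dvol TYPE('a) k))"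
 unfolding dmax_def by (simp add: SUP_le_iff ennreal_divide_le_iff)

lemma dmax_ge:
 fixes x :: "'a::euclidean_space"
 shows "(\<integral>y\<in>trip k x. h y) \<le> dmax h x * ennreal (dvol TYPE('a) k)"
 using dmax_le_iff[of h x "dmax h x"] by simp

lemma dmax_ge_dc:
 fixes x :: "'a::euclidean_space"
 shows "(\<integral>y\<in>dc k x. h y) \<le> dmax h x * ennreal (dvol TYPE('a) k)"
 by (rule order_trans[OF _ dmax_ge]) (intro nn_integral_mono mult_left_mono indicator_leI, use dc_subset_trip in auto)

lemma emeasure_UN_le_count_space:
 assumes "countable J" "\<And>j. j \<in> J \<Longrightarrow> A j \<in> sets M"
 shows "emeasure M (\<Union>j\<in>J. A j) \<le> (\<Sum>\<^sup>+j\<in>J. emeasure M (A j))"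
proof -
 have "emeasure M (\<Union>j\<in>J. A j) = (\<integral>\<^sup>+x. indicator (\<Union>j\<in>J. A j) x \<partial>M)"
  using assms by (intro nn_integral_indicator[symmetric] sets.countable_UN') auto
 also have "\<dots> \<le> (\<integral>\<^sup>+x. (\<Sum>\<^sup>+j\<in>J. indicator (A j) x) \<partial>M)"
 proof (rule nn_integral_mono)
  fix x
  show "indicator (\<Union>j\<in>J. A j) x \<le> (\<Sum>\<^sup>+j\<in>J. indicator (A j) x)"
  proof (cases "x \<in> (\<Union>j\<in>J. A j)")
   case True
   then obtain j where j: "j \<in> J" "x \<in> A j" by auto
   have "indicator (A j) x \<le> (\<Sum>\<^sup>+j\<in>J. indicator (A j) x)"
    using nn_integral_ge_point[OF j(1), of "\<lambda>j. indicator (A j) x"] .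
   then show ?thesis using j True by simp
  qed simp
 qed
 also have "\<dots> = (\<Sum>\<^sup>+j\<in>J. (\<integral>\<^sup>+x. indicator (A j) x \<partial>M))"
  by (rule nn_integral_count_space_nn_integral) (use assms in auto)
 also have "\<dots> = (\<Sum>\<^sup>+j\<in>J. emeasure M (A j))"
  by (rule nn_integral_cong) (use assms in auto)
 finally show ?thesis .
qed

text \<open>If the selected cell containing \<open>x\<close> were finer than level \<open>k\<close>,
  its point \<open>z\<close> would satisfy \<open>P k z\<close>, against the maximality of the
  cell.\<close>

lemma stopping_cubes_top:
 assumes compat: "\<And>k x y. y \<in> dc k x \<Longrightarrow> P k y = P k x"
  and J: "\<And>k z k'. (k, z) \<in> J \<Longrightarrow> k' < k \<Longrightarrow> \<not> P k' z" "(\<Union>(cell ` J)) = {x. \<exists>k. P k x}"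
  and "P k x"
 obtains k' z where "(k', z) \<in> J" "k' \<le> k" "x \<in> dc k' z"
proof -
 obtain k' z where kz: "(k', z) \<in> J" "x \<in> dc k' z" using J(2) \<open>P k x\<close> by blast
 have "k' \<le> k"
 proof (rule ccontr)
  assume "\<not> k' \<le> k"
  then have "z \<in> dc k x" using kz(2) dc_mono[of k k' x] dc_sym by (metis linear subsetD)
  then have "P k z" using compat \<open>P k x\<close> by blast
  then show False using J(1)[OF kz(1), of k] \<open>\<not> k' \<le> k\<close> by simp
 qed
 then show ?thesis using that kz by blast
qed

lemma countable_J_sets: "(cell j) \<in> sets lebesgue" for j :: "int \<times> 'a::euclidean_space"
 by (cases j) simp

lemma trip_average:
 fixes x :: "'a::euclidean_space"
 assumes [measurable]: "lm h"
  and "\<And>q. q \<in> trip k x \<Longrightarrow> (\<integral>y\<in>dc k q. h y) \<le> c * ennreal (dvol TYPE('a) k)"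
 shows "(\<integral>y\<in>trip k x. h y) \<le> 3 ^ DIM('a) * c * ennreal (dvol TYPE('a) k)"
proof -
 obtain C where C: "countable C" "disjoint_family_on (dc k) C" "(\<Union>q\<in>C. dc k q) = trip k x"
  by (rule trip_decompose)
 have qC: "q \<in> trip k x" if "q \<in> C" for q using C(3) that dc_self by blast
 have "(\<integral>y\<in>trip k x. h y) = (\<Sum>\<^sup>+q\<in>C. (\<integral>y\<in>dc k q. h y))"
  unfolding C(3)[symmetric] by (rule nn_integral_UN_countable[OF C(1,2)]) auto
 also have "\<dots> \<le> (\<Sum>\<^sup>+q\<in>C. c * (\<integral>y\<in>dc k q. 1))"
  by (rule nn_integral_mono) (use assms(2) qC in \<open>auto simp: emeasure_dc\<close>)
 also have "\<dots> = c * (\<Sum>\<^sup>+q\<in>C. (\<integral>y\<in>dc k q. 1))"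
  by (rule nn_integral_cmult) auto
 also have "(\<Sum>\<^sup>+q\<in>C. (\<integral>y\<in>dc k q. 1)) = (\<integral>y\<in>trip k x. 1)"
  unfolding C(3)[symmetric] by (rule nn_integral_UN_countable[OF C(1,2), symmetric]) auto
 also have "\<dots> = 3 ^ DIM('a) * ennreal (dvol TYPE('a) k)"
  by (simp add: emeasure_trip ennreal_mult ennreal_power[symmetric])
 finally show ?thesis by (simp add: mult_ac)
qed

lemma cells_large:
 assumes "b < top" "c > 0"
 shows "\<exists>K. \<forall>k<K. ennreal (c * dvol TYPE('a::euclidean_space) k) > b"
proof -
 obtain r where r: "b = ennreal r" "r \<ge> 0" using \<open>b < top\<close> by (cases b) auto
 obtain K where K: "\<And>k. k \<le> K \<Longrightarrow> dside k > max 1 (r / c)" using dside_large by blast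
 have "c * dvol TYPE('a) k > r" if "k < K" for k
 proof -
  have s: "dside k > 1" "dside k > r / c" using K[of k] that by auto
  have "dside k ^ 1 \<le> dside k ^ DIM('a)" using s by (intro power_increasing) (auto simp: Suc_leI)
  then have "r / c < dvol TYPE('a) k" using s by (simp add: dvol_def)
  then show ?thesis using \<open>c > 0\<close> by (simp add: field_simps)
 qed
 then show ?thesis using r by (metis ennreal_lessI less_le_trans not_le order_le_less_trans)
qed

text \<open>If \<open>dmax h x\<close> exceeds \<open>3^n c\<close>, some cell in a triple around
  \<open>x\<close> has average above \<open>c\<close>. It lies in a stopping cell whose triple
  contains \<open>x\<close>, and the triples have at most \<open>3^n\<close> times the total volume
  of the disjoint stopping cells.\<close>

lemma dmax_weak:
 fixes h :: "'a::euclidean_space \<Rightarrow> ennreal"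
 assumes [measurable]: "lm h" and c: "c > 0"
 shows "leb {x. dmax h x > 3 ^ DIM('a) * ennreal c} \<le> ennreal (3 ^ DIM('a) / c) * (\<integral>x. h x)"
proof (cases "(\<integral>x. h x) = top")
 case True
 then show ?thesis using c by (simp add: ennreal_mult_top)
next
 case False
 define P where "P = (\<lambda>k x. (\<integral>y\<in>dc k x. h y) > ennreal c * ennreal (dvol TYPE('a) k))"
 have compat: "P k y = P k x" if "y \<in> dc k x" for k x y unfolding P_def using dc_eq[OF that] by simp
 have "\<exists>K. \<forall>k<K. \<not> P k x" for x
 proof -
  obtain K where K: "\<And>k. k < K \<Longrightarrow> ennreal (c * dvol TYPE('a) k) > (\<integral>x. h x)"
   using cells_large[OF _ c] False by (metis top.not_eq_extremum)
  have "\<not> P k x" if "k < K" for k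
  proof -
   have "(\<integral>y\<in>dc k x. h y) \<le> (\<integral>x. h x)"
    by (intro nn_integral_mono) (auto simp: indicator_def)
   then show ?thesis using K[OF that] c by (auto simp: P_def ennreal_mult)
  qed
  then show ?thesis by blast
 qed
 then obtain J :: "(int \<times> 'a) set" where J: "countable J" "\<And>k z. (k, z) \<in> J \<Longrightarrow> P k z" "\<And>k z k'. (k, z) \<in> J \<Longrightarrow> k' < k \<Longrightarrow> \<not> P k' z"
  "disjoint_family_on cell J" "(\<Union>(cell ` J)) = {x. \<exists>k. P k x}"
  using stopping_cubes[of P, OF compat] by metis
 have sub: "{x. dmax h x > 3 ^ DIM('a) * ennreal c} \<subseteq> (\<Union>j\<in>J. case j of (k, z) \<Rightarrow> trip k z)"
 proof
  fix x assume "x \<in> {x. dmax h x > 3 ^ DIM('a) * ennreal c}"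
  then obtain k where k: "\<not> (\<integral>y\<in>trip k x. h y) \<le> 3 ^ DIM('a) * ennreal c * ennreal (dvol TYPE('a) k)"
   using dmax_le_iff[of h x] by (auto simp: not_le[symmetric])
  then obtain q where q: "q \<in> trip k x" "P k q"
   using trip_average[of h k x "ennreal c"] unfolding P_def by (meson assms(1) not_le)
  obtain k' z where kz: "(k', z) \<in> J" "k' \<le> k" "q \<in> dc k' z"
   by (rule stopping_cubes_top[OF compat J(3,5) q(2)])
  have "x \<in> trip k' z" using trip_sym q(1) trip_mono[OF kz(2)] trip_eq[OF kz(3)] by blast
  then show "x \<in> (\<Union>j\<in>J. case j of (k, z) \<Rightarrow> trip k z)" using kz(1) by blast
 qed
 have tm: "(case j of (k, z) \<Rightarrow> trip k z) \<in> sets lebesgue" for j :: "int \<times> 'a" by (cases j) simp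
 have "leb {x. dmax h x > 3 ^ DIM('a) * ennreal c} \<le> leb (\<Union>j\<in>J. case j of (k, z) \<Rightarrow> trip k z)"
  using J(1) tm by (intro emeasure_mono[OF sub] sets.countable_UN') auto
 also have "\<dots> \<le> (\<Sum>\<^sup>+j\<in>J. leb (case j of (k, z) \<Rightarrow> trip k z))"
  by (rule emeasure_UN_le_count_space[OF J(1) tm])
 also have "\<dots> \<le> (\<Sum>\<^sup>+j\<in>J. ennreal (3 ^ DIM('a) / c) * (\<integral>x\<in>cell j. h x))"
 proof (rule nn_integral_mono)
  fix j assume "j \<in> space (count_space J)"
  then obtain k z where kz: "j = (k, z)" "(k, z) \<in> J" by (cases j) auto
  have "ennreal c * ennreal (dvol TYPE('a) k) \<le> (\<integral>y\<in>dc k z. h y)"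
   using J(2) kz unfolding P_def by (meson less_imp_le)
  then have "ennreal (3 ^ DIM('a) / c) * (ennreal c * ennreal (dvol TYPE('a) k)) \<le> ennreal (3 ^ DIM('a) / c) * (\<integral>y\<in>dc k z. h y)"
   by (rule mult_left_mono) simp
  also have "ennreal (3 ^ DIM('a) / c) * (ennreal c * ennreal (dvol TYPE('a) k)) = leb (trip k z)"
   using c by (simp add: emeasure_trip ennreal_mult[symmetric])
  finally show "leb (case j of (k, z) \<Rightarrow> trip k z)
   \<le> ennreal (3 ^ DIM('a) / c) * (\<integral>x\<in>cell j. h x)" using kz by simp
 qed
 also have "\<dots> = ennreal (3 ^ DIM('a) / c) * (\<Sum>\<^sup>+j\<in>J. (\<integral>x\<in>cell j. h x))"
  by (rule nn_integral_cmult) auto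
 also have "(\<Sum>\<^sup>+j\<in>J. (\<integral>x\<in>cell j. h x)) = (\<integral>x\<in>(\<Union>j\<in>J. cell j). h x)"
  by (rule nn_integral_UN_countable[OF J(1,4) countable_J_sets, symmetric]) auto
 also have "\<dots> \<le> (\<integral>x. h x)"
  by (intro nn_integral_mono) (auto simp: indicator_def)
 finally show ?thesis by (simp add: mult_left_mono)
qed


section \<open>Strong type bounds for the dyadic maximal function, with explicit constants\<close>

lemma dyadic_floor:
 assumes "(x::real) > 0" shows "\<exists>i::int. 2 powr i < x \<and> x \<le> 2 powr (real_of_int i + 1)"
proof (intro exI[of _ "\<lceil>log 2 x\<rceil> - 1"] conjI)
 have x: "x = 2 powr (log 2 x)" using assms by simp
 show "2 powr real_of_int (\<lceil>log 2 x\<rceil> - 1) < x" by (subst (2) x) (intro powr_less_mono, linarith+)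
 show "x \<le> 2 powr (real_of_int (\<lceil>log 2 x\<rceil> - 1) + 1)" by (subst (1) x) (intro powr_mono, linarith+)
qed

text \<open>A single layer suffices: \<open>D\<close> lies between \<open>a 2^i\<close> and
  \<open>a 2^(i+1)\<close> for some \<open>i\<close>, and the term of this \<open>i\<close> already
  dominates. For infinite \<open>D\<close> the terms are unbounded.\<close>

lemma epow_le_level_sum:
 assumes a: "a > 0" and P: "P > 0"
 shows "epow D P \<le> (\<Sum>\<^sup>+i\<in>(UNIV :: int set). ennreal ((a * 2 powr (real_of_int i + 1)) powr P) * indicator {t. t > ennreal (a * 2 powr i)} D)"
  (is "_ \<le> ?S")
proof -
 have ge: "ennreal ((a * 2 powr (real_of_int i + 1)) powr P) \<le> ?S" if "D > ennreal (a * 2 powr i)" for i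
  using nn_integral_ge_point[of i UNIV "\<lambda>i. ennreal ((a * 2 powr (real_of_int i + 1)) powr P) * indicator {t. t > ennreal (a * 2 powr i)} D"] that
  by simp
 show ?thesis
 proof (cases D)
  case (real r)
  show ?thesis
  proof (cases "r = 0")
   case False
   then have "r / a > 0" using real a by simp
   from dyadic_floor[OF this] obtain i :: int where i: "2 powr i < r / a" "r / a \<le> 2 powr (real_of_int i + 1)" by blast
   have "r powr P \<le> (a * 2 powr (real_of_int i + 1)) powr P"
    using i a P real by (intro powr_mono2) (auto simp: field_simps)
   moreover have "D > ennreal (a * 2 powr i)" using i a real by (simp add: field_simps ennreal_less_iff)
   ultimately have "ennreal (r powr P) \<le> ?S" using order_trans[OF ennreal_leI ge] by blast
   then show ?thesis using real by (simp add: epow_ennreal)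
  qed (simp add: real)
 next
  case top
  have ge_all: "ennreal b \<le> ?S" if b: "b > 0" for b
  proof -
   obtain i :: int where i: "b powr (1/P) / a \<le> 2 powr (real_of_int i + 1)" using dyadic_floor[of "b powr (1/P) / a"] a b by auto
   have "b = (b powr (1/P)) powr P" using P b by (simp add: powr_powr)
   also have "\<dots> \<le> (a * 2 powr (real_of_int i + 1)) powr P"
    using i a P by (intro powr_mono2) (auto simp: field_simps)
   finally show ?thesis using ge[of i] top by (meson ennreal_leI ennreal_less_top order_trans)
  qed
  have "?S = top"
  proof (cases ?S)
   case (real s)
   then have "ennreal (s + 1) \<le> ennreal s" using ge_all[of "s + 1"] by simp
   then show ?thesis using real by simp
  qed
  then show ?thesis by simp
 qed
qed

text \<open>A geometric series ending at the largest \<open>i\<close> with \<open>2^i < h\<close>.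
  Its ratio \<open>2 powr (1 - P)\<close> is the origin of the blow-up as \<open>P\<close> tends to
  1.\<close>

lemma level_sum_le_epow:
 assumes P: "P > 1"
 shows "(\<Sum>\<^sup>+i\<in>(UNIV :: int set). ennreal (2 powr (real_of_int i * (P - 1))) * indicator {t. t > ennreal (2 powr i)} h)
  \<le> ennreal (1 / (1 - 2 powr (1 - P))) * epow h (P - 1)"
proof (cases h)
 case (real r)
 show ?thesis
 proof (cases "r = 0")
  case True
  then show ?thesis using real by simp
 next
  case False
  then have "r > 0" using real by simp
  from dyadic_floor[OF this] obtain i0 :: int where i0: "2 powr i0 < r" "r \<le> 2 powr (real_of_int i0 + 1)" by blast
  have q: "0 < 2 powr (1 - P)" "2 powr (1 - P) < (1::real)" using P by (auto simp: powr_less_one)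
  have "(\<Sum>\<^sup>+i\<in>(UNIV :: int set). ennreal (2 powr (real_of_int i * (P - 1))) * indicator {t. t > ennreal (2 powr i)} h)
   \<le> (\<Sum>\<^sup>+i\<in>UNIV. ennreal (2 powr (real_of_int i * (P - 1))) * indicator {..i0} i)"
  proof (rule nn_integral_mono, rule mult_left_mono)
   fix i :: int
   have "i \<le> i0" if "ennreal (2 powr i) < h"
   proof -
    have "2 powr real_of_int i < r" using that real by (simp add: ennreal_less_iff)
    then have "2 powr real_of_int i < 2 powr (real_of_int i0 + 1)" using i0(2) by linarith
    then have "real_of_int i < real_of_int i0 + 1" by (rule powr_less_cancel) simp
    then show ?thesis by linarith
   qed
   then show "indicator {t. ennreal (2 powr i) < t} h \<le> (indicator {..i0} i :: ennreal)"
    by (auto simp: indicator_def)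
  qed simp
  also have "\<dots> = (\<Sum>\<^sup>+i\<in>{..i0}. ennreal (2 powr (real_of_int i * (P - 1))))"
   by (simp add: nn_integral_count_space_indicator)
  also have "\<dots> = (\<Sum>\<^sup>+l\<in>UNIV. ennreal (2 powr (real_of_int (i0 - int l) * (P - 1))))"
   by (intro nn_integral_bij_count_space[symmetric] bij_betwI[where g="\<lambda>i. nat (i0 - i)"]) auto
  also have "\<dots> = (\<Sum>\<^sup>+l\<in>UNIV. ennreal (2 powr (i0 * (P - 1)) * (2 powr (1 - P)) ^ l))"
   by (intro nn_integral_cong) (simp add: powr_realpow[symmetric] powr_powr powr_add[symmetric] algebra_simps)
  also have "\<dots> = (\<Sum>l. ennreal (2 powr (i0 * (P - 1)) * (2 powr (1 - P)) ^ l))"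
   by (rule nn_integral_count_space_nat)
  also have "\<dots> = ennreal (\<Sum>l. 2 powr (i0 * (P - 1)) * (2 powr (1 - P)) ^ l)"
   by (rule suminf_ennreal2) (use q in \<open>auto intro!: summable_mult summable_geometric\<close>)
  also have "(\<Sum>l. 2 powr (i0 * (P - 1)) * (2 powr (1 - P)) ^ l) = 2 powr (i0 * (P - 1)) * (1 / (1 - 2 powr (1 - P)))"
   using q by (subst suminf_mult) (auto intro!: summable_geometric simp: suminf_geometric)
  also have "\<dots> \<le> r powr (P - 1) * (1 / (1 - 2 powr (1 - P)))"
  proof (rule mult_right_mono)
   have "2 powr (i0 * (P - 1)) = (2 powr i0) powr (P - 1)" by (simp add: powr_powr)
   also have "\<dots> \<le> r powr (P - 1)" using i0 P by (intro powr_mono2) auto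
   finally show "2 powr (i0 * (P - 1)) \<le> r powr (P - 1)" .
  qed (use q in simp)
  finally show ?thesis using real q by (simp add: epow_ennreal ennreal_mult[symmetric] mult.commute ennreal_leI)
 qed
next
 case top
 have "2 powr (1 - P) < (1::real)" using P by (auto simp: powr_less_one)
 then show ?thesis using top P by (simp add: ennreal_mult_top)
qed

text \<open>The values of \<open>h\<close> up to \<open>c\<close> contribute at most
  \<open>3^n c\<close> to \<open>dmax h\<close>, so the values above \<open>c\<close> must account
  for the rest.\<close>

lemma dmax_truncate:
 fixes h :: "'a::euclidean_space \<Rightarrow> ennreal"
 assumes [measurable]: "lm h"
  and "dmax h x > 2 * 3 ^ DIM('a) * ennreal c" and c: "c > 0"
 shows "dmax (\<lambda>y. h y * indicator {t. t > ennreal c} (h y)) x > 3 ^ DIM('a) * ennreal c"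
proof (rule ccontr)
 let ?h = "\<lambda>y. h y * indicator {t. t > ennreal c} (h y)"
 assume "\<not> ?thesis"
 then have le: "dmax ?h x \<le> 3 ^ DIM('a) * ennreal c" by (simp add: not_less)
 have "dmax h x \<le> 2 * 3 ^ DIM('a) * ennreal c"
  unfolding dmax_le_iff
 proof
  fix k
  have "(\<integral>y\<in>trip k x. h y) \<le> (\<integral>y. ?h y * indicator (trip k x) y + ennreal c * indicator (trip k x) y)"
   by (intro nn_integral_mono) (auto simp: indicator_def)
  also have "\<dots> = (\<integral>y\<in>trip k x. ?h y) + ennreal c * leb (trip k x)"
   by (subst nn_integral_add) (auto simp: nn_integral_cmult_indicator)
  also have "\<dots> \<le> 3 ^ DIM('a) * ennreal c * ennreal (dvol TYPE('a) k) + ennreal c * (3 ^ DIM('a) * ennreal (dvol TYPE('a) k))"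
   by (intro add_mono order_trans[OF dmax_ge] mult_right_mono le) (auto simp: emeasure_trip ennreal_mult ennreal_power[symmetric])
  also have "\<dots> = 2 * 3 ^ DIM('a) * ennreal c * ennreal (dvol TYPE('a) k)"
   by (simp add: mult_ac mult_2[symmetric])
  finally show "(\<integral>y\<in>trip k x. h y) \<le> 2 * 3 ^ DIM('a) * ennreal c * ennreal (dvol TYPE('a) k)" .
 qed
 then show False using assms(2) by simp
qed

text \<open>Marcinkiewicz interpolation by layers. At height \<open>2 N 2^i\<close> the function
  \<open>dmax h\<close> is compared with \<open>dmax\<close> of the values of \<open>h\<close> above
  \<open>2^i\<close>, where the weak type bound applies; after exchanging sum and integral,
  \<open>level_sum_le_epow\<close> acts at each point.\<close>

lemma dmax_strong_aux:
 fixes h :: "'a::euclidean_space \<Rightarrow> ennreal"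
 assumes [measurable]: "lm h" and P: "P > 1"
 shows "(\<integral>x. epow (dmax h x) P)
  \<le> ennreal (3 ^ DIM('a) * (4 * 3 ^ DIM('a)) powr P / (1 - 2 powr (1 - P))) * (\<integral>x. epow (h x) P)"
proof -
 define N :: real where "N = 3 ^ DIM('a)"
 have N: "N > 0" by (simp add: N_def)
 have Ne: "(3::ennreal) ^ DIM('a) = ennreal N" by (simp add: N_def ennreal_power[symmetric])
 define w where "w = (\<lambda>i::int. ennreal ((2 * N * 2 powr (real_of_int i + 1)) powr P))"
 have "(\<integral>x. epow (dmax h x) P)
  \<le> (\<integral>x. (\<Sum>\<^sup>+i\<in>(UNIV :: int set). w i * indicator {t. t > ennreal (2 * N * 2 powr i)} (dmax h x)))"
  unfolding w_def by (intro nn_integral_mono epow_le_level_sum) (use N P in auto)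
 also have "\<dots> = (\<Sum>\<^sup>+i\<in>(UNIV :: int set). (\<integral>x. w i * indicator {t. t > ennreal (2 * N * 2 powr i)} (dmax h x)))"
  by (rule nn_integral_count_space_nn_integral) auto
 also have "\<dots> \<le> (\<Sum>\<^sup>+i\<in>(UNIV :: int set). (\<integral>x. ennreal N * ennreal ((4 * N) powr P) * (h x * (ennreal (2 powr (real_of_int i * (P - 1))) * indicator {t. t > ennreal (2 powr i)} (h x)))))"
 proof (rule nn_integral_mono)
  fix i :: int
  let ?c = "2 powr real_of_int i"
  let ?h = "\<lambda>y. h y * indicator {t. t > ennreal ?c} (h y)"
  have "(\<integral>x. w i * indicator {t. t > ennreal (2 * N * ?c)} (dmax h x))
   \<le> (\<integral>x. w i * indicator {x. dmax ?h x > 3 ^ DIM('a) * ennreal ?c} x)"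
  proof (intro nn_integral_mono mult_left_mono)
   fix x
   show "indicator {t. t > ennreal (2 * N * ?c)} (dmax h x) \<le> (indicator {x. dmax ?h x > 3 ^ DIM('a) * ennreal ?c} x :: ennreal)"
    using dmax_truncate[of h ?c x] N by (auto simp: indicator_def Ne ennreal_mult)
  qed simp
  also have "\<dots> = w i * leb {x. dmax ?h x > 3 ^ DIM('a) * ennreal ?c}"
   by (intro nn_integral_cmult_indicator Collect_less_lebesgue) measurable
  also have "\<dots> \<le> w i * (ennreal (N / ?c) * (\<integral>x. ?h x))"
   unfolding N_def by (intro mult_left_mono dmax_weak) auto
  also have "\<dots> = (w i * ennreal (N / ?c)) * (\<integral>x. ?h x)" by (simp add: mult_ac)
  also have "w i * ennreal (N / ?c) = ennreal N * ennreal ((4 * N) powr P) * ennreal (2 powr (real_of_int i * (P - 1)))"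
  proof -
   have "(2 * N * 2 powr (real_of_int i + 1)) powr P * (N / ?c) = N * (4 * N) powr P * 2 powr (real_of_int i * (P - 1))"
   proof -
    have e1: "2 * N * 2 powr (real_of_int i + 1) = 4 * N * ?c" by (simp add: powr_add)
    have e2: "?c powr P / ?c = 2 powr (real_of_int i * (P - 1))"
     by (simp add: powr_powr powr_diff right_diff_distrib)
    have "(4 * N * ?c) powr P * (N / ?c) = N * (4 * N) powr P * (?c powr P / ?c)"
     using N by (simp add: powr_mult)
    then show ?thesis unfolding e1 e2 .
   qed
   then show ?thesis using N by (simp add: w_def ennreal_mult[symmetric] mult.assoc)
  qed
  also have "ennreal N * ennreal ((4 * N) powr P) * ennreal (2 powr (real_of_int i * (P - 1))) * (\<integral>x. ?h x)
   = (\<integral>x. ennreal N * ennreal ((4 * N) powr P) * (h x * (ennreal (2 powr (real_of_int i * (P - 1))) * indicator {t. t > ennreal (2 powr i)} (h x))))"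
   by (subst nn_integral_cmult[symmetric]) (auto simp: mult_ac)
  finally show "(\<integral>x. w i * indicator {t. t > ennreal (2 * N * ?c)} (dmax h x))
   \<le> (\<integral>x. ennreal N * ennreal ((4 * N) powr P) * (h x * (ennreal (2 powr (real_of_int i * (P - 1))) * indicator {t. t > ennreal (2 powr i)} (h x))))" .
 qed
 also have "\<dots> = (\<integral>x. (\<Sum>\<^sup>+i\<in>(UNIV :: int set). ennreal N * ennreal ((4 * N) powr P) * (h x * (ennreal (2 powr (real_of_int i * (P - 1))) * indicator {t. t > ennreal (2 powr i)} (h x)))))"
  by (rule nn_integral_count_space_nn_integral[symmetric]) auto
 also have "\<dots> = (\<integral>x. ennreal N * ennreal ((4 * N) powr P) * (h x * (\<Sum>\<^sup>+i\<in>(UNIV :: int set). ennreal (2 powr (real_of_int i * (P - 1))) * indicator {t. t > ennreal (2 powr i)} (h x))))"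
  by (simp add: nn_integral_cmult)
 also have "\<dots> \<le> (\<integral>x. ennreal N * ennreal ((4 * N) powr P) * (h x * (ennreal (1 / (1 - 2 powr (1 - P))) * epow (h x) (P - 1))))"
  by (intro nn_integral_mono mult_left_mono level_sum_le_epow P) auto
 also have "\<dots> = (\<integral>x. (ennreal N * ennreal ((4 * N) powr P) * ennreal (1 / (1 - 2 powr (1 - P)))) * epow (h x) P)"
 proof (rule nn_integral_cong)
  fix x
  have e: "h x * epow (h x) (P - 1) = epow (h x) P" using epow_add[of "h x" 1 "P - 1"] by simp
  show "ennreal N * ennreal ((4 * N) powr P) * (h x * (ennreal (1 / (1 - 2 powr (1 - P))) * epow (h x) (P - 1)))
   = (ennreal N * ennreal ((4 * N) powr P) * ennreal (1 / (1 - 2 powr (1 - P)))) * epow (h x) P"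
   unfolding e[symmetric] by (simp only: mult_ac)
 qed
 also have "\<dots> = ennreal (N * (4 * N) powr P / (1 - 2 powr (1 - P))) * (\<integral>x. epow (h x) P)"
 proof -
  have "2 powr (1 - P) < (1::real)" using P by (auto simp: powr_less_one)
  then show ?thesis using N by (subst nn_integral_cmult) (auto simp: ennreal_mult[symmetric])
 qed
 finally show ?thesis unfolding N_def .
qed

text \<open>Convexity of \<open>2 powr (- x)\<close> on the unit interval, in the form of the
  weighted arithmetic-geometric mean of 1/2 and 1.\<close>

lemma one_minus_powr_ge: assumes "0 < x" "x \<le> 1" shows "1 - 2 powr (- x) \<ge> x / (2::real)"
proof -
 have "(1/2) powr x * 1 powr (1 - x) \<le> x * (1/2) + (1 - x) * (1::real)"
  using assms by (intro Youngs_inequality_0) auto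
 then show ?thesis by (simp add: powr_minus powr_divide field_simps)
qed

text \<open>The factor \<open>1 / (P - 1)\<close> is kept explicit because
  \<open>bimax_bound\<close> uses exponents \<open>P\<close> that approach 1 as the level
  grows.\<close>

lemma dmax_strong:
 fixes h :: "'a::euclidean_space \<Rightarrow> ennreal"
 assumes [measurable]: "lm h" and P: "P > 1" "P \<le> 2"
 shows "(\<integral>x. epow (dmax h x) P)
  \<le> ennreal (2 * 3 ^ DIM('a) * (4 * 3 ^ DIM('a))\<^sup>2 / (P - 1)) * (\<integral>x. epow (h x) P)"
proof -
 let ?N = "3 ^ DIM('a) :: real"
 have 1: "1 - 2 powr (1 - P) \<ge> (P - 1) / 2" using one_minus_powr_ge[of "P - 1"] P by simp
 have 2: "(4 * ?N) powr P \<le> (4 * ?N)\<^sup>2"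
 proof -
  have "1 \<le> ?N" by simp
  then have "(4 * ?N) powr P \<le> (4 * ?N) powr 2" using P by (intro powr_mono) linarith+
  then show ?thesis by simp
 qed
 have "?N * (4 * ?N) powr P / (1 - 2 powr (1 - P)) \<le> ?N * (4 * ?N)\<^sup>2 / ((P - 1) / 2)"
  using 1 2 P by (intro frac_le mult_left_mono) auto
 also have "\<dots> = 2 * ?N * (4 * ?N)\<^sup>2 / (P - 1)" by simp
 finally show ?thesis
  by (intro order_trans[OF dmax_strong_aux[OF assms(1) P(1)]] mult_right_mono ennreal_leI) auto
qed

section \<open>Calderon-Zygmund stopping cells\<close>

abbreviation cvol :: "(int \<times> 'a::euclidean_space) set \<Rightarrow> ennreal" where
 "cvol J \<equiv> \<integral>\<^sup>+(k, z). ennreal (dvol TYPE('a) k) \<partial>count_space J"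

lemma J_union_sets: "countable J \<Longrightarrow> (\<Union>(cell ` J)) \<in> sets lebesgue"
 by (rule sets.countable_UN'') (use countable_J_sets in auto)

text \<open>The finite mass makes all coarse cells fail, so maximal cells exist. The parent of a
  selected cell fails too and is only \<open>2^n\<close> times larger, which gives the upper bound;
  off the cells all averages are at most \<open>A\<close>, and \<open>dyadic_differentiation\<close>
  gives the bound for \<open>h\<close>.\<close>

lemma cz_cubes:
 fixes h :: "'a::euclidean_space \<Rightarrow> ennreal"
 assumes [measurable]: "lm h" and fin: "(\<integral>x. h x) < top" and A: "A > 0"
 obtains J :: "(int \<times> 'a) set" where "countable J" "disjoint_family_on cell J"
  "\<And>k z. (k, z) \<in> J \<Longrightarrow> ennreal (A * dvol TYPE('a) k) < (\<integral>y\<in>dc k z. h y)"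
  "\<And>k z. (k, z) \<in> J \<Longrightarrow> (\<integral>y\<in>dc k z. h y) \<le> ennreal (2 ^ DIM('a) * A * dvol TYPE('a) k)"
  "\<And>k z k'. (k, z) \<in> J \<Longrightarrow> k' < k \<Longrightarrow> (\<integral>y\<in>dc k' z. h y) \<le> ennreal (A * dvol TYPE('a) k')"
  "AE x. x \<notin> (\<Union>(cell ` J)) \<longrightarrow> h x \<le> ennreal A"
  "ennreal A * cvol J \<le> (\<integral>x\<in>(\<Union>(cell ` J)). h x)"
proof -
 define P where "P = (\<lambda>k x. (\<integral>y\<in>dc k x. h y) > ennreal (A * dvol TYPE('a) k))"
 have compat: "P k y = P k x" if "y \<in> dc k x" for k x y unfolding P_def using dc_eq[OF that] by simp
 have "\<exists>K. \<forall>k<K. \<not> P k x" for x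
 proof -
  obtain K where K: "\<And>k. k < K \<Longrightarrow> ennreal (A * dvol TYPE('a) k) > (\<integral>x. h x)"
   using cells_large[OF fin A] by metis
  have "\<not> P k x" if "k < K" for k
  proof -
   have "(\<integral>y\<in>dc k x. h y) \<le> (\<integral>x. h x)"
    by (intro nn_integral_mono) (auto simp: indicator_def)
   then show ?thesis using K[OF that] by (auto simp: P_def)
  qed
  then show ?thesis by blast
 qed
 then obtain J :: "(int \<times> 'a) set" where J: "countable J" "\<And>k z. (k, z) \<in> J \<Longrightarrow> P k z" "\<And>k z k'. (k, z) \<in> J \<Longrightarrow> k' < k \<Longrightarrow> \<not> P k' z"
  "disjoint_family_on cell J" "(\<Union>(cell ` J)) = {x. \<exists>k. P k x}"
  using stopping_cubes[of P, OF compat] by metis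
 have 5: "(\<integral>y\<in>dc k' z. h y) \<le> ennreal (A * dvol TYPE('a) k')" if "(k, z) \<in> J" "k' < k" for k z k'
  using J(3)[OF that] by (simp add: P_def)
 have 4: "(\<integral>y\<in>dc k z. h y) \<le> ennreal (2 ^ DIM('a) * A * dvol TYPE('a) k)" if "(k, z) \<in> J" for k z
 proof -
  have "(\<integral>y\<in>dc k z. h y) \<le> (\<integral>y\<in>dc (k - 1) z. h y)"
   by (intro nn_integral_mono) (use dc_pred in \<open>auto simp: indicator_def\<close>)
  also have "\<dots> \<le> ennreal (A * dvol TYPE('a) (k - 1))" using 5[OF that] by simp
  finally show ?thesis by (simp add: dvol_pred mult_ac)
 qed
 have 6: "AE x. x \<notin> (\<Union>(cell ` J)) \<longrightarrow> h x \<le> ennreal A"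
 proof -
  have "AE x. x \<in> - (\<Union>(cell ` J)) \<longrightarrow> h x \<le> ennreal A"
  proof (rule dyadic_differentiation[of h "\<lambda>_. ennreal A" _ 0])
   show "- (\<Union>(cell ` J)) \<in> sets lebesgue" using J_union_sets[OF J(1)] Compl_in_sets_lebesgue by blast
   show "(\<integral>y\<in>dc k x. ennreal A) < \<infinity>" for k and x :: 'a
    by (simp add: nn_integral_cmult_indicator emeasure_dc ennreal_mult_less_top)
   fix k x assume "x \<in> - (\<Union>(cell ` J))"
   then have "\<not> P k x" using J(5) by auto
   then show "(\<integral>y\<in>dc k x. h y) \<le> (\<integral>y\<in>dc k x. ennreal A)"
    using A by (simp add: P_def nn_integral_cmult_indicator emeasure_dc ennreal_mult)
  qed auto
  then show ?thesis by simp
 qed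
 have 7: "ennreal A * cvol J \<le> (\<integral>x\<in>(\<Union>(cell ` J)). h x)"
 proof -
  have "ennreal A * cvol J = (\<Sum>\<^sup>+(k, z)\<in>J. ennreal A * ennreal (dvol TYPE('a) k))"
   by (subst nn_integral_cmult[symmetric]) (auto simp: case_prod_unfold)
  also have "\<dots> \<le> (\<Sum>\<^sup>+j\<in>J. (\<integral>x\<in>cell j. h x))"
   by (rule nn_integral_mono) (use J(2) A in \<open>force simp: P_def ennreal_mult intro: less_imp_le\<close>)
  also have "\<dots> = (\<integral>x\<in>(\<Union>(cell ` J)). h x)"
   by (rule nn_integral_UN_countable[OF J(1,4) countable_J_sets, symmetric]) auto
  finally show ?thesis .
 qed
 have 3: "ennreal (A * dvol TYPE('a) k) < (\<integral>y\<in>dc k z. h y)" if "(k, z) \<in> J" for k z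
  using J(2)[OF that] by (simp add: P_def)
 show ?thesis by (rule that[OF J(1,4) 3 4 5 6 7])
qed

lemma dvol_mono: "k' \<le> k \<Longrightarrow> dvol TYPE('a::euclidean_space) k \<le> dvol TYPE('a) k'"
proof -
 assume "k' \<le> k"
 then have "k' = k - int (nat (k - k'))" by simp
 then have "dvol TYPE('a) k' = 2 ^ (nat (k - k') * DIM('a)) * dvol TYPE('a) k" by (metis dvol_minus)
 then show ?thesis using mult_right_mono[of 1 "2 ^ (nat (k - k') * DIM('a))" "dvol TYPE('a) k"] by simp
qed

text \<open>The decomposition of \<open>h\<close> cut to the cell. Its whole mass is at most
  \<open>A\<close> times the volume of the cell, so no cell of the same or a larger size is
  selected; the selected ones lie strictly inside.\<close>

lemma cz_cubes_local:
 fixes h :: "'a::euclidean_space \<Rightarrow> ennreal"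
 assumes [measurable]: "lm h" and A: "A > 0"
  and le: "(\<integral>y\<in>dc k0 x0. h y) \<le> ennreal (A * dvol TYPE('a) k0)"
 obtains J :: "(int \<times> 'a) set" where "countable J" "disjoint_family_on cell J"
  "\<And>k z. (k, z) \<in> J \<Longrightarrow> k0 < k \<and> z \<in> dc k0 x0"
  "\<And>k z. (k, z) \<in> J \<Longrightarrow> (\<integral>y\<in>dc k z. h y) \<le> ennreal (2 ^ DIM('a) * A * dvol TYPE('a) k)"
  "AE x. x \<in> dc k0 x0 \<longrightarrow> x \<notin> (\<Union>(cell ` J)) \<longrightarrow> h x \<le> ennreal A"
  "ennreal A * cvol J \<le> (\<integral>y\<in>dc k0 x0. h y)"
proof -
 let ?h = "\<lambda>y. h y * indicator (dc k0 x0) y"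
 have hm: "?h \<in> borel_measurable lebesgue" by measurable
 have fin: "(\<integral>x. ?h x) < top" using le by (simp add: le_less_trans)
 obtain J :: "(int \<times> 'a) set" where J: "countable J" "disjoint_family_on cell J"
  "\<And>k z. (k, z) \<in> J \<Longrightarrow> ennreal (A * dvol TYPE('a) k) < (\<integral>y\<in>dc k z. ?h y)"
  "\<And>k z. (k, z) \<in> J \<Longrightarrow> (\<integral>y\<in>dc k z. ?h y) \<le> ennreal (2 ^ DIM('a) * A * dvol TYPE('a) k)"
  "\<And>k z k'. (k, z) \<in> J \<Longrightarrow> k' < k \<Longrightarrow> (\<integral>y\<in>dc k' z. ?h y) \<le> ennreal (A * dvol TYPE('a) k')"
  "AE x. x \<notin> (\<Union>(cell ` J)) \<longrightarrow> ?h x \<le> ennreal A"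
  "ennreal A * cvol J \<le> (\<integral>x\<in>(\<Union>(cell ` J)). ?h x)"
  by (rule cz_cubes[OF hm fin A], rule that) (assumption | blast)+
 have 3: "k0 < k \<and> z \<in> dc k0 x0" if kz: "(k, z) \<in> J" for k z
 proof
  show "k0 < k"
  proof (rule ccontr)
   assume "\<not> k0 < k"
   have "(\<integral>y\<in>dc k z. ?h y) \<le> (\<integral>y\<in>dc k0 x0. h y)"
    by (intro nn_integral_mono) (auto simp: indicator_def)
   also have "\<dots> \<le> ennreal (A * dvol TYPE('a) k)"
    using \<open>\<not> k0 < k\<close> A dvol_mono[of k k0, where 'a='a] by (intro order_trans[OF le] ennreal_leI) auto
   finally show False using J(3)[OF kz] by simp
  qed
  have "(\<integral>y\<in>dc k z. ?h y) \<noteq> 0" using J(3)[OF kz] by auto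
  then have "dc k z \<inter> dc k0 x0 \<noteq> {}"
  proof (rule contrapos_nn)
   assume "dc k z \<inter> dc k0 x0 = {}"
   then have "(\<lambda>y. ?h y * indicator (dc k z) y) = (\<lambda>y. 0)" by (auto simp: indicator_def fun_eq_iff)
   then show "(\<integral>y\<in>dc k z. ?h y) = 0" by simp
  qed
  then have "dc k z \<subseteq> dc k0 x0" using dc_meet[of k0 k x0 z] \<open>k0 < k\<close> by (simp add: Int_commute)
  then show "z \<in> dc k0 x0" using dc_self by blast
 qed
 have 4: "(\<integral>y\<in>dc k z. h y) \<le> ennreal (2 ^ DIM('a) * A * dvol TYPE('a) k)" if kz: "(k, z) \<in> J" for k z
 proof -
  have "dc k z \<subseteq> dc k0 x0" using 3[OF kz] dc_nested[of k0 k z x0] by simp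
  then have "(\<integral>y\<in>dc k z. h y) = (\<integral>y\<in>dc k z. ?h y)"
   by (intro nn_integral_cong) (auto simp: indicator_def)
  then show ?thesis using J(4)[OF kz] by simp
 qed
 have 5: "AE x. x \<in> dc k0 x0 \<longrightarrow> x \<notin> (\<Union>(cell ` J)) \<longrightarrow> h x \<le> ennreal A"
  using J(6) by eventually_elim auto
 have 6: "ennreal A * cvol J \<le> (\<integral>y\<in>dc k0 x0. h y)"
  by (rule order_trans[OF J(7)]) (intro nn_integral_mono, auto simp: indicator_def)
 show ?thesis by (rule that[OF J(1,2) 3 4 5 6])
qed

section \<open>Exponential integrability of BMO functions\<close>

text \<open>Integrate \<open>\<bar>c1 - c2\<bar> \<le> \<bar>b y - c1\<bar> + \<bar>b y -
  c2\<bar>\<close> over the cell. This controls the change of the centre from one cube to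
  another.\<close>

lemma cell_oscillation:
 fixes b :: "'a::euclidean_space \<Rightarrow> real"
 assumes [measurable]: "lm b"
  and "(\<integral>y\<in>dc k x. ennreal \<bar>b y - c1\<bar>) \<le> ennreal (\<beta>1 * dvol TYPE('a) k)"
  and "(\<integral>y\<in>dc k x. ennreal \<bar>b y - c2\<bar>) \<le> ennreal (\<beta>2 * dvol TYPE('a) k)" "\<beta>1 \<ge> 0" "\<beta>2 \<ge> 0"
 shows "\<bar>c1 - c2\<bar> \<le> \<beta>1 + \<beta>2"
proof -
 have "ennreal (\<bar>c1 - c2\<bar> * dvol TYPE('a) k) = (\<integral>y\<in>dc k x. ennreal \<bar>c1 - c2\<bar>)"
  by (simp add: nn_integral_cmult_indicator emeasure_dc ennreal_mult)
 also have "\<dots> \<le> (\<integral>y. ennreal \<bar>b y - c1\<bar> * indicator (dc k x) y + ennreal \<bar>b y - c2\<bar> * indicator (dc k x) y)"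
  by (intro nn_integral_mono) (auto simp: indicator_def ennreal_plus[symmetric] simp del: ennreal_plus)
 also have "\<dots> = (\<integral>y\<in>dc k x. ennreal \<bar>b y - c1\<bar>) + (\<integral>y\<in>dc k x. ennreal \<bar>b y - c2\<bar>)"
  by (rule nn_integral_add) auto
 also have "\<dots> \<le> ennreal (\<beta>1 * dvol TYPE('a) k) + ennreal (\<beta>2 * dvol TYPE('a) k)"
  by (intro add_mono assms)
 also have "\<dots> = ennreal ((\<beta>1 + \<beta>2) * dvol TYPE('a) k)"
  using assms(4,5) by (simp add: distrib_right)
 finally have "\<bar>c1 - c2\<bar> * dvol TYPE('a) k \<le> (\<beta>1 + \<beta>2) * dvol TYPE('a) k"
  using assms(4,5) by (subst (asm) ennreal_le_iff) auto
 then show ?thesis by simp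
qed

text \<open>The exponential is truncated at height \<open>L\<close>, so that its supremal average is finite and can be absorbed.\<close>

lemma john_nirenberg:
 fixes b :: "'a::euclidean_space \<Rightarrow> real" and c :: "int \<Rightarrow> 'a \<Rightarrow> real"
 assumes [measurable]: "lm b" and \<beta>: "\<beta> > 0"
  and osc: "\<And>k x. (\<integral>y\<in>trip k x. ennreal \<bar>b y - c k x\<bar>) \<le> ennreal (\<beta> * dvol TYPE('a) k)"
 shows "\<exists>\<theta>>0. \<forall>k x. (\<integral>y\<in>trip k x. ennreal (exp (\<theta> * \<bar>b y - c k x\<bar>))) \<le> ennreal (9 * 3 ^ DIM('a) * dvol TYPE('a) k)"
proof -
 \<comment> \<open>With \<open>A\<close> twice the mean oscillation the stopping cells fill at most
   half of a cell. \<open>D\<close> bounds the change of the centre both from a cell to its stopping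
   cells and between the cells of one triple.\<close>
 define A where "A = 2 * \<beta>"
 define D where "D = \<beta> + 2 ^ DIM('a) * A"
 have A: "A > 0" using \<beta> by (simp add: A_def)
 have AD: "A \<le> D" "2 * \<beta> \<le> D" "D > 0"
 proof -
  have "1 * A \<le> 2 ^ DIM('a) * A" using A by (intro mult_right_mono) auto
  then show "A \<le> D" using \<beta> by (simp add: D_def)
  then show "2 * \<beta> \<le> D" "D > 0" using A by (auto simp: A_def)
 qed
 \<comment> \<open>Now \<open>exp (\<theta> * D) = 3 / 2\<close>, and the supremum \<open>s\<close>
   of the means satisfies \<open>s \<le> 3/2 + 3/2 * s / 2\<close>, that is
   \<open>s \<le> 6\<close>. Passing to triples costs another factor 3/2, whence the 9 in the
   conclusion.\<close>
 define \<theta> where "\<theta> = ln (3/2) / D"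
 have \<theta>: "\<theta> > 0" using AD by (simp add: \<theta>_def)
 have eD: "exp (\<theta> * D) = 3 / 2" using AD by (simp add: \<theta>_def)
 have eA: "exp (\<theta> * A) \<le> 3 / 2" using AD \<theta> eD by (metis exp_le_cancel_iff mult_le_cancel_left_pos)
 have osc': "(\<integral>y\<in>dc k q. ennreal \<bar>b y - c k x\<bar>) \<le> ennreal (\<beta> * dvol TYPE('a) k)" if "q \<in> trip k x" for k x q
  by (rule order_trans[OF _ osc]) (intro nn_integral_mono, use trip_cell_subset[OF that] in \<open>auto simp: indicator_def\<close>)
 have trunc: "(\<integral>y\<in>dc k x. ennreal (min (exp (\<theta> * \<bar>b y - c k x\<bar>)) L)) \<le> ennreal (6 * dvol TYPE('a) k)" if L: "L > 0" for L k x
 proof -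
  define X where "X = (\<lambda>k x. \<integral>\<^sup>+y\<in>dc k x. ennreal (min (exp (\<theta> * \<bar>b y - c k x\<bar>)) L) \<partial>lebesgue)"
  define S where "S = (SUP (k, x). X k x / ennreal (dvol TYPE('a) k))"
  have XS: "X k x \<le> S * ennreal (dvol TYPE('a) k)" for k x
  proof -
   have "X k x / ennreal (dvol TYPE('a) k) \<le> S" unfolding S_def by (rule SUP_upper2[of "(k, x)"]) auto
   then show ?thesis by (simp add: ennreal_divide_le_iff)
  qed
  have XL: "X k x \<le> ennreal L * ennreal (dvol TYPE('a) k)" for k x
  proof -
   have "X k x \<le> (\<integral>y\<in>dc k x. ennreal L)" unfolding X_def
    by (intro nn_integral_mono mult_right_mono ennreal_leI) auto
   then show ?thesis by (simp add: nn_integral_cmult_indicator emeasure_dc)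
  qed
  have "S \<le> ennreal L" unfolding S_def
   by (rule SUP_least) (use XL in \<open>auto simp: ennreal_divide_le_iff\<close>)
  then obtain s where s: "S = ennreal s" "s \<ge> 0" by (cases S) (auto simp: top_unique)
  have rec: "X k x \<le> ennreal ((3/2 + 3/4 * s) * dvol TYPE('a) k)" for k x
  proof -
   let ?h = "\<lambda>y. ennreal \<bar>b y - c k x\<bar>" and ?V = "dvol TYPE('a)"
   have hm: "?h \<in> borel_measurable lebesgue" by measurable
   have le: "(\<integral>y\<in>dc k x. ?h y) \<le> ennreal (\<beta> * ?V k)" by (rule osc') simp
   also have "\<dots> \<le> ennreal (A * ?V k)" using \<beta> by (intro ennreal_leI mult_right_mono) (auto simp: A_def)
   finally have le2: "(\<integral>y\<in>dc k x. ?h y) \<le> ennreal (A * ?V k)" .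
   obtain J :: "(int \<times> 'a) set" where J: "countable J" "disjoint_family_on cell J"
    "\<And>k' z. (k', z) \<in> J \<Longrightarrow> k < k' \<and> z \<in> dc k x"
    "\<And>k' z. (k', z) \<in> J \<Longrightarrow> (\<integral>y\<in>dc k' z. ?h y) \<le> ennreal (2 ^ DIM('a) * A * ?V k')"
    "AE y. y \<in> dc k x \<longrightarrow> y \<notin> (\<Union>(cell ` J)) \<longrightarrow> ?h y \<le> ennreal A"
    "ennreal A * cvol J \<le> (\<integral>y\<in>dc k x. ?h y)"
    by (rule cz_cubes_local[OF hm A le2], rule that) (assumption | blast)+
   let ?U = "\<Union>(cell ` J)"
   have Um [measurable]: "?U \<in> sets lebesgue" by (rule J_union_sets[OF J(1)])
   have sJ: "cvol J \<le> ennreal (?V k / 2)"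
   proof -
    have "ennreal A * cvol J \<le> ennreal A * ennreal (?V k / 2)"
     using order_trans[OF J(6) le] A by (simp add: A_def ennreal_mult[symmetric])
    then show ?thesis using A by (subst (asm) ennreal_mult_le_mult_iff) auto
   qed
   let ?E = "\<lambda>c y. ennreal (min (exp (\<theta> * \<bar>b y - c\<bar>)) L)"
   have "X k x \<le> (\<integral>y. ennreal (3/2) * indicator (dc k x) y + ?E (c k x) y * indicator ?U y)"
    unfolding X_def
   proof (rule nn_integral_mono_AE)
    show "AE y. ?E (c k x) y * indicator (dc k x) y \<le> ennreal (3/2) * indicator (dc k x) y + ?E (c k x) y * indicator ?U y"
     using J(5)
    proof eventually_elim
     case (elim y)
     show ?case
     proof (cases "y \<in> ?U \<or> y \<notin> dc k x")
      case True
      then show ?thesis by (auto simp: indicator_def)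
     next
      case False
      then have "\<bar>b y - c k x\<bar> \<le> A" using elim A by auto
      then have "exp (\<theta> * \<bar>b y - c k x\<bar>) \<le> exp (\<theta> * A)" using \<theta> by simp
      then have "min (exp (\<theta> * \<bar>b y - c k x\<bar>)) L \<le> 3 / 2" using eA by linarith
      then show ?thesis using False by (auto simp: indicator_def intro!: ennreal_leI add_increasing2)
     qed
    qed
   qed
   also have "\<dots> = ennreal (3/2) * ennreal (?V k) + (\<integral>y\<in>?U. ?E (c k x) y)"
    by (subst nn_integral_add) (auto simp: nn_integral_cmult_indicator emeasure_dc)
   also have "(\<integral>y\<in>?U. ?E (c k x) y) = (\<Sum>\<^sup>+j\<in>J. (\<integral>y\<in>cell j. ?E (c k x) y))"
    by (rule nn_integral_UN_countable[OF J(1,2) countable_J_sets]) measurable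
   also have "\<dots> \<le> (\<Sum>\<^sup>+j\<in>J. ennreal (3/2 * s) * (case j of (k, z) \<Rightarrow> ennreal (?V k)))"
   proof (rule nn_integral_mono)
    fix j assume "j \<in> space (count_space J)"
    then obtain k' z where kz: "j = (k', z)" "(k', z) \<in> J" by (cases j) auto
    have "\<bar>c k' z - c k x\<bar> \<le> \<beta> + 2 ^ DIM('a) * A"
     by (rule cell_oscillation[where b=b and k=k' and x=z]) (use osc'[where k=k' and x=z and q=z] J(4)[OF kz(2)] \<beta> A in auto)
    then have d: "\<bar>c k' z - c k x\<bar> \<le> D" by (simp add: D_def)
    have "(\<integral>y\<in>dc k' z. ?E (c k x) y) \<le> (\<integral>y. ennreal (3/2) * (?E (c k' z) y * indicator (dc k' z) y))"
    proof (rule nn_integral_mono)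
     fix y
     have "\<theta> * \<bar>b y - c k x\<bar> \<le> \<theta> * \<bar>b y - c k' z\<bar> + \<theta> * D"
      using d \<theta> by (simp add: distrib_left[symmetric])
     then have "exp (\<theta> * \<bar>b y - c k x\<bar>) \<le> exp (\<theta> * \<bar>b y - c k' z\<bar>) * (3/2)"
      unfolding eD[symmetric] exp_add[symmetric] by simp
     then have "min (exp (\<theta> * \<bar>b y - c k x\<bar>)) L \<le> 3/2 * min (exp (\<theta> * \<bar>b y - c k' z\<bar>)) L"
      using L by (auto simp: min_def)
     then show "?E (c k x) y * indicator (dc k' z) y \<le> ennreal (3/2) * (?E (c k' z) y * indicator (dc k' z) y)"
      using L by (auto simp: indicator_def ennreal_mult[symmetric] intro!: ennreal_leI)
    qed
    also have "\<dots> = ennreal (3/2) * X k' z" unfolding X_def by (rule nn_integral_cmult) measurable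
    also have "\<dots> \<le> ennreal (3/2) * (S * ennreal (?V k'))" by (intro mult_left_mono XS) simp
    also have "\<dots> = ennreal (3/2 * s) * ennreal (?V k')" using s by (simp add: ennreal_mult[symmetric])
    finally show "(\<integral>y\<in>cell j. ?E (c k x) y) \<le> ennreal (3/2 * s) * (case j of (k, z) \<Rightarrow> ennreal (?V k))"
     using kz by simp
   qed
   also have "\<dots> = ennreal (3/2 * s) * cvol J"
    by (rule nn_integral_cmult) auto
   also have "\<dots> \<le> ennreal (3/2 * s) * ennreal (?V k / 2)" by (intro mult_left_mono sJ) simp
   also have "ennreal (3/2) * ennreal (?V k) + ennreal (3/2 * s) * ennreal (?V k / 2) = ennreal ((3/2 + 3/4 * s) * ?V k)"
    using s by (simp add: ennreal_mult[symmetric] ennreal_plus[symmetric] algebra_simps del: ennreal_plus)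
   finally show ?thesis by (simp add: add_mono)
  qed
  have rec': "X k x \<le> ennreal (3/2 + 3/4 * s) * ennreal (dvol TYPE('a) k)" for k x
   using rec[of k x] s by (subst ennreal_mult[symmetric]) auto
  have "S \<le> ennreal (3/2 + 3/4 * s)" unfolding S_def
   by (rule SUP_least) (use rec' in \<open>auto simp: ennreal_divide_le_iff simp del: ennreal_plus\<close>)
  then have "s \<le> 3/2 + 3/4 * s" using s by (subst (asm) s(1), subst (asm) ennreal_le_iff) auto
  then have "s \<le> 6" by simp
  have "X k x \<le> ennreal s * ennreal (dvol TYPE('a) k)" using XS s by simp
  also have "\<dots> \<le> ennreal (6 * dvol TYPE('a) k)"
   using \<open>s \<le> 6\<close> s by (simp add: ennreal_mult[symmetric] ennreal_leI)
  finally show ?thesis unfolding X_def .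
 qed
 have full: "(\<integral>y\<in>dc k x. ennreal (exp (\<theta> * \<bar>b y - c k x\<bar>))) \<le> ennreal (6 * dvol TYPE('a) k)" for k x
 proof -
  let ?f = "\<lambda>L::nat. \<lambda>y. ennreal (min (exp (\<theta> * \<bar>b y - c k x\<bar>)) (real L + 1)) * indicator (dc k x) y"
  have "(\<lambda>y. SUP L. ?f L y) = (\<lambda>y. ennreal (exp (\<theta> * \<bar>b y - c k x\<bar>)) * indicator (dc k x) y)"
  proof
   fix y
   obtain n :: nat where n: "exp (\<theta> * \<bar>b y - c k x\<bar>) \<le> real n" using real_arch_simple by blast
   show "(SUP L. ?f L y) = ennreal (exp (\<theta> * \<bar>b y - c k x\<bar>)) * indicator (dc k x) y"
   proof (rule antisym)
    show "(SUP L. ?f L y) \<le> ennreal (exp (\<theta> * \<bar>b y - c k x\<bar>)) * indicator (dc k x) y"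
     by (intro SUP_least mult_right_mono ennreal_leI) auto
    show "ennreal (exp (\<theta> * \<bar>b y - c k x\<bar>)) * indicator (dc k x) y \<le> (SUP L. ?f L y)"
     by (rule SUP_upper2[of n]) (use n in \<open>auto simp: min_def\<close>)
   qed
  qed
  then have "(\<integral>y\<in>dc k x. ennreal (exp (\<theta> * \<bar>b y - c k x\<bar>))) = (\<integral>y. (SUP L. ?f L y))" by simp
  also have "\<dots> = (SUP L. \<integral>\<^sup>+y. ?f L y \<partial>lebesgue)"
  proof (rule nn_integral_monotone_convergence_SUP)
   show "incseq ?f" by (auto simp: incseq_def le_fun_def intro!: mult_right_mono ennreal_leI)
  qed measurable
  also have "\<dots> \<le> ennreal (6 * dvol TYPE('a) k)" by (rule SUP_least) (rule trunc, simp)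
  finally show ?thesis .
 qed
 have "(\<integral>y\<in>trip k x. ennreal (exp (\<theta> * \<bar>b y - c k x\<bar>))) \<le> ennreal (9 * 3 ^ DIM('a) * dvol TYPE('a) k)" for k x
 proof -
  have "(\<integral>y\<in>trip k x. ennreal (exp (\<theta> * \<bar>b y - c k x\<bar>))) \<le> 3 ^ DIM('a) * ennreal 9 * ennreal (dvol TYPE('a) k)"
  proof (rule trip_average)
   fix q assume q: "q \<in> trip k x"
   have "\<bar>c k q - c k x\<bar> \<le> \<beta> + \<beta>"
    by (rule cell_oscillation[where b=b and k=k and x=q]) (use osc'[where k=k and x=q and q=q] osc'[OF q] \<beta> in auto)
   then have d: "\<bar>c k q - c k x\<bar> \<le> D" using AD by simp
   have "(\<integral>y\<in>dc k q. ennreal (exp (\<theta> * \<bar>b y - c k x\<bar>)))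
    \<le> (\<integral>y. ennreal (3/2) * (ennreal (exp (\<theta> * \<bar>b y - c k q\<bar>)) * indicator (dc k q) y))"
   proof (rule nn_integral_mono)
    fix y
    have "\<theta> * \<bar>b y - c k x\<bar> \<le> \<theta> * \<bar>b y - c k q\<bar> + \<theta> * D"
     using d \<theta> by (simp add: distrib_left[symmetric])
    then have "exp (\<theta> * \<bar>b y - c k x\<bar>) \<le> exp (\<theta> * \<bar>b y - c k q\<bar>) * (3/2)"
     unfolding eD[symmetric] exp_add[symmetric] by simp
    then show "ennreal (exp (\<theta> * \<bar>b y - c k x\<bar>)) * indicator (dc k q) y \<le> ennreal (3/2) * (ennreal (exp (\<theta> * \<bar>b y - c k q\<bar>)) * indicator (dc k q) y)"
     by (auto simp: indicator_def ennreal_mult[symmetric] intro!: ennreal_leI)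
   qed
   also have "\<dots> = ennreal (3/2) * (\<integral>y\<in>dc k q. ennreal (exp (\<theta> * \<bar>b y - c k q\<bar>)))"
    by (rule nn_integral_cmult) measurable
   also have "\<dots> \<le> ennreal (3/2) * ennreal (6 * dvol TYPE('a) k)" by (intro mult_left_mono full) simp
   also have "\<dots> = ennreal 9 * ennreal (dvol TYPE('a) k)"
    using ennreal_mult[of "9::real" "dvol TYPE('a) k"] by (simp add: ennreal_mult[symmetric])
   finally show "(\<integral>y\<in>dc k q. ennreal (exp (\<theta> * \<bar>b y - c k x\<bar>))) \<le> ennreal 9 * ennreal (dvol TYPE('a) k)" .
  qed measurable
  also have "\<dots> = ennreal (9 * 3 ^ DIM('a) * dvol TYPE('a) k)"
   by (simp add: ennreal_mult ennreal_power[symmetric] mult_ac)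
  finally show ?thesis .
 qed
 then show ?thesis using \<theta> by blast
qed

section \<open>Calderon-Zygmund operators\<close>

abbreviation l2sq :: "('a::euclidean_space \<Rightarrow> complex) \<Rightarrow> ennreal" where
 "l2sq f \<equiv> \<integral>x. ennreal ((cmod (f x))\<^sup>2)"

lemma L2_iff: "L2 f \<longleftrightarrow> f \<in> borel_measurable lebesgue \<and> (l2sq f) < \<infinity>"
 unfolding L2_def integrable_iff_bounded by (auto intro!: borel_measurable_power)

lemma L2_measurable: "L2 f \<Longrightarrow> lm f" by (simp add: L2_def)

lemma L2norm_sq: "L2 f \<Longrightarrow> ennreal ((L2norm f)\<^sup>2) = (l2sq f)"
 unfolding L2norm_def by (subst nn_integral_eq_integral) (auto simp: L2_def integral_nonneg_AE)

lemma L2_dominated: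
 assumes "lm f" "L2 g" "AE x. cmod (f x) \<le> c * cmod (g x)"
 shows "L2 f"
proof -
 note [measurable] = assms(1) L2_measurable[OF assms(2)]
 have "(l2sq f) \<le> (\<integral>x. ennreal (c\<^sup>2) * ennreal ((cmod (g x))\<^sup>2))"
 proof (rule nn_integral_mono_AE)
  show "AE x. ennreal ((cmod (f x))\<^sup>2) \<le> ennreal (c\<^sup>2) * ennreal ((cmod (g x))\<^sup>2)"
   using assms(3)
  proof eventually_elim
   case (elim x)
   then have "(cmod (f x))\<^sup>2 \<le> (c * cmod (g x))\<^sup>2" by (intro power_mono) auto
   then show ?case by (simp add: ennreal_mult[symmetric] power_mult_distrib ennreal_leI)
  qed
 qed
 also have "\<dots> = ennreal (c\<^sup>2) * (l2sq g)"
  by (rule nn_integral_cmult) measurable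
 also have "\<dots> < \<infinity>" using assms(2) by (auto simp: L2_iff ennreal_mult_less_top)
 finally show ?thesis using assms(1) by (simp add: L2_iff)
qed

lemma L2_add: assumes "L2 f" "L2 g" shows "L2 (\<lambda>x. f x + g x)"
proof -
 note [measurable] = L2_measurable[OF assms(1)] L2_measurable[OF assms(2)]
 have pt: "(cmod (a + b))\<^sup>2 \<le> 2 * (cmod a)\<^sup>2 + 2 * (cmod b)\<^sup>2" for a b
 proof -
  have "(cmod (a + b))\<^sup>2 \<le> (cmod a + cmod b)\<^sup>2" by (intro power_mono norm_triangle_ineq) auto
  also have "\<dots> \<le> 2 * (cmod a)\<^sup>2 + 2 * (cmod b)\<^sup>2" using sum_squares_bound[of "cmod a" "cmod b"] by (simp add: power2_sum)
  finally show ?thesis .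
 qed
 have "(\<integral>x. ennreal ((cmod (f x + g x))\<^sup>2)) \<le> (\<integral>x. 2 * ennreal ((cmod (f x))\<^sup>2) + 2 * ennreal ((cmod (g x))\<^sup>2))"
 proof (rule nn_integral_mono)
  fix x
  have "ennreal ((cmod (f x + g x))\<^sup>2) \<le> ennreal (2 * (cmod (f x))\<^sup>2 + 2 * (cmod (g x))\<^sup>2)" by (intro ennreal_leI pt)
  then show "ennreal ((cmod (f x + g x))\<^sup>2) \<le> 2 * ennreal ((cmod (f x))\<^sup>2) + 2 * ennreal ((cmod (g x))\<^sup>2)"
   by (simp add: ennreal_mult)
 qed
 also have "\<dots> = 2 * (l2sq f) + 2 * (l2sq g)"
  by (simp add: nn_integral_add nn_integral_cmult)
 also have "\<dots> < \<infinity>" using assms by (auto simp: L2_iff ennreal_mult_less_top)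
 finally show ?thesis by (simp add: L2_iff)
qed

lemma L2_scale: assumes "L2 f" shows "L2 (\<lambda>x. c * f x)"
proof -
 note [measurable] = L2_measurable[OF assms]
 show ?thesis by (rule L2_dominated[OF _ assms, of _ "cmod c"]) (auto simp: norm_mult)
qed

lemma L2_diff: assumes "L2 f" "L2 g" shows "L2 (\<lambda>x. f x - g x)"
 using L2_add[OF assms(1) L2_scale[OF assms(2), of "-1"]] by simp

lemma L2_zero [simp]: "L2 (\<lambda>x. 0)" by (simp add: L2_iff)

lemma L2_sum: assumes "\<And>i. i \<in> A \<Longrightarrow> L2 (f i)" shows "L2 (\<lambda>x. \<Sum>i\<in>A. f i x)"
 using assms by (induction A rule: infinite_finite_induct) (auto intro!: L2_add)

lemma L2_indicator: assumes "L2 f" "S \<in> sets lebesgue" shows "L2 (\<lambda>x. f x * indicator S x)"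
proof -
 note [measurable] = L2_measurable[OF assms(1)] assms(2)
 show ?thesis by (rule L2_dominated[OF _ assms(1), of _ 1]) (auto simp: norm_mult indicator_def)
qed

lemma L2_indicator_const:
 assumes "S \<in> sets lebesgue" "leb S < \<infinity>" shows "L2 (\<lambda>x. c * indicator S x)"
proof -
 note [measurable] = assms(1)
 have "(\<integral>x. ennreal ((cmod (indicator S x :: complex))\<^sup>2)) = (\<integral>x. indicator S x)"
  by (intro nn_integral_cong) (auto simp: indicator_def)
 then have "L2 (\<lambda>x. indicator S x :: complex)" using assms by (simp add: L2_iff)
 then show ?thesis by (rule L2_scale)
qed

lemma trip_shell:
 assumes "x \<notin> trip k z" obtains l where "x \<in> trip (k - int l - 1) z" "x \<notin> trip (k - int l) z"
proof -
 define m where "m = (LEAST l. x \<in> trip (k - int l) z)"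
 have ex: "\<exists>l. x \<in> trip (k - int l) z" using UN_trip[of k z] by blast
 have m: "x \<in> trip (k - int m) z" unfolding m_def using ex by (rule LeastI_ex)
 then have "m \<noteq> 0" using assms by (metis diff_zero of_nat_0)
 then obtain l where l: "m = Suc l" by (cases m) auto
 have "x \<notin> trip (k - int l) z" using not_less_Least[of l "\<lambda>l. x \<in> trip (k - int l) z"] l by (simp add: m_def)
 moreover have "x \<in> trip (k - int l - 1) z" using m l by (simp add: algebra_simps)
 ultimately show ?thesis using that by blast
qed

locale czo =
 fixes T :: "('a::euclidean_space \<Rightarrow> complex) \<Rightarrow> 'a \<Rightarrow> complex" and K :: "'a \<Rightarrow> complex"
 assumes czo: "CZO T K"
begin

lemma T_add: "L2 f \<Longrightarrow> L2 g \<Longrightarrow> AE x. T (\<lambda>y. f y + g y) x = T f x + T g x"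
 using czo by (simp add: CZO_def)

lemma T_scale: "L2 f \<Longrightarrow> AE x. T (\<lambda>y. c * f y) x = c * T f x"
 using czo by (simp add: CZO_def)

lemma T_L2: "L2 f \<Longrightarrow> L2 (T f)"
 using czo by (auto simp: CZO_def)

lemma T_measurable: "L2 f \<Longrightarrow> T f \<in> borel_measurable lebesgue"
 using T_L2 L2_measurable by blast

lemma T_kernel: "L2 f \<Longrightarrow> compact S \<Longrightarrow> (AE y. y \<notin> S \<longrightarrow> f y = 0) \<Longrightarrow>
  (AE x. x \<notin> S \<longrightarrow> T f x = (\<integral>y. K (x - y) * f y \<partial>lebesgue))"
 using czo by (simp add: CZO_def)

lemma K_measurable: "lm K"
 using czo by (simp add: CZO_def)

lemma T_diff: assumes "L2 f" "L2 g" shows "AE x. T (\<lambda>y. f y - g y) x = T f x - T g x"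
 using T_add[OF assms(1) L2_scale[OF assms(2), of "-1"]] T_scale[OF assms(2), of "-1"]
 by eventually_elim simp

lemma T_zero: "AE x. T (\<lambda>y. 0) x = 0"
 using T_scale[of "\<lambda>y. 0" 0] by simp

lemma T_sum: assumes "finite A" "\<And>i. i \<in> A \<Longrightarrow> L2 (f i)"
 shows "AE x. T (\<lambda>y. \<Sum>i\<in>A. f i y) x = (\<Sum>i\<in>A. T (f i) x)"
 using assms
proof (induction A rule: finite_induct)
 case empty
 then show ?case using T_zero by simp
next
 case (insert j A)
 have "AE x. T (\<lambda>y. f j y + (\<Sum>i\<in>A. f i y)) x = T (f j) x + T (\<lambda>y. \<Sum>i\<in>A. f i y) x"
  using insert by (intro T_add L2_sum) auto
 moreover have "AE x. T (\<lambda>y. \<Sum>i\<in>A. f i y) x = (\<Sum>i\<in>A. T (f i) x)" using insert by auto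
 ultimately show ?case using insert by (auto elim!: eventually_elim2)
qed

lemma T_chebyshev: "\<exists>C>0. \<forall>f c. L2 f \<longrightarrow> c > 0 \<longrightarrow>
 leb {x. cmod (T f x) > c} \<le> ennreal (C / c\<^sup>2) * (l2sq f)"
proof -
 obtain C where C: "\<And>f. L2 f \<Longrightarrow> L2norm (T f) \<le> C * L2norm f" using czo unfolding CZO_def by blast
 \<comment> \<open>The bound \<open>C\<close> of the operator may be 0 or negative; adding 1 to its
   square gives a positive constant.\<close>
 define D where "D = C\<^sup>2 + 1"
 have D: "D > 0" "C\<^sup>2 \<le> D" by (auto simp: D_def add_nonneg_pos)
 have "leb {x. cmod (T f x) > c} \<le> ennreal (D / c\<^sup>2) * (l2sq f)"
  if f: "L2 f" and c: "c > 0" for f c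
 proof -
  note [measurable] = T_measurable[OF f]
  have N0: "L2norm f \<ge> 0" "L2norm (T f) \<ge> 0" by (auto simp: L2norm_def)
  have "(L2norm (T f))\<^sup>2 \<le> (C * L2norm f)\<^sup>2" using C[OF f] N0 by (intro power_mono) auto
  also have "\<dots> \<le> D * (L2norm f)\<^sup>2" using D by (simp add: power_mult_distrib mult_right_mono)
  finally have "ennreal ((L2norm (T f))\<^sup>2) \<le> ennreal (D * (L2norm f)\<^sup>2)" by (rule ennreal_leI)
  then have TT: "(\<integral>x. ennreal ((cmod (T f x))\<^sup>2)) \<le> ennreal D * (l2sq f)"
   using L2norm_sq[OF f] L2norm_sq[OF T_L2[OF f]] D by (simp add: ennreal_mult)
  have "leb {x. cmod (T f x) > c} = (\<integral>x. indicator {x. cmod (T f x) > c} x)"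
   by (intro nn_integral_indicator[symmetric] Collect_less_lebesgue) measurable
  also have "\<dots> \<le> (\<integral>x. ennreal (1 / c\<^sup>2) * ennreal ((cmod (T f x))\<^sup>2))"
  proof (rule nn_integral_mono)
   fix x
   show "indicator {x. cmod (T f x) > c} x \<le> ennreal (1 / c\<^sup>2) * ennreal ((cmod (T f x))\<^sup>2)"
   proof (cases "cmod (T f x) > c")
    case True
    then have "c\<^sup>2 \<le> (cmod (T f x))\<^sup>2" using c by (intro power_mono) auto
    then have "1 \<le> 1 / c\<^sup>2 * (cmod (T f x))\<^sup>2" using c by (simp add: field_simps)
    then have "ennreal 1 \<le> ennreal (1 / c\<^sup>2 * (cmod (T f x))\<^sup>2)" by (rule ennreal_leI)
    then show ?thesis using True by (simp add: ennreal_mult[symmetric])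
   qed simp
  qed
  also have "\<dots> = ennreal (1 / c\<^sup>2) * (\<integral>x. ennreal ((cmod (T f x))\<^sup>2))"
   by (rule nn_integral_cmult) measurable
  also have "\<dots> \<le> ennreal (1 / c\<^sup>2) * (ennreal D * (l2sq f))"
   by (intro mult_left_mono TT) simp
  also have "\<dots> = ennreal (D / c\<^sup>2) * (l2sq f)"
   using D by (simp add: mult.assoc[symmetric] ennreal_mult[symmetric])
  finally show ?thesis .
 qed
 then show ?thesis using D by blast
qed

text \<open>\<open>T\<close> acts on functions, and its linearity alone does not identify functions
  that agree almost everywhere; the L2 bound does.\<close>

lemma T_null: assumes "L2 f" "AE x. f x = 0" shows "AE x. T f x = 0"
proof -
 note [measurable] = T_measurable[OF assms(1)]
 note [measurable] = L2_measurable[OF assms(1)]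
 have z: "(l2sq f) = 0"
  using assms(2) by (subst nn_integral_0_iff_AE) auto
 have "\<forall>n::nat. AE x. \<not> cmod (T f x) > 1 / (real n + 1)"
 proof
  fix n :: nat
  obtain C where "\<And>c. c > 0 \<Longrightarrow> leb {x. cmod (T f x) > c} \<le> ennreal (C / c\<^sup>2) * (l2sq f)"
   using T_chebyshev assms(1) by blast
  from this[of "1 / (real n + 1)"] have "leb {x. cmod (T f x) > 1 / (real n + 1)} = 0" by (simp add: z)
  then have "{x. cmod (T f x) > 1 / (real n + 1)} \<in> null_sets lebesgue"
   by (simp add: null_sets_def Collect_less_lebesgue)
  from AE_not_in[OF this] show "AE x. \<not> cmod (T f x) > 1 / (real n + 1)" by simp
 qed
 then have "AE x. \<forall>n::nat. \<not> cmod (T f x) > 1 / (real n + 1)" by (simp add: AE_all_countable)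
 then show ?thesis
 proof eventually_elim
  case (elim x)
  show ?case
  proof (rule ccontr)
   assume "T f x \<noteq> 0"
   then obtain n where "inverse (real (Suc n)) < cmod (T f x)" using reals_Archimedean[of "cmod (T f x)"] by auto
   then show False using elim[rule_format, of n] by (simp add: inverse_eq_divide add.commute)
  qed
 qed
qed

text \<open>The smoothness condition applies only if \<open>a\<close> and \<open>b\<close> are close
  compared with \<open>norm a\<close>. Otherwise \<open>\<rho> \<le> 2 * s\<close>, and the size
  condition alone gives the bound.\<close>

lemma kernel_osc: "\<exists>C>0. \<forall>a b \<rho> s. \<rho> > 0 \<longrightarrow> norm a \<ge> \<rho> \<longrightarrow> norm b \<ge> \<rho> \<longrightarrow> norm (a - b) \<le> s \<longrightarrow>
  cmod (K a - K b) \<le> C * s / \<rho> ^ (DIM('a) + 1)"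
proof -
 let ?n = "DIM('a)"
 obtain C1 where C1: "\<And>x. x \<noteq> 0 \<Longrightarrow> cmod (K x) \<le> C1 / norm x ^ ?n" using czo by (auto simp: CZO_def)
 obtain C2 where C2: "\<And>x y z. norm (x - y) > 2 * norm (y - z) \<Longrightarrow> cmod (K (x - y) - K (x - z)) \<le> C2 * norm (y - z) / norm (x - y) ^ (?n + 1)"
  using czo unfolding CZO_def by blast
 define C where "C = max 1 (max C2 (4 * C1))"
 have C: "C > 0" "C2 \<le> C" "4 * C1 \<le> C" by (auto simp: C_def)
 have "cmod (K a - K b) \<le> C * s / \<rho> ^ (?n + 1)" if \<rho>: "\<rho> > 0" and a: "norm a \<ge> \<rho>" and b: "norm b \<ge> \<rho>" and s: "norm (a - b) \<le> s" for a b \<rho> s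
 proof (cases "norm a > 2 * norm (a - b)")
  case True
  have s0: "s \<ge> 0" using s norm_ge_zero[of "a - b"] by linarith
  have "norm (a - 0) > 2 * norm (0 - (a - b))" using True by (simp add: norm_minus_commute)
  \<comment> \<open>With this choice \<open>x - y = a\<close> and \<open>x - z = b\<close>.\<close>
  from C2[where x=a and y=0 and z="a - b"] True have "cmod (K a - K b) \<le> C2 * norm (a - b) / norm a ^ (?n + 1)"
   by (simp add: norm_minus_commute)
  also have "\<dots> \<le> C * s / norm a ^ (?n + 1)"
   using C s by (intro divide_right_mono mult_mono) auto
  also have "\<dots> \<le> C * s / \<rho> ^ (?n + 1)"
   using C s0 \<rho> a by (intro divide_left_mono power_mono mult_pos_pos zero_less_power mult_nonneg_nonneg) auto
  finally show ?thesis .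
 next
  case False
  then have s\<rho>: "\<rho> \<le> 2 * s" using a s by linarith
  have k: "cmod (K x) \<le> C / 4 / \<rho> ^ ?n" if "norm x \<ge> \<rho>" for x
  proof -
   have "x \<noteq> 0" using that \<rho> by auto
   then have "cmod (K x) \<le> C1 / norm x ^ ?n" by (rule C1)
   also have "\<dots> \<le> C / 4 / norm x ^ ?n" using C by (intro divide_right_mono) auto
   also have "\<dots> \<le> C / 4 / \<rho> ^ ?n"
    using C \<rho> that by (intro divide_left_mono power_mono mult_pos_pos zero_less_power) auto
   finally show ?thesis .
  qed
  have "cmod (K a - K b) \<le> cmod (K a) + cmod (K b)" by (rule norm_triangle_ineq4)
  also have "\<dots> \<le> C / 2 / \<rho> ^ ?n" using k[OF a] k[OF b] by simp
  also have "\<dots> = C / 2 * \<rho> / \<rho> ^ (?n + 1)" using \<rho> by simp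
  also have "\<dots> \<le> C / 2 * (2 * s) / \<rho> ^ (?n + 1)"
   using C s\<rho> \<rho> by (intro divide_right_mono mult_left_mono) auto
  finally show ?thesis by simp
 qed
 then show ?thesis using C by blast
qed

text \<open>The diameter of the cell relative to its distance from \<open>x\<close> gives the decay
  \<open>2^(-l)\<close>. The first inequality serves for integration in \<open>y\<close> against
  functions of mean zero, the second for the variation of \<open>T H\<close> over the cell.\<close>

lemma kernel_cell: "\<exists>C>0. \<forall>k q x y y' l. y \<in> dc k q \<longrightarrow> y' \<in> dc k q \<longrightarrow> x \<notin> trip (k - int l) q \<longrightarrow>
  cmod (K (x - y) - K (x - y')) \<le> C * (1/2) ^ l / dvol TYPE('a) (k - int l - 1) \<and>
  cmod (K (y - x) - K (y' - x)) \<le> C * (1/2) ^ l / dvol TYPE('a) (k - int l - 1)"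
proof -
 let ?n = "DIM('a)"
 obtain C where C: "C > 0" "\<And>a b \<rho> s. \<rho> > 0 \<Longrightarrow> norm a \<ge> \<rho> \<Longrightarrow> norm b \<ge> \<rho> \<Longrightarrow> norm (a - b) \<le> s \<Longrightarrow>
  cmod (K a - K b) \<le> C * s / \<rho> ^ (?n + 1)" using kernel_osc by blast
 define D where "D = C * sqrt ?n * 2 ^ ?n"
 have D: "D > 0" using C by (simp add: D_def)
 have "cmod (K (x - y) - K (x - y')) \<le> D * (1/2) ^ l / dvol TYPE('a) (k - int l - 1) \<and>
  cmod (K (y - x) - K (y' - x)) \<le> D * (1/2) ^ l / dvol TYPE('a) (k - int l - 1)"
  if y: "y \<in> dc k q" "y' \<in> dc k q" "x \<notin> trip (k - int l) q" for k q x y y' l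
 proof -
  let ?\<rho> = "dside (k - int l)" and ?s = "sqrt ?n * dside k"
  have yd: "y \<in> dc (k - int l) q" "y' \<in> dc (k - int l) q" using y dc_mono[of "k - int l" k q] by auto
  have 1: "norm (y - x) \<ge> ?\<rho>" "norm (y' - x) \<ge> ?\<rho>" using trip_dist[OF yd(1) y(3)] trip_dist[OF yd(2) y(3)] by auto
  have 2: "norm (y - y') \<le> ?s" using dc_dist[OF y(1,2)] .
  have eq: "C * ?s / ?\<rho> ^ (?n + 1) = D * (1/2) ^ l / dvol TYPE('a) (k - int l - 1)"
  proof -
   have "?\<rho> ^ (?n + 1) = ?\<rho> ^ ?n * (2 ^ l * dside k)" using dside_minus[of k l] by simp
   moreover have "dvol TYPE('a) (k - int l - 1) = 2 ^ ?n * ?\<rho> ^ ?n" by (simp add: dvol_pred) (simp add: dvol_def)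
   ultimately show ?thesis by (simp add: D_def power_one_over divide_simps)
  qed
  have "cmod (K (x - y) - K (x - y')) \<le> C * ?s / ?\<rho> ^ (?n + 1)"
   by (rule C(2)) (use 1 2 in \<open>auto simp: norm_minus_commute\<close>)
  moreover have "cmod (K (y - x) - K (y' - x)) \<le> C * ?s / ?\<rho> ^ (?n + 1)"
   by (rule C(2)) (use 1 2 in \<open>auto simp: norm_minus_commute\<close>)
  ultimately show ?thesis unfolding eq by simp
 qed
 then show ?thesis using D by blast
qed

end

section \<open>The weak type (1,1) bound\<close>

lemma compact_dcl: "compact (dcl k x)" by (simp add: dcl_def)

lemma dcl_trip: "dcl k x \<subseteq> trip k x"
proof
 fix y assume y: "y \<in> dcl k x"
 show "y \<in> trip k x" unfolding trip_box
 proof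
  fix i :: 'a assume i: "i \<in> Basis"
  have "cn k x \<bullet> i \<le> y \<bullet> i" "y \<bullet> i \<le> cn k x \<bullet> i + dside k"
   using y i by (auto simp: dcl_def mem_box inner_add_left)
  then show "cn k x \<bullet> i - dside k \<le> y \<bullet> i \<and> y \<bullet> i < cn k x \<bullet> i + 2 * dside k"
   using dside_pos(1)[of k] by linarith
 qed
qed

lemma nn_integral_add3:
 assumes "f \<in> borel_measurable M" "g \<in> borel_measurable M" "h \<in> borel_measurable M"
 shows "(\<integral>\<^sup>+x. f x + g x + c * h x \<partial>M) = (\<integral>\<^sup>+x. f x \<partial>M) + (\<integral>\<^sup>+x. g x \<partial>M) + c * (\<integral>\<^sup>+x. h x \<partial>M)"
 using assms by (simp add: nn_integral_add nn_integral_cmult)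

lemma nn_integral_compl_split:
 assumes "lm f" "A \<in> sets lebesgue"
 shows "(\<integral>x\<in>A. f x) + (\<integral>x\<in>-A. f x) = (\<integral>x. f x)"
proof -
 have "- A \<in> sets lebesgue" using assms(2) by (simp add: Compl_in_sets_lebesgue)
 then have "(\<integral>x\<in>A. f x) + (\<integral>x\<in>-A. f x) = (\<integral>x. f x * indicator A x + f x * indicator (- A) x)"
  using assms by (subst nn_integral_add) auto
 also have "\<dots> = (\<integral>x. f x)" by (intro nn_integral_cong) (auto simp: indicator_def)
 finally show ?thesis .
qed

lemma Collect_ge_lebesgue: "lm f \<Longrightarrow> {x. c \<le> f x} \<in> sets lebesgue"
 for f :: "'a::euclidean_space \<Rightarrow> 'b::{linorder_topology}"
 using measurable_sets[of f lebesgue borel "{c..}"] by (simp add: vimage_def)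

context czo
begin

text \<open>On the shell between two consecutive triples the kernel difference is at most
  \<open>2^(-l)\<close> over the volume of the shell's level, so each shell contributes a term of a
  geometric series.\<close>

lemma T_outside_trip:
 "\<exists>C>0. \<forall>k z h. L2 h \<longrightarrow> integrable lebesgue h \<longrightarrow> (\<forall>y. y \<notin> dc k z \<longrightarrow> h y = 0) \<longrightarrow> (\<integral>y. h y \<partial>lebesgue) = 0 \<longrightarrow>
  (\<integral>x\<in>-trip k z. enorm (T h x)) \<le> ennreal C * (\<integral>x. enorm (h x))"
proof -
 obtain D where D: "D > 0" "\<And>k q x y y' l. y \<in> dc k q \<Longrightarrow> y' \<in> dc k q \<Longrightarrow> x \<notin> trip (k - int l) q \<Longrightarrow>
   cmod (K (x - y) - K (x - y')) \<le> D * (1/2) ^ l / dvol TYPE('a) (k - int l - 1)"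
  using kernel_cell by blast
 define C where "C = 2 * D * 3 ^ DIM('a)"
 have C: "C > 0" using D by (simp add: C_def)
 have "(\<integral>x\<in>-trip k z. enorm (T h x)) \<le> ennreal C * (\<integral>x. enorm (h x))"
  if h: "L2 h" "integrable lebesgue h" "\<And>y. y \<notin> dc k z \<Longrightarrow> h y = 0" and h0: "(\<integral>y. h y \<partial>lebesgue) = 0" for k z h
 proof -
  define H where "H = (\<integral>x. cmod (h x) \<partial>lebesgue)"
  have H: "H \<ge> 0" "(\<integral>x. enorm (h x)) = ennreal H"
   unfolding H_def using h(2) by (auto intro!: nn_integral_eq_integral)
  define w where "w l = ennreal (D * (1/2) ^ l / dvol TYPE('a) (k - int l - 1) * H)" for l
  have "AE y. y \<notin> dcl k z \<longrightarrow> h y = 0" using h(3) dc_dcl by (intro AE_I2) blast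
  from T_kernel[OF h(1) compact_dcl this]
  have "AE x. x \<notin> dcl k z \<longrightarrow> T h x = (\<integral>y. K (x - y) * h y \<partial>lebesgue)" .
  then have "AE x. enorm (T h x) * indicator (- trip k z) x \<le> (\<Sum>l. w l * indicator (trip (k - int l - 1) z) x)"
  proof eventually_elim
   case (elim x)
   show ?case
   proof (cases "x \<in> trip k z")
    case False
    then obtain l where l: "x \<in> trip (k - int l - 1) z" "x \<notin> trip (k - int l) z" by (rule trip_shell)
    have Tx: "T h x = (\<integral>y. K (x - y) * h y \<partial>lebesgue)" using elim False dcl_trip by blast
    let ?c = "D * (1/2) ^ l / dvol TYPE('a) (k - int l - 1)"
    have "cmod (\<integral>y. K (x - y) * h y \<partial>lebesgue) \<le> ?c * H"
    proof (cases "integrable lebesgue (\<lambda>y. K (x - y) * h y)")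
     case True
     have i2: "integrable lebesgue (\<lambda>y. K (x - z) * h y)" using h(2) by simp
     \<comment> \<open>Mean value zero permits subtracting the constant
       \<open>K (x - z)\<close>.\<close>
     have "(\<integral>y. K (x - y) * h y \<partial>lebesgue) = (\<integral>y. K (x - y) * h y - K (x - z) * h y \<partial>lebesgue)"
      using True i2 h0 by simp
     also have "cmod \<dots> \<le> (\<integral>y. ?c * cmod (h y) \<partial>lebesgue)"
     proof (rule order_trans[OF integral_norm_bound integral_mono])
      show "integrable lebesgue (\<lambda>y. cmod (K (x - y) * h y - K (x - z) * h y))" using True i2 by simp
      show "integrable lebesgue (\<lambda>y. ?c * cmod (h y))" using h(2) by simp
      fix y
      show "cmod (K (x - y) * h y - K (x - z) * h y) \<le> ?c * cmod (h y)"
      proof (cases "y \<in> dc k z")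
       case True
       have "cmod (K (x - y) * h y - K (x - z) * h y) = cmod (K (x - y) - K (x - z)) * cmod (h y)"
        by (metis left_diff_distrib norm_mult)
       also have "\<dots> \<le> ?c * cmod (h y)" by (intro mult_right_mono D(2)[OF True _ l(2)]) auto
       finally show ?thesis .
      qed (simp add: h(3))
     qed
     also have "\<dots> = ?c * H" unfolding H_def by (rule integral_mult_right_zero)
     finally show ?thesis .
    next
     \<comment> \<open>The integral of a function that is not integrable is 0 by convention, so the
       bound is trivial.\<close>
     case False
     then show ?thesis using H D by (simp add: not_integrable_integral_eq)
    qed
    then have "enorm (T h x) \<le> w l * indicator (trip (k - int l - 1) z) x"
     using l by (simp add: Tx w_def ennreal_leI)
    also have "\<dots> \<le> (\<Sum>l. w l * indicator (trip (k - int l - 1) z) x)"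
    proof -
     define f where "f l = w l * indicator (trip (k - int l - 1) z) x" for l
     have "sum f {l} \<le> suminf f" by (rule sum_le_suminf) auto
     then have "f l \<le> suminf f" by simp
     then show ?thesis by (simp only: f_def[abs_def])
    qed
    finally show ?thesis using False by simp
   qed simp
  qed
  then have "(\<integral>x\<in>-trip k z. enorm (T h x)) \<le> (\<integral>x. (\<Sum>l. w l * indicator (trip (k - int l - 1) z) x))"
   by (rule nn_integral_mono_AE)
  also have "\<dots> = (\<Sum>l. (\<integral>x. w l * indicator (trip (k - int l - 1) z) x))"
   by (rule nn_integral_suminf) measurable
  also have "\<dots> = (\<Sum>l. ennreal (D * 3 ^ DIM('a) * H * (1/2) ^ l))"
  proof (rule suminf_cong)
   fix l
   show "(\<integral>x. w l * indicator (trip (k - int l - 1) z) x) = ennreal (D * 3 ^ DIM('a) * H * (1/2) ^ l)"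
    using D H by (subst nn_integral_cmult_indicator) (auto simp: emeasure_trip w_def ennreal_mult[symmetric] mult_ac)
  qed
  also have "\<dots> = ennreal (\<Sum>l. D * 3 ^ DIM('a) * H * (1/2) ^ l)"
   by (rule suminf_ennreal2) (use D H in \<open>auto intro!: summable_mult summable_geometric\<close>)
  also have "(\<Sum>l. D * 3 ^ DIM('a) * H * (1/2) ^ l) = C * H"
   by (subst suminf_mult) (auto intro!: summable_geometric simp: suminf_geometric C_def)
  also have "ennreal (C * H) = ennreal C * (\<integral>x. enorm (h x))"
   using C H by (simp add: ennreal_mult)
  finally show ?thesis .
 qed
 then show ?thesis using C by blast
qed

text \<open>Linearity of \<open>T\<close> reaches only finite sums. Cancellation is therefore
  arranged on finitely many stopping cells, chosen so that the mass left on the others is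
  small.\<close>

lemma finite_cubes_approx:
 assumes J: "countable J" "disjoint_family_on cell J"
  and m [measurable]: "lm f" and fin: "(\<integral>x. f x) < \<infinity>" and e: "e > 0"
 obtains J' where "finite J'" "J' \<subseteq> J" "(\<integral>x\<in>(\<Union>(cell ` J)) - (\<Union>(k, z)\<in>J'. dc k (z::'a)). f x) < e"
proof -
 define JN where "JN N = {j\<in>J. to_nat_on J j < N}" for N
 have fJN: "finite (JN N)" for N
 proof -
  have "inj_on (to_nat_on J) (JN N)" using inj_on_to_nat_on[OF J(1)] by (auto simp: JN_def intro: inj_on_subset)
  moreover have "to_nat_on J ` JN N \<subseteq> {..<N}" by (auto simp: JN_def)
  ultimately show ?thesis using finite_subset finite_imageD by (metis finite_lessThan)
 qed
 let ?U = "\<lambda>J. (\<Union>(cell ` J))"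
 have Um: "?U (JN N) \<in> sets lebesgue" "?U J \<in> sets lebesgue" for N
  using J_union_sets[of "JN N"] J_union_sets[OF J(1)] fJN countable_finite by auto
 define A where "A N = ?U J - ?U (JN N)" for N
 have A: "A N \<in> sets lebesgue" for N using Um by (simp add: A_def sets.Diff)
 let ?\<nu> = "density lebesgue f"
 have em: "emeasure ?\<nu> (A N) = (\<integral>x\<in>A N. f x)" for N using A by (simp add: emeasure_density)
 have "(\<lambda>N. emeasure ?\<nu> (A N)) \<longlonglongrightarrow> emeasure ?\<nu> (\<Inter>N. A N)"
 proof (rule Lim_emeasure_decseq)
  show "range A \<subseteq> sets ?\<nu>" using A by auto
  show "decseq A" by (auto simp: decseq_def A_def JN_def)
  fix N
  have "(\<integral>x\<in>A N. f x) \<le> (\<integral>x. f x)" by (intro nn_integral_mono) (auto simp: indicator_def)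
  then show "emeasure ?\<nu> (A N) \<noteq> \<infinity>" using fin by (auto simp: em)
 qed
 moreover have "(\<Inter>N. A N) = {}"
 proof -
  have False if x: "x \<in> (\<Inter>N. A N)" for x
  proof -
   have "x \<in> ?U J" using x by (auto simp: A_def)
   then obtain k z where kz: "(k, z) \<in> J" "x \<in> dc k z" by blast
   then have "(k, z) \<in> JN (Suc (to_nat_on J (k, z)))" by (simp add: JN_def)
   then have "x \<in> ?U (JN (Suc (to_nat_on J (k, z))))" using kz(2) by blast
   then show False using x by (auto simp: A_def)
  qed
  then show ?thesis by blast
 qed
 ultimately have "(\<lambda>N. emeasure ?\<nu> (A N)) \<longlonglongrightarrow> 0" by simp
 then have "eventually (\<lambda>N. emeasure ?\<nu> (A N) < e) sequentially" using e by (rule order_tendstoD(2))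
 then obtain N where "emeasure ?\<nu> (A N) < e" by (auto simp: eventually_sequentially)
 then have "(\<integral>x\<in>A N. f x) < e" by (simp add: em)
 then show ?thesis using that[of "JN N"] fJN by (auto simp: A_def JN_def)
qed

text \<open>The Calderon-Zygmund decomposition with finitely many bad parts. On the stopping cells
  left out, \<open>F\<close> stays in the good part \<open>g\<close>; it may be large there, but its
  square integral over these cells is small.\<close>

lemma weak_type:
 "\<exists>C>0. \<forall>F c. L2 F \<longrightarrow> (\<integral>x. enorm (F x)) < \<infinity> \<longrightarrow> c > 0 \<longrightarrow>
  leb {x. cmod (T F x) > c} \<le> ennreal (C / c) * (\<integral>x. enorm (F x))"
proof -
 let ?n = "DIM('a)"
 obtain C1 where C1: "C1 > 0" "\<And>f c. L2 f \<Longrightarrow> c > 0 \<Longrightarrow>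
  leb {x. cmod (T f x) > c} \<le> ennreal (C1 / c\<^sup>2) * (l2sq f)"
  using T_chebyshev by blast
 obtain C2 where C2: "C2 > 0" "\<And>k z h. L2 h \<Longrightarrow> integrable lebesgue h \<Longrightarrow> (\<forall>y. y \<notin> dc k z \<longrightarrow> h y = 0) \<Longrightarrow> (\<integral>y. h y \<partial>lebesgue) = 0 \<Longrightarrow>
  (\<integral>x\<in>-trip k z. enorm (T h x)) \<le> ennreal C2 * (\<integral>x. enorm (h x))"
  using T_outside_trip by blast
 \<comment> \<open>The summands come from \<open>T g\<close> by the L2 bound, from the triples of
   the cells, and from the bad parts outside the triples.\<close>
 define C where "C = C1 * (2 ^ ?n + 1) + 3 ^ ?n + 2 * C2"
 have C: "C > 0" using C1 C2 by (simp add: C_def add_pos_pos)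
 have main: "leb {x. cmod (T F x) > 2 * c} \<le> ennreal (C / c) * (\<integral>x. enorm (F x))"
  if F: "L2 F" "(\<integral>x. enorm (F x)) < \<infinity>" and c: "c > 0" for F c
 proof (cases "(\<integral>x. enorm (F x)) = 0")
  \<comment> \<open>The tolerance \<open>c * L\<close> used below has to be positive, so a null
    function is treated apart.\<close>
  case True
  note [measurable] = L2_measurable[OF F(1)]
  have "AE x. F x = 0" using True by (simp add: nn_integral_0_iff_AE)
  then have "AE x. T F x = 0" by (rule T_null[OF F(1)])
  then have "AE x. x \<notin> {x. cmod (T F x) > 2 * c}" by eventually_elim (use c in auto)
  then have "{x. cmod (T F x) > 2 * c} \<in> null_sets lebesgue"
   by (subst AE_iff_null_sets) (use T_measurable[OF F(1)] in \<open>auto intro!: Collect_less_lebesgue borel_measurable_norm\<close>)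
  then show ?thesis by (simp add: null_sets_def)
 next
  case nz: False
  note Fm [measurable] = L2_measurable[OF F(1)]
  define L where "L = (\<integral>x. cmod (F x) \<partial>lebesgue)"
  have Fi: "integrable lebesgue F" using F(2) by (simp add: integrable_iff_bounded)
  have L: "(\<integral>x. enorm (F x)) = ennreal L" "L \<ge> 0"
   unfolding L_def using Fi by (auto intro!: nn_integral_eq_integral)
  have Lp: "L > 0" using nz L by (cases "L = 0") auto
  let ?h = "\<lambda>x. enorm (F x)" and ?V = "dvol TYPE('a)"
  have hm: "?h \<in> borel_measurable lebesgue" by measurable
  have hfin: "(\<integral>x. ?h x) < top" using L by simp
  obtain J :: "(int \<times> 'a) set" where J: "countable J" "disjoint_family_on cell J"
   "\<And>k z. (k, z) \<in> J \<Longrightarrow> (\<integral>y\<in>dc k z. ?h y) \<le> ennreal (2 ^ ?n * c * ?V k)"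
   "AE x. x \<notin> (\<Union>(cell ` J)) \<longrightarrow> ?h x \<le> ennreal c"
   "ennreal c * cvol J \<le> (\<integral>x\<in>(\<Union>(cell ` J)). ?h x)"
   by (rule cz_cubes[OF hm hfin c], rule that) (assumption | blast)+
  let ?U = "\<lambda>J. (\<Union>(cell ` J)) :: 'a set"
  \<comment> \<open>The tolerance has the size of the bound wanted for the square integral of
    \<open>g\<close>; it is the 1 in \<open>2 ^ ?n + 1\<close>.\<close>
  obtain J' where J': "finite J'" "J' \<subseteq> J" "(\<integral>x\<in>?U J - ?U J'. ennreal ((cmod (F x))\<^sup>2)) < ennreal (c * L)"
   by (rule finite_cubes_approx[OF J(1,2), of "\<lambda>x. ennreal ((cmod (F x))\<^sup>2)" "ennreal (c * L)"])
     (use F(1) Lp c in \<open>auto simp: L2_iff\<close>)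
  have cJ': "countable J'" using J'(1) by (rule countable_finite)
  have dJ': "disjoint_family_on cell J'" using J(2) J'(2) by (rule disjoint_family_on_mono[rotated])
  have Um [measurable]: "?U J \<in> sets lebesgue" "?U J' \<in> sets lebesgue" by (rule J_union_sets J(1) cJ')+
  define I where "I k z = (\<integral>y. F y * indicator (dc k z) y \<partial>lebesgue)" for k z
  have Fi': "integrable lebesgue (\<lambda>y. F y * indicator (dc k z) y)" for k z
   by (rule Bochner_Integration.integrable_bound[OF Fi]) (auto simp: indicator_def)
  define a where "a k z = I k z / of_real (?V k)" for k z
  have a: "ennreal (cmod (a k z) * ?V k) \<le> (\<integral>y\<in>dc k z. ?h y)" for k z
  proof -
   have "cmod (a k z) * ?V k = cmod (I k z)" by (simp add: a_def norm_divide)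
   also have "ennreal \<dots> \<le> (\<integral>y. enorm (F y * indicator (dc k z) y))"
    unfolding I_def by (rule integral_norm_bound_ennreal[OF Fi'])
   also have "\<dots> = (\<integral>y\<in>dc k z. ?h y)"
    by (intro nn_integral_cong) (auto simp: indicator_def)
   finally show ?thesis .
  qed
  have a2: "cmod (a k z) \<le> 2 ^ ?n * c" if "(k, z) \<in> J" for k z
  proof -
   have "ennreal (cmod (a k z) * ?V k) \<le> ennreal (2 ^ ?n * c * ?V k)" using a J(3)[OF that] by (rule order_trans)
   then show ?thesis using c by simp
  qed
  define hj where "hj j y = (case j of (k, z) \<Rightarrow> F y * indicator (dc k z) y - a k z * indicator (dc k z) y)" for j :: "int \<times> 'a" and y
  have hL2: "L2 (hj j)" for j unfolding hj_def case_prod_beta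
   by (intro L2_diff L2_indicator L2_indicator_const F) (auto simp: emeasure_dc)
  have cind: "integrable lebesgue (\<lambda>y. indicator (dc k z) y :: complex)"
   "(\<integral>y. (indicator (dc k z) y :: complex) \<partial>lebesgue) = of_real (?V k)" for k and z :: 'a
  proof -
   have e: "(\<lambda>y. indicator (dc k z) y :: complex) = (\<lambda>y. of_real (indicator (dc k z) y))" by (auto simp: indicator_def)
   have i: "integrable lebesgue (indicator (dc k z) :: 'a \<Rightarrow> real)" by (simp add: emeasure_dc)
   show "integrable lebesgue (\<lambda>y. indicator (dc k z) y :: complex)" unfolding e using i by (rule integrable_of_real)
   have "measure lebesgue (dc k z) = ?V k" by (simp add: measure_def emeasure_dc)
   then show "(\<integral>y. (indicator (dc k z) y :: complex) \<partial>lebesgue) = of_real (?V k)"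
    unfolding e integral_of_real by simp
  qed
  have ii: "integrable lebesgue (\<lambda>y. a k z * indicator (dc k z) y)" for k z
   using cind(1) by (rule integrable_mult_right)
  have hint: "integrable lebesgue (hj j)" for j unfolding hj_def case_prod_beta
   using Fi' ii by (intro Bochner_Integration.integrable_diff) auto
  have h0: "(\<integral>y. hj j y \<partial>lebesgue) = 0" for j
  proof -
   obtain k z where j: "j = (k, z)" by (cases j)
   have "(\<integral>y. hj j y \<partial>lebesgue) = I k z - a k z * (\<integral>y. indicator (dc k z) y \<partial>lebesgue)"
    unfolding j hj_def I_def using Fi' ii by simp
   also note cind(2)
   finally show ?thesis by (simp add: a_def)
  qed
  have hsupp: "\<forall>y. y \<notin> dc k z \<longrightarrow> hj (k, z) y = 0" for k z by (simp add: hj_def)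
  have hnorm: "(\<integral>y. enorm (hj (k, z) y)) \<le> 2 * (\<integral>y\<in>dc k z. ?h y)" for k z
  proof -
   have "(\<integral>y. enorm (hj (k, z) y)) \<le> (\<integral>y. ?h y * indicator (dc k z) y + enorm (a k z) * indicator (dc k z) y)"
    by (intro nn_integral_mono) (auto simp: hj_def indicator_def ennreal_plus[symmetric] norm_triangle_ineq4 intro!: ennreal_leI simp del: ennreal_plus)
   also have "\<dots> = (\<integral>y\<in>dc k z. ?h y) + ennreal (cmod (a k z) * ?V k)"
    by (subst nn_integral_add) (auto simp: nn_integral_cmult_indicator emeasure_dc ennreal_mult)
   also have "\<dots> \<le> (\<integral>y\<in>dc k z. ?h y) + (\<integral>y\<in>dc k z. ?h y)"
    by (intro add_left_mono a)
   finally show ?thesis by (simp add: mult_2)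
  qed
  define h where "h y = (\<Sum>j\<in>J'. hj j y)" for y
  define g where "g y = F y - h y" for y
  have hL2': "L2 h" unfolding h_def by (intro L2_sum hL2)
  have gL2: "L2 g" unfolding g_def by (intro L2_diff F hL2')
  have gval: "g y = a k z" if kz: "(k, z) \<in> J'" "y \<in> dc k z" for k z y
  proof -
   have "hj j y = 0" if j: "j \<in> J'" "j \<noteq> (k, z)" for j
   proof -
    obtain k' z' where jj: "j = (k', z')" by (cases j)
    have "dc k' z' \<inter> dc k z = {}" using dJ' j kz(1) unfolding disjoint_family_on_def jj by fastforce
    then have "y \<notin> dc k' z'" using kz(2) by blast
    then show ?thesis by (simp add: hj_def jj)
   qed
   then have "h y = hj (k, z) y" unfolding h_def using kz(1) J'(1) by (subst sum.remove[of _ "(k, z)"]) auto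
   then show ?thesis using kz(2) by (simp add: g_def hj_def)
  qed
  have gout: "g y = F y" if "y \<notin> ?U J'" for y
  proof -
   have "hj j y = 0" if "j \<in> J'" for j using that \<open>y \<notin> ?U J'\<close> by (cases j) (auto simp: hj_def)
   then show ?thesis by (simp add: g_def h_def)
  qed
  have hF: "(\<integral>x\<in>?U J'. ?h x) \<le> ennreal L" "(\<integral>x\<in>?U J. ?h x) \<le> ennreal L"
   unfolding L(1)[symmetric] by (intro nn_integral_mono, auto simp: indicator_def)+
  have gsq: "(l2sq g) \<le> ennreal ((2 ^ ?n + 1) * c * L)"
  proof -
   note [measurable] = L2_measurable[OF gL2]
   let ?G = "\<lambda>x. ennreal ((cmod (g x))\<^sup>2)"
   have 1: "(\<integral>x\<in>?U J'. ?G x) \<le> ennreal (2 ^ ?n * c) * (\<integral>x\<in>?U J'. ?h x)"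
   proof -
    have "(\<integral>x\<in>?U J'. ?G x) = (\<Sum>\<^sup>+j\<in>J'. (\<integral>x\<in>cell j. ?G x))"
     by (rule nn_integral_UN_countable[OF cJ' dJ' countable_J_sets]) measurable
    also have "\<dots> \<le> (\<Sum>\<^sup>+j\<in>J'. ennreal (2 ^ ?n * c) * (\<integral>x\<in>cell j. ?h x))"
    proof (rule nn_integral_mono)
     fix j assume "j \<in> space (count_space J')"
     then obtain k z where kz: "j = (k, z)" "(k, z) \<in> J'" by (cases j) auto
     have "(\<integral>x\<in>dc k z. ?G x) = (\<integral>x. ennreal ((cmod (a k z))\<^sup>2) * indicator (dc k z) x)"
      by (intro nn_integral_cong) (use gval[OF kz(2)] in \<open>auto simp: indicator_def\<close>)
     also have "\<dots> = ennreal (cmod (a k z) * (cmod (a k z) * ?V k))"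
      by (simp add: nn_integral_cmult_indicator emeasure_dc ennreal_mult[symmetric] power2_eq_square mult.assoc)
     also have "\<dots> \<le> ennreal (2 ^ ?n * c) * ennreal (cmod (a k z) * ?V k)"
      using a2[of k z] kz J'(2) c by (auto simp: ennreal_mult[symmetric] intro!: ennreal_leI mult_right_mono)
     also have "\<dots> \<le> ennreal (2 ^ ?n * c) * (\<integral>x\<in>dc k z. ?h x)"
      by (intro mult_left_mono a) simp
     finally show "(\<integral>x\<in>cell j. ?G x) \<le> ennreal (2 ^ ?n * c) * (\<integral>x\<in>cell j. ?h x)"
      using kz by simp
    qed
    also have "\<dots> = ennreal (2 ^ ?n * c) * (\<Sum>\<^sup>+j\<in>J'. (\<integral>x\<in>cell j. ?h x))"
     by (rule nn_integral_cmult) auto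
    also have "(\<Sum>\<^sup>+j\<in>J'. (\<integral>x\<in>cell j. ?h x)) = (\<integral>x\<in>?U J'. ?h x)"
     by (rule nn_integral_UN_countable[OF cJ' dJ' countable_J_sets, symmetric]) measurable
    finally show ?thesis .
   qed
   have "(\<integral>x. ?G x) \<le> (\<integral>x. ?G x * indicator (?U J') x + ennreal ((cmod (F x))\<^sup>2) * indicator (?U J - ?U J') x + ennreal c * (?h x * indicator (- ?U J') x))"
   proof (rule nn_integral_mono_AE)
    show "AE x. ?G x \<le> ?G x * indicator (?U J') x + ennreal ((cmod (F x))\<^sup>2) * indicator (?U J - ?U J') x + ennreal c * (?h x * indicator (- ?U J') x)"
     using J(4)
    proof eventually_elim
     case (elim x)
     show ?case
     proof (cases "x \<in> ?U J'")
      case False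
      show ?thesis
      proof (cases "x \<in> ?U J")
       case True
       then show ?thesis using False gout[OF False] by (simp add: indicator_def)
      next
       case nJ: False
       then have "cmod (F x) \<le> c" using elim c by simp
       then have "(cmod (F x))\<^sup>2 \<le> c * cmod (F x)" by (simp add: power2_eq_square mult_right_mono)
       then show ?thesis using False nJ gout[OF False] c by (simp add: indicator_def ennreal_mult[symmetric] ennreal_leI)
      qed
     qed (simp add: indicator_def)
    qed
   qed
   also have "\<dots> = (\<integral>x\<in>?U J'. ?G x) + (\<integral>x\<in>?U J - ?U J'. ennreal ((cmod (F x))\<^sup>2)) + ennreal c * (\<integral>x\<in>- ?U J'. ?h x)"
    by (rule nn_integral_add3) measurable
   also have "\<dots> \<le> ennreal (2 ^ ?n * c) * (\<integral>x\<in>?U J'. ?h x) + ennreal (c * L) + ennreal (2 ^ ?n * c) * (\<integral>x\<in>- ?U J'. ?h x)"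
   proof (intro add_mono mult_right_mono 1)
    have "1 * c \<le> 2 ^ ?n * c" using c by (intro mult_right_mono) auto
    then show "ennreal c \<le> ennreal (2 ^ ?n * c)" by (simp add: ennreal_leI)
   qed (use J'(3) in auto)
   also have "\<dots> = ennreal (2 ^ ?n * c) * ((\<integral>x\<in>?U J'. ?h x) + (\<integral>x\<in>- ?U J'. ?h x)) + ennreal (c * L)"
    by (simp add: distrib_left add_ac)
   also have "(\<integral>x\<in>?U J'. ?h x) + (\<integral>x\<in>- ?U J'. ?h x) = ennreal L"
    unfolding L(1)[symmetric] by (rule nn_integral_compl_split) measurable
   also have "ennreal (2 ^ ?n * c) * ennreal L + ennreal (c * L) = ennreal ((2 ^ ?n + 1) * c * L)"
    using c Lp by (simp add: ennreal_mult[symmetric] ennreal_plus[symmetric] distrib_right del: ennreal_plus)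
   finally show ?thesis .
  qed
  have sV: "(\<Sum>\<^sup>+(k, z)\<in>J'. ennreal (?V k)) \<le> ennreal (L / c)"
  proof -
   have "(\<Sum>\<^sup>+(k, z)\<in>J'. ennreal (?V k)) \<le> cvol J"
    using J'(2) by (auto simp: nn_integral_count_space_indicator indicator_def intro!: nn_integral_mono)
   moreover have "ennreal c * cvol J \<le> ennreal c * ennreal (L / c)"
    using order_trans[OF J(5) hF(2)] c Lp by (simp add: ennreal_mult[symmetric])
   then have "cvol J \<le> ennreal (L / c)"
    using c by (subst (asm) ennreal_mult_le_mult_iff) auto
   ultimately show ?thesis by (rule order_trans)
  qed
  let ?W = "\<Union>(k, z)\<in>J'. trip k z"
  have tm: "(case j of (k, z) \<Rightarrow> trip k z) \<in> sets lebesgue" for j :: "int \<times> 'a" by (cases j) simp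
  have Wm [measurable]: "?W \<in> sets lebesgue" using J'(1) tm by (intro sets.finite_UN) auto
  have W: "leb ?W \<le> ennreal (3 ^ ?n * L / c)"
  proof -
   have "leb ?W \<le> (\<Sum>\<^sup>+j\<in>J'. leb (case j of (k, z) \<Rightarrow> trip k z))"
    by (rule emeasure_UN_le_count_space[OF cJ' tm])
   also have "\<dots> = (\<Sum>\<^sup>+j\<in>J'. ennreal (3 ^ ?n) * (case j of (k, z) \<Rightarrow> ennreal (?V k)))"
   proof (rule nn_integral_cong)
    fix j :: "int \<times> 'a"
    obtain k z where j: "j = (k, z)" by (cases j)
    show "leb (case j of (k, z) \<Rightarrow> trip k z) = ennreal (3 ^ ?n) * (case j of (k, z) \<Rightarrow> ennreal (?V k))"
     unfolding j prod.case emeasure_trip by (simp add: ennreal_mult)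
   qed
   also have "\<dots> = ennreal (3 ^ ?n) * (\<Sum>\<^sup>+(k, z)\<in>J'. ennreal (?V k))"
    by (rule nn_integral_cmult) auto
   also have "\<dots> \<le> ennreal (3 ^ ?n) * ennreal (L / c)" by (intro mult_left_mono sV) simp
   also have "\<dots> = ennreal (3 ^ ?n * L / c)" using c Lp by (subst ennreal_mult[symmetric]) auto
   finally show ?thesis .
  qed
  note [measurable] = T_measurable[OF hL2'] T_measurable[OF gL2] T_measurable[OF F(1)]
  have Tsum: "AE x. T h x = (\<Sum>j\<in>J'. T (hj j) x)"
   unfolding h_def by (rule T_sum[OF J'(1) hL2])
  have Bh: "(\<integral>x\<in>-?W. enorm (T h x)) \<le> ennreal (2 * C2 * L)"
  proof -
   have "(\<integral>x\<in>-?W. enorm (T h x)) \<le> (\<integral>x. (\<Sum>j\<in>J'. enorm (T (hj j) x) * indicator (- (case j of (k, z) \<Rightarrow> trip k z)) x))"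
   proof (rule nn_integral_mono_AE)
    show "AE x. enorm (T h x) * indicator (- ?W) x \<le> (\<Sum>j\<in>J'. enorm (T (hj j) x) * indicator (- (case j of (k, z) \<Rightarrow> trip k z)) x)"
     using Tsum
    proof eventually_elim
     case (elim x)
     show ?case
     proof (cases "x \<in> ?W")
      case False
      have "enorm (T h x) \<le> (\<Sum>j\<in>J'. enorm (T (hj j) x))"
       unfolding elim by (simp add: ennreal_leI norm_sum)
      also have "\<dots> = (\<Sum>j\<in>J'. enorm (T (hj j) x) * indicator (- (case j of (k, z) \<Rightarrow> trip k z)) x)"
       using False by (intro sum.cong) (auto simp: indicator_def)
      finally show ?thesis using False by simp
     qed simp
    qed
   qed
   also have "\<dots> = (\<Sum>j\<in>J'. (\<integral>x. enorm (T (hj j) x) * indicator (- (case j of (k, z) \<Rightarrow> trip k z)) x))"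
   proof (rule nn_integral_sum)
    fix j
    note [measurable] = T_measurable[OF hL2[of j]] tm[of j]
    show "lm (\<lambda>x. enorm (T (hj j) x) * indicator (- (case j of (k, z) \<Rightarrow> trip k z)) x)"
     by measurable
   qed
   also have "\<dots> \<le> (\<Sum>j\<in>J'. ennreal (2 * C2) * (\<integral>x\<in>cell j. ?h x))"
   proof (rule sum_mono)
    fix j assume "j \<in> J'"
    obtain k z where j: "j = (k, z)" by (cases j)
    have "(\<integral>x\<in>-trip k z. enorm (T (hj j) x)) \<le> ennreal C2 * (\<integral>x. enorm (hj j x))"
     by (rule C2(2)) (use hL2 hint h0 hsupp in \<open>auto simp: j\<close>)
    also have "\<dots> \<le> ennreal C2 * (2 * (\<integral>x\<in>dc k z. ?h x))"
     unfolding j by (intro mult_left_mono hnorm) simp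
    also have "\<dots> = ennreal (2 * C2) * (\<integral>x\<in>dc k z. ?h x)"
     using C2 by (simp add: ennreal_mult mult_ac)
    finally show "(\<integral>x. enorm (T (hj j) x) * indicator (- (case j of (k, z) \<Rightarrow> trip k z)) x)
      \<le> ennreal (2 * C2) * (\<integral>x\<in>cell j. ?h x)" using j by simp
   qed
   also have "\<dots> = ennreal (2 * C2) * (\<Sum>\<^sup>+j\<in>J'. (\<integral>x\<in>cell j. ?h x))"
    using J'(1) by (simp add: nn_integral_count_space_finite sum_distrib_left)
   also have "(\<Sum>\<^sup>+j\<in>J'. (\<integral>x\<in>cell j. ?h x)) = (\<integral>x\<in>?U J'. ?h x)"
    by (rule nn_integral_UN_countable[OF cJ' dJ' countable_J_sets, symmetric]) measurable
   also have "ennreal (2 * C2) * \<dots> \<le> ennreal (2 * C2) * ennreal L" by (intro mult_left_mono hF) simp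
   finally show ?thesis using C2 Lp by (simp add: ennreal_mult[symmetric])
  qed
  let ?A = "{x. cmod (T g x) > c}" and ?B = "{x. ennreal c \<le> enorm (T h x) * indicator (- ?W) x}"
  have Am [measurable]: "?A \<in> sets lebesgue" by (rule Collect_less_lebesgue) measurable
  have Bm [measurable]: "?B \<in> sets lebesgue"
   by (rule Collect_ge_lebesgue) measurable
  have Be: "leb ?B \<le> ennreal (2 * C2 * L / c)"
  proof -
   have "leb ?B = (\<integral>x. indicator ?B x)" by (rule nn_integral_indicator[OF Bm, symmetric])
   also have "\<dots> \<le> (\<integral>x. ennreal (1 / c) * (enorm (T h x) * indicator (- ?W) x))"
   proof (rule nn_integral_mono)
    fix x
    show "indicator ?B x \<le> ennreal (1 / c) * (enorm (T h x) * indicator (- ?W) x)"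
    proof (cases "x \<in> ?B")
     case True
     then have "ennreal (1 / c) * ennreal c \<le> ennreal (1 / c) * (enorm (T h x) * indicator (- ?W) x)"
      by (intro mult_left_mono) auto
     then show ?thesis using True c by (simp add: ennreal_mult[symmetric])
    qed simp
   qed
   also have "\<dots> = ennreal (1 / c) * (\<integral>x\<in>-?W. enorm (T h x))"
    by (rule nn_integral_cmult) measurable
   also have "\<dots> \<le> ennreal (1 / c) * ennreal (2 * C2 * L)" by (intro mult_left_mono Bh) simp
   also have "\<dots> = ennreal (2 * C2 * L / c)" using c C2 Lp by (simp add: ennreal_mult[symmetric])
   finally show ?thesis .
  qed
  have Ae: "leb ?A \<le> ennreal (C1 * (2 ^ ?n + 1) * L / c)"
  proof -
   have "leb ?A \<le> ennreal (C1 / c\<^sup>2) * (l2sq g)" by (rule C1(2)[OF gL2 c])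
   also have "\<dots> \<le> ennreal (C1 / c\<^sup>2) * ennreal ((2 ^ ?n + 1) * c * L)" by (intro mult_left_mono gsq) simp
   also have "\<dots> = ennreal (C1 / c\<^sup>2 * ((2 ^ ?n + 1) * c * L))" using C1(1) c Lp by (subst ennreal_mult[symmetric]) auto
   also have "C1 / c\<^sup>2 * ((2 ^ ?n + 1) * c * L) = C1 * (2 ^ ?n + 1) * L / c" using c by (simp add: power2_eq_square)
   finally show ?thesis .
  qed
  have "AE x. T F x = T g x + T h x"
   using T_diff[OF F(1) hL2'] unfolding g_def by eventually_elim simp
  then have "AE x. x \<in> {x. cmod (T F x) > 2 * c} \<longrightarrow> x \<in> ?A \<union> ?W \<union> ?B"
  proof eventually_elim
   case (elim x)
   show ?case
   proof
    assume "x \<in> {x. cmod (T F x) > 2 * c}"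
    then have "2 * c < cmod (T g x) + cmod (T h x)" using elim norm_triangle_ineq[of "T g x" "T h x"] by simp
    then have "cmod (T g x) > c \<or> cmod (T h x) \<ge> c" by linarith
    then show "x \<in> ?A \<union> ?W \<union> ?B" by (auto simp: indicator_def ennreal_leI)
   qed
  qed
  then have "leb {x. cmod (T F x) > 2 * c} \<le> leb (?A \<union> ?W \<union> ?B)"
   by (rule emeasure_mono_AE) measurable
  also have "\<dots> \<le> leb ?A + leb ?W + leb ?B"
   by (intro order_trans[OF emeasure_subadditive] add_mono emeasure_subadditive) measurable
  also have "\<dots> \<le> ennreal (C1 * (2 ^ ?n + 1) * L / c) + ennreal (3 ^ ?n * L / c) + ennreal (2 * C2 * L / c)"
   by (intro add_mono Ae W Be)
  also have "\<dots> = ennreal (C1 * (2 ^ ?n + 1) * L / c + 3 ^ ?n * L / c + 2 * C2 * L / c)"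
   using C1 C2 c Lp by (subst ennreal_plus[symmetric], simp, simp)+ simp
  also have "C1 * (2 ^ ?n + 1) * L / c + 3 ^ ?n * L / c + 2 * C2 * L / c = C / c * L"
   by (simp add: C_def add_divide_distrib distrib_right)
  also have "ennreal (C / c * L) = ennreal (C / c) * (\<integral>x. enorm (F x))"
   unfolding L(1) using C c L(2) by (intro ennreal_mult) auto
  finally show ?thesis .
 qed
 have "leb {x. cmod (T F x) > c} \<le> ennreal (2 * C / c) * (\<integral>x. enorm (F x))"
  if "L2 F" "(\<integral>x. enorm (F x)) < \<infinity>" "c > 0" for F c
  using main[of F "c / 2"] that by (simp add: mult.commute)
 then show ?thesis using C by (intro exI[of _ "2 * C"]) auto
qed

end

section \<open>Commutators\<close>

text \<open>Linearity and boundedness of \<open>T\<close> are assumed on L2 only, while the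
  commutators apply \<open>T\<close> to the functions \<open>b^j F\<close>. The class is stable
  under multiplication by \<open>b\<close>, by shifts of \<open>b\<close> and by cutting
  \<open>F\<close>.\<close>

definition adm :: "('a::euclidean_space \<Rightarrow> real) \<Rightarrow> ('a \<Rightarrow> complex) \<Rightarrow> bool" where
 "adm b F \<longleftrightarrow> (\<forall>j. L2 (\<lambda>x. of_real (b x) ^ j * F x))"

lemma admD: "adm b F \<Longrightarrow> L2 (\<lambda>x. of_real (b x) ^ j * F x)" by (simp add: adm_def)
lemma adm_L2: "adm b F \<Longrightarrow> L2 F" using admD[of b F 0] by simp

lemma adm_mult: "adm b F \<Longrightarrow> adm b (\<lambda>x. of_real (b x) * F x)"
 unfolding adm_def
proof
 fix j assume *: "\<forall>j. L2 (\<lambda>x. of_real (b x) ^ j * F x)"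
 have "L2 (\<lambda>x. of_real (b x) ^ Suc j * F x)" using * by blast
 then show "L2 (\<lambda>x. of_real (b x) ^ j * (of_real (b x) * F x))" by (simp add: mult_ac)
qed

lemma adm_add: "adm b F \<Longrightarrow> adm b G \<Longrightarrow> adm b (\<lambda>x. F x + G x)"
 unfolding adm_def by (auto simp: distrib_left intro!: L2_add)

lemma adm_scale: "adm b F \<Longrightarrow> adm b (\<lambda>x. c * F x)"
 unfolding adm_def using L2_scale[of _ c] by (auto simp: mult.left_commute[of _ c])

lemma adm_indicator: "adm b F \<Longrightarrow> S \<in> sets lebesgue \<Longrightarrow> adm b (\<lambda>x. F x * indicator S x)"
 unfolding adm_def by (auto simp: mult.assoc[symmetric] intro!: L2_indicator)

lemma adm_shift: assumes "adm b F" shows "adm (\<lambda>x. b x - c) F"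
 unfolding adm_def
proof
 fix j
 have "(\<lambda>x. of_real (b x - c) ^ j * F x) = (\<lambda>x. \<Sum>k\<le>j. (of_nat (j choose k) * (- of_real c) ^ (j - k)) * (of_real (b x) ^ k * F x))"
 proof
  fix x
  have "of_real (b x - c) ^ j = (of_real (b x) + (- of_real c) :: complex) ^ j" by simp
  then show "of_real (b x - c) ^ j * F x = (\<Sum>k\<le>j. (of_nat (j choose k) * (- of_real c) ^ (j - k)) * (of_real (b x) ^ k * F x))"
   unfolding binomial_ring by (simp add: sum_distrib_right sum_distrib_left mult_ac)
 qed
 then show "L2 (\<lambda>x. of_real (b x - c) ^ j * F x)"
  using assms by (simp only:) (intro L2_sum L2_scale admD)
qed

lemma adm_dilate: "adm b F \<Longrightarrow> adm (\<lambda>x. s * b x) F"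
 unfolding adm_def using L2_scale[of "\<lambda>x. of_real (b x) ^ j * F x" "of_real s ^ j" for j]
 by (auto simp: power_mult_distrib mult_ac)

context czo
begin

lemma comm_add: "adm b F \<Longrightarrow> adm b G \<Longrightarrow>
 AE x. commutator T b m (\<lambda>y. F y + G y) x = commutator T b m F x + commutator T b m G x"
proof (induction m arbitrary: F G)
 case 0
 then show ?case using T_add adm_L2 by auto
next
 case (Suc m)
 have "AE x. commutator T b m (\<lambda>y. of_real (b y) * F y + of_real (b y) * G y) x
   = commutator T b m (\<lambda>y. of_real (b y) * F y) x + commutator T b m (\<lambda>y. of_real (b y) * G y) x"
  by (intro Suc.IH adm_mult Suc.prems)
 then show ?case using Suc.IH[OF Suc.prems]
  by eventually_elim (simp add: distrib_left)
qed

lemma comm_scale: "adm b F \<Longrightarrow>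
 AE x. commutator T b m (\<lambda>y. c * F y) x = c * commutator T b m F x"
proof (induction m arbitrary: F)
 case 0
 then show ?case using T_scale adm_L2 by auto
next
 case (Suc m)
 have "AE x. commutator T b m (\<lambda>y. c * (of_real (b y) * F y)) x
   = c * commutator T b m (\<lambda>y. of_real (b y) * F y) x"
  by (intro Suc.IH adm_mult Suc.prems)
 then show ?case using Suc.IH[OF Suc.prems]
  by eventually_elim (simp add: mult.left_commute right_diff_distrib)
qed

lemma comm_measurable: "adm b F \<Longrightarrow> lm b \<Longrightarrow> commutator T b m F \<in> borel_measurable lebesgue"
proof (induction m arbitrary: F)
 case 0
 from T_measurable[OF adm_L2[OF 0(1)]] show ?case by simp
next
 case (Suc m)
 note [measurable] = Suc.IH[OF Suc.prems] Suc.IH[OF adm_mult[OF Suc.prems(1)] Suc.prems(2)] Suc.prems(2)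
 show ?case by simp
qed

text \<open>The commutator is a binomial combination of powers of \<open>b x\<close> with the values
  \<open>T (b^i F) x\<close>. Applied to \<open>b - c\<close> in place of \<open>b\<close>, this is
  the source of the weight \<open>bw\<close>.\<close>

lemma comm_bound:
 assumes "\<And>i. i \<le> m \<Longrightarrow> cmod (T (\<lambda>y. of_real (b y) ^ i * F y) x) \<le> A"
 shows "cmod (commutator T b m F x) \<le> (1 + \<bar>b x\<bar>) ^ m * A"
 using assms
proof (induction m arbitrary: F)
 case 0
 from "0"[of 0] show ?case by simp
next
 case (Suc m)
 have 1: "cmod (commutator T b m F x) \<le> (1 + \<bar>b x\<bar>) ^ m * A" by (rule Suc.IH) (simp add: Suc.prems)
 have 2: "cmod (commutator T b m (\<lambda>y. of_real (b y) * F y) x) \<le> (1 + \<bar>b x\<bar>) ^ m * A"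
 proof (rule Suc.IH)
  fix i assume "i \<le> m"
  then show "cmod (T (\<lambda>y. of_real (b y) ^ i * (of_real (b y) * F y)) x) \<le> A"
   using Suc.prems[of "Suc i"] by (simp add: mult_ac)
 qed
 have "cmod (commutator T b (Suc m) F x) \<le> \<bar>b x\<bar> * cmod (commutator T b m F x) + cmod (commutator T b m (\<lambda>y. of_real (b y) * F y) x)"
  by (auto intro!: order_trans[OF norm_triangle_ineq4] simp: norm_mult)
 also have "\<dots> \<le> \<bar>b x\<bar> * ((1 + \<bar>b x\<bar>) ^ m * A) + (1 + \<bar>b x\<bar>) ^ m * A"
  by (intro add_mono mult_left_mono 1 2) auto
 also have "\<dots> = (1 + \<bar>b x\<bar>) ^ Suc m * A" by (simp add: algebra_simps)
 finally show ?case .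
qed

text \<open>Multiplication by a constant commutes with \<open>T\<close>, so the symbol can be
  centred anew on every cube. The identity holds almost everywhere only, as linearity does.\<close>

lemma comm_shift: "adm b F \<Longrightarrow>
 AE x. commutator T (\<lambda>y. b y - c) m F x = commutator T b m F x"
proof (induction m arbitrary: F)
 case 0
 then show ?case by simp
next
 case (Suc m)
 have a: "adm b (\<lambda>y. of_real (b y) * F y + (- of_real c) * F y)"
  by (intro adm_add adm_scale adm_mult Suc.prems)
 have e: "(\<lambda>y. of_real (b y) * F y + (- of_real c) * F y) = (\<lambda>y. of_real (b y - c) * F y)"
  by (simp add: algebra_simps)
 have "AE x. commutator T (\<lambda>y. b y - c) m (\<lambda>y. of_real (b y - c) * F y) x = commutator T b m (\<lambda>y. of_real (b y - c) * F y) x"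
  using Suc.IH[OF a] unfolding e .
 moreover have "AE x. commutator T b m (\<lambda>y. of_real (b y - c) * F y) x =
   commutator T b m (\<lambda>y. of_real (b y) * F y) x + commutator T b m (\<lambda>y. (- of_real c) * F y) x"
  unfolding e[symmetric] by (intro comm_add adm_scale adm_mult Suc.prems)
 moreover have "AE x. commutator T b m (\<lambda>y. (- of_real c) * F y) x = (- of_real c) * commutator T b m F x"
  by (intro comm_scale Suc.prems)
 ultimately show ?case using Suc.IH[OF Suc.prems]
  by eventually_elim (simp add: algebra_simps)
qed

text \<open>Homogeneity of degree \<open>m\<close> in the symbol, by which the BMO norm is
  normalised at the end.\<close>

lemma comm_dilate: "adm b F \<Longrightarrow>
 AE x. commutator T (\<lambda>y. s * b y) m F x = of_real s ^ m * commutator T b m F x"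
proof (induction m arbitrary: F)
 case 0
 then show ?case by simp
next
 case (Suc m)
 have a: "adm b (\<lambda>y. of_real s * (of_real (b y) * F y))" by (intro adm_scale adm_mult Suc.prems)
 have e: "(\<lambda>y. of_real s * (of_real (b y) * F y)) = (\<lambda>y. of_real (s * b y) * F y)" by (simp add: mult_ac)
 have "AE x. commutator T (\<lambda>y. s * b y) m (\<lambda>y. of_real (s * b y) * F y) x = of_real s ^ m * commutator T b m (\<lambda>y. of_real s * (of_real (b y) * F y)) x"
  using Suc.IH[OF a] unfolding e .
 moreover have "AE x. commutator T b m (\<lambda>y. of_real s * (of_real (b y) * F y)) x = of_real s * commutator T b m (\<lambda>y. of_real (b y) * F y) x"
  by (intro comm_scale adm_mult Suc.prems)
 ultimately show ?case using Suc.IH[OF Suc.prems]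
  by eventually_elim (simp add: algebra_simps)
qed

end

section \<open>The stopping step of the sparse domination\<close>

lemma reflect_measurable: "lm K \<Longrightarrow> (\<lambda>y. K (x - y)) \<in> borel_measurable lebesgue"
 for K :: "'a::euclidean_space \<Rightarrow> complex"
proof -
 assume K: "lm K"
 have "(\<lambda>y::'a. x + (\<Sum>j\<in>Basis. (- 1 * (y \<bullet> j)) *\<^sub>R j)) \<in> lebesgue \<rightarrow>\<^sub>M lebesgue"
  by (rule lebesgue_affine_measurable) auto
 moreover have "(\<lambda>y::'a. x + (\<Sum>j\<in>Basis. (- 1 * (y \<bullet> j)) *\<^sub>R j)) = (\<lambda>y. x - y)"
  by (simp add: sum_negf euclidean_representation)
 ultimately show ?thesis using measurable_compose[OF _ K] by simp
qed

text \<open>The kernel formula holds off a compact set carrying the function. Half-open triples are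
  not compact, so the interior of the closed triple of the cell is removed from a closed cube; the
  cell lies in that interior.\<close>

lemma dc_avoids:
 fixes z :: "'a::euclidean_space"
 obtains S where "compact S" "dc k z \<inter> S = {}" "\<And>y. y \<in> trip k0 x0 \<Longrightarrow> y \<notin> trip k z \<Longrightarrow> y \<in> S"
proof
 let ?B = "box (cn k z - dside k *\<^sub>R One) ((cn k z - dside k *\<^sub>R One) + (3 * dside k) *\<^sub>R One)"
 show "compact (tcl k0 x0 - ?B)" unfolding tcl_def by (intro compact_diff compact_cbox open_box)
 have "dc k z \<subseteq> ?B"
 proof
  fix y assume y: "y \<in> dc k z"
  show "y \<in> ?B" unfolding mem_box
  proof
   fix i :: 'a assume i: "i \<in> Basis"
   have "cn k z \<bullet> i \<le> y \<bullet> i \<and> y \<bullet> i < cn k z \<bullet> i + dside k" using y i by (auto simp: dc_box)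
   then show "(cn k z - dside k *\<^sub>R One) \<bullet> i < y \<bullet> i \<and> y \<bullet> i < ((cn k z - dside k *\<^sub>R One) + (3 * dside k) *\<^sub>R One) \<bullet> i"
    using i dside_pos(1)[of k] by (simp add: inner_diff_left inner_add_left)
  qed
 qed
 then show "dc k z \<inter> (tcl k0 x0 - ?B) = {}" by blast
 fix y assume "y \<in> trip k0 x0" "y \<notin> trip k z"
 then show "y \<in> tcl k0 x0 - ?B" using trip_tcl[of k0 x0] trip_box_sub[of k z] by blast
qed

context czo
begin

text \<open>The maximal function at \<open>x1\<close> controls all shells around the cell at once,
  with a geometric factor from \<open>kernel_cell\<close>. The quantifiers are nested because
  \<open>T H\<close> is known up to null sets and \<open>x1\<close> is chosen after
  \<open>x\<close>, from a set of positive measure.\<close>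

lemma T_tail_osc:
 "\<exists>C>0. \<forall>k z k0 x0 H M. L2 H \<longrightarrow> (\<integral>x. enorm (H x)) < \<infinity> \<longrightarrow> (\<forall>y. y \<notin> trip k0 x0 \<longrightarrow> H y = 0) \<longrightarrow>
  (\<forall>y\<in>trip k z. H y = 0) \<longrightarrow> M \<ge> 0 \<longrightarrow>
  (AE x. AE x1. x \<in> dc k z \<longrightarrow> x1 \<in> dc k z \<longrightarrow> dmax (\<lambda>y. enorm (H y)) x1 \<le> ennreal M \<longrightarrow>
   cmod (T H x) \<le> cmod (T H x1) + C * M)"
proof -
 let ?n = "DIM('a)"
 obtain D where D: "D > 0" "\<And>k q x y y' l. y \<in> dc k q \<Longrightarrow> y' \<in> dc k q \<Longrightarrow> x \<notin> trip (k - int l) q \<Longrightarrow>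
   cmod (K (y - x) - K (y' - x)) \<le> D * (1/2) ^ l / dvol TYPE('a) (k - int l - 1)"
  using kernel_cell by blast
 obtain C1 where C1: "\<And>x. x \<noteq> 0 \<Longrightarrow> cmod (K x) \<le> C1 / norm x ^ ?n" using czo by (auto simp: CZO_def)
 have "AE x. AE x1. x \<in> dc k z \<longrightarrow> x1 \<in> dc k z \<longrightarrow> dmax (\<lambda>y. enorm (H y)) x1 \<le> ennreal M \<longrightarrow>
   cmod (T H x) \<le> cmod (T H x1) + 2 * D * M"
  if H: "L2 H" "(\<integral>x. enorm (H x)) < \<infinity>" "\<And>y. y \<notin> trip k0 x0 \<Longrightarrow> H y = 0" "\<And>y. y \<in> trip k z \<Longrightarrow> H y = 0"
   and M: "M \<ge> 0" for k z k0 x0 H M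
 proof -
  note [measurable] = L2_measurable[OF H(1)]
  have Hi: "integrable lebesgue H" using H(2) by (simp add: integrable_iff_bounded)
  obtain S where S: "compact S" "dc k z \<inter> S = {}" "\<And>y. y \<in> trip k0 x0 \<Longrightarrow> y \<notin> trip k z \<Longrightarrow> y \<in> S"
   by (rule dc_avoids[of k z k0 x0], rule that) (assumption | blast)+
  have "AE y. y \<notin> S \<longrightarrow> H y = 0" using S(3) H(3,4) by (intro AE_I2) blast
  from T_kernel[OF H(1) S(1) this]
  have rep: "AE x. x \<in> dc k z \<longrightarrow> T H x = (\<integral>y. K (x - y) * H y \<partial>lebesgue)"
   by eventually_elim (use S(2) in blast)
  \<comment> \<open>\<open>H\<close> vanishes on the triple, and off it the kernel is bounded; so
    both integrals exist and may be subtracted.\<close>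
  have int: "integrable lebesgue (\<lambda>y. K (x - y) * H y)" if x: "x \<in> dc k z" for x
  proof (rule Bochner_Integration.integrable_bound)
   show "integrable lebesgue (\<lambda>y. of_real (\<bar>C1\<bar> / dside k ^ ?n) * H y)" using Hi by simp
   note [measurable] = reflect_measurable[OF K_measurable, of x]
   show "lm (\<lambda>y. K (x - y) * H y)" by measurable
   show "AE y. norm (K (x - y) * H y) \<le> norm (of_real (\<bar>C1\<bar> / dside k ^ ?n) * H y)"
   proof (rule AE_I2)
    fix y
    show "norm (K (x - y) * H y) \<le> norm (of_real (\<bar>C1\<bar> / dside k ^ ?n) * H y)"
    proof (cases "y \<in> trip k z")
     case False
     then have d: "dside k \<le> norm (x - y)" by (rule trip_dist[OF x])
     then have "norm (x - y) > 0" using dside_pos(1)[of k] by linarith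
     then have "x - y \<noteq> 0" by simp
     then have "cmod (K (x - y)) \<le> C1 / norm (x - y) ^ ?n" by (rule C1)
     also have "\<dots> \<le> \<bar>C1\<bar> / norm (x - y) ^ ?n" by (intro divide_right_mono) auto
     also have "\<dots> \<le> \<bar>C1\<bar> / dside k ^ ?n"
      using d \<open>norm (x - y) > 0\<close> by (intro divide_left_mono power_mono mult_pos_pos zero_less_power) auto
     finally have "cmod (K (x - y)) * cmod (H y) \<le> \<bar>C1\<bar> / dside k ^ ?n * cmod (H y)" by (rule mult_right_mono) simp
     then show ?thesis by (simp add: norm_mult norm_divide norm_power)
    qed (simp add: H(4))
   qed
  qed
  have osc: "cmod ((\<integral>y. K (x - y) * H y \<partial>lebesgue) - (\<integral>y. K (x1 - y) * H y \<partial>lebesgue)) \<le> 2 * D * M"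
   if x: "x \<in> dc k z" "x1 \<in> dc k z" and d: "dmax (\<lambda>y. enorm (H y)) x1 \<le> ennreal M" for x x1
  proof -
   have "enorm ((\<integral>y. K (x - y) * H y \<partial>lebesgue) - (\<integral>y. K (x1 - y) * H y \<partial>lebesgue))
    = enorm (\<integral>y. K (x - y) * H y - K (x1 - y) * H y \<partial>lebesgue)"
    using int[OF x(1)] int[OF x(2)] by simp
   also have "\<dots> \<le> (\<integral>y. enorm (K (x - y) * H y - K (x1 - y) * H y))"
    using int[OF x(1)] int[OF x(2)] by (intro integral_norm_bound_ennreal) auto
   also have "\<dots> \<le> (\<integral>y. (\<Sum>l. ennreal (D * (1/2) ^ l / dvol TYPE('a) (k - int l - 1)) * (enorm (H y) * indicator (trip (k - int l - 1) x1) y)))"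
   proof (rule nn_integral_mono)
    fix y
    show "enorm (K (x - y) * H y - K (x1 - y) * H y) \<le> (\<Sum>l. ennreal (D * (1/2) ^ l / dvol TYPE('a) (k - int l - 1)) * (enorm (H y) * indicator (trip (k - int l - 1) x1) y))"
    proof (cases "y \<in> trip k z")
     case True
     then show ?thesis by (simp add: H(4))
    next
     case False
     then obtain l where l: "y \<in> trip (k - int l - 1) z" "y \<notin> trip (k - int l) z" by (rule trip_shell)
     define f where "f l = ennreal (D * (1/2) ^ l / dvol TYPE('a) (k - int l - 1)) * (enorm (H y) * indicator (trip (k - int l - 1) x1) y)" for l
     have "x1 \<in> dc (k - int l - 1) z" using x(2) dc_mono[of "k - int l - 1" k z] by auto
     then have l1: "y \<in> trip (k - int l - 1) x1" using l(1) trip_eq by blast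
     have "cmod (K (x - y) * H y - K (x1 - y) * H y) = cmod (K (x - y) - K (x1 - y)) * cmod (H y)"
      by (metis left_diff_distrib norm_mult)
     also have "\<dots> \<le> D * (1/2) ^ l / dvol TYPE('a) (k - int l - 1) * cmod (H y)"
      by (intro mult_right_mono D(2)[OF x l(2)]) auto
     finally have "enorm (K (x - y) * H y - K (x1 - y) * H y) \<le> f l"
      using D l1 by (simp add: f_def ennreal_mult[symmetric] ennreal_leI)
     also have "f l = sum f {l}" by simp
     also have "\<dots> \<le> suminf f" by (rule sum_le_suminf) auto
     finally show ?thesis by (simp only: f_def[abs_def])
    qed
   qed
   also have "\<dots> = (\<Sum>l. (\<integral>y. ennreal (D * (1/2) ^ l / dvol TYPE('a) (k - int l - 1)) * (enorm (H y) * indicator (trip (k - int l - 1) x1) y)))"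
    by (rule nn_integral_suminf) measurable
   also have "\<dots> \<le> (\<Sum>l. ennreal (D * M * (1/2) ^ l))"
   proof (intro suminf_le allI)
    fix l
    have "(\<integral>y. ennreal (D * (1/2) ^ l / dvol TYPE('a) (k - int l - 1)) * (enorm (H y) * indicator (trip (k - int l - 1) x1) y))
     = ennreal (D * (1/2) ^ l / dvol TYPE('a) (k - int l - 1)) * (\<integral>y\<in>trip (k - int l - 1) x1. enorm (H y))"
     by (rule nn_integral_cmult) measurable
    also have "\<dots> \<le> ennreal (D * (1/2) ^ l / dvol TYPE('a) (k - int l - 1)) * (ennreal M * ennreal (dvol TYPE('a) (k - int l - 1)))"
     by (intro mult_left_mono order_trans[OF dmax_ge] mult_right_mono d) auto
    also have "\<dots> = ennreal (D * M * (1/2) ^ l)"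
     using D M by (simp add: ennreal_mult[symmetric] mult_ac)
    finally show "(\<integral>y. ennreal (D * (1/2) ^ l / dvol TYPE('a) (k - int l - 1)) * (enorm (H y) * indicator (trip (k - int l - 1) x1) y)) \<le> ennreal (D * M * (1/2) ^ l)" .
   qed auto
   also have "\<dots> = ennreal (\<Sum>l. D * M * (1/2) ^ l)"
    by (rule suminf_ennreal2) (use D M in \<open>auto intro!: summable_mult summable_geometric\<close>)
   also have "(\<Sum>l. D * M * (1/2) ^ l) = 2 * D * M"
    by (subst suminf_mult) (auto intro!: summable_geometric simp: suminf_geometric)
   finally show ?thesis using D M by simp
  qed
  show ?thesis
   using rep
  proof eventually_elim
   case (elim x)
   show ?case using rep
   proof eventually_elim
    case (elim x1)
    show ?case
    proof (intro impI)
     assume x: "x \<in> dc k z" "x1 \<in> dc k z" and d: "dmax (\<lambda>y. enorm (H y)) x1 \<le> ennreal M"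
     have "cmod (T H x - T H x1) \<le> 2 * D * M" using osc[OF x d] elim x \<open>x \<in> dc k z \<longrightarrow> T H x = _\<close> by simp
     then show "cmod (T H x) \<le> cmod (T H x1) + 2 * D * M"
      using norm_triangle_sub[of "T H x" "T H x1"] by linarith
    qed
   qed
  qed
 qed
 note main = this
 show ?thesis
 proof (rule exI[of _ "2 * D"], intro conjI allI impI)
  fix k k0 :: int and z x0 :: 'a and H :: "'a \<Rightarrow> complex" and M :: real
  assume "L2 H" "(\<integral>x. enorm (H x)) < \<infinity>" "\<forall>y. y \<notin> trip k0 x0 \<longrightarrow> H y = 0"
   "\<forall>y\<in>trip k z. H y = 0" "0 \<le> M"
  then show "AE x. AE x1. x \<in> dc k z \<longrightarrow> x1 \<in> dc k z \<longrightarrow> dmax (\<lambda>y. enorm (H y)) x1 \<le> ennreal M \<longrightarrow>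
   cmod (T H x) \<le> cmod (T H x1) + 2 * D * M"
   by (intro main) auto
 qed (use D(1) in simp)
qed

end

lemma dmax_mono: "(\<And>y. f y \<le> g y) \<Longrightarrow> dmax f x \<le> dmax g x"
 unfolding dmax_def by (intro SUP_mono' divide_right_mono_ennreal nn_integral_mono mult_right_mono) auto

lemma emeasure_ge_le: "emeasure M (A \<union> B) \<le> a + b" if "emeasure M A \<le> a" "emeasure M B \<le> b" "A \<in> sets M" "B \<in> sets M"
 using emeasure_subadditive[OF that(3,4)] add_mono[OF that(1,2)] by (rule order_trans)

abbreviation sparse_cells :: "int \<Rightarrow> 'a::euclidean_space \<Rightarrow> (int \<times> 'a) set \<Rightarrow> bool" where
 "sparse_cells k0 x0 J \<equiv> countable J \<and> disjoint_family_on cell J \<and> (\<forall>(k, z)\<in>J. k0 < k \<and> z \<in> dc k0 x0) \<and>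
   cvol J \<le> ennreal (dvol TYPE('a) k0 / 2) "

context czo
begin

abbreviation stopping_cells :: "nat \<Rightarrow> int \<Rightarrow> 'a \<Rightarrow> (nat \<Rightarrow> 'a \<Rightarrow> complex) \<Rightarrow> real \<Rightarrow> (int \<times> 'a) set \<Rightarrow> bool" where
 "stopping_cells m k0 x0 F L J \<equiv> sparse_cells k0 x0 J \<and>
   (AE x. x \<in> dc k0 x0 \<longrightarrow> x \<notin> (\<Union>(cell ` J)) \<longrightarrow> (\<forall>i\<le>m. cmod (T (F i) x) \<le> L)) \<and>
   (\<forall>(k, z)\<in>J. AE x. x \<in> dc k z \<longrightarrow> (\<forall>i\<le>m. cmod (T (\<lambda>y. F i y * indicator (- trip k z) y) x) \<le> L))"

text \<open>The cells are stopped on the density of a bad set \<open>E\<close>, where some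
  \<open>T (F i)\<close> or some maximal function is large. In each of them a point outside
  \<open>E\<close> remains at which the part inside the triple is also controlled, by the weak type
  bound; the outer part is then controlled at this point, and \<open>T_tail_osc\<close> carries the
  bound over the whole cell.\<close>

lemma stopping_step:
 fixes m :: nat
 shows "\<exists>C>0. \<forall>k0 x0 F a. (\<forall>i\<le>m. L2 (F i) \<and> (\<forall>y. y \<notin> trip k0 x0 \<longrightarrow> F i y = 0) \<and>
    (\<integral>x. enorm (F i x)) \<le> ennreal (a * dvol TYPE('a) k0)) \<longrightarrow> a \<ge> 0 \<longrightarrow>
  (\<exists>J. stopping_cells m k0 x0 F (C * a) J)"
proof -
 let ?n = "DIM('a)" and ?V = "dvol TYPE('a)"
 obtain C1 where C1: "C1 > 0" "\<And>F c. L2 F \<Longrightarrow> (\<integral>x. enorm (F x)) < \<infinity> \<Longrightarrow> c > 0 \<Longrightarrow>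
  leb {x. cmod (T F x) > c} \<le> ennreal (C1 / c) * (\<integral>x. enorm (F x))"
  using weak_type by blast
 obtain C2 where C2: "C2 > 0" "\<And>k z k0 x0 H M. L2 H \<Longrightarrow> (\<integral>x. enorm (H x)) < \<infinity> \<Longrightarrow> (\<forall>y. y \<notin> trip k0 x0 \<longrightarrow> H y = 0) \<Longrightarrow>
  (\<forall>y\<in>trip k z. H y = 0) \<Longrightarrow> M \<ge> 0 \<Longrightarrow>
  (AE x. AE x1. x \<in> dc k z \<longrightarrow> x1 \<in> dc k z \<longrightarrow> dmax (\<lambda>y. enorm (H y)) x1 \<le> ennreal M \<longrightarrow>
   cmod (T H x) \<le> cmod (T H x1) + C2 * M)"
  using T_tail_osc by blast
 define N :: real where "N = 3 ^ ?n"
 have N: "N > 0" by (simp add: N_def)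
 have Ne: "(3::ennreal) ^ ?n = ennreal N" by (simp add: N_def ennreal_power[symmetric])
 \<comment> \<open>\<open>E\<close> lies in the union of \<open>m + 1\<close> pairs of level sets;
   this height makes its measure at most the volume of the cell over
   \<open>2 ^ (?n + 2)\<close>.\<close>
 define \<Lambda> where "\<Lambda> = (real m + 1) * (C1 + N) * 2 ^ (?n + 2)"
 have \<Lambda>: "\<Lambda> > 0" using C1 N by (simp add: \<Lambda>_def add_pos_pos)
 \<comment> \<open>Chosen so that the weak type bound for the part inside the triple excludes at
   most a quarter of a stopping cell.\<close>
 define \<Lambda>2 where "\<Lambda>2 = 4 * C1 * N * \<Lambda>"
 have \<Lambda>2: "\<Lambda>2 > 0" using C1 N \<Lambda> by (simp add: \<Lambda>2_def)
 define C where "C = \<Lambda> + \<Lambda>2 + C2 * (N * \<Lambda>)"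
 have C: "C > 0" "\<Lambda> \<le> C" "\<Lambda> + \<Lambda>2 + C2 * (N * \<Lambda>) \<le> C" using C2 N \<Lambda> \<Lambda>2 by (auto simp: C_def add_pos_pos less_imp_le)
 have "\<exists>J. stopping_cells m k0 x0 F (C * a) J"
  if F: "\<forall>i\<le>m. L2 (F i) \<and> (\<forall>y. y \<notin> trip k0 x0 \<longrightarrow> F i y = 0) \<and> (\<integral>x. enorm (F i x)) \<le> ennreal (a * ?V k0)"
   and a: "a \<ge> 0" for k0 x0 and F :: "nat \<Rightarrow> 'a \<Rightarrow> complex" and a :: real
 proof -
  have F1: "L2 (F i)" "\<And>y. y \<notin> trip k0 x0 \<Longrightarrow> F i y = 0" "(\<integral>x. enorm (F i x)) \<le> ennreal (a * ?V k0)" if "i \<le> m" for i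
   using F that by auto
  have Fm: "lm (F i)" if "i \<le> m" for i using L2_measurable[OF F1(1)[OF that]] .
  have Ffin: "(\<integral>x. enorm (F i x)) < \<infinity>" if "i \<le> m" for i
   using F1(3)[OF that] by (auto intro: le_less_trans)
  show ?thesis
  proof (cases "a = 0")
   \<comment> \<open>The weak type bound needs a positive height; for \<open>a = 0\<close> every
     \<open>F i\<close> is null and no cell has to be selected.\<close>
   case True
   have z: "AE x. T (F i) x = 0" if "i \<le> m" for i
   proof -
    note [measurable] = Fm[OF that]
    have "(\<integral>x. enorm (F i x)) = 0" using F1(3)[OF that] True by simp
    then have "AE x. F i x = 0" by (simp add: nn_integral_0_iff_AE)
    then show ?thesis by (rule T_null[OF F1(1)[OF that]])
   qed
   have "AE x. \<forall>i\<in>{..m}. T (F i) x = 0"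
    by (subst AE_ball_countable) (use z in auto)
   then have "AE x. x \<in> dc k0 x0 \<longrightarrow> x \<notin> (\<Union>(k, z)\<in>{}. dc k z) \<longrightarrow> (\<forall>i\<le>m. cmod (T (F i) x) \<le> C * a)"
    by eventually_elim (auto simp: True)
   then show ?thesis by (intro exI[of _ "{}"]) (auto simp: disjoint_family_on_def nn_integral_empty)
  next
   case False
   then have ap: "a > 0" using a by simp
   let ?A = "\<lambda>i. {x. cmod (T (F i) x) > \<Lambda> * a}" and ?B = "\<lambda>i. {x. dmax (\<lambda>y. enorm (F i y)) x > 3 ^ ?n * ennreal (\<Lambda> * a)}"
   define E where "E = dc k0 x0 \<inter> (\<Union>i\<in>{..m}. (?A i) \<union> (?B i))"
   have Es: "(?A i) \<in> sets lebesgue" "(?B i) \<in> sets lebesgue" if "i \<le> m" for i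
   proof -
    note [measurable] = T_measurable[OF F1(1)[OF that]]
    show "(?A i) \<in> sets lebesgue" by (rule Collect_less_lebesgue) measurable
    show "(?B i) \<in> sets lebesgue" by (rule Collect_less_lebesgue) measurable
   qed
   have Em [measurable]: "E \<in> sets lebesgue" unfolding E_def using Es by (intro sets.Int sets.finite_UN sets.Un) auto
   have E1: "leb (?A i) \<le> ennreal (C1 / \<Lambda> * ?V k0)" if "i \<le> m" for i
   proof -
    have "leb (?A i) \<le> ennreal (C1 / (\<Lambda> * a)) * (\<integral>x. enorm (F i x))"
     using \<Lambda> ap by (intro C1(2) F1(1) Ffin that) auto
    also have "\<dots> \<le> ennreal (C1 / (\<Lambda> * a)) * ennreal (a * ?V k0)" by (intro mult_left_mono F1(3) that) auto
    also have "\<dots> = ennreal (C1 / \<Lambda> * ?V k0)" using C1(1) \<Lambda> ap by (subst ennreal_mult[symmetric]) auto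
    finally show ?thesis .
   qed
   have E2: "leb (?B i) \<le> ennreal (N / \<Lambda> * ?V k0)" if "i \<le> m" for i
   proof -
    note [measurable] = Fm[OF that]
    have "leb (?B i) \<le> ennreal (3 ^ ?n / (\<Lambda> * a)) * (\<integral>x. enorm (F i x))"
     by (rule dmax_weak) (use \<Lambda> ap in auto)
    also have "\<dots> \<le> ennreal (3 ^ ?n / (\<Lambda> * a)) * ennreal (a * ?V k0)" by (intro mult_left_mono F1(3) that) auto
    also have "\<dots> = ennreal (N / \<Lambda> * ?V k0)" using \<Lambda> ap by (subst ennreal_mult[symmetric]) (auto simp: N_def)
    finally show ?thesis .
   qed
   have Esmall: "leb E \<le> ennreal (?V k0 / 2 ^ (?n + 2))"
   proof -
    have "leb E \<le> leb (\<Union>i\<in>{..m}. (?A i) \<union> (?B i))"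
     unfolding E_def using Es by (intro emeasure_mono sets.finite_UN sets.Un) auto
    also have "\<dots> \<le> (\<Sum>i\<in>{..m}. leb ((?A i) \<union> (?B i)))"
     using Es by (intro emeasure_subadditive_finite) auto
    also have "\<dots> \<le> (\<Sum>i\<in>{..m}. ennreal (C1 / \<Lambda> * ?V k0) + ennreal (N / \<Lambda> * ?V k0))"
     using Es E1 E2 by (intro sum_mono emeasure_ge_le) auto
    also have "\<dots> = (\<Sum>i\<in>{..m}. ennreal ((C1 + N) / \<Lambda> * ?V k0))"
     using C1(1) N \<Lambda> by (simp add: add_divide_distrib distrib_right)
    also have "\<dots> = ennreal ((real m + 1) * ((C1 + N) / \<Lambda> * ?V k0))"
    proof -
     have "(C1 + N) / \<Lambda> * ?V k0 \<ge> 0" using C1(1) N \<Lambda> by simp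
     then show ?thesis by (subst sum_ennreal) (auto simp: add.commute)
    qed
    also have "(real m + 1) * ((C1 + N) / \<Lambda> * ?V k0) = ?V k0 / 2 ^ (?n + 2)"
    proof -
     have *: "r * (t / (r * t * p) * V) = V / p" if "r \<noteq> 0" "t \<noteq> 0" for r t p V :: real
      using that by simp
     show ?thesis unfolding \<Lambda>_def by (rule *) (use C1(1) N in linarith)+
    qed
    finally show ?thesis .
   qed
   \<comment> \<open>Stopping the indicator of \<open>E\<close> at this height leaves at most half
     of each selected cell in \<open>E\<close>, and the total volume of the cells is at most
     \<open>leb E / A\<close>, half of the original cell.\<close>
   define A :: real where "A = 1 / 2 ^ (?n + 1)"
   have A: "A > 0" "A < 1" "2 ^ ?n * A = 1 / 2"
   proof -
    have "(1::real) \<le> 2 ^ ?n" by simp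
    then have "(1::real) < 2 * 2 ^ ?n" by linarith
    then show "A > 0" "A < 1" "2 ^ ?n * A = 1 / 2" by (auto simp: A_def divide_simps)
   qed
   have Ee: "(\<integral>y\<in>S. indicator E y) = leb (E \<inter> S)" if S: "S \<in> sets lebesgue" for S
   proof -
    have "(\<integral>y\<in>S. indicator E y) = (\<integral>y. indicator (E \<inter> S) y)"
     by (intro nn_integral_cong) (auto simp: indicator_def)
    also have "\<dots> = leb (E \<inter> S)" by (rule nn_integral_indicator[OF sets.Int[OF Em S]])
    finally show ?thesis .
   qed
   have EQ: "E \<inter> dc k0 x0 = E" by (auto simp: E_def)
   have le: "(\<integral>y\<in>dc k0 x0. indicator E y) \<le> ennreal (A * ?V k0)"
   proof -
    have "(\<integral>y\<in>dc k0 x0. indicator E y) \<le> ennreal (?V k0 / 2 ^ (?n + 2))"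
     using Esmall by (simp add: Ee EQ)
    also have "\<dots> \<le> ennreal (A * ?V k0)" by (intro ennreal_leI) (simp add: A_def divide_simps)
    finally show ?thesis .
   qed
   have im: "(indicator E :: 'a \<Rightarrow> ennreal) \<in> borel_measurable lebesgue" by measurable
   obtain J :: "(int \<times> 'a) set" where J: "countable J" "disjoint_family_on cell J"
    "\<And>k z. (k, z) \<in> J \<Longrightarrow> k0 < k \<and> z \<in> dc k0 x0"
    "\<And>k z. (k, z) \<in> J \<Longrightarrow> (\<integral>y\<in>dc k z. indicator E y) \<le> ennreal (2 ^ DIM('a) * A * dvol TYPE('a) k)"
    "AE x. x \<in> dc k0 x0 \<longrightarrow> x \<notin> (\<Union>(cell ` J)) \<longrightarrow> indicator E x \<le> ennreal A"
    "ennreal A * cvol J \<le> (\<integral>y\<in>dc k0 x0. indicator E y)"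
    by (rule cz_cubes_local[OF im A(1) le], rule that) (assumption | blast)+
   have sJ: "cvol J \<le> ennreal (?V k0 / 2)"
   proof -
    have "ennreal A * cvol J \<le> ennreal (?V k0 / 2 ^ (?n + 2))"
     using J(6) Esmall by (simp add: Ee EQ)
    also have "\<dots> = ennreal A * ennreal (?V k0 / 2)" using A by (subst ennreal_mult[symmetric]) (auto simp: A_def)
    finally show ?thesis using A by (subst (asm) ennreal_mult_le_mult_iff) auto
   qed
   have good: "AE x. x \<in> dc k0 x0 \<longrightarrow> x \<notin> (\<Union>(cell ` J)) \<longrightarrow> (\<forall>i\<le>m. cmod (T (F i) x) \<le> C * a)"
    using J(5)
   proof eventually_elim
    case (elim x)
    show ?case
    proof (intro impI allI)
     fix i assume x: "x \<in> dc k0 x0" "x \<notin> (\<Union>(cell ` J))" and i: "i \<le> m"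
     have "x \<notin> E"
     proof
      assume "x \<in> E"
      then have "1 \<le> ennreal A" using elim x by simp
      then show False using A by simp
     qed
     then have "cmod (T (F i) x) \<le> \<Lambda> * a" using x(1) i by (auto simp: E_def not_less)
     also have "\<dots> \<le> C * a" using C a by (intro mult_right_mono) auto
     finally show "cmod (T (F i) x) \<le> C * a" .
    qed
   qed
   have tail: "AE x. x \<in> dc k z \<longrightarrow> cmod (T (\<lambda>y. F i y * indicator (- trip k z) y) x) \<le> C * a" if kz: "(k, z) \<in> J" and i: "i \<le> m" for k z i
   proof -
    have k0: "k0 < k" "z \<in> dc k0 x0" using J(3)[OF kz] by auto
    have sub: "dc k z \<subseteq> dc k0 x0" using dc_nested[of k0 k z x0] k0 by auto
    have EP: "leb (E \<inter> dc k z) \<le> ennreal (?V k / 2)"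
     using J(4)[OF kz] A by (simp add: Ee)
    let ?G = "\<lambda>y. F i y * indicator (trip k z) y" and ?H = "\<lambda>y. F i y * indicator (- trip k z) y"
    note [measurable] = Fm[OF i]
    have ctm: "- trip k z \<in> sets lebesgue" using trip_lebesgue Compl_in_sets_lebesgue by blast
    have GL: "L2 ?G" by (intro L2_indicator F1 i) simp
    have HL: "L2 ?H" by (intro L2_indicator F1 i ctm)
    have leF: "(\<integral>x. enorm (F i x * indicator S x)) \<le> (\<integral>x. enorm (F i x))" for S
     by (intro nn_integral_mono ennreal_leI) (auto simp: indicator_def)
    have Gf: "(\<integral>x. enorm (?G x)) < \<infinity>" "(\<integral>x. enorm (?H x)) < \<infinity>"
     using leF Ffin[OF i] by (auto intro: le_less_trans)
    have dH: "dmax (\<lambda>y. enorm (?H y)) x \<le> dmax (\<lambda>y. enorm (F i y)) x" for x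
     by (rule dmax_mono) (auto simp: indicator_def)
    have notE: "dmax (\<lambda>y. enorm (F i y)) x \<le> ennreal (N * (\<Lambda> * a))" "cmod (T (F i) x) \<le> \<Lambda> * a" if "x \<in> dc k z" "x \<notin> E" for x
     using that sub i \<Lambda> a N by (auto simp: E_def not_less Ne ennreal_mult)
    define B where "B = {x. cmod (T ?G x) > \<Lambda>2 * a}"
    have Bm: "B \<in> sets lebesgue" unfolding B_def by (rule Collect_less_lebesgue) (use T_measurable[OF GL] in measurable)
    \<comment> \<open>One point outside \<open>E\<close> suffices: since
      \<open>trip k x1 = trip k z\<close>, the maximal function at \<open>x1\<close> bounds the
      average over the whole triple.\<close>
    have BP: "leb B \<le> ennreal (?V k / 4)" if x1: "x1 \<in> dc k z" "x1 \<notin> E" for x1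
    proof -
     have "(\<integral>x. enorm (?G x)) = (\<integral>x\<in>trip k x1. enorm (F i x))"
      unfolding trip_eq[OF x1(1)] by (intro nn_integral_cong) (auto simp: indicator_def)
     also have "\<dots> \<le> dmax (\<lambda>y. enorm (F i y)) x1 * ennreal (?V k)" by (rule dmax_ge)
     also have "\<dots> \<le> ennreal (N * (\<Lambda> * a)) * ennreal (?V k)" by (intro mult_right_mono notE x1) auto
     finally have *: "(\<integral>x. enorm (?G x)) \<le> ennreal (N * (\<Lambda> * a)) * ennreal (?V k)" .
     have "leb B \<le> ennreal (C1 / (\<Lambda>2 * a)) * (\<integral>x. enorm (?G x))"
      unfolding B_def using \<Lambda>2 ap by (intro C1(2) GL Gf) auto
     also have "\<dots> \<le> ennreal (C1 / (\<Lambda>2 * a)) * (ennreal (N * (\<Lambda> * a)) * ennreal (?V k))" by (intro mult_left_mono *) auto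
     also have "\<dots> = ennreal (C1 / (\<Lambda>2 * a) * (N * (\<Lambda> * a) * ?V k))"
      using C1(1) \<Lambda>2 ap N \<Lambda> by (simp add: ennreal_mult[symmetric])
     also have "C1 / (\<Lambda>2 * a) * (N * (\<Lambda> * a) * ?V k) = ?V k / 4"
      unfolding \<Lambda>2_def using C1(1) ap N \<Lambda> by (simp add: field_simps)
     finally show ?thesis .
    qed
    have "AE x. AE x1. x \<in> dc k z \<longrightarrow> x1 \<in> dc k z \<longrightarrow> dmax (\<lambda>y. enorm (?H y)) x1 \<le> ennreal (N * (\<Lambda> * a)) \<longrightarrow>
      cmod (T ?H x) \<le> cmod (T ?H x1) + C2 * (N * (\<Lambda> * a))"
     by (rule C2(2)[of ?H k0 x0]) (use HL Gf F1(2)[OF i] N \<Lambda> a in auto)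
    then show ?thesis
    proof eventually_elim
     case (elim x)
     show ?case
     proof
      assume x: "x \<in> dc k z"
      have eqT: "AE x1. T (F i) x1 = T ?G x1 + T ?H x1"
      proof -
       have "F i = (\<lambda>y. ?G y + ?H y)" by (auto simp: indicator_def fun_eq_iff)
       then show ?thesis using T_add[OF GL HL] by simp
      qed
      have good1: "AE x1. T (F i) x1 = T ?G x1 + T ?H x1 \<and> (x1 \<in> dc k z \<longrightarrow> dmax (\<lambda>y. enorm (?H y)) x1 \<le> ennreal (N * (\<Lambda> * a)) \<longrightarrow>
        cmod (T ?H x) \<le> cmod (T ?H x1) + C2 * (N * (\<Lambda> * a)))"
       using eqT elim by eventually_elim (use x in auto)
      have "\<exists>x1\<in>dc k z. x1 \<notin> E \<and> x1 \<notin> B \<and> (T (F i) x1 = T ?G x1 + T ?H x1 \<and> (x1 \<in> dc k z \<longrightarrow> dmax (\<lambda>y. enorm (?H y)) x1 \<le> ennreal (N * (\<Lambda> * a)) \<longrightarrow>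
        cmod (T ?H x) \<le> cmod (T ?H x1) + C2 * (N * (\<Lambda> * a))))"
      proof (rule ccontr)
       assume no: "\<not> ?thesis"
       have "AE x1. x1 \<in> dc k z \<longrightarrow> x1 \<in> (E \<inter> dc k z) \<union> B"
        using good1 by eventually_elim (use no in blast)
       then have "leb (dc k z) \<le> leb ((E \<inter> dc k z) \<union> B)"
        by (rule emeasure_mono_AE) (use Bm in measurable)
       also have "\<dots> \<le> leb (E \<inter> dc k z) + leb B"
        by (rule emeasure_subadditive) (use Bm in measurable)
       finally have 1: "leb (dc k z) \<le> leb (E \<inter> dc k z) + leb B" .
       \<comment> \<open>Some point outside \<open>E\<close> is needed before \<open>BP\<close> can
         be used; then the fractions 1/2 and 1/4 do not add up to the full cell.\<close>
       have "\<exists>x1\<in>dc k z. x1 \<notin> E"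
       proof (rule ccontr)
        assume "\<not> ?thesis"
        then have "E \<inter> dc k z = dc k z" by auto
        then have "ennreal (?V k) \<le> ennreal (?V k / 2)" using EP emeasure_dc[of k z] by simp
        then show False using dvol_pos(1)[of "TYPE('a)" k] by simp
       qed
       then have "leb B \<le> ennreal (?V k / 4)" using BP by blast
       then have "ennreal (?V k) \<le> ennreal (?V k / 2) + ennreal (?V k / 4)"
        using order_trans[OF 1 add_mono[OF EP]] emeasure_dc[of k z] by simp
       also have "\<dots> = ennreal (?V k / 2 + ?V k / 4)" by (rule ennreal_plus[symmetric]) auto
       finally show False using dvol_pos(1)[of "TYPE('a)" k] by (subst (asm) ennreal_le_iff) auto
      qed
      then obtain x1 where x1: "x1 \<in> dc k z" "x1 \<notin> E" "x1 \<notin> B" "T (F i) x1 = T ?G x1 + T ?H x1"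
       "dmax (\<lambda>y. enorm (?H y)) x1 \<le> ennreal (N * (\<Lambda> * a)) \<longrightarrow> cmod (T ?H x) \<le> cmod (T ?H x1) + C2 * (N * (\<Lambda> * a))"
       by blast
      have "cmod (T ?H x) \<le> cmod (T ?H x1) + C2 * (N * (\<Lambda> * a))"
       using x1(5) order_trans[OF dH notE(1)[OF x1(1,2)]] by blast
      also have "cmod (T ?H x1) \<le> cmod (T (F i) x1) + cmod (T ?G x1)"
       using x1(4) norm_triangle_ineq4[of "T (F i) x1" "T ?G x1"] by simp
      also have "\<dots> \<le> \<Lambda> * a + \<Lambda>2 * a" using notE(2)[OF x1(1,2)] x1(3) by (intro add_mono) (auto simp: B_def)
      finally have "cmod (T ?H x) \<le> (\<Lambda> + \<Lambda>2 + C2 * (N * \<Lambda>)) * a" by (simp add: algebra_simps)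
      also have "\<dots> \<le> C * a" using C a by (intro mult_right_mono) auto
      finally show "cmod (T ?H x) \<le> C * a" .
     qed
    qed
   qed
   have tail2: "AE x. x \<in> dc k z \<longrightarrow> (\<forall>i\<le>m. cmod (T (\<lambda>y. F i y * indicator (- trip k z) y) x) \<le> C * a)" if kz: "(k, z) \<in> J" for k z
   proof -
    have "AE x. \<forall>i\<in>{..m}. x \<in> dc k z \<longrightarrow> cmod (T (\<lambda>y. F i y * indicator (- trip k z) y) x) \<le> C * a"
     by (subst AE_ball_countable) (use tail[OF kz] in auto)
    then show ?thesis by eventually_elim auto
   qed
   show ?thesis
   proof (rule exI[of _ J], intro conjI J(1,2) sJ good)
    show "\<forall>(k, z)\<in>J. k0 < k \<and> z \<in> dc k0 x0" using J(3) by blast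
    show "\<forall>(k, z)\<in>J. AE x. x \<in> dc k z \<longrightarrow> (\<forall>i\<le>m. cmod (T (\<lambda>y. F i y * indicator (- trip k z) y) x) \<le> C * a)"
     using tail2 by blast
   qed
  qed
 qed
 note main = this
 show ?thesis
  by (rule exI[of _ C], intro conjI allI impI main) (use C in auto)
qed

end

section \<open>Sparse domination in integrated form\<close>

text \<open>The sets \<open>Z N\<close> for different \<open>N\<close> are unrelated, so there is no
  monotone limit. Their measures are summable, hence almost every point leaves them eventually, and
  Fatou's lemma applies.\<close>

lemma limit_exhaustion:
 assumes h [measurable]: "lm h" and Q [measurable]: "Q \<in> sets lebesgue"
  and Z: "\<And>N. Z N \<in> sets lebesgue" "\<And>N. leb (Z N) \<le> ennreal ((1/2) ^ N * v)" "v \<ge> 0"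
  and le: "\<And>N. (\<integral>x\<in>Q - Z N. h x) \<le> B"
 shows "(\<integral>x\<in>Q. h x) \<le> B"
proof -
 note [measurable] = Z(1)
 have m: "measure lebesgue (Z N) \<le> (1/2) ^ N * v" for N
  using Z(2)[of N] Z(3) by (simp add: measure_def enn2real_leI)
 have "AE x. eventually (\<lambda>N. x \<in> space lebesgue - Z N) sequentially"
 proof (rule borel_cantelli_AE1)
  show "leb (Z N) < \<infinity>" for N using Z(2)[of N] by (auto intro: le_less_trans)
  show "summable (\<lambda>N. measure lebesgue (Z N))"
   by (rule summable_comparison_test_ev[where g="\<lambda>N. (1/2) ^ N * v"])
    (use m in \<open>auto intro!: summable_mult2 summable_geometric\<close>)
 qed (rule Z(1))
 then have "AE x. h x * indicator Q x \<le> liminf (\<lambda>N. h x * indicator (Q - Z N) x)"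
 proof eventually_elim
  case (elim x)
  then have "eventually (\<lambda>N. h x * indicator Q x \<le> h x * indicator (Q - Z N) x) sequentially"
   by eventually_elim (auto simp: indicator_def)
  then show ?case by (rule Liminf_bounded)
 qed
 then have "(\<integral>x\<in>Q. h x) \<le> (\<integral>x. liminf (\<lambda>N. h x * indicator (Q - Z N) x))"
  by (rule nn_integral_mono_AE)
 also have "\<dots> \<le> liminf (\<lambda>N. \<integral>\<^sup>+x\<in>Q - Z N. h x \<partial>lebesgue)"
  by (rule nn_integral_liminf) measurable
 also have "\<dots> \<le> B"
 proof (rule order_trans)
  show "liminf (\<lambda>N. \<integral>\<^sup>+x\<in>Q - Z N. h x \<partial>lebesgue) \<le> limsup (\<lambda>N. \<integral>\<^sup>+x\<in>Q - Z N. h x \<partial>lebesgue)"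
   by (rule Liminf_le_Limsup) simp
  show "limsup (\<lambda>N. \<integral>\<^sup>+x\<in>Q - Z N. h x \<partial>lebesgue) \<le> B"
   by (rule Limsup_bounded) (use le in auto)
 qed
 finally show ?thesis .
qed

lemma ennreal_divide_mult_cancel: "c > 0 \<Longrightarrow> c < top \<Longrightarrow> a / c * c = (a::ennreal)"
 by (simp add: ennreal_divide_times ennreal_times_divide mult_divide_eq_ennreal)

lemma measurable_nn_integral_count_space:
 fixes f :: "'i \<Rightarrow> 'a \<Rightarrow> ennreal"
 assumes "countable J" "\<And>j. f j \<in> borel_measurable M"
 shows "(\<lambda>y. \<integral>\<^sup>+j. f j y \<partial>count_space J) \<in> borel_measurable M"
proof (cases "finite J")
 case True
 then show ?thesis using assms(2) by (simp add: nn_integral_count_space_finite)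
next
 case False
 then have bij: "bij_betw (from_nat_into J) UNIV J" using assms(1) by (rule bij_betw_from_nat_into[rotated])
 have "(\<Sum>\<^sup>+j\<in>J. f j y) = (\<Sum>n. f (from_nat_into J n) y)" for y
  by (subst nn_integral_bij_count_space[OF bij, symmetric]) (rule nn_integral_count_space_nat)
 then show ?thesis using assms(2) by simp
qed

definition bw :: "nat \<Rightarrow> ('a \<Rightarrow> real) \<Rightarrow> real \<Rightarrow> 'a \<Rightarrow> real" where
 "bw m b c y = (1 + \<bar>b y - c\<bar>) ^ m"

lemma bw_pos: "bw m b c y \<ge> 0" by (simp add: bw_def)
lemma bw_measurable [measurable]: "b \<in> borel_measurable M \<Longrightarrow> bw m b c \<in> borel_measurable M"
 unfolding bw_def[abs_def]
 by (intro borel_measurable_power borel_measurable_add borel_measurable_abs borel_measurable_diff borel_measurable_const)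

text \<open>An integral, not yet divided by a volume; the division takes place where an average is
  meant.\<close>

abbreviation bmean :: "nat \<Rightarrow> ('a::euclidean_space \<Rightarrow> real) \<Rightarrow> (int \<Rightarrow> 'a \<Rightarrow> real) \<Rightarrow> int \<Rightarrow> 'a \<Rightarrow> ('a \<Rightarrow> ennreal) \<Rightarrow> ennreal" where
 "bmean m b c k x f \<equiv> \<integral>y\<in>trip k x. ennreal (bw m b (c k x) y) * f y"

abbreviation finite_means :: "nat \<Rightarrow> ('a::euclidean_space \<Rightarrow> real) \<Rightarrow> (int \<Rightarrow> 'a \<Rightarrow> real) \<Rightarrow> ('a \<Rightarrow> complex) \<Rightarrow> bool" where
 "finite_means m b c F \<equiv> \<forall>k x. (bmean m b c k x (\<lambda>y. enorm (F y))) < \<infinity>"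

context czo
begin

abbreviation reduction_cells :: "nat \<Rightarrow> ('a \<Rightarrow> real) \<Rightarrow> real \<Rightarrow> int \<Rightarrow> 'a \<Rightarrow> ('a \<Rightarrow> complex) \<Rightarrow> real \<Rightarrow> (int \<times> 'a) set \<Rightarrow> bool" where
 "reduction_cells m b c k0 x0 F L J \<equiv> sparse_cells k0 x0 J \<and>
   (AE x. x \<in> dc k0 x0 \<longrightarrow> x \<notin> (\<Union>(cell ` J)) \<longrightarrow>
     cmod (commutator T b m (\<lambda>y. F y * indicator (trip k0 x0) y) x) \<le> L * bw m b c x) \<and>
   (\<forall>(k, z)\<in>J. AE x. x \<in> dc k z \<longrightarrow>
     cmod (commutator T b m (\<lambda>y. F y * indicator (trip k0 x0) y) x)
     \<le> L * bw m b c x + cmod (commutator T b m (\<lambda>y. F y * indicator (trip k z) y) x))"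

text \<open>\<open>stopping_step\<close> for the functions \<open>(b - c)^i F\<close> cut to the
  triple, \<open>i \<le> m\<close>: their L1 norms are all below the weighted integral in the
  hypothesis. \<open>comm_shift\<close> and \<open>comm_bound\<close> translate the bounds for
  \<open>T\<close> into bounds for the commutator.\<close>

lemma sparse_step:
 "\<exists>C>0. \<forall>b F k0 x0 c a. lm b \<longrightarrow> adm b F \<longrightarrow> a \<ge> 0 \<longrightarrow>
  (\<integral>y\<in>trip k0 x0. ennreal (bw m b c y) * enorm (F y)) \<le> ennreal (a * dvol TYPE('a) k0) \<longrightarrow>
  (\<exists>J. reduction_cells m b c k0 x0 F (C * a) J)"
proof -
 let ?V = "dvol TYPE('a)"
 obtain C where C: "C > 0" "\<And>k0 x0 F a. (\<forall>i\<le>m. L2 (F i) \<and> (\<forall>y. y \<notin> trip k0 x0 \<longrightarrow> F i y = 0) \<and>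
    (\<integral>x. enorm (F i x)) \<le> ennreal (a * ?V k0)) \<Longrightarrow> a \<ge> 0 \<Longrightarrow>
  (\<exists>J. stopping_cells m k0 x0 F (C * a) J)"
  using stopping_step[of m] by blast
 have "\<exists>J. reduction_cells m b c k0 x0 F (C * a) J"
  if b [measurable]: "lm b" and F: "adm b F" and a: "a \<ge> 0"
   and le: "(\<integral>y\<in>trip k0 x0. ennreal (bw m b c y) * enorm (F y)) \<le> ennreal (a * ?V k0)" for b F k0 x0 c a
 proof -
  let ?G = "\<lambda>y. F y * indicator (trip k0 x0) y"
  let ?b = "\<lambda>y. b y - c"
  have G: "adm b ?G" using F by (rule adm_indicator) simp
  have G': "adm ?b ?G" using G by (rule adm_shift)
  define Fi where "Fi i y = of_real (?b y) ^ i * ?G y" for i :: nat and y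
  have 1: "\<forall>i\<le>m. L2 (Fi i) \<and> (\<forall>y. y \<notin> trip k0 x0 \<longrightarrow> Fi i y = 0) \<and>
    (\<integral>x. enorm (Fi i x)) \<le> ennreal (a * ?V k0)"
  proof (intro allI impI conjI)
   fix i assume i: "i \<le> m"
   show "L2 (Fi i)" unfolding Fi_def by (rule admD[OF G'])
   show "Fi i y = 0" if "y \<notin> trip k0 x0" for y using that by (simp add: Fi_def)
   have "(\<integral>x. enorm (Fi i x)) \<le> (\<integral>y\<in>trip k0 x0. ennreal (bw m b c y) * enorm (F y))"
   proof (rule nn_integral_mono)
    fix y
    have "\<bar>?b y\<bar> ^ i \<le> (1 + \<bar>?b y\<bar>) ^ i" by (intro power_mono) auto
    also have "\<dots> \<le> (1 + \<bar>?b y\<bar>) ^ m" using i by (intro power_increasing) auto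
    finally have "\<bar>?b y\<bar> ^ i * cmod (F y) \<le> bw m b c y * cmod (F y)" unfolding bw_def by (intro mult_right_mono) auto
    moreover have "cmod (Fi i y) = \<bar>?b y\<bar> ^ i * cmod (F y) * indicator (trip k0 x0) y"
     by (auto simp: Fi_def norm_mult norm_power indicator_def simp flip: of_real_diff)
    ultimately show "enorm (Fi i y) \<le> ennreal (bw m b c y) * enorm (F y) * indicator (trip k0 x0) y"
     by (auto simp: indicator_def ennreal_mult[symmetric] bw_pos ennreal_leI)
   qed
   also note le
   finally show "(\<integral>x. enorm (Fi i x)) \<le> ennreal (a * ?V k0)" .
  qed
  obtain J :: "(int \<times> 'a) set" where J: "countable J" "disjoint_family_on cell J" "\<forall>(k, z)\<in>J. k0 < k \<and> z \<in> dc k0 x0"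
   "cvol J \<le> ennreal (?V k0 / 2)"
   "AE x. x \<in> dc k0 x0 \<longrightarrow> x \<notin> (\<Union>(cell ` J)) \<longrightarrow> (\<forall>i\<le>m. cmod (T (Fi i) x) \<le> C * a)"
   "\<forall>(k, z)\<in>J. AE x. x \<in> dc k z \<longrightarrow> (\<forall>i\<le>m. cmod (T (\<lambda>y. Fi i y * indicator (- trip k z) y) x) \<le> C * a)"
   using C(2)[of Fi k0 x0 a, OF 1 a] by blast
  have A: "AE x. x \<in> dc k0 x0 \<longrightarrow> x \<notin> (\<Union>(cell ` J)) \<longrightarrow> cmod (commutator T b m ?G x) \<le> C * a * bw m b c x"
   using J(5) comm_shift[OF G, of c m]
  proof eventually_elim
   case (elim x)
   show ?case
   proof (intro impI)
    assume "x \<in> dc k0 x0" "x \<notin> (\<Union>(cell ` J))"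
    then have "\<And>i. i \<le> m \<Longrightarrow> cmod (T (\<lambda>y. of_real (?b y) ^ i * ?G y) x) \<le> C * a"
     using elim(1) unfolding Fi_def[abs_def] by blast
    from comm_bound[of m ?b ?G x, OF this] show "cmod (commutator T b m ?G x) \<le> C * a * bw m b c x"
     using elim(2) by (simp add: bw_def mult.commute)
   qed
  qed
  have B: "AE x. x \<in> dc k z \<longrightarrow> cmod (commutator T b m ?G x)
     \<le> C * a * bw m b c x + cmod (commutator T b m (\<lambda>y. F y * indicator (trip k z) y) x)" if kz: "(k, z) \<in> J" for k z
  proof -
   have k: "k0 < k" "z \<in> dc k0 x0" using J(3) kz by auto
   have sub: "trip k z \<subseteq> trip k0 x0" using trip_dc_mono[of k0 k z x0] k by simp
   let ?G1 = "\<lambda>y. F y * indicator (trip k z) y" and ?G2 = "\<lambda>y. ?G y * indicator (- trip k z) y"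
   have ctm: "- trip k z \<in> sets lebesgue" using trip_lebesgue Compl_in_sets_lebesgue by blast
   have G1: "adm b ?G1" using F by (rule adm_indicator) simp
   have G2: "adm b ?G2" using G ctm by (rule adm_indicator)
   have "?G = (\<lambda>y. ?G1 y + ?G2 y)" using sub by (auto simp: indicator_def fun_eq_iff)
   then have sum: "AE x. commutator T b m ?G x = commutator T b m ?G1 x + commutator T b m ?G2 x"
    using comm_add[OF G1 G2, of m] by simp
   have "AE x. x \<in> dc k z \<longrightarrow> (\<forall>i\<le>m. cmod (T (\<lambda>y. Fi i y * indicator (- trip k z) y) x) \<le> C * a)"
    using J(6) kz by blast
   then show ?thesis using sum comm_shift[OF G2, of c m]
   proof eventually_elim
    case (elim x)
    show ?case
    proof
     assume "x \<in> dc k z"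
     then have "\<And>i. i \<le> m \<Longrightarrow> cmod (T (\<lambda>y. of_real (?b y) ^ i * ?G2 y) x) \<le> C * a"
      using elim(1) unfolding Fi_def[abs_def] by (simp only: mult.assoc)
     from comm_bound[of m ?b ?G2 x, OF this] have "cmod (commutator T b m ?G2 x) \<le> C * a * bw m b c x"
      using elim(3) by (simp add: bw_def mult.commute)
     then show "cmod (commutator T b m ?G x) \<le> C * a * bw m b c x + cmod (commutator T b m ?G1 x)"
      unfolding elim(2) using norm_triangle_ineq[of "commutator T b m ?G1 x" "commutator T b m ?G2 x"] by linarith
    qed
   qed
  qed
  show ?thesis
  proof (rule exI[of _ J], intro conjI J(1-4) A)
   show "\<forall>(k, z)\<in>J. AE x. x \<in> dc k z \<longrightarrow>
     cmod (commutator T b m ?G x) \<le> C * a * bw m b c x + cmod (commutator T b m (\<lambda>y. F y * indicator (trip k z) y) x)"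
    using B by blast
  qed
 qed
 note main = this
 show ?thesis by (rule exI[of _ C], intro conjI allI impI main C(1))
qed

abbreviation exhaustion_estimate :: "nat \<Rightarrow> real \<Rightarrow> bool" where
 "exhaustion_estimate m C \<equiv> (\<forall>b F G Y c N. lm b \<longrightarrow> adm b F \<longrightarrow> lm G \<longrightarrow> lm Y \<longrightarrow>
  finite_means m b c F \<longrightarrow>
  (\<forall>k x y. y \<in> dc k x \<longrightarrow> (bmean m b c k x (\<lambda>y. enorm (F y))) / ennreal (dvol TYPE('a) k)
     * ((\<integral>y\<in>dc k x. ennreal (bw m b (c k x) y) * G y) / ennreal (dvol TYPE('a) k)) \<le> Y y) \<longrightarrow>
  (\<forall>k x. \<exists>Z. Z \<in> sets lebesgue \<and> Z \<subseteq> dc k x \<and> leb Z \<le> ennreal ((1/2) ^ N * dvol TYPE('a) k) \<and>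
   (\<integral>y\<in>dc k x - Z. enorm (commutator T b m (\<lambda>y. F y * indicator (trip k x) y) y) * G y)
   \<le> ennreal C * (\<integral>y\<in>dc k x - Z. Y y)))"

text \<open>The cost of a cell is charged to the integral of \<open>Y\<close> over the part of the
  cell outside its stopping cells, which is at least half of it. These parts are disjoint over all
  generations, so the constant does not grow with \<open>N\<close>, while the unfinished set
  \<open>Z\<close> halves each time.\<close>

lemma sparse_iteration:
 "\<exists>C>0. exhaustion_estimate m C"
proof -
 let ?V = "dvol TYPE('a)"
 obtain C where C: "C > 0" "\<And>b F kk xx c a. lm b \<Longrightarrow> adm b F \<Longrightarrow> a \<ge> 0 \<Longrightarrow>
  (\<integral>y\<in>trip kk xx. ennreal (bw m b c y) * enorm (F y)) \<le> ennreal (a * ?V kk) \<Longrightarrow>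
  (\<exists>J. reduction_cells m b c kk xx F (C * a) J)"
  using sparse_step[of m] by blast
 have "\<exists>Z. Z \<in> sets lebesgue \<and> Z \<subseteq> dc k x \<and> leb Z \<le> ennreal ((1/2) ^ N * ?V k) \<and>
   (\<integral>y\<in>dc k x - Z. enorm (commutator T b m (\<lambda>y. F y * indicator (trip k x) y) y) * G y)
   \<le> ennreal (2 * C) * (\<integral>y\<in>dc k x - Z. Y y)"
  if b [measurable]: "lm b" and F: "adm b F"
   and G [measurable]: "lm G" and Y [measurable]: "lm Y"
   and fin: "finite_means m b c F"
   and YY: "\<forall>k x y. y \<in> dc k x \<longrightarrow> (bmean m b c k x (\<lambda>y. enorm (F y))) / ennreal (?V k)
     * ((\<integral>y\<in>dc k x. ennreal (bw m b (c k x) y) * G y) / ennreal (?V k)) \<le> Y y"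
  for b F G Y c N k x
 proof (induction N arbitrary: k x)
  case 0
  show ?case by (intro exI[of _ "dc k x"]) (use emeasure_dc[of k x] in auto)
 next
  case (Suc N)
  let ?co = "\<lambda>k z y. enorm (commutator T b m (\<lambda>y. F y * indicator (trip k z) y) y)"
  have com [measurable]: "?co k z \<in> borel_measurable lebesgue" for k z
   using comm_measurable[OF adm_indicator[OF F trip_lebesgue] b] by measurable
  define P where "P k x Z \<longleftrightarrow> Z \<in> sets lebesgue \<and> Z \<subseteq> dc k x \<and> leb Z \<le> ennreal ((1/2) ^ N * ?V k) \<and>
   (\<integral>y\<in>dc k x - Z. ?co k x y * G y) \<le> ennreal (2 * C) * (\<integral>y\<in>dc k x - Z. Y y)" for k x Z
  define Z where "Z k x = (SOME Z. P k x Z)" for k x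
  have "P k x (Z k x)" for k x
   unfolding Z_def by (rule someI_ex) (use Suc.IH in \<open>simp add: P_def\<close>)
  then have Z: "\<And>k x. Z k x \<in> sets lebesgue" "\<And>k x. Z k x \<subseteq> dc k x" "\<And>k x. leb (Z k x) \<le> ennreal ((1/2) ^ N * ?V k)"
   "\<And>k x. (\<integral>y\<in>dc k x - Z k x. ?co k x y * G y) \<le> ennreal (2 * C) * (\<integral>y\<in>dc k x - Z k x. Y y)"
   unfolding P_def by blast+
  let ?I = "\<integral>\<^sup>+y\<in>trip k x. ennreal (bw m b (c k x) y) * enorm (F y) \<partial>lebesgue"
  have "?I < \<infinity>" using fin by blast
  then obtain r where r: "?I = ennreal r" "r \<ge> 0" by (cases ?I) auto
  define a where "a = r / ?V k"
  have a: "a \<ge> 0" "?I = ennreal (a * ?V k)" using r by (auto simp: a_def)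
  obtain J :: "(int \<times> 'a) set" where J: "countable J" "disjoint_family_on cell J" "\<forall>(k', z)\<in>J. k < k' \<and> z \<in> dc k x"
   "cvol J \<le> ennreal (?V k / 2)"
   "AE y. y \<in> dc k x \<longrightarrow> y \<notin> (\<Union>(cell ` J)) \<longrightarrow>
     cmod (commutator T b m (\<lambda>y. F y * indicator (trip k x) y) y) \<le> C * a * bw m b (c k x) y"
   "\<forall>(k', z)\<in>J. AE y. y \<in> dc k' z \<longrightarrow>
     cmod (commutator T b m (\<lambda>y. F y * indicator (trip k x) y) y)
     \<le> C * a * bw m b (c k x) y + cmod (commutator T b m (\<lambda>y. F y * indicator (trip k' z) y) y)"
   using C(2)[OF b F a(1), where kk=k and xx=x and c="c k x"] a(2) by (simp only: order_refl) blast
  let ?U = "(\<Union>(cell ` J)) :: 'a set"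
  let ?Z = "\<Union>j\<in>J. case j of (k, z) \<Rightarrow> Z k z"
  let ?g = "\<lambda>j y. case j of (k, z) \<Rightarrow> ?co k z y * G y * indicator (dc k z - Z k z) y"
  let ?S = "\<lambda>j. case j of (k, z) \<Rightarrow> dc k z - Z k z"
  have Zs: "(case j of (k, z) \<Rightarrow> Z k z) \<in> sets lebesgue" for j by (cases j) (simp add: Z)
  have Ss: "?S j \<in> sets lebesgue" for j by (cases j) (simp add: Z sets.Diff)
  have Um [measurable]: "?U \<in> sets lebesgue" by (rule J_union_sets[OF J(1)])
  have Zm [measurable]: "?Z \<in> sets lebesgue" using J(1) Zs by (intro sets.countable_UN'') auto
  have USm [measurable]: "(\<Union>j\<in>J. ?S j) \<in> sets lebesgue" using J(1) Ss by (intro sets.countable_UN'') auto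
  have subQ: "dc k' z \<subseteq> dc k x" if "(k', z) \<in> J" for k' z
   using bspec[OF J(3) that] dc_nested[of k k' z x] by simp
  have Sdisj: "disjoint_family_on ?S J" using J(2) unfolding disjoint_family_on_def by (fastforce split: prod.splits)
  have US: "(\<Union>j\<in>J. ?S j) = ?U - ?Z"
  proof
   show "(\<Union>j\<in>J. ?S j) \<subseteq> ?U - ?Z"
   proof
    fix y assume "y \<in> (\<Union>j\<in>J. ?S j)"
    then obtain k' z where kz: "(k', z) \<in> J" "y \<in> dc k' z" "y \<notin> Z k' z" by auto
    have "y \<notin> Z k2 z2" if "(k2, z2) \<in> J" for k2 z2
    proof (cases "(k2, z2) = (k', z)")
     case False
     then have "dc k2 z2 \<inter> dc k' z = {}" using J(2) kz(1) that unfolding disjoint_family_on_def by fastforce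
     then show ?thesis using kz(2) Z(2)[of k2 z2] by blast
    qed (use kz in simp)
    then show "y \<in> ?U - ?Z" using kz by auto
   qed
   show "?U - ?Z \<subseteq> (\<Union>j\<in>J. ?S j)" by fastforce
  qed
  have Zsub: "?Z \<subseteq> ?U" using Z(2) by fastforce
  have UQ: "?U \<subseteq> dc k x" using subQ by auto
  define R where "R = dc k x - ?U"
  have Rm [measurable]: "R \<in> sets lebesgue" unfolding R_def by (intro sets.Diff Um) simp
  have split: "dc k x - ?Z = R \<union> (\<Union>j\<in>J. ?S j)" unfolding US R_def using Zsub UQ by blast
  have Rdisj: "R \<inter> (\<Union>j\<in>J. ?S j) = {}" unfolding US R_def by blast
  have eU: "leb ?U \<le> ennreal (?V k / 2)"
  proof -
   have "leb ?U \<le> (\<Sum>\<^sup>+j\<in>J. leb (cell j))"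
    by (rule emeasure_UN_le_count_space[OF J(1) countable_J_sets])
   also have "\<dots> = cvol J"
   proof (rule nn_integral_cong)
    fix j :: "int \<times> 'a"
    show "leb (cell j) = (case j of (k, z) \<Rightarrow> ennreal (?V k))"
     by (cases j) (simp only: prod.case emeasure_dc)
   qed
   finally show ?thesis using J(4) by (rule order_trans)
  qed
  have eR: "ennreal (?V k) \<le> 2 * leb R"
  proof -
   have "ennreal (?V k) \<le> leb R + leb ?U"
   proof -
    have "dc k x = R \<union> ?U" using UQ by (auto simp: R_def)
    then show ?thesis using emeasure_subadditive[OF Rm Um] emeasure_dc[of k x] by simp
   qed
   also have "\<dots> \<le> leb R + ennreal (?V k / 2)" by (intro add_left_mono eU)
   finally have *: "ennreal (?V k) \<le> leb R + ennreal (?V k / 2)" .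
   have "leb R \<le> ennreal (?V k)"
    using emeasure_mono[of R "dc k x" lebesgue] emeasure_dc[of k x] by (simp add: R_def)
   then obtain s where s: "leb R = ennreal s" "s \<ge> 0" by (cases "leb R") (auto simp: top_unique)
   then have "?V k \<le> s + ?V k / 2" using * by (simp add: ennreal_plus[symmetric] del: ennreal_plus)
   then have "?V k \<le> 2 * s" by simp
   then show ?thesis using s by (metis ennreal_leI ennreal_mult' ennreal_numeral zero_le_numeral)
  qed
  let ?B = "\<lambda>y. ennreal (bw m b (c k x) y) * G y"
  have main: "(\<integral>y\<in>dc k x. ?B y) * ennreal (C * a) \<le> ennreal (2 * C) * (\<integral>y\<in>R. Y y)"
  proof -
   \<comment> \<open>The product of the two averages for the present cell. It is a constant below
     \<open>Y\<close> on the whole cell, so it may be integrated over \<open>R\<close>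
     alone.\<close>
   define \<kappa> where "\<kappa> = ennreal a * ((\<integral>y\<in>dc k x. ?B y) / ennreal (?V k))"
   have \<kappa>Y: "\<kappa> \<le> Y y" if "y \<in> dc k x" for y
   proof -
    have "ennreal a = ?I / ennreal (?V k)" using r by (simp add: a_def divide_ennreal)
    then show ?thesis using YY that unfolding \<kappa>_def by auto
   qed
   have "(\<integral>y\<in>dc k x. ?B y) * ennreal (C * a) = ennreal C * (\<kappa> * ennreal (?V k))"
   proof -
    let ?X = "\<integral>\<^sup>+y\<in>dc k x. ?B y \<partial>lebesgue"
    have "\<kappa> * ennreal (?V k) = ennreal a * (?X / ennreal (?V k) * ennreal (?V k))"
     unfolding \<kappa>_def by (simp only: mult.assoc)
    also have "?X / ennreal (?V k) * ennreal (?V k) = ?X"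
     by (rule ennreal_divide_mult_cancel) auto
    finally show ?thesis using C(1) a(1) by (simp add: ennreal_mult mult_ac)
   qed
   also have "\<dots> \<le> ennreal C * (\<kappa> * (2 * leb R))" by (intro mult_left_mono eR) auto
   also have "\<dots> = ennreal (2 * C) * (\<integral>y\<in>R. \<kappa>)"
   proof -
    have "(\<integral>y\<in>R. \<kappa>) = \<kappa> * leb R" by (rule nn_integral_cmult_indicator[OF Rm])
    then show ?thesis using C(1) by (simp add: ennreal_mult mult_ac)
   qed
   also have "\<dots> \<le> ennreal (2 * C) * (\<integral>y\<in>R. Y y)"
    by (intro mult_left_mono nn_integral_mono) (use \<kappa>Y in \<open>auto simp: R_def indicator_def\<close>)
   finally show ?thesis .
  qed
  have pt: "AE y. ?co k x y * G y * indicator (dc k x - ?Z) y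
   \<le> ennreal (C * a) * (?B y * indicator (dc k x) y) + (\<Sum>\<^sup>+j\<in>J. (?g j y))"
  proof -
   have "AE y. \<forall>j\<in>J. case j of (k', z) \<Rightarrow> y \<in> dc k' z \<longrightarrow>
     cmod (commutator T b m (\<lambda>y. F y * indicator (trip k x) y) y)
     \<le> C * a * bw m b (c k x) y + cmod (commutator T b m (\<lambda>y. F y * indicator (trip k' z) y) y)"
    unfolding AE_ball_countable[OF J(1)] using J(6) by (auto split: prod.splits)
   then show ?thesis using J(5)
   proof eventually_elim
    case (elim y)
    let ?c = "C * a * bw m b (c k x) y"
    have c0: "?c \<ge> 0" using C a by (simp add: bw_pos)
    have ce: "ennreal ?c = ennreal (C * a) * ennreal (bw m b (c k x) y)" using C a by (simp add: ennreal_mult bw_pos)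
    show ?case
    proof (cases "y \<in> dc k x - ?Z")
     case True
     show ?thesis
     proof (cases "y \<in> ?U")
      case False
      then have "cmod (commutator T b m (\<lambda>y. F y * indicator (trip k x) y) y) \<le> ?c" using elim(2) True by blast
      then have "?co k x y \<le> ennreal ?c" by (rule ennreal_leI)
      then have "?co k x y * G y \<le> ennreal ?c * G y" by (rule mult_right_mono) simp
      also have "\<dots> = ennreal (C * a) * (?B y * indicator (dc k x) y)" using True unfolding ce by (simp add: mult_ac)
      also have "\<dots> \<le> ennreal (C * a) * (?B y * indicator (dc k x) y) + (\<Sum>\<^sup>+j\<in>J. (?g j y))"
       by (rule add_increasing2) auto
      finally show ?thesis using True by simp
     next
      case yU: True
      then obtain k' z where kz: "(k', z) \<in> J" "y \<in> dc k' z" by blast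
      have nZ: "y \<notin> Z k' z" using True kz by auto
      have "cmod (commutator T b m (\<lambda>y. F y * indicator (trip k x) y) y)
        \<le> ?c + cmod (commutator T b m (\<lambda>y. F y * indicator (trip k' z) y) y)"
       using elim(1) kz by auto
      then have "?co k x y \<le> ennreal (?c + cmod (commutator T b m (\<lambda>y. F y * indicator (trip k' z) y) y))" by (rule ennreal_leI)
      also have "\<dots> = ennreal ?c + ?co k' z y" using c0 by (intro ennreal_plus) auto
      finally have "?co k x y * G y \<le> (ennreal ?c + ?co k' z y) * G y" by (rule mult_right_mono) simp
      also have "\<dots> = ennreal (C * a) * (?B y * indicator (dc k x) y) + ?co k' z y * G y * indicator (dc k' z - Z k' z) y"
       using True kz nZ unfolding ce by (simp add: distrib_left mult_ac)
      also have "?co k' z y * G y * indicator (dc k' z - Z k' z) y \<le> (\<Sum>\<^sup>+j\<in>J. (?g j y))"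
       using nn_integral_ge_point[OF kz(1), of "\<lambda>j. (?g j y)"] by simp
      finally have "?co k x y * G y \<le> ennreal (C * a) * (?B y * indicator (dc k x) y) + (\<Sum>\<^sup>+j\<in>J. (?g j y))"
       by (simp add: add_left_mono)
      then show ?thesis using True by simp
     qed
    qed simp
   qed
  qed
  have "(\<integral>y\<in>dc k x - ?Z. ?co k x y * G y) \<le> (\<integral>y. ennreal (C * a) * (?B y * indicator (dc k x) y) + (\<Sum>\<^sup>+j\<in>J. (?g j y)))"
   by (rule nn_integral_mono_AE[OF pt])
  also have "\<dots> = (\<integral>y. ennreal (C * a) * (?B y * indicator (dc k x) y)) + (\<integral>y. (\<Sum>\<^sup>+j\<in>J. (?g j y)))"
  proof (rule nn_integral_add)
   show "lm (\<lambda>y. \<integral>\<^sup>+j. (?g j y) \<partial>count_space J)"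
   proof (rule measurable_nn_integral_count_space[OF J(1)])
    fix j :: "int \<times> 'a"
    obtain k z where j: "j = (k, z)" by (cases j)
    have [measurable]: "dc k z - Z k z \<in> sets lebesgue" using Ss[of j] j by simp
    show "lm (\<lambda>y. case j of (k, z) \<Rightarrow> ?co k z y * G y * indicator (dc k z - Z k z) y)"
     unfolding j prod.case by measurable
   qed
  qed measurable
  also have "(\<integral>y. ennreal (C * a) * (?B y * indicator (dc k x) y)) = ennreal (C * a) * (\<integral>y\<in>dc k x. ?B y)"
   by (rule nn_integral_cmult) measurable
  also have "(\<integral>y. (\<Sum>\<^sup>+j\<in>J. (?g j y)))
   = (\<Sum>\<^sup>+j\<in>J. (\<integral>y. (?g j y)))"
  proof (rule nn_integral_count_space_nn_integral[OF J(1)])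
   fix j :: "int \<times> 'a"
   obtain k z where j: "j = (k, z)" by (cases j)
   have [measurable]: "dc k z - Z k z \<in> sets lebesgue" using Ss[of j] j by simp
   show "lm (\<lambda>y. case j of (k, z) \<Rightarrow> ?co k z y * G y * indicator (dc k z - Z k z) y)"
    unfolding j prod.case by measurable
  qed
  also have "\<dots> \<le> (\<Sum>\<^sup>+j\<in>J. ennreal (2 * C) * (\<integral>y\<in>?S j. Y y))"
  proof (rule nn_integral_mono)
   fix j :: "int \<times> 'a"
   obtain k z where j: "j = (k, z)" by (cases j)
   show "(\<integral>y. (?g j y)) \<le> ennreal (2 * C) * (\<integral>y\<in>?S j. Y y)"
    unfolding j prod.case by (rule Z(4))
  qed
  also have "\<dots> = ennreal (2 * C) * (\<Sum>\<^sup>+j\<in>J. (\<integral>y\<in>?S j. Y y))"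
   by (rule nn_integral_cmult) auto
  also have "(\<Sum>\<^sup>+j\<in>J. (\<integral>y\<in>?S j. Y y)) = (\<integral>y\<in>(\<Union>j\<in>J. ?S j). Y y)"
   by (rule nn_integral_UN_countable[OF J(1) Sdisj Ss Y, symmetric])
  finally have "(\<integral>y\<in>dc k x - ?Z. ?co k x y * G y) \<le> ennreal (C * a) * (\<integral>y\<in>dc k x. ?B y) + ennreal (2 * C) * (\<integral>y\<in>(\<Union>j\<in>J. ?S j). Y y)"
   by (simp add: add_left_mono)
  also have "\<dots> \<le> ennreal (2 * C) * (\<integral>y\<in>R. Y y) + ennreal (2 * C) * (\<integral>y\<in>(\<Union>j\<in>J. ?S j). Y y)"
   using main by (intro add_right_mono) (simp add: mult.commute)
  also have "\<dots> = ennreal (2 * C) * (\<integral>y\<in>dc k x - ?Z. Y y)"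
   unfolding split nn_integral_disjoint_pair[OF Y Rm USm Rdisj] by (simp add: distrib_left)
  finally have fin_ineq: "(\<integral>y\<in>dc k x - ?Z. ?co k x y * G y) \<le> ennreal (2 * C) * (\<integral>y\<in>dc k x - ?Z. Y y)" .
  have eZ: "leb ?Z \<le> ennreal ((1/2) ^ Suc N * ?V k)"
  proof -
   have "leb ?Z \<le> (\<Sum>\<^sup>+j\<in>J. leb (case j of (k, z) \<Rightarrow> Z k z))"
    by (rule emeasure_UN_le_count_space[OF J(1) Zs])
   also have "\<dots> \<le> (\<Sum>\<^sup>+j\<in>J. ennreal ((1/2) ^ N) * (case j of (k, z) \<Rightarrow> ennreal (?V k)))"
   proof (rule nn_integral_mono)
    fix j :: "int \<times> 'a"
    obtain k z where j: "j = (k, z)" by (cases j)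
    show "leb (case j of (k, z) \<Rightarrow> Z k z) \<le> ennreal ((1/2) ^ N) * (case j of (k, z) \<Rightarrow> ennreal (?V k))"
     unfolding j prod.case using Z(3)[of k z] by (simp add: ennreal_mult)
   qed
   also have "\<dots> = ennreal ((1/2) ^ N) * cvol J"
    by (rule nn_integral_cmult) auto
   also have "\<dots> \<le> ennreal ((1/2) ^ N) * ennreal (?V k / 2)" by (intro mult_left_mono J(4)) simp
   also have "\<dots> = ennreal ((1/2) ^ Suc N * ?V k)" by (subst ennreal_mult[symmetric]) auto
   finally show ?thesis .
  qed
  show ?case
   by (rule exI[of _ ?Z], intro conjI Zm eZ fin_ineq) (use Zsub UQ in blast)
 qed
 note main = this
 show ?thesis
  by (rule exI[of _ "2 * C"], intro conjI allI impI main) (use C(1) in auto)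
qed

end

text \<open>A maximal function in place of a sum over a sparse family; its integral dominates such a
  sum. \<open>f\<close> is averaged over triples, to which the stopping step localises, and
  \<open>g\<close> over the cells themselves.\<close>

definition bimax :: "nat \<Rightarrow> ('a::euclidean_space \<Rightarrow> real) \<Rightarrow> (int \<Rightarrow> 'a \<Rightarrow> real) \<Rightarrow> ('a \<Rightarrow> ennreal) \<Rightarrow> ('a \<Rightarrow> ennreal) \<Rightarrow> 'a \<Rightarrow> ennreal" where
 "bimax m b c f g x = (SUP k. (bmean m b c k x f) / ennreal (dvol TYPE('a) k)
   * ((\<integral>y\<in>dc k x. ennreal (bw m b (c k x) y) * g y) / ennreal (dvol TYPE('a) k)))"

lemma bimax_measurable:
 fixes b :: "'a::euclidean_space \<Rightarrow> real"
 assumes "\<And>k x y. y \<in> dc k x \<Longrightarrow> c k y = c k x"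
 shows "bimax m b c f g \<in> borel_measurable lebesgue"
proof -
 have [measurable]: "lm (\<lambda>x. (bmean m b c k x f) / ennreal (dvol TYPE('a) k)
   * ((\<integral>y\<in>dc k x. ennreal (bw m b (c k x) y) * g y) / ennreal (dvol TYPE('a) k)))" for k
  by (rule cell_const_measurable[where k=k]) (simp add: trip_eq dc_eq assms)
 show ?thesis unfolding bimax_def[abs_def] by measurable
qed

context czo
begin

abbreviation sparse_estimate :: "nat \<Rightarrow> real \<Rightarrow> bool" where
 "sparse_estimate m C \<equiv> (\<forall>b F G c S. lm b \<longrightarrow> adm b F \<longrightarrow> lm G \<longrightarrow>
  (\<forall>k x y. y \<in> dc k x \<longrightarrow> c k y = c k x) \<longrightarrow> bounded S \<longrightarrow> (\<forall>x. x \<notin> S \<longrightarrow> F x = 0) \<longrightarrow>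
  finite_means m b c F \<longrightarrow>
  (\<integral>x. enorm (commutator T b m F x) * G x) \<le> ennreal C * (\<integral>x. bimax m b c (\<lambda>y. enorm (F y)) G x))"

text \<open>\<open>sparse_iteration\<close> concerns \<open>F\<close> cut to the triple of a cell;
  once the triple contains the support, the cut disappears. Distant points need coarser cells for
  this, hence the exhaustion by the sets \<open>X N\<close>.\<close>

lemma sparse_domination:
 "\<exists>C>0. sparse_estimate m C"
proof -
 from sparse_iteration[of m] obtain C where C: "C > 0"
  and C2: "exhaustion_estimate m C"
  by (elim exE conjE) (rule that)
 have "(\<integral>x. enorm (commutator T b m F x) * G x) \<le> ennreal C * (\<integral>x. bimax m b c (\<lambda>y. enorm (F y)) G x)"
  if b [measurable]: "lm b" and F: "adm b F" and G [measurable]: "lm G"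
   and c: "\<forall>k x y. y \<in> dc k x \<longrightarrow> c k y = c k x" and S: "bounded S" "\<forall>x. x \<notin> S \<longrightarrow> F x = 0"
   and fin: "finite_means m b c F" for b F G and c :: "int \<Rightarrow> 'a \<Rightarrow> real" and S
 proof -
  let ?Y = "bimax m b c (\<lambda>y. enorm (F y)) G"
  let ?h = "\<lambda>x. enorm (commutator T b m F x) * G x"
  have Ym [measurable]: "?Y \<in> borel_measurable lebesgue" by (rule bimax_measurable) (use c in blast)
  have [measurable]: "commutator T b m F \<in> borel_measurable lebesgue" by (rule comm_measurable[OF F b])
  have YY: "\<forall>k x y. y \<in> dc k x \<longrightarrow> (bmean m b c k x (\<lambda>y. enorm (F y))) / ennreal (dvol TYPE('a) k)
     * ((\<integral>y\<in>dc k x. ennreal (bw m b (c k x) y) * G y) / ennreal (dvol TYPE('a) k)) \<le> ?Y y"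
  proof (intro allI impI)
   fix k and x y :: 'a assume y: "y \<in> dc k x"
   have e: "trip k y = trip k x" "dc k y = dc k x" "c k y = c k x" using y trip_eq dc_eq c by blast+
   show "(bmean m b c k x (\<lambda>y. enorm (F y))) / ennreal (dvol TYPE('a) k)
     * ((\<integral>y\<in>dc k x. ennreal (bw m b (c k x) y) * G y) / ennreal (dvol TYPE('a) k)) \<le> ?Y y"
    unfolding bimax_def by (rule SUP_upper2[of k]) (simp_all only: e UNIV_I order_refl)
  qed
  have local: "(\<integral>y\<in>dc k x. ?h y) \<le> ennreal C * (\<integral>y\<in>dc k x. ?Y y)" if sub: "S \<subseteq> trip k x" for k x
  proof -
   have FF: "(\<lambda>y. F y * indicator (trip k x) y) = F" using S(2) sub by (auto simp: indicator_def fun_eq_iff)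
   define P where "P N Z \<longleftrightarrow> Z \<in> sets lebesgue \<and> Z \<subseteq> dc k x \<and> leb Z \<le> ennreal ((1/2) ^ N * dvol TYPE('a) k) \<and>
    (\<integral>y\<in>dc k x - Z. ?h y) \<le> ennreal C * (\<integral>y\<in>dc k x - Z. ?Y y)" for N Z
   have ex: "\<exists>Z. P N Z" for N
    using C2[rule_format, OF b F G Ym fin[rule_format] YY[rule_format], of k x N] unfolding P_def FF by blast
   define Z where "Z N = (SOME Z. P N Z)" for N
   have PZ: "P N (Z N)" for N unfolding Z_def by (rule someI_ex[OF ex])
   show ?thesis
   proof (rule limit_exhaustion[where Z=Z and v="dvol TYPE('a) k"])
    show "Z N \<in> sets lebesgue" "leb (Z N) \<le> ennreal ((1/2) ^ N * dvol TYPE('a) k)" for N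
     using PZ[of N] unfolding P_def by blast+
    fix N
    have "(\<integral>y\<in>dc k x - Z N. ?h y) \<le> ennreal C * (\<integral>y\<in>dc k x - Z N. ?Y y)"
     using PZ[of N] unfolding P_def by blast
    also have "\<dots> \<le> ennreal C * (\<integral>y\<in>dc k x. ?Y y)"
     by (intro mult_left_mono nn_integral_mono) (auto simp: indicator_def)
    finally show "(\<integral>y\<in>dc k x - Z N. ?h y) \<le> ennreal C * (\<integral>y\<in>dc k x. ?Y y)" .
   qed measurable
  qed
  define X where "X N = {x. S \<subseteq> trip (- int N) x}" for N
  have XN: "(\<integral>y\<in>X N. ?h y) \<le> ennreal C * (\<integral>y. ?Y y)" and Xm: "X N \<in> sets lebesgue" for N
  proof -
   obtain D where D: "countable D" "disjoint_family_on (dc (- int N)) D" "(\<Union>q\<in>D. dc (- int N) q) = (UNIV::'a set)"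
    by (rule cover_by_cells[where k="- int N"])
   let ?D = "{q\<in>D. S \<subseteq> trip (- int N) q}"
   have D': "countable ?D" "disjoint_family_on (dc (- int N)) ?D"
    using D(1,2) by (auto intro: countable_subset[of ?D D] disjoint_family_on_mono[of ?D D])
   have XD: "X N = (\<Union>q\<in>?D. dc (- int N) q)"
   proof (intro set_eqI iffI)
    fix x assume "x \<in> X N"
    moreover obtain q where q: "q \<in> D" "x \<in> dc (- int N) q" using D(3) by blast
    moreover note trip_eq[OF q(2)]
    ultimately show "x \<in> (\<Union>q\<in>?D. dc (- int N) q)" by (auto simp: X_def)
   next
    fix x assume "x \<in> (\<Union>q\<in>?D. dc (- int N) q)"
    then obtain q where "S \<subseteq> trip (- int N) q" "x \<in> dc (- int N) q" by blast
    then show "x \<in> X N" using trip_eq[of x "- int N" q] by (simp add: X_def)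
   qed
   show "X N \<in> sets lebesgue" unfolding XD using D'(1) by (intro sets.countable_UN'') auto
   have "(\<integral>y\<in>X N. ?h y) = (\<Sum>\<^sup>+q\<in>?D. (\<integral>y\<in>dc (- int N) q. ?h y))"
    unfolding XD by (rule nn_integral_UN_countable[OF D']) measurable
   also have "\<dots> \<le> (\<Sum>\<^sup>+q\<in>?D. ennreal C * (\<integral>y\<in>dc (- int N) q. ?Y y))"
    by (rule nn_integral_mono) (use local in auto)
   also have "\<dots> = ennreal C * (\<Sum>\<^sup>+q\<in>?D. (\<integral>y\<in>dc (- int N) q. ?Y y))"
    by (rule nn_integral_cmult) auto
   also have "(\<Sum>\<^sup>+q\<in>?D. (\<integral>y\<in>dc (- int N) q. ?Y y)) = (\<integral>y\<in>X N. ?Y y)"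
    unfolding XD by (rule nn_integral_UN_countable[OF D', symmetric]) measurable
   also have "\<dots> \<le> (\<integral>y. ?Y y)" by (intro nn_integral_mono) (auto simp: indicator_def)
   finally show "(\<integral>y\<in>X N. ?h y) \<le> ennreal C * (\<integral>y. ?Y y)" by (simp add: mult_left_mono)
  qed
  note [measurable] = Xm
  have mono: "X N \<subseteq> X M" if "N \<le> M" for N M
   using trip_mono[of "- int M" "- int N"] that by (fastforce simp: X_def)
  have cover: "\<exists>N. x \<in> X N" for x
  proof -
   have "bounded (insert x S)" using S(1) by simp
   then obtain K where K: "\<forall>k\<le>K. \<forall>y\<in>insert x S. insert x S \<subseteq> trip k y" using bounded_in_trip by blast
   have "- int (nat (- K)) \<le> K" by simp
   then have "insert x S \<subseteq> trip (- int (nat (- K))) x" using K by blast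
   then show ?thesis unfolding X_def by blast
  qed
  have "(\<integral>x. ?h x) = (\<integral>x. (SUP N. ?h x * indicator (X N) x))"
  proof (rule nn_integral_cong)
   fix x
   obtain N where N: "x \<in> X N" using cover by blast
   show "?h x = (SUP N. ?h x * indicator (X N) x)"
   proof (rule antisym)
    show "?h x \<le> (SUP N. ?h x * indicator (X N) x)" by (rule SUP_upper2[of N]) (use N in auto)
    show "(SUP N. ?h x * indicator (X N) x) \<le> ?h x" by (rule SUP_least) (auto simp: indicator_def)
   qed
  qed
  also have "\<dots> = (SUP N. \<integral>\<^sup>+x. ?h x * indicator (X N) x \<partial>lebesgue)"
  proof (rule nn_integral_monotone_convergence_SUP)
   show "incseq (\<lambda>N x. ?h x * indicator (X N) x)"
    using mono by (auto simp: incseq_def le_fun_def indicator_def)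
  qed measurable
  also have "\<dots> \<le> ennreal C * (\<integral>y. ?Y y)" by (rule SUP_least) (rule XN)
  finally show ?thesis .
 qed
 note main = this
 show ?thesis by (rule exI[of _ C], rule conjI[OF C], intro allI impI, rule main) assumption+
qed

end

section \<open>Weighted estimates for the bilinear maximal function\<close>

lemma epow_ennreal_mult: "x \<ge> 0 \<Longrightarrow> y \<ge> 0 \<Longrightarrow> epow (ennreal (x * y)) p = ennreal (x powr p) * epow (ennreal y) p"
 by (simp add: epow_ennreal epow_mult powr_mult ennreal_mult)

lemma holder_set:
 assumes [measurable]: "f \<in> borel_measurable M" "g \<in> borel_measurable M" "S \<in> sets M"
  and ab: "\<alpha> > 0" "\<beta> > 0" "\<alpha> + \<beta> = 1"
 shows "(\<integral>\<^sup>+x\<in>S. epow (f x) \<alpha> * epow (g x) \<beta> \<partial>M) \<le> epow (\<integral>\<^sup>+x\<in>S. f x \<partial>M) \<alpha> * epow (\<integral>\<^sup>+x\<in>S. g x \<partial>M) \<beta>"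
proof -
 have "(\<integral>\<^sup>+x\<in>S. epow (f x) \<alpha> * epow (g x) \<beta> \<partial>M) = (\<integral>\<^sup>+x. epow (f x * indicator S x) \<alpha> * epow (g x * indicator S x) \<beta> \<partial>M)"
  by (intro nn_integral_cong) (auto simp: indicator_def epow_mult)
 also have "\<dots> \<le> epow (\<integral>\<^sup>+x\<in>S. f x \<partial>M) \<alpha> * epow (\<integral>\<^sup>+x\<in>S. g x \<partial>M) \<beta>"
  by (rule holder_epow) (use ab in auto)
 finally show ?thesis .
qed

lemma holder_set3:
 assumes [measurable]: "f \<in> borel_measurable M" "g \<in> borel_measurable M" "h \<in> borel_measurable M" "S \<in> sets M"
  and ab: "\<alpha> > 0" "\<beta> > 0" "\<gamma> > 0" "\<alpha> + \<beta> + \<gamma> = 1"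
 shows "(\<integral>\<^sup>+x\<in>S. epow (f x) \<alpha> * epow (g x) \<beta> * epow (h x) \<gamma> \<partial>M)
  \<le> epow (\<integral>\<^sup>+x\<in>S. f x \<partial>M) \<alpha> * epow (\<integral>\<^sup>+x\<in>S. g x \<partial>M) \<beta> * epow (\<integral>\<^sup>+x\<in>S. h x \<partial>M) \<gamma>"
proof -
 have "(\<integral>\<^sup>+x\<in>S. epow (f x) \<alpha> * epow (g x) \<beta> * epow (h x) \<gamma> \<partial>M) = (\<integral>\<^sup>+x. epow (f x * indicator S x) \<alpha> * epow (g x * indicator S x) \<beta> * epow (h x * indicator S x) \<gamma> \<partial>M)"
  by (intro nn_integral_cong) (auto simp: indicator_def epow_mult)
 also have "\<dots> \<le> epow (\<integral>\<^sup>+x\<in>S. f x \<partial>M) \<alpha> * epow (\<integral>\<^sup>+x\<in>S. g x \<partial>M) \<beta> * epow (\<integral>\<^sup>+x\<in>S. h x \<partial>M) \<gamma>"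
  by (rule holder_epow3) (use ab in auto)
 finally show ?thesis .
qed

text \<open>The inequality \<open>exp z \<ge> z\<close> at \<open>z = \<theta> * t / a\<close>,
  raised to the power \<open>a\<close>. The dependence on \<open>a\<close> matters, since
  \<open>a = m * q\<close> with \<open>q\<close> unbounded; writing \<open>a + 1\<close> covers
  \<open>a = 0\<close>.\<close>

lemma powr_le_exp: assumes "(t::real) \<ge> 0" "a \<ge> 0" "\<theta> > 0" shows "t powr a \<le> ((a + 1) / \<theta>) powr a * exp (\<theta> * t)"
proof (cases "a = 0")
 case False
 then have a: "a > 0" using assms by linarith
 have "\<theta> * t / a \<le> exp (\<theta> * t / a)" using exp_ge_add_one_self[of "\<theta> * t / a"] by linarith
 then have "(\<theta> * t / a) powr a \<le> exp (\<theta> * t / a) powr a" using assms a by (intro powr_mono2) auto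
 also have "\<dots> = exp (\<theta> * t)" using a by (simp add: exp_powr_real)
 finally have 1: "(\<theta> * t / a) powr a \<le> exp (\<theta> * t)" .
 have "t powr a = (a / \<theta>) powr a * (\<theta> * t / a) powr a"
  using a assms by (simp flip: powr_mult)
 also have "\<dots> \<le> ((a + 1) / \<theta>) powr a * exp (\<theta> * t)"
  using a assms by (intro mult_mono 1 powr_mono2 divide_right_mono) auto
 finally show ?thesis .
qed (use assms in \<open>auto simp: powr_def\<close>)

text \<open>What is used of BMO from here on: a centre for every cell, constant on the cell, with
  uniform exponential integrability over the triple.\<close>

locale bmo_data =
 fixes b :: "'a::euclidean_space \<Rightarrow> real" and c :: "int \<Rightarrow> 'a \<Rightarrow> real" and \<theta> J :: real
 assumes b_meas [measurable]: "lm b"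
  and c_cell: "\<And>k x y. y \<in> dc k x \<Longrightarrow> c k y = c k x"
  and \<theta>: "\<theta> > 0" and J: "J \<ge> 1"
  and jn: "\<And>k x. (\<integral>y\<in>trip k x. ennreal (exp (\<theta> * \<bar>b y - c k x\<bar>))) \<le> ennreal (J * dvol TYPE('a) k)"
begin

text \<open>Exponential integrability lets the power means of \<open>bw\<close> grow no faster than
  \<open>q^m\<close>. With \<open>q\<close> of order \<open>2^i\<close> this is the factor
  \<open>2^(i m)\<close> on level \<open>i\<close>.\<close>

lemma bw_power_mean:
 assumes q: "q \<ge> 1"
 shows "epow (\<integral>y\<in>trip k x. epow (ennreal (bw m b (c k x) y)) q) (1 / q)
  \<le> ennreal (((real m * q + 1) / \<theta>) ^ m * (exp \<theta> * J)) * epow (ennreal (dvol TYPE('a) k)) (1 / q)"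
proof -
 let ?a = "real m * q"
 let ?A = "((?a + 1) / \<theta>) powr ?a"
 have a: "?a \<ge> 0" using q by simp
 have pt: "bw m b (c k x) y powr q \<le> ?A * exp \<theta> * exp (\<theta> * \<bar>b y - c k x\<bar>)" for y
 proof -
  have "bw m b (c k x) y powr q = (1 + \<bar>b y - c k x\<bar>) powr ?a"
   by (simp add: bw_def powr_realpow[symmetric] powr_powr)
  also have "\<dots> \<le> ?A * exp (\<theta> * (1 + \<bar>b y - c k x\<bar>))"
   by (rule powr_le_exp) (use a \<theta> in auto)
  finally show ?thesis by (simp add: distrib_left exp_add mult.assoc)
 qed
 have "(\<integral>y\<in>trip k x. epow (ennreal (bw m b (c k x) y)) q)
   \<le> (\<integral>y. ennreal (?A * exp \<theta>) * (ennreal (exp (\<theta> * \<bar>b y - c k x\<bar>)) * indicator (trip k x) y))"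
  using pt by (intro nn_integral_mono) (auto simp: indicator_def epow_ennreal bw_pos ennreal_mult[symmetric] intro!: ennreal_leI)
 also have "\<dots> = ennreal (?A * exp \<theta>) * (\<integral>y\<in>trip k x. ennreal (exp (\<theta> * \<bar>b y - c k x\<bar>)))"
  by (rule nn_integral_cmult) measurable
 also have "\<dots> \<le> ennreal (?A * exp \<theta>) * ennreal (J * dvol TYPE('a) k)"
  by (intro mult_left_mono jn) simp
 also have "\<dots> = ennreal (?A * (exp \<theta> * J) * dvol TYPE('a) k)"
  using J by (subst ennreal_mult[symmetric]) (auto simp: mult_ac)
 finally have "epow (\<integral>y\<in>trip k x. epow (ennreal (bw m b (c k x) y)) q) (1 / q) \<le> epow (ennreal (?A * (exp \<theta> * J) * dvol TYPE('a) k)) (1 / q)"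
  using q by (intro epow_mono) auto
 also have "\<dots> = ennreal ((?A * (exp \<theta> * J)) powr (1 / q)) * epow (ennreal (dvol TYPE('a) k)) (1 / q)"
  using J by (intro epow_ennreal_mult) auto
 also have "(?A * (exp \<theta> * J)) powr (1 / q) \<le> ((?a + 1) / \<theta>) ^ m * (exp \<theta> * J)"
 proof -
  have "(?A * (exp \<theta> * J)) powr (1 / q) = ?A powr (1 / q) * (exp \<theta> * J) powr (1 / q)"
   using J by (simp add: powr_mult)
  also have "?A powr (1 / q) = ((?a + 1) / \<theta>) ^ m"
  proof -
   have "(?a + 1) / \<theta> > 0" using a \<theta> by simp
   then show ?thesis using q by (simp add: powr_powr powr_realpow)
  qed
  also have "(exp \<theta> * J) powr (1 / q) \<le> (exp \<theta> * J) powr 1"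
  proof (rule powr_mono)
   have "1 * 1 \<le> exp \<theta> * J" using \<theta> J by (intro mult_mono) auto
   then show "1 \<le> exp \<theta> * J" by simp
  qed (use q in auto)
  finally show ?thesis using J a \<theta> by (simp add: mult_left_mono)
 qed
 finally show ?thesis by (simp add: mult_right_mono ennreal_leI)
qed

end

text \<open>Young's inequality after scaling \<open>x\<close> and \<open>y\<close> by reciprocal
  factors. The small coefficient of the second term allows \<open>comm_strong\<close> to absorb
  it.\<close>

lemma young_eps:
 assumes r: "r > 1" and \<tau>: "\<tau> > 0"
 shows "\<exists>K>0. \<forall>x y. x * y \<le> ennreal K * epow x r + ennreal \<tau> * epow y (r / (r - 1))"
proof -
 let ?r' = "r / (r - 1)"
 have r': "?r' > 0" using r by simp
 have conj: "1 / r + 1 / ?r' = 1" using r by (simp add: field_simps)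
 define \<sigma> where "\<sigma> = \<tau> powr (1 / ?r')"
 have \<sigma>: "\<sigma> > 0" "\<sigma> powr ?r' = \<tau>" using \<tau> r r' by (auto simp: \<sigma>_def powr_powr)
 define K where "K = (1 / \<sigma>) powr r"
 have "x * y \<le> ennreal K * epow x r + ennreal \<tau> * epow y ?r'" for x y
 proof -
  let ?u = "ennreal (1 / \<sigma>) * x" and ?v = "ennreal \<sigma> * y"
  have "x * y = ennreal (1 / \<sigma> * \<sigma>) * (x * y)" using \<sigma> by simp
  also have "\<dots> = ?u * ?v" using \<sigma> by (subst ennreal_mult) (auto simp: mult_ac)
  also have "\<dots> = epow (epow ?u r) (1 / r) * epow (epow ?v ?r') (1 / ?r')"
   using r by (simp add: epow_epow)
  also have "\<dots> \<le> ennreal (1 / r) * epow ?u r + ennreal (1 / ?r') * epow ?v ?r'"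
   by (rule epow_young) (use r r' conj in auto)
  also have "\<dots> \<le> 1 * epow ?u r + 1 * epow ?v ?r'"
  proof (intro add_mono mult_right_mono)
   show "ennreal (1 / r) \<le> 1" using r by (simp add: ennreal_le_1)
   have "1 / ?r' \<le> 1" using conj r by simp
   then show "ennreal (1 / ?r') \<le> 1" by (simp only: ennreal_le_1)
  qed auto
  also have "\<dots> = ennreal K * epow x r + ennreal \<tau> * epow y ?r'"
   using \<sigma> by (simp add: epow_mult epow_ennreal K_def)
  finally show ?thesis .
 qed
 moreover have "K > 0" using \<sigma> by (simp add: K_def)
 ultimately show ?thesis by blast
qed

definition phi :: "real \<Rightarrow> real \<Rightarrow> real" where
 "phi \<kappa> t = t * (1 + log_plus t) powr \<kappa>"

lemma log_plus_nonneg: "log_plus t \<ge> 0" by (simp add: log_plus_def)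

lemma phi_nonneg: "t \<ge> 0 \<Longrightarrow> phi \<kappa> t \<ge> 0" by (simp add: phi_def)

lemma Phi_phi: "Phi m \<epsilon> = phi (real m + \<epsilon>)" by (simp add: Phi_def phi_def fun_eq_iff)

lemma log_plus_measurable [measurable]: "log_plus \<in> borel_measurable borel"
 unfolding log_plus_def[abs_def] by measurable

lemma phi_measurable [measurable]: "phi \<kappa> \<in> borel_measurable borel"
 unfolding phi_def[abs_def] by measurable

text \<open>For \<open>i > 0\<close> the logarithm is comparable to \<open>2 ^ i\<close> on level \<open>i\<close>, hence \<open>phi\<close> gains a factor \<open>2 ^ i\<close> to the power \<open>\<kappa>\<close>.\<close>

definition lev :: "nat \<Rightarrow> real \<Rightarrow> bool" where
 "lev i u \<longleftrightarrow> (if i = 0 then u \<le> exp 2 else exp (2 ^ i) < u \<and> u \<le> exp (2 ^ (i + 1)))"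

lemma lev_ex: "\<exists>i. lev i u"
proof (cases "u \<le> exp 2")
 case False
 have ex: "\<exists>i. u \<le> exp (2 ^ (i + 1))"
 proof -
  obtain i where "ln u < 2 ^ i" using real_arch_pow[of 2 "ln u"] by auto
  moreover have "(2::real) ^ i \<le> 2 ^ (i + 1)" by simp
  ultimately have "ln u \<le> 2 ^ (i + 1)" by linarith
  moreover have "u > 0" using False by (meson exp_gt_zero less_trans not_le)
  ultimately show ?thesis by (metis exp_le_cancel_iff exp_ln)
 qed
 define i where "i = (LEAST i. u \<le> exp (2 ^ (i + 1)))"
 have i: "u \<le> exp (2 ^ (i + 1))" unfolding i_def by (rule LeastI_ex[OF ex])
 have "i \<noteq> 0" using i False by (intro notI) simp
 then obtain l where l: "i = Suc l" by (cases i) auto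
 have "\<not> u \<le> exp (2 ^ (l + 1))" using not_less_Least[of l "\<lambda>i. u \<le> exp (2 ^ (i + 1))"] l by (simp add: i_def)
 then have "lev i u" using i l by (simp add: lev_def)
 then show ?thesis by blast
qed (use lev_def[of 0 u] in auto)

lemma lev_measurable: "lm w \<Longrightarrow> {y. lev i (w y / s)} \<in> sets lebesgue"
proof -
 assume w: "lm w"
 have "{u. lev i u} \<in> sets borel" unfolding lev_def by (cases "i = 0") auto
 moreover have "lm (\<lambda>y. w y / s)" using w by measurable
 ultimately have "(\<lambda>y. w y / s) -` {u. lev i u} \<inter> space lebesgue \<in> sets lebesgue" by (rule measurable_sets[rotated])
 then show ?thesis by (simp add: vimage_def)
qed

text \<open>On level \<open>i\<close> the logarithm of \<open>u\<close> is at most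
  \<open>2 ^ (i + 1)\<close>, so the extra power \<tau> costs at most a factor \<open>exp 1\<close>,
  while \<open>phi\<close> contains the factor \<open>2 powr (i * \<kappa>)\<close>. On level 0,
  \<open>u\<close> is simply bounded.\<close>

lemma lev_power_bound:
 assumes u: "u \<ge> 0" "lev i u" and \<tau>: "0 \<le> \<tau>" "\<tau> * 2 ^ (i + 1) \<le> 1" and \<kappa>: "\<kappa> \<ge> 0"
 shows "u powr (1 + \<tau>) \<le> exp 4 * 2 powr (- (real i * \<kappa>)) * (phi \<kappa> u + 1)"
proof (cases "i = 0")
 case True
 have "u powr (1 + \<tau>) \<le> exp 2 powr (1 + \<tau>)" using u True \<tau> by (intro powr_mono2) (auto simp: lev_def)
 also have "\<dots> = exp (2 + 2 * \<tau>)" by (simp add: exp_powr_real distrib_left)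
 also have "\<dots> \<le> exp 4" using \<tau> True by simp
 also have "\<dots> \<le> exp 4 * (phi \<kappa> u + 1)" using phi_nonneg[OF u(1), of \<kappa>] by simp
 finally show ?thesis using True by simp
next
 case False
 then have i: "exp (2 ^ i) < u" "u \<le> exp (2 ^ (i + 1))" using u by (auto simp: lev_def)
 have u0: "u > 0" using i(1) by (meson exp_gt_zero less_trans)
 have lnu: "2 ^ i < ln u" "ln u \<le> 2 ^ (i + 1)"
  using i u0 by (metis exp_less_cancel_iff exp_ln, metis exp_le_cancel_iff exp_ln)
 have u1: "u > 1" using i(1) by (meson less_trans one_less_exp_iff zero_less_numeral zero_less_power)
 have "u powr \<tau> = exp (\<tau> * ln u)" using u0 by (simp add: powr_def)
 also have "\<dots> \<le> exp 1"
  using \<tau> lnu(2) by (subst exp_le_cancel_iff) (meson mult_left_mono order_trans)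
 finally have 1: "u powr \<tau> \<le> exp 1" .
 have "(2 powr real i) powr \<kappa> \<le> (1 + log_plus u) powr \<kappa>"
  using \<kappa> lnu(1) u1 by (intro powr_mono2) (auto simp: log_plus_def powr_realpow)
 then have "2 powr (real i * \<kappa>) \<le> (1 + log_plus u) powr \<kappa>" by (simp add: powr_powr)
 then have "u * 2 powr (real i * \<kappa>) \<le> phi \<kappa> u" unfolding phi_def using u by (intro mult_left_mono) auto
 then have 2: "u \<le> 2 powr (- (real i * \<kappa>)) * phi \<kappa> u" by (simp add: powr_minus field_simps)
 have "u powr (1 + \<tau>) = u * u powr \<tau>" using u0 by (simp add: powr_add)
 also have "\<dots> \<le> (2 powr (- (real i * \<kappa>)) * phi \<kappa> u) * exp 1" using 1 2 u by (intro mult_mono) (auto simp: phi_nonneg)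
 also have "\<dots> \<le> (2 powr (- (real i * \<kappa>)) * (phi \<kappa> u + 1)) * exp 4"
  using phi_nonneg[OF u(1), of \<kappa>] by (intro mult_mono mult_left_mono) auto
 finally show ?thesis by (simp add: mult_ac)
qed

context bmo_data
begin

text \<open>On this side a fixed exponent \<open>s > 1\<close> suffices, so \<open>bw\<close> costs
  a constant that does not depend on any level.\<close>

lemma f_side:
 assumes s: "s > 1" and [measurable]: "lm f"
 shows "(bmean m b c k x f)
  \<le> ennreal (((real m * (s / (s - 1)) + 1) / \<theta>) ^ m * (exp \<theta> * J)) * ennreal (dvol TYPE('a) k) * epow (dmax (\<lambda>y. epow (f y) s) x) (1 / s)"
proof -
 let ?s' = "s / (s - 1)" and ?V = "ennreal (dvol TYPE('a) k)"
 have s': "?s' \<ge> 1" using s by (simp add: field_simps)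
 have conj: "1 / ?s' + 1 / s = 1" using s by (simp add: field_simps)
 have "(bmean m b c k x f)
  = (\<integral>y\<in>trip k x. epow (epow (ennreal (bw m b (c k x) y)) ?s') (1 / ?s') * epow (epow (f y) s) (1 / s))"
  using s by (simp add: epow_epow)
 also have "\<dots> \<le> epow (\<integral>y\<in>trip k x. epow (ennreal (bw m b (c k x) y)) ?s') (1 / ?s') * epow (\<integral>y\<in>trip k x. epow (f y) s) (1 / s)"
  by (rule holder_set) (use s conj in \<open>auto intro!: divide_pos_pos\<close>)
 also have "\<dots> \<le> (ennreal (((real m * ?s' + 1) / \<theta>) ^ m * (exp \<theta> * J)) * epow ?V (1 / ?s')) * epow (dmax (\<lambda>y. epow (f y) s) x * ?V) (1 / s)"
  using s by (intro mult_mono bw_power_mean[OF s'] epow_mono dmax_ge) auto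
 also have "\<dots> = ennreal (((real m * ?s' + 1) / \<theta>) ^ m * (exp \<theta> * J)) * (epow ?V (1 / ?s') * epow ?V (1 / s)) * epow (dmax (\<lambda>y. epow (f y) s) x) (1 / s)"
  by (simp add: epow_mult mult_ac)
 also have "epow ?V (1 / ?s') * epow ?V (1 / s) = ?V" unfolding epow_add[symmetric] conj by simp
 finally show ?thesis .
qed

text \<open>Hoelder with the exponents \<eta>, \<open>1 / r' + \<eta>\<close> and
  \<open>1 / r - 2 * \<eta>\<close> for \<open>bw\<close>, \<open>g\<close> and the weight, where
  \<eta> = \<eta>0 / 2^i. The first factor costs \<open>2^(i m)\<close>, the last gains
  \<open>2^(-i \<kappa> / r)\<close>, and the middle one leaves a maximal function whose power is
  only slightly below \<open>r'\<close>. The choice of \<eta>0 makes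
  \<open>r' * \<eta> = 1 / (16 * 2 ^ i)\<close>.\<close>

lemma g_side:
 assumes r: "1 < r" "r < 2" and \<kappa>: "\<kappa> \<ge> 0"
 defines "r' \<equiv> r / (r - 1)" defines "\<eta>0 \<equiv> 1 / (16 * r')"
 shows "\<exists>C>0. \<forall>w s k x i g. lm w \<longrightarrow> (\<forall>y. w y \<ge> 0) \<longrightarrow> lm g \<longrightarrow> s > 0 \<longrightarrow>
   (\<integral>y\<in>trip k x. ennreal (phi \<kappa> (w y / s))) \<le> ennreal (3 ^ DIM('a) * dvol TYPE('a) k) \<longrightarrow>
   (\<integral>y\<in>dc k x. ennreal (bw m b (c k x) y) * (g y * ennreal (w y powr (1 / r))) * indicator {y. lev i (w y / s)} y)
   \<le> ennreal (C * 2 powr (real i * (real m - \<kappa> / r))) * ennreal (s powr (1 / r)) * ennreal (dvol TYPE('a) k) *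
    epow (dmax (\<lambda>y. epow (g y) (1 / (1 / r' + \<eta>0 / 2 ^ i))) x) (1 / r' + \<eta>0 / 2 ^ i)"
proof -
 let ?n = "DIM('a)"
 have r': "r' > 2" using r by (simp add: r'_def field_simps)
 have conj: "1 / r + 1 / r' = 1" using r by (simp add: r'_def field_simps)
 have \<eta>0: "\<eta>0 > 0" "\<eta>0 \<le> 1 / 32" using r' by (auto simp: \<eta>0_def field_simps)
 define C where "C = ((real m / \<eta>0 + 1) / \<theta>) ^ m * (exp \<theta> * J) * (2 * 3 ^ ?n * exp 4 * 2 powr \<kappa>)"
 have C: "C > 0" using \<eta>0 \<theta> J by (auto simp: C_def intro!: mult_pos_pos zero_less_power divide_pos_pos add_nonneg_pos)
 have main: "(\<integral>y\<in>dc k x. ennreal (bw m b (c k x) y) * (g y * ennreal (w y powr (1 / r))) * indicator {y. lev i (w y / s)} y)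
   \<le> ennreal (C * 2 powr (real i * (real m - \<kappa> / r))) * ennreal (s powr (1 / r)) * ennreal (dvol TYPE('a) k) *
    epow (dmax (\<lambda>y. epow (g y) (1 / (1 / r' + \<eta>0 / 2 ^ i))) x) (1 / r' + \<eta>0 / 2 ^ i)"
  if w [measurable]: "lm w" and w0: "\<And>y. w y \<ge> 0" and g [measurable]: "lm g" and s: "s > 0"
   and le: "(\<integral>y\<in>trip k x. ennreal (phi \<kappa> (w y / s))) \<le> ennreal (3 ^ ?n * dvol TYPE('a) k)"
  for w :: "'a \<Rightarrow> real" and s :: real and k x i and g
 proof -
  define \<eta> where "\<eta> = \<eta>0 / 2 ^ i"
  have \<eta>: "\<eta> > 0" "\<eta> \<le> 1 / 32"
  proof -
   have "\<eta> \<le> \<eta>0 / 1" unfolding \<eta>_def using \<eta>0 by (intro divide_left_mono) auto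
   then show "\<eta> \<le> 1 / 32" using \<eta>0 by linarith
   show "\<eta> > 0" using \<eta>0 by (simp add: \<eta>_def)
  qed
  define \<beta> where "\<beta> = 1 / r' + \<eta>"
  define \<gamma> where "\<gamma> = 1 / r - 2 * \<eta>"
  have \<beta>: "\<beta> > 0" using r' \<eta> by (simp add: \<beta>_def add_pos_pos)
  have r2: "1 / r > 1 / 2" using r by (simp add: field_simps)
  have "1 / r \<le> 1" using r by simp
  then have \<gamma>: "\<gamma> > 0" "\<gamma> \<le> 1" unfolding \<gamma>_def using r2 \<eta> by linarith+
  have sum: "\<eta> + \<beta> + \<gamma> = 1" using conj by (simp add: \<beta>_def \<gamma>_def)
  \<comment> \<open>\<open>1 + \<tau>\<close> is the exponent of the weight once the third factor is
    raised to \<open>1 / \<gamma>\<close>.\<close>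
  define \<tau> where "\<tau> = 1 / (r * \<gamma>) - 1"
  have r\<gamma>: "r * \<gamma> = 1 - 2 * \<eta> * r" using r by (simp add: \<gamma>_def field_simps)
  have r\<gamma>2: "1 / 2 \<le> r * \<gamma>" "r * \<gamma> \<le> 1"
  proof -
   have "2 * \<eta> * r \<le> 2 * (1/32) * 2" using \<eta> r by (intro mult_mono) auto
   then show "1 / 2 \<le> r * \<gamma>" "r * \<gamma> \<le> 1" unfolding r\<gamma> using \<eta> r by auto
  qed
  have \<tau>0: "\<tau> \<ge> 0" using r\<gamma>2 by (simp add: \<tau>_def field_simps)
  \<comment> \<open>Halving \<eta> from level to level compensates the doubling of the logarithm, so
    \<open>lev_power_bound\<close> applies on each level.\<close>
  have \<tau>i: "\<tau> * 2 ^ (i + 1) \<le> 1"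
  proof -
   have "r * \<gamma> \<noteq> 0" using r\<gamma>2 by linarith
   then have "\<tau> = (1 - r * \<gamma>) / (r * \<gamma>)" by (simp add: \<tau>_def diff_divide_distrib)
   also have "1 - r * \<gamma> = 2 * \<eta> * r" using r\<gamma> by simp
   finally have "\<tau> = 2 * \<eta> * r / (r * \<gamma>)" .
   also have "\<dots> \<le> 2 * \<eta> * r / (1/2)" using r\<gamma>2 \<eta> r by (intro divide_left_mono) auto
   also have "\<dots> \<le> 8 * \<eta>" using r \<eta> by simp
   finally have "\<tau> * 2 ^ (i + 1) \<le> 8 * \<eta> * 2 ^ (i + 1)" by (intro mult_right_mono) auto
   also have "\<dots> = 16 * \<eta>0" by (simp add: \<eta>_def)
   also have "\<dots> \<le> 1" using \<eta>0 by simp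
   finally show ?thesis .
  qed
  let ?V = "ennreal (dvol TYPE('a) k)" and ?A = "{y. lev i (w y / s)}"
  have Am [measurable]: "?A \<in> sets lebesgue" by (rule lev_measurable[OF w])
  let ?f1 = "\<lambda>y. epow (ennreal (bw m b (c k x) y)) (1 / \<eta>)"
  let ?f2 = "\<lambda>y. epow (g y) (1 / \<beta>)"
  let ?f3 = "\<lambda>y. epow (ennreal (w y powr (1 / r)) * indicator ?A y) (1 / \<gamma>)"
  have "(\<integral>y\<in>dc k x. ennreal (bw m b (c k x) y) * (g y * ennreal (w y powr (1 / r))) * indicator ?A y)
   = (\<integral>y\<in>dc k x. epow (?f1 y) \<eta> * epow (?f2 y) \<beta> * epow (?f3 y) \<gamma>)"
   using \<eta> \<beta> \<gamma> by (simp add: epow_epow mult_ac)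
  also have "\<dots> \<le> epow (\<integral>y\<in>dc k x. ?f1 y) \<eta> * epow (\<integral>y\<in>dc k x. ?f2 y) \<beta> * epow (\<integral>y\<in>dc k x. ?f3 y) \<gamma>"
   by (rule holder_set3) (use \<eta> \<beta> \<gamma> sum in auto)
  also have "epow (\<integral>y\<in>dc k x. ?f1 y) \<eta> * epow (\<integral>y\<in>dc k x. ?f2 y) \<beta> * epow (\<integral>y\<in>dc k x. ?f3 y) \<gamma>
    \<le> (ennreal (((real m / \<eta>0 + 1) / \<theta>) ^ m * (exp \<theta> * J) * 2 powr (real i * real m)) * epow ?V \<eta>) *
    (epow (dmax ?f2 x) \<beta> * epow ?V \<beta>) * (ennreal (s powr (1 / r) * (2 * 3 ^ ?n * exp 4 * 2 powr \<kappa>) * 2 powr (- (real i * \<kappa> / r))) * epow ?V \<gamma>)"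
  proof -
   have sub: "(\<integral>y\<in>dc k x. h y) \<le> (\<integral>y\<in>trip k x. h y)" for h :: "'a \<Rightarrow> ennreal"
    by (intro nn_integral_mono mult_left_mono indicator_leI) (use dc_subset_trip in auto)
   have "epow (\<integral>y\<in>dc k x. ?f1 y) \<eta> \<le> epow (\<integral>y\<in>trip k x. ?f1 y) (1 / (1 / \<eta>))"
    using \<eta> sub by (simp add: epow_mono)
   also have "\<dots> \<le> ennreal (((real m * (1 / \<eta>) + 1) / \<theta>) ^ m * (exp \<theta> * J)) * epow ?V (1 / (1 / \<eta>))"
    by (rule bw_power_mean) (use \<eta> in \<open>simp add: field_simps\<close>)
   also have "\<dots> \<le> ennreal (((real m / \<eta>0 + 1) / \<theta>) ^ m * (exp \<theta> * J) * 2 powr (real i * real m)) * epow ?V \<eta>"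
   proof (rule mult_mono[OF ennreal_leI])
    have "((real m * (1 / \<eta>) + 1) / \<theta>) ^ m \<le> ((real m / \<eta>0 + 1) * 2 ^ i / \<theta>) ^ m"
    proof (intro power_mono divide_right_mono)
     have "real m * (1 / \<eta>) = real m / \<eta>0 * 2 ^ i" by (simp add: \<eta>_def)
     moreover have "(1::real) \<le> 2 ^ i" by simp
     ultimately show "real m * (1 / \<eta>) + 1 \<le> (real m / \<eta>0 + 1) * 2 ^ i" by (simp add: distrib_right)
    qed (use \<theta> \<eta> in auto)
    also have "\<dots> = ((real m / \<eta>0 + 1) / \<theta>) ^ m * 2 powr (real i * real m)"
     by (simp add: power_mult_distrib power_divide powr_powr[symmetric] powr_realpow)
    finally show "((real m * (1 / \<eta>) + 1) / \<theta>) ^ m * (exp \<theta> * J) \<le> ((real m / \<eta>0 + 1) / \<theta>) ^ m * (exp \<theta> * J) * 2 powr (real i * real m)"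
     using J by (simp add: mult_ac mult_right_mono)
   qed auto
   finally have A1: "epow (\<integral>y\<in>dc k x. ?f1 y) \<eta> \<le> ennreal (((real m / \<eta>0 + 1) / \<theta>) ^ m * (exp \<theta> * J) * 2 powr (real i * real m)) * epow ?V \<eta>" .
   have A2: "epow (\<integral>y\<in>dc k x. ?f2 y) \<beta> \<le> epow (dmax ?f2 x) \<beta> * epow ?V \<beta>"
    unfolding epow_mult[symmetric] by (intro epow_mono \<beta> dmax_ge_dc)
   let ?X = "s powr (1 / (r * \<gamma>)) * (exp 4 * 2 powr (- (real i * \<kappa>)))"
   have "(\<integral>y\<in>dc k x. ?f3 y) \<le> (\<integral>y\<in>trip k x. ?f3 y)" by (rule sub)
   also have "\<dots> \<le> (\<integral>y. ennreal ?X * (ennreal (phi \<kappa> (w y / s)) * indicator (trip k x) y + indicator (trip k x) y))"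
   proof (rule nn_integral_mono)
    fix y
    let ?u = "w y / s"
    have u0: "?u \<ge> 0" using w0 s by simp
    show "?f3 y * indicator (trip k x) y \<le> ennreal ?X * (ennreal (phi \<kappa> ?u) * indicator (trip k x) y + indicator (trip k x) y)"
    proof (cases "y \<in> ?A \<and> y \<in> trip k x")
     case True
     have "?f3 y = ennreal ((w y powr (1 / r)) powr (1 / \<gamma>))" using True by (simp add: epow_ennreal)
     also have "(w y powr (1 / r)) powr (1 / \<gamma>) = (s * ?u) powr (1 / (r * \<gamma>))" using s by (simp add: powr_powr)
     also have "\<dots> = s powr (1 / (r * \<gamma>)) * ?u powr (1 + \<tau>)" unfolding powr_mult by (simp add: \<tau>_def)
     also have "\<dots> \<le> s powr (1 / (r * \<gamma>)) * (exp 4 * 2 powr (- (real i * \<kappa>)) * (phi \<kappa> ?u + 1))"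
      by (intro mult_left_mono lev_power_bound u0 \<tau>0 \<tau>i \<kappa>) (use True in auto)
     also have "\<dots> = ?X * (phi \<kappa> ?u + 1)" by (simp add: mult.assoc)
     finally have "?f3 y \<le> ennreal (?X * (phi \<kappa> ?u + 1))" by (simp add: ennreal_leI)
     also have "\<dots> = ennreal ?X * (ennreal (phi \<kappa> ?u) + 1)" using phi_nonneg[OF u0, of \<kappa>] by (simp add: ennreal_mult)
     finally show ?thesis using True by simp
    qed (auto simp: indicator_def)
   qed
   also have "\<dots> = ennreal ?X * ((\<integral>y\<in>trip k x. ennreal (phi \<kappa> (w y / s))) + leb (trip k x))"
   proof -
    have [measurable]: "lm (\<lambda>y. phi \<kappa> (w y / s))"
     by (rule measurable_compose[OF _ phi_measurable]) measurable
    show ?thesis by (subst nn_integral_cmult, measurable) (subst nn_integral_add, auto)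
   qed
   also have "\<dots> \<le> ennreal ?X * (ennreal (3 ^ ?n * dvol TYPE('a) k) + ennreal (3 ^ ?n * dvol TYPE('a) k))"
    unfolding emeasure_trip by (intro mult_left_mono add_mono le) auto
   also have "\<dots> = ennreal (?X * (2 * 3 ^ ?n) * dvol TYPE('a) k)"
    by (simp add: ennreal_plus[symmetric] ennreal_mult[symmetric] mult_ac del: ennreal_plus)
   finally have "epow (\<integral>y\<in>dc k x. ?f3 y) \<gamma> \<le> epow (ennreal (?X * (2 * 3 ^ ?n) * dvol TYPE('a) k)) \<gamma>"
    using \<gamma> by (intro epow_mono) auto
   also have "\<dots> = ennreal ((?X * (2 * 3 ^ ?n)) powr \<gamma>) * epow ?V \<gamma>"
    by (rule epow_ennreal_mult) auto
   also have "(?X * (2 * 3 ^ ?n)) powr \<gamma> \<le> s powr (1 / r) * (2 * 3 ^ ?n * exp 4 * 2 powr \<kappa>) * 2 powr (- (real i * \<kappa> / r))"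
   proof -
    have "(?X * (2 * 3 ^ ?n)) powr \<gamma> = (s powr (1 / (r * \<gamma>))) powr \<gamma> * (2 * 3 ^ ?n * exp 4) powr \<gamma> * (2 powr (- (real i * \<kappa>))) powr \<gamma>"
     by (simp add: powr_mult)
    also have "(s powr (1 / (r * \<gamma>))) powr \<gamma> = s powr (1 / r)" using \<gamma> by (simp add: powr_powr)
    also have "(2 * 3 ^ ?n * exp 4) powr \<gamma> \<le> (2 * 3 ^ ?n * exp 4) powr 1"
    proof (rule powr_mono)
     have "(1::real) * 1 * 1 \<le> 2 * 3 ^ ?n * exp 4" by (intro mult_mono) auto
     then show "(1::real) \<le> 2 * 3 ^ ?n * exp 4" by simp
    qed (use \<gamma> in auto)
    also have "(2 powr (- (real i * \<kappa>))) powr \<gamma> = 2 powr (- (real i * \<kappa>) * \<gamma>)" by (rule powr_powr)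
    also have "\<dots> \<le> 2 powr (\<kappa> + - (real i * \<kappa> / r))"
    proof (rule powr_mono)
     \<comment> \<open>The exponent \<gamma> falls short of \<open>1 / r\<close> by
       \<open>2 * \<eta>\<close>; since \<open>i * \<eta>\<close> stays bounded, this costs at most
       the factor \<open>2 powr \<kappa>\<close>.\<close>
     have "real i * \<eta> \<le> 1 / 2"
     proof -
      have "real i \<le> 2 ^ i" by (simp add: less_imp_le)
      then have "real i * \<eta>0 \<le> 2 ^ i * (1 / 32)" using \<eta>0 by (intro mult_mono) auto
      then have "real i * \<eta> \<le> 1 / 32" by (simp add: \<eta>_def field_simps)
      then show ?thesis by simp
     qed
     then have "2 * \<kappa> * (real i * \<eta>) \<le> 2 * \<kappa> * (1/2)" using \<kappa> by (intro mult_left_mono) auto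
     then show "- (real i * \<kappa>) * \<gamma> \<le> \<kappa> + - (real i * \<kappa> / r)" by (simp add: \<gamma>_def algebra_simps)
    qed auto
    also have "2 powr (\<kappa> + - (real i * \<kappa> / r)) = 2 powr \<kappa> * 2 powr (- (real i * \<kappa> / r))" by (rule powr_add)
    finally show ?thesis by (simp add: mult_left_mono mult_right_mono mult_ac)
   qed
   finally have A3: "epow (\<integral>y\<in>dc k x. ?f3 y) \<gamma> \<le> ennreal (s powr (1 / r) * (2 * 3 ^ ?n * exp 4 * 2 powr \<kappa>) * 2 powr (- (real i * \<kappa> / r))) * epow ?V \<gamma>"
    by (simp add: mult_right_mono ennreal_leI)
   show ?thesis by (intro mult_mono A1 A2 A3) auto
  qed
  also have "\<dots> = ennreal ((((real m / \<eta>0 + 1) / \<theta>) ^ m * (exp \<theta> * J) * 2 powr (real i * real m)) * (s powr (1 / r) * (2 * 3 ^ ?n * exp 4 * 2 powr \<kappa>) * 2 powr (- (real i * \<kappa> / r)))) *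
    (epow ?V \<eta> * epow ?V \<beta> * epow ?V \<gamma>) * epow (dmax ?f2 x) \<beta>"
  proof -
   have "0 \<le> ((real m / \<eta>0 + 1) / \<theta>) ^ m * (exp \<theta> * J) * 2 powr (real i * real m)" using \<eta>0 \<theta> J by simp
   then show ?thesis by (subst ennreal_mult) (auto simp: mult_ac)
  qed
  also have "epow ?V \<eta> * epow ?V \<beta> * epow ?V \<gamma> = ?V" unfolding epow_add[symmetric] sum by simp
  also have "(((real m / \<eta>0 + 1) / \<theta>) ^ m * (exp \<theta> * J) * 2 powr (real i * real m)) * (s powr (1 / r) * (2 * 3 ^ ?n * exp 4 * 2 powr \<kappa>) * 2 powr (- (real i * \<kappa> / r)))
    = (C * 2 powr (real i * (real m - \<kappa> / r))) * s powr (1 / r)"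
  proof -
   have "2 powr (real i * (real m - \<kappa> / r)) = 2 powr (real i * real m) * 2 powr (- (real i * \<kappa> / r))"
    unfolding powr_add[symmetric] by (simp add: right_diff_distrib)
   then show ?thesis by (simp add: C_def mult_ac)
  qed
  also have "ennreal (C * 2 powr (real i * (real m - \<kappa> / r)) * s powr (1 / r)) = ennreal (C * 2 powr (real i * (real m - \<kappa> / r))) * ennreal (s powr (1 / r))"
   using C by (intro ennreal_mult) auto
  finally show ?thesis unfolding \<beta>_def \<eta>_def .
 qed
 show ?thesis by (rule exI[of _ C], rule conjI[OF C], intro allI impI, rule main) auto
qed

end

context bmo_data
begin

text \<open>\<open>Wq\<close> normalises \<open>w\<close> on each triple as a Luxemburg norm would,
  and \<open>W\<close> is a function above all these numbers. \<open>H\<close> stands in for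
  \<open>f\<close>: its weighted averages have to dominate those of \<open>f\<close> only on cells
  where \<open>w\<close> does not vanish.\<close>

abbreviation bimax_estimate :: "nat \<Rightarrow> real \<Rightarrow> real \<Rightarrow> real \<Rightarrow> real \<Rightarrow> real \<Rightarrow> bool" where
 "bimax_estimate m r \<kappa> \<tau> CH K \<equiv> (\<forall>w Wq W f H g. lm w \<longrightarrow> (\<forall>y. w y \<ge> 0) \<longrightarrow> lm W \<longrightarrow>
   H \<in> borel_measurable lebesgue \<longrightarrow> lm g \<longrightarrow> (\<forall>k x. Wq k x \<ge> 0) \<longrightarrow>
   (\<forall>k x. AE y. y \<in> trip k x \<longrightarrow> ennreal (Wq k x) \<le> W y) \<longrightarrow>
   (\<forall>k x. Wq k x > 0 \<longrightarrow> (\<integral>y\<in>trip k x. ennreal (phi \<kappa> (w y / Wq k x))) \<le> ennreal (3 ^ DIM('a) * dvol TYPE('a) k)) \<longrightarrow>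
   (\<forall>k x. Wq k x = 0 \<longrightarrow> (AE y. y \<in> dc k x \<longrightarrow> w y = 0)) \<longrightarrow>
   (\<forall>k x. \<not> (AE y. y \<in> dc k x \<longrightarrow> w y = 0) \<longrightarrow>
    (bmean m b c k x f) \<le> ennreal CH * (bmean m b c k x H)) \<longrightarrow>
   (\<integral>x. bimax m b c f (\<lambda>y. g y * ennreal (w y)) x)
    \<le> ennreal K * (\<integral>y. epow (H y) r * W y) + ennreal \<tau> * (\<integral>y. epow (g y) (r / (r - 1)) * ennreal (w y)))"

text \<open>At each point the bilinear maximal function is at most \<open>M1\<close> times a
  geometrically weighted sum of maximal functions of \<open>gt\<close>, one for each level.
  \<open>Wq\<close> to the power \<open>1 / r\<close> is moved from the side of \<open>g\<close> to
  that of \<open>f\<close>, where \<open>W\<close> majorises it; Young's inequality and the maximal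
  theorem finish.\<close>

lemma bimax_bound:
 assumes r: "1 < r" "r < 2" and \<kappa>: "\<kappa> > (real m + 1) * r - 1" and \<tau>: "\<tau> > 0" and CH: "CH > 0"
 shows "\<exists>K>0. bimax_estimate m r \<kappa> \<tau> CH K"
proof -
 define r' where "r' = r / (r - 1)"
 define \<eta>0 where "\<eta>0 = 1 / (16 * r')"
 have r': "r' > 2" using r by (simp add: r'_def field_simps)
 have conj: "1 / r + 1 / r' = 1" using r by (simp add: r'_def field_simps)
 have mr: "(real m + 1) * r \<ge> 1 * 1" using r by (intro mult_mono) auto
 then have \<kappa>0: "\<kappa> \<ge> 0" using \<kappa> by simp
 \<comment> \<open>The gain of the bump minus the costs of \<open>bw\<close> and of the maximal
   theorem; its positivity is the hypothesis on \<kappa>.\<close>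
 define \<delta> where "\<delta> = \<kappa> / r - real m - 1 / r'"
 have \<delta>: "\<delta> > 0"
 proof -
  have "\<kappa> / r > ((real m + 1) * r - 1) / r" using \<kappa> r by (intro divide_strict_right_mono) auto
  also have "((real m + 1) * r - 1) / r = real m + 1 - 1 / r" using r by (simp add: diff_divide_distrib)
  finally show ?thesis using conj by (simp add: \<delta>_def)
 qed
 obtain CB where CB: "CB > 0" "\<And>w s k x i g. lm w \<Longrightarrow> (\<forall>y. w y \<ge> 0) \<Longrightarrow> lm g \<Longrightarrow> s > 0 \<Longrightarrow>
   (\<integral>y\<in>trip k x. ennreal (phi \<kappa> (w y / s))) \<le> ennreal (3 ^ DIM('a) * dvol TYPE('a) k) \<Longrightarrow>
   (\<integral>y\<in>dc k x. ennreal (bw m b (c k x) y) * (g y * ennreal (w y powr (1 / r))) * indicator {y. lev i (w y / s)} y)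
   \<le> ennreal (CB * 2 powr (real i * (real m - \<kappa> / r))) * ennreal (s powr (1 / r)) * ennreal (dvol TYPE('a) k) *
    epow (dmax (\<lambda>y. epow (g y) (1 / (1 / r' + \<eta>0 / 2 ^ i))) x) (1 / r' + \<eta>0 / 2 ^ i)"
  using g_side[OF r \<kappa>0, of m] unfolding r'_def \<eta>0_def by blast
 let ?cb = "\<lambda>i. CB * 2 powr (real i * (real m - \<kappa> / r))"
 \<comment> \<open>An exponent strictly between 1 and \<open>r\<close>, so that the maximal theorem
   applies to \<open>M1\<close> with exponent \<open>r / s\<close>.\<close>
 define s where "s = (1 + r) / 2"
 have s: "1 < s" "s < r" "r / s > 1" "r / s \<le> 2" using r by (auto simp: s_def field_simps)
 define CA where "CA = ((real m * (s / (s - 1)) + 1) / \<theta>) ^ m * (exp \<theta> * J)"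
 have CA: "CA > 0" using s \<theta> J by (auto simp: CA_def intro!: mult_pos_pos zero_less_power divide_pos_pos add_nonneg_pos)
 define A where "A = CH * CA * CB"
 have A: "A > 0" using CH CA CB by (simp add: A_def)
 have q: "0 < 2 powr - \<delta>" "2 powr - \<delta> < (1::real)" using \<delta> by (auto simp: powr_less_one)
 define A' where "A' = A * (1 / (1 - 2 powr - \<delta>))"
 have A': "A' > 0" using A q by (simp add: A'_def)
 define Cn where "Cn = 2 * 3 ^ DIM('a) * (4 * 3 ^ DIM('a))\<^sup>2 * (1::real)"
 have Cn: "Cn > 0" by (simp add: Cn_def)
 \<comment> \<open>After the maximal theorem, with factor \<open>16 * Cn\<close>, and the sum over
   the levels, with factor \<open>A'\<close>, the coefficient of the second integral is
   \<tau>.\<close>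
 define \<tau>0 where "\<tau>0 = \<tau> / (A' * (16 * Cn))"
 have \<tau>0: "\<tau>0 > 0" using \<tau> A' Cn by (simp add: \<tau>0_def)
 obtain K0 where K0: "K0 > 0" "\<And>x y. x * y \<le> ennreal K0 * epow x r + ennreal \<tau>0 * epow y r'"
  using young_eps[OF r(1) \<tau>0] unfolding r'_def by blast
 define C1 where "C1 = Cn / (r / s - 1)"
 have C1: "C1 > 0" using Cn s by (simp add: C1_def)
 define K where "K = A' * (K0 * C1)"
 have K: "K > 0" using A' K0 C1 by (simp add: K_def)
 have main: "(\<integral>x. bimax m b c f (\<lambda>y. g y * ennreal (w y)) x)
    \<le> ennreal K * (\<integral>y. epow (H y) r * W y) + ennreal \<tau> * (\<integral>y. epow (g y) r' * ennreal (w y))"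
  if w [measurable]: "lm w" and w0: "\<forall>y. w y \<ge> 0" and W [measurable]: "lm W"
   and H [measurable]: "lm H" and g [measurable]: "lm g" and Wq: "\<forall>k x. Wq k x \<ge> 0"
   and W1: "\<forall>k x. AE y. y \<in> trip k x \<longrightarrow> ennreal (Wq k x) \<le> W y"
   and W2: "\<forall>k x. Wq k x > 0 \<longrightarrow> (\<integral>y\<in>trip k x. ennreal (phi \<kappa> (w y / Wq k x))) \<le> ennreal (3 ^ DIM('a) * dvol TYPE('a) k)"
   and W3: "\<forall>k x. Wq k x = 0 \<longrightarrow> (AE y. y \<in> dc k x \<longrightarrow> w y = 0)"
   and HF: "\<forall>k x. \<not> (AE y. y \<in> dc k x \<longrightarrow> w y = 0) \<longrightarrow>
    (bmean m b c k x f) \<le> ennreal CH * (bmean m b c k x H)"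
  for w :: "'a \<Rightarrow> real" and Wq :: "int \<Rightarrow> 'a \<Rightarrow> real" and W f H g
 proof -
  \<comment> \<open>The weight is split into the powers \<open>1 / r'\<close> and
    \<open>1 / r\<close>. The first joins \<open>g\<close>, so that the \<open>r'\<close>-th power
    of \<open>gt\<close> is the integrand in the conclusion; the second is measured against
    \<open>Wq\<close>.\<close>
  define gt where "gt y = g y * ennreal (w y powr (1 / r'))" for y
  have gtm [measurable]: "lm gt" unfolding gt_def[abs_def] by measurable
  define HW where "HW y = H y * epow (W y) (1 / r)" for y
  have HWm [measurable]: "lm HW" unfolding HW_def[abs_def] by measurable
  define \<beta> where "\<beta> i = 1 / r' + \<eta>0 / 2 ^ i" for i :: nat
  define D where "D i x = epow (dmax (\<lambda>y. epow (gt y) (1 / \<beta> i)) x) (\<beta> i)" for i x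
  define M1 where "M1 x = epow (dmax (\<lambda>y. epow (HW y) s) x) (1 / s)" for x
  have [measurable]: "lm (D i)" "lm M1" for i
   unfolding D_def[abs_def] M1_def[abs_def] by measurable
  \<comment> \<open>The maximal theorem at exponent \<open>1 + 1 / (16 * 2 ^ i)\<close> costs
    \<open>16 * 2 ^ i\<close>; this factor, raised to \<open>r'\<close>, cancels the
    \<open>2 ^ i\<close>.\<close>
  let ?D = "\<lambda>i x. ennreal (2 powr (- (real i / r'))) * D i x"
  have gw: "g y * ennreal (w y) = gt y * ennreal (w y powr (1 / r))" for y
  proof -
   have "w y = w y powr (1 / r' + 1 / r)" using conj w0 by (simp add: add.commute)
   also have "\<dots> = w y powr (1 / r') * w y powr (1 / r)" by (rule powr_add)
   finally have "ennreal (w y) = ennreal (w y powr (1 / r')) * ennreal (w y powr (1 / r))" by (simp add: ennreal_mult[symmetric])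
   then show ?thesis by (simp add: gt_def mult.assoc)
  qed
  have pt: "bimax m b c f (\<lambda>y. g y * ennreal (w y)) x \<le> (\<Sum>i. ennreal (A * (2 powr - \<delta>) ^ i) * (M1 x * (?D i x)))" (is "_ \<le> ?S") for x
   unfolding bimax_def
  proof (rule SUP_least)
   fix k :: int
   let ?V = "ennreal (dvol TYPE('a) k)"
   let ?X = "\<integral>\<^sup>+y\<in>trip k x. ennreal (bw m b (c k x) y) * f y \<partial>lebesgue"
   let ?Y = "\<integral>\<^sup>+y\<in>dc k x. ennreal (bw m b (c k x) y) * (g y * ennreal (w y)) \<partial>lebesgue"
   show "?X / ?V * (?Y / ?V) \<le> ?S"
   proof (cases "AE y. y \<in> dc k x \<longrightarrow> w y = 0")
    case True
    then have "AE y. ennreal (bw m b (c k x) y) * (g y * ennreal (w y)) * indicator (dc k x) y = 0"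
     by eventually_elim (auto simp: indicator_def)
    then have "?Y = 0" by (subst nn_integral_0_iff_AE) auto
    then show ?thesis by simp
   next
    case nz: False
    let ?W = "Wq k x"
    have Wp: "?W > 0" using W3 nz Wq by (metis less_eq_real_def)
    have le: "(\<integral>y\<in>trip k x. ennreal (phi \<kappa> (w y / ?W))) \<le> ennreal (3 ^ DIM('a) * dvol TYPE('a) k)"
     using W2 Wp by blast
    have "?Y = (\<integral>y\<in>dc k x. ennreal (bw m b (c k x) y) * (gt y * ennreal (w y powr (1 / r))))"
     by (simp only: gw)
    also have "\<dots> \<le> (\<integral>y. (\<Sum>i. ennreal (bw m b (c k x) y) * (gt y * ennreal (w y powr (1 / r))) * indicator {y. lev i (w y / ?W)} y * indicator (dc k x) y))"
    proof (rule nn_integral_mono)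
     fix y
     obtain i where i: "lev i (w y / ?W)" using lev_ex by blast
     define h where "h i = ennreal (bw m b (c k x) y) * (gt y * ennreal (w y powr (1 / r))) * indicator {y. lev i (w y / ?W)} y * indicator (dc k x) y" for i
     have "ennreal (bw m b (c k x) y) * (gt y * ennreal (w y powr (1 / r))) * indicator (dc k x) y = h i"
      using i by (simp add: h_def)
     also have "\<dots> = sum h {i}" by simp
     also have "\<dots> \<le> suminf h" by (rule sum_le_suminf) auto
     finally show "ennreal (bw m b (c k x) y) * (gt y * ennreal (w y powr (1 / r))) * indicator (dc k x) y \<le> (\<Sum>i. ennreal (bw m b (c k x) y) * (gt y * ennreal (w y powr (1 / r))) * indicator {y. lev i (w y / ?W)} y * indicator (dc k x) y)"
      by (simp only: h_def[abs_def])
    qed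
    also have "\<dots> = (\<Sum>i. (\<integral>y\<in>dc k x. ennreal (bw m b (c k x) y) * (gt y * ennreal (w y powr (1 / r))) * indicator {y. lev i (w y / ?W)} y))"
    proof (rule nn_integral_suminf)
     fix i
     have [measurable]: "{y. lev i (w y / ?W)} \<in> sets lebesgue" by (rule lev_measurable[OF w])
     show "lm (\<lambda>y. ennreal (bw m b (c k x) y) * (gt y * ennreal (w y powr (1 / r))) * indicator {y. lev i (w y / ?W)} y * indicator (dc k x) y)"
      by measurable
    qed
    also have "\<dots> \<le> (\<Sum>i. ennreal (?W powr (1 / r)) * ?V * (ennreal (?cb i) * D i x))"
    proof (intro suminf_le allI)
     fix i
     have "(\<integral>y\<in>dc k x. ennreal (bw m b (c k x) y) * (gt y * ennreal (w y powr (1 / r))) * indicator {y. lev i (w y / ?W)} y)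
      \<le> ennreal (?cb i) * ennreal (?W powr (1 / r)) * ?V * D i x"
      unfolding D_def \<beta>_def by (rule CB(2)[OF w w0 gtm Wp le])
     then show "(\<integral>y\<in>dc k x. ennreal (bw m b (c k x) y) * (gt y * ennreal (w y powr (1 / r))) * indicator {y. lev i (w y / ?W)} y)
      \<le> ennreal (?W powr (1 / r)) * ?V * (ennreal (?cb i) * D i x)" by (simp add: mult_ac)
    qed auto
    also have "\<dots> = ennreal (?W powr (1 / r)) * ?V * (\<Sum>i. ennreal (?cb i) * D i x)"
     by (rule ennreal_suminf_cmult)
    finally have Y: "?Y / ?V \<le> ennreal (?W powr (1 / r)) * (\<Sum>i. ennreal (?cb i) * D i x)"
     by (subst ennreal_divide_le_iff) (auto simp: mult_ac)
    have "?X * ennreal (?W powr (1 / r)) \<le> ennreal CH * (bmean m b c k x H) * ennreal (?W powr (1 / r))"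
     using HF nz by (intro mult_right_mono) auto
    also have "\<dots> = ennreal CH * (\<integral>y. ennreal (bw m b (c k x) y) * H y * indicator (trip k x) y * ennreal (?W powr (1 / r)))"
     by (subst nn_integral_multc) (auto simp: mult.assoc)
    also have "\<dots> \<le> ennreal CH * (\<integral>y\<in>trip k x. ennreal (bw m b (c k x) y) * HW y)"
    proof (intro mult_left_mono nn_integral_mono_AE)
     have "AE y. y \<in> trip k x \<longrightarrow> ennreal ?W \<le> W y" using W1 by blast
     then show "AE y. ennreal (bw m b (c k x) y) * H y * indicator (trip k x) y * ennreal (?W powr (1 / r)) \<le> ennreal (bw m b (c k x) y) * HW y * indicator (trip k x) y"
     proof eventually_elim
      case (elim y)
      show ?case
      proof (cases "y \<in> trip k x")
       case True
       have "ennreal (?W powr (1 / r)) = epow (ennreal ?W) (1 / r)" using Wp by (simp add: epow_ennreal)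
       also have "\<dots> \<le> epow (W y) (1 / r)" using elim True r by (intro epow_mono) auto
       finally show ?thesis using True by (simp add: HW_def mult.assoc mult_left_mono)
      qed simp
     qed
    qed simp
    also have "\<dots> \<le> ennreal CH * (ennreal CA * ?V * M1 x)"
     unfolding CA_def M1_def by (intro mult_left_mono f_side s(1)) measurable
    finally have X: "?X / ?V * ennreal (?W powr (1 / r)) \<le> ennreal CH * (ennreal CA * M1 x)"
    proof -
     assume *: "?X * ennreal (?W powr (1 / r)) \<le> ennreal CH * (ennreal CA * ?V * M1 x)"
     have "?X / ?V * ennreal (?W powr (1 / r)) = ?X * ennreal (?W powr (1 / r)) / ?V"
      by (simp add: ennreal_times_divide mult.commute)
     also have "\<dots> \<le> ennreal CH * (ennreal CA * M1 x)"
      using * by (subst ennreal_divide_le_iff) (auto simp: mult_ac)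
     finally show ?thesis .
    qed
    have "?X / ?V * (?Y / ?V) \<le> ?X / ?V * (ennreal (?W powr (1 / r)) * (\<Sum>i. ennreal (?cb i) * D i x))"
     by (intro mult_left_mono Y) simp
    also have "\<dots> = (?X / ?V * ennreal (?W powr (1 / r))) * (\<Sum>i. ennreal (?cb i) * D i x)"
     by (simp only: mult.assoc)
    also have "\<dots> \<le> (ennreal CH * (ennreal CA * M1 x)) * (\<Sum>i. ennreal (?cb i) * D i x)"
     by (intro mult_right_mono X) simp
    also have "\<dots> = (\<Sum>i. ennreal CH * (ennreal CA * M1 x) * (ennreal (?cb i) * D i x))"
     by (rule ennreal_suminf_cmult[symmetric])
    also have "\<dots> = ?S"
    proof (rule suminf_cong)
     fix i
     have e: "2 powr (real i * (real m - \<kappa> / r)) = (2 powr - \<delta>) ^ i * 2 powr (- (real i / r'))"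
     proof -
      have "(2 powr - \<delta>) ^ i = 2 powr (real i * - \<delta>)" by (simp add: powr_realpow[symmetric] powr_powr mult.commute)
      then have "(2 powr - \<delta>) ^ i * 2 powr (- (real i / r')) = 2 powr (real i * - \<delta> + - (real i / r'))" by (simp only: powr_add)
      also have "real i * - \<delta> + - (real i / r') = real i * (real m - \<kappa> / r)" by (simp add: \<delta>_def algebra_simps)
      finally show ?thesis by simp
     qed
     have "ennreal (A * (2 powr - \<delta>) ^ i) * ennreal (2 powr (- (real i / r'))) = ennreal CH * ennreal CA * ennreal (?cb i)"
      using CH CA CB(1) by (simp add: ennreal_mult[symmetric] A_def e mult_ac)
     then show "ennreal CH * (ennreal CA * M1 x) * (ennreal (?cb i) * D i x) =
      ennreal (A * (2 powr - \<delta>) ^ i) * (M1 x * (?D i x))"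
      by (simp only: mult_ac)
    qed
    finally show ?thesis .
   qed
  qed
  define I1 where "I1 = (\<integral>y. epow (H y) r * W y)"
  define I2 where "I2 = (\<integral>y. epow (g y) r' * ennreal (w y))"
  have M1i: "(\<integral>x. epow (M1 x) r) \<le> ennreal C1 * I1"
  proof -
   have "(\<integral>x. epow (M1 x) r) = (\<integral>x. epow (dmax (\<lambda>y. epow (HW y) s) x) (r / s))"
    by (simp add: M1_def epow_epow)
   also have "\<dots> \<le> ennreal (2 * 3 ^ DIM('a) * (4 * 3 ^ DIM('a))\<^sup>2 / (r / s - 1)) * (\<integral>y. epow (epow (HW y) s) (r / s))"
    by (rule dmax_strong[OF _ s(3,4)]) measurable
   also have "(\<integral>y. epow (epow (HW y) s) (r / s)) = I1"
    unfolding I1_def HW_def using s r by (simp add: epow_epow epow_mult)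
   finally show ?thesis by (simp add: C1_def Cn_def)
  qed
  have Di: "(\<integral>x. epow (?D i x) r') \<le> ennreal (16 * Cn) * I2" for i
  proof -
   have \<beta>: "\<beta> i > 0" using r' by (auto simp: \<beta>_def \<eta>0_def intro!: add_pos_pos)
   have P: "\<beta> i * r' = 1 + 1 / (16 * 2 ^ i)" using r' by (simp add: \<beta>_def \<eta>0_def field_simps)
   have P1: "\<beta> i * r' > 1" "\<beta> i * r' \<le> 2"
   proof -
    have "(1::real) \<le> 16 * 2 ^ i" using one_le_power[of "2::real" i] by linarith
    then have "1 / (16 * 2 ^ i) \<le> (1::real)" by simp
    then show "\<beta> i * r' > 1" "\<beta> i * r' \<le> 2" unfolding P by auto
   qed
   have "(\<integral>x. epow (?D i x) r') = (\<integral>x. ennreal (2 powr (- real i)) * epow (dmax (\<lambda>y. epow (gt y) (1 / \<beta> i)) x) (\<beta> i * r'))"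
    using r' by (simp add: D_def epow_mult epow_epow epow_ennreal powr_powr)
   also have "\<dots> = ennreal (2 powr (- real i)) * (\<integral>x. epow (dmax (\<lambda>y. epow (gt y) (1 / \<beta> i)) x) (\<beta> i * r'))"
    by (rule nn_integral_cmult) measurable
   also have "\<dots> \<le> ennreal (2 powr (- real i)) * (ennreal (2 * 3 ^ DIM('a) * (4 * 3 ^ DIM('a))\<^sup>2 / (\<beta> i * r' - 1)) * (\<integral>y. epow (epow (gt y) (1 / \<beta> i)) (\<beta> i * r')))"
    by (intro mult_left_mono dmax_strong P1) measurable
   also have "(\<integral>y. epow (epow (gt y) (1 / \<beta> i)) (\<beta> i * r')) = I2"
    unfolding I2_def gt_def using \<beta> r' w0 by (simp add: epow_epow epow_mult epow_ennreal powr_powr)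
   also have "ennreal (2 powr (- real i)) * (ennreal (2 * 3 ^ DIM('a) * (4 * 3 ^ DIM('a))\<^sup>2 / (\<beta> i * r' - 1)) * I2)
     = ennreal (16 * Cn) * I2"
   proof -
    have "2 powr (- real i) * (2 * 3 ^ DIM('a) * (4 * 3 ^ DIM('a))\<^sup>2 / (\<beta> i * r' - 1)) = 16 * Cn"
     unfolding P Cn_def by (simp add: powr_minus powr_realpow)
    then show ?thesis unfolding mult.assoc[symmetric] by (subst ennreal_mult[symmetric]) (use P1 in auto)
   qed
   finally show ?thesis .
  qed
  have "(\<integral>x. bimax m b c f (\<lambda>y. g y * ennreal (w y)) x)
   \<le> (\<integral>x. (\<Sum>i. ennreal (A * (2 powr - \<delta>) ^ i) * (M1 x * (?D i x))))"
   by (intro nn_integral_mono pt)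
  also have "\<dots> = (\<Sum>i. (\<integral>x. ennreal (A * (2 powr - \<delta>) ^ i) * (M1 x * (?D i x))))"
   by (rule nn_integral_suminf) measurable
  also have "\<dots> \<le> (\<Sum>i. (ennreal K0 * (ennreal C1 * I1) + ennreal \<tau>0 * (ennreal (16 * Cn) * I2)) * ennreal (A * (2 powr - \<delta>) ^ i))"
  proof (intro suminf_le allI)
   fix i
   have "(\<integral>x. M1 x * (?D i x)) \<le>
    (\<integral>x. ennreal K0 * epow (M1 x) r + ennreal \<tau>0 * epow (?D i x) r')"
    by (intro nn_integral_mono K0(2))
   also have "\<dots> = ennreal K0 * (\<integral>x. epow (M1 x) r) + ennreal \<tau>0 * (\<integral>x. epow (?D i x) r')"
    by (subst nn_integral_add) (auto simp: nn_integral_cmult)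
   also have "\<dots> \<le> ennreal K0 * (ennreal C1 * I1) + ennreal \<tau>0 * (ennreal (16 * Cn) * I2)"
    by (intro add_mono mult_left_mono M1i Di) auto
   finally have *: "(\<integral>x. M1 x * (?D i x)) \<le> ennreal K0 * (ennreal C1 * I1) + ennreal \<tau>0 * (ennreal (16 * Cn) * I2)" .
   have "(\<integral>x. ennreal (A * (2 powr - \<delta>) ^ i) * (M1 x * (?D i x)))
     = ennreal (A * (2 powr - \<delta>) ^ i) * (\<integral>x. M1 x * (?D i x))"
    by (rule nn_integral_cmult) measurable
   also have "\<dots> \<le> ennreal (A * (2 powr - \<delta>) ^ i) * (ennreal K0 * (ennreal C1 * I1) + ennreal \<tau>0 * (ennreal (16 * Cn) * I2))"
    by (intro mult_left_mono *) auto
   finally show "(\<integral>x. ennreal (A * (2 powr - \<delta>) ^ i) * (M1 x * (?D i x)))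
    \<le> (ennreal K0 * (ennreal C1 * I1) + ennreal \<tau>0 * (ennreal (16 * Cn) * I2)) * ennreal (A * (2 powr - \<delta>) ^ i)" by (simp only: mult.commute)
  qed auto
  also have "\<dots> = (ennreal K0 * (ennreal C1 * I1) + ennreal \<tau>0 * (ennreal (16 * Cn) * I2)) * (\<Sum>i. ennreal (A * (2 powr - \<delta>) ^ i))"
   by (rule ennreal_suminf_cmult)
  also have "(\<Sum>i. ennreal (A * (2 powr - \<delta>) ^ i)) = ennreal (\<Sum>i. A * (2 powr - \<delta>) ^ i)"
   by (rule suminf_ennreal2) (use A q in \<open>auto intro!: summable_mult summable_geometric\<close>)
  also have "(\<Sum>i. A * (2 powr - \<delta>) ^ i) = A'"
   unfolding A'_def using q by (subst suminf_mult) (auto intro!: summable_geometric simp: suminf_geometric)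
  also have "(ennreal K0 * (ennreal C1 * I1) + ennreal \<tau>0 * (ennreal (16 * Cn) * I2)) * ennreal A' = ennreal K * I1 + ennreal \<tau> * I2"
  proof -
   have "ennreal K = ennreal A' * (ennreal K0 * ennreal C1)" using A' K0(1) C1 by (simp add: K_def ennreal_mult)
   moreover have "ennreal \<tau> = ennreal \<tau>0 * ennreal (16 * Cn) * ennreal A'"
   proof -
    have e: "\<tau> = \<tau>0 * (16 * Cn) * A'" using A' Cn by (simp add: \<tau>0_def)
    show ?thesis unfolding e using A' \<tau>0 Cn by (subst ennreal_mult, simp, simp, subst ennreal_mult) auto
   qed
   ultimately show ?thesis by (simp add: distrib_left distrib_right mult_ac)
  qed
  finally show ?thesis unfolding I1_def I2_def .
 qed
 show ?thesis unfolding r'_def[symmetric] by (rule exI[of _ K], rule conjI[OF K], intro allI impI, rule main) assumption+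
qed

end

section \<open>The strong type estimate for the commutator by duality and absorption\<close>

lemma ennreal_absorb:
 fixes A Y :: ennreal
 assumes "Y \<le> A + ennreal (1 / 2) * Y" "Y < \<infinity>"
 shows "Y \<le> ennreal 2 * A"
proof (cases "A = \<infinity>")
 case False
 then obtain a where a: "A = ennreal a" "a \<ge> 0" by (cases A) auto
 obtain y where y: "Y = ennreal y" "y \<ge> 0" using assms(2) by (cases Y) auto
 have "ennreal (1 / 2) * ennreal y = ennreal (1 / 2 * y)" using y by (subst ennreal_mult) auto
 then have "ennreal y \<le> ennreal (a + 1 / 2 * y)" using assms(1) a y by (simp add: ennreal_plus)
 then have "y \<le> 2 * a" using a y by (subst (asm) ennreal_le_iff) auto
 then have "ennreal y \<le> ennreal (2 * a)" by (rule ennreal_leI)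
 then show ?thesis using a y by (simp add: ennreal_mult)
qed (simp add: ennreal_mult_top)

abbreviation (in czo) strong_estimate :: "('a \<Rightarrow> real) \<Rightarrow> (int \<Rightarrow> 'a \<Rightarrow> real) \<Rightarrow> nat \<Rightarrow> real \<Rightarrow> real \<Rightarrow> real \<Rightarrow> real \<Rightarrow> bool" where
 "strong_estimate b c m r \<kappa> CH C \<equiv> (\<forall>F S w Wq W H. adm b F \<longrightarrow> bounded S \<longrightarrow> (\<forall>x. x \<notin> S \<longrightarrow> F x = 0) \<longrightarrow>
   finite_means m b c F \<longrightarrow>
   w \<in> borel_measurable lebesgue \<longrightarrow> (\<forall>y. w y \<ge> 0) \<longrightarrow> lm W \<longrightarrow>
   H \<in> borel_measurable lebesgue \<longrightarrow> (\<forall>k x. Wq k x \<ge> 0) \<longrightarrow>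
   (\<forall>k x. AE y. y \<in> trip k x \<longrightarrow> ennreal (Wq k x) \<le> W y) \<longrightarrow>
   (\<forall>k x. Wq k x > 0 \<longrightarrow> (\<integral>y\<in>trip k x. ennreal (phi \<kappa> (w y / Wq k x))) \<le> ennreal (3 ^ DIM('a) * dvol TYPE('a) k)) \<longrightarrow>
   (\<forall>k x. Wq k x = 0 \<longrightarrow> (AE y. y \<in> dc k x \<longrightarrow> w y = 0)) \<longrightarrow>
   (\<forall>k x. \<not> (AE y. y \<in> dc k x \<longrightarrow> w y = 0) \<longrightarrow>
    (bmean m b c k x (\<lambda>y. enorm (F y)))
     \<le> ennreal CH * (bmean m b c k x H)) \<longrightarrow>
   (\<integral>x. ennreal (cmod (commutator T b m F x) powr r * w x)) \<le> ennreal C * (\<integral>y. epow (H y) r * W y))"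

text \<open>Sparse domination is tested with the commutator's own power \<open>r - 1\<close> times
  the weight. \<open>bimax_bound\<close> then returns a small multiple of the left-hand side, which
  is absorbed; truncation makes it finite beforehand and is removed by Fatou's lemma.\<close>

lemma (in czo) comm_strong:
 assumes bd: "bmo_data b c \<theta> J"
  and r: "1 < r" "r < 2" and \<kappa>: "\<kappa> > (real m + 1) * r - 1" and CH: "CH > 0"
 shows "\<exists>C>0. strong_estimate b c m r \<kappa> CH C"
proof -
 interpret bmo_data b c \<theta> J by fact
 from sparse_domination[of m] obtain C0 where C0: "C0 > 0"
  and C02: "sparse_estimate m C0"
  by (elim exE conjE) (rule that)
 \<comment> \<open>Multiplied by \<open>C0\<close> from the sparse domination, this leaves the
   coefficient 1/2.\<close>
 have \<tau>: "1 / (2 * C0) > 0" using C0 by simp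
 from bimax_bound[OF r \<kappa> \<tau> CH] obtain K where K: "K > 0"
  and K2: "bimax_estimate m r \<kappa> (1 / (2 * C0)) CH K"
  by (elim exE conjE) (rule that)
 have main: "(\<integral>x. ennreal (cmod (commutator T b m F x) powr r * w x)) \<le> ennreal (2 * (C0 * K)) * (\<integral>y. epow (H y) r * W y)"
  if ad: "adm b F" and S: "bounded S" "\<forall>x. x \<notin> S \<longrightarrow> F x = 0"
   and fin: "finite_means m b c F"
   and w [measurable]: "lm w" and w0: "\<forall>y. w y \<ge> 0" and W [measurable]: "lm W"
   and H [measurable]: "lm H" and Wq: "\<forall>k x. Wq k x \<ge> 0"
   and W1: "\<forall>k x. AE y. y \<in> trip k x \<longrightarrow> ennreal (Wq k x) \<le> W y"
   and W2: "\<forall>k x. Wq k x > 0 \<longrightarrow> (\<integral>y\<in>trip k x. ennreal (phi \<kappa> (w y / Wq k x))) \<le> ennreal (3 ^ DIM('a) * dvol TYPE('a) k)"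
   and W3: "\<forall>k x. Wq k x = 0 \<longrightarrow> (AE y. y \<in> dc k x \<longrightarrow> w y = 0)"
   and HF: "\<forall>k x. \<not> (AE y. y \<in> dc k x \<longrightarrow> w y = 0) \<longrightarrow>
    (bmean m b c k x (\<lambda>y. enorm (F y)))
     \<le> ennreal CH * (bmean m b c k x H)"
  for F S w Wq W H
 proof -
  define I where "I = (\<integral>y. epow (H y) r * W y)"
  define h where "h x = cmod (commutator T b m F x)" for x
  have hm [measurable]: "lm h"
   unfolding h_def[abs_def] using comm_measurable[OF ad b_meas] by measurable
  \<comment> \<open>The truncation bounds the weight and the domain; together with the cut of
    \<open>h\<close> at height \<open>n\<close> it makes \<open>Z n\<close> integrable.\<close>
  define A where "A n = {x. w x \<le> real n} \<inter> ball 0 (real n)" for n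
  have wm: "{x. w x \<le> real n} \<in> sets lebesgue" for n
   using Collect_ge_lebesgue[of "\<lambda>x. - w x" "- real n"] by simp
  have Am [measurable]: "A n \<in> sets lebesgue" for n using wm by (auto simp: A_def)
  define gr where "gr n x = min (h x) (real n) powr (r - 1) * indicator (A n) x" for n x
  have [measurable]: "lm (gr n)" for n unfolding gr_def[abs_def] by measurable
  define Z where "Z n x = ennreal (min (h x) (real n) powr r * w x) * indicator (A n) x" for n x
  have Zm [measurable]: "lm (Z n)" for n unfolding Z_def[abs_def] by measurable
  have h0: "h x \<ge> 0" for x by (simp add: h_def)
  \<comment> \<open>Since \<open>(r - 1) * (r / (r - 1)) = r\<close>, the second term of
    \<open>bimax_bound\<close> is again the integral of \<open>Z n\<close>.\<close>
  have Zg: "epow (ennreal (gr n x)) (r / (r - 1)) * ennreal (w x) = Z n x" for n x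
   using r w0 h0 by (cases "x \<in> A n") (auto simp: gr_def Z_def epow_ennreal powr_powr ennreal_mult)
  have Zle: "Z n x \<le> ennreal (h x) * (ennreal (gr n x) * ennreal (w x))" for n x
  proof (cases "x \<in> A n")
   case True
   have "min (h x) n powr r \<le> h x * min (h x) n powr (r - 1)"
   proof -
    have "min (h x) n powr r = min (h x) n powr (1 + (r - 1))" by simp
    also have "\<dots> = min (h x) n powr 1 * min (h x) n powr (r - 1)" by (rule powr_add)
    also have "\<dots> \<le> h x * min (h x) n powr (r - 1)" using h0[of x] by (intro mult_right_mono) auto
    finally show ?thesis .
   qed
   then have "min (h x) n powr r * w x \<le> h x * min (h x) n powr (r - 1) * w x" using w0 by (intro mult_right_mono) auto
   then show ?thesis using True h0[of x] w0 by (simp add: Z_def gr_def ennreal_mult[symmetric] mult.assoc ennreal_leI)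
  qed (simp add: Z_def)
  have Zn: "(\<integral>x. Z n x) \<le> ennreal (2 * (C0 * K)) * I" for n
  proof -
   have "(\<integral>x. Z n x) \<le> (\<integral>x. ennreal (real n powr r * real n) * indicator (ball 0 (real n) :: 'a set) x)"
   proof (rule nn_integral_mono)
    fix x
    show "Z n x \<le> ennreal (real n powr r * real n) * indicator (ball 0 (real n)) x"
    proof (cases "x \<in> A n")
     case True
     then have "min (h x) n powr r * w x \<le> real n powr r * real n"
      using w0 h0[of x] r by (intro mult_mono powr_mono2) (auto simp: A_def)
     with True show ?thesis by (auto simp: Z_def A_def intro: ennreal_leI)
    qed (simp add: Z_def)
   qed
   also have "\<dots> = ennreal (real n powr r * real n) * leb (ball 0 (real n) :: 'a set)"
    by (rule nn_integral_cmult_indicator) simp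
   also have "\<dots> < \<infinity>"
    using emeasure_bounded_finite[OF bounded_ball, of "0::'a" "real n"] by (simp add: ennreal_mult_less_top)
   finally have Zfin: "(\<integral>x. Z n x) < \<infinity>" .
   have "(\<integral>x. Z n x) \<le> (\<integral>x. ennreal (h x) * (ennreal (gr n x) * ennreal (w x)))"
    by (intro nn_integral_mono Zle)
   also have "\<dots> \<le> ennreal C0 * (\<integral>x. bimax m b c (\<lambda>y. enorm (F y)) (\<lambda>y. ennreal (gr n y) * ennreal (w y)) x)"
    unfolding h_def using c_cell by (intro C02[rule_format, OF b_meas ad _ _ S(1)]) (use S fin in auto)
   also have "\<dots> \<le> ennreal C0 * (ennreal K * I + ennreal (1 / (2 * C0)) * (\<integral>y. epow (ennreal (gr n y)) (r / (r - 1)) * ennreal (w y)))"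
    unfolding I_def
   proof (rule mult_left_mono)
    show "(\<integral>x. bimax m b c (\<lambda>y. enorm (F y)) (\<lambda>y. ennreal (gr n y) * ennreal (w y)) x) \<le> ennreal K * (\<integral>y. epow (H y) r * W y) + ennreal (1 / (2 * C0)) * (\<integral>y. epow (ennreal (gr n y)) (r / (r - 1)) * ennreal (w y))"
     by (rule K2[rule_format, OF w _ W H _ _ W1[rule_format] W2[rule_format] W3[rule_format] HF[rule_format]]) (use w0 Wq in \<open>auto simp del: AE_iff_measurable\<close>)
   qed simp
   also have "\<dots> = ennreal (C0 * K) * I + ennreal (1 / 2) * (\<integral>x. Z n x)"
   proof -
    have "ennreal C0 * ennreal (1 / (2 * C0)) = ennreal (1 / 2)" using C0 by (subst ennreal_mult[symmetric]) auto
    moreover have "ennreal (C0 * K) = ennreal C0 * ennreal K" using C0 K by (simp add: ennreal_mult)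
    ultimately show ?thesis unfolding Zg by (simp only: distrib_left mult.assoc[symmetric])
   qed
   finally have "(\<integral>x. Z n x) \<le> ennreal 2 * (ennreal (C0 * K) * I)"
    by (rule ennreal_absorb) (rule Zfin)
   also have "\<dots> = ennreal (2 * (C0 * K)) * I"
    using C0 K by (simp add: ennreal_mult mult.assoc)
   finally show ?thesis .
  qed
  have lim: "(\<lambda>n. Z n x) \<longlonglongrightarrow> ennreal (h x powr r * w x)" for x
  proof (rule tendsto_eventually)
   have "eventually (\<lambda>n. real n \<ge> max (h x) (max (w x) (norm x + 1))) sequentially"
    by (rule eventually_sequentiallyI[of "nat \<lceil>max (h x) (max (w x) (norm x + 1))\<rceil>"]) linarith
   then show "eventually (\<lambda>n. Z n x = ennreal (h x powr r * w x)) sequentially"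
    by eventually_elim (auto simp: Z_def A_def min_def)
  qed
  have "(\<integral>x. ennreal (h x powr r * w x)) = (\<integral>x. liminf (\<lambda>n. Z n x))"
   by (intro nn_integral_cong lim_imp_Liminf[symmetric] lim) simp
  also have "\<dots> \<le> liminf (\<lambda>n. \<integral>\<^sup>+x. Z n x \<partial>lebesgue)" by (rule nn_integral_liminf) measurable
  also have "\<dots> \<le> limsup (\<lambda>n. \<integral>\<^sup>+x. Z n x \<partial>lebesgue)" by (rule Liminf_le_Limsup) simp
  also have "\<dots> \<le> ennreal (2 * (C0 * K)) * I" by (rule Limsup_bounded) (simp add: Zn)
  finally show ?thesis unfolding h_def I_def .
 qed
 have CC: "2 * (C0 * K) > 0" using C0 K by simp
 show ?thesis by (rule exI[of _ "2 * (C0 * K)"], rule conjI[OF CC], intro allI impI, rule main) assumption+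
qed

section \<open>Weights in the classes RH and A\<close>

text \<open>\<open>a k x\<close> is the average of \<open>v\<close> over \<open>dc k x\<close>, \<open>s k x\<close> that of the dual weight over \<open>trip k x\<close>. A weight is only positive
 almost everywhere; it is changed on a null set to meet the assumption \<open>v_pos\<close>.\<close>

locale muckenhoupt =
 fixes v :: "'a::euclidean_space \<Rightarrow> real" and \<alpha> :: real and a s :: "int \<Rightarrow> 'a \<Rightarrow> real" and C :: real
 assumes v_meas [measurable]: "lm v" and v_pos: "\<And>y. v y > 0" and \<alpha>_pos: "\<alpha> > 0"
  and C_ge: "C \<ge> 1" and a_pos: "\<And>k x. a k x > 0" and s_pos: "\<And>k x. s k x > 0"
  and v_dc: "\<And>k x. (\<integral>y\<in>dc k x. ennreal (v y)) = ennreal (a k x * dvol TYPE('a) k)"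
  and v_le: "\<And>k x. AE y. y \<in> trip k x \<longrightarrow> v y \<le> C * a k x"
  and a_pred: "\<And>k x. a (k - 1) x \<le> C * a k x"
  and \<sigma>_trip: "\<And>k x. (\<integral>y\<in>trip k x. ennreal (v y powr - \<alpha>)) = ennreal (s k x * (3 ^ DIM('a) * dvol TYPE('a) k))"
  and s_le: "\<And>k x. AE y. y \<in> trip k x \<longrightarrow> s k x \<le> C * v y powr - \<alpha>"

lemma nn_set_integral:
 assumes "set_integrable lebesgue Q f" "AE y. f y \<ge> 0" "Q \<in> sets lebesgue"
 shows "(\<integral>y\<in>Q. ennreal (f y)) = ennreal (LINT y:Q|lebesgue. f y)"
proof -
 have "(\<integral>y\<in>Q. ennreal (f y)) = (\<integral>y. ennreal (indicator Q y *\<^sub>R f y))"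
  by (intro nn_integral_cong) (auto simp: indicator_def)
 also have "\<dots> = ennreal (LINT y:Q|lebesgue. f y)"
  unfolding set_lebesgue_integral_def
  by (rule nn_integral_eq_integral) (use assms in \<open>auto simp: set_integrable_def\<close>)
 finally show ?thesis .
qed

lemma is_cube_measure:
 assumes "is_cube (R::'a::euclidean_space set)"
 shows "compact R" "R \<in> sets lebesgue" "measure lebesgue R > 0" "leb R = ennreal (measure lebesgue R)"
proof -
 obtain a r where R: "r > 0" "R = cbox a (a + r *\<^sub>R One)" using assms by (auto simp: is_cube_def)
 show "compact R" "R \<in> sets lebesgue" using R by auto
 have "leb R = ennreal (r ^ DIM('a))" unfolding R using R by (intro emeasure_cube) auto
 then show "measure lebesgue R > 0" "leb R = ennreal (measure lebesgue R)"
  using R(1) by (auto simp: measure_def)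
qed

text \<open>The tangent at \<open>A\<close> to the convex function \<open>t powr - \<alpha>\<close>.
  Integrated with \<open>A\<close> the mean of \<open>t\<close>, it becomes Jensen's
  inequality.\<close>

lemma powr_tangent:
 assumes "t > 0" "A > 0" "\<alpha> > (0::real)"
 shows "(1 + \<alpha>) * A powr - \<alpha> \<le> t powr - \<alpha> + \<alpha> * A powr (- \<alpha> - 1) * t"
proof -
 have "1 - \<alpha> * (t / A - 1) \<le> 1 - \<alpha> * ln (t / A)"
  using assms ln_le_minus_one[of "t / A"] by (intro diff_left_mono mult_left_mono) auto
 also have "\<dots> \<le> exp (- \<alpha> * ln (t / A))" using exp_ge_add_one_self[of "- \<alpha> * ln (t / A)"] by simp
 also have "\<dots> = (t / A) powr - \<alpha>" using assms by (simp add: powr_def)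
 also have "\<dots> = t powr - \<alpha> / A powr - \<alpha>" using assms by (simp add: powr_divide)
 finally have "A powr - \<alpha> * (1 - \<alpha> * (t / A - 1)) \<le> A powr - \<alpha> * (t powr - \<alpha> / A powr - \<alpha>)"
  by (intro mult_left_mono) auto
 then have *: "A powr - \<alpha> * (1 - \<alpha> * (t / A - 1)) \<le> t powr - \<alpha>" using assms by simp
 have "A powr (- \<alpha> - 1) = A powr - \<alpha> / A" using assms by (simp add: powr_diff)
 then have "\<alpha> * A powr (- \<alpha> - 1) * t = A powr - \<alpha> * (\<alpha> * (t / A))" by simp
 with * show ?thesis by (simp add: algebra_simps)
qed

text \<open>Jensen's inequality bounds the mean of the dual weight from below and the A condition
  bounds it from above; together they give doubling. By RH the weight is at most a multiple of its
  mean, which turns the upper bound into a pointwise bound by the dual weight itself.\<close>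

lemma RH_A_muckenhoupt:
 fixes v :: "'a::euclidean_space \<Rightarrow> real"
 assumes RH: "v \<in> RH_infty" and A: "v \<in> A_class q" and q: "q > 1"
 shows "\<exists>w a s C. muckenhoupt w (conj_exp q - 1) a s C \<and> (AE y. w y = v y)"
proof -
 define \<alpha> where "\<alpha> = conj_exp q - 1"
 have \<alpha>: "\<alpha> = 1 / (q - 1)" "\<alpha> > 0" "\<alpha> * (q - 1) = 1" using q by (auto simp: \<alpha>_def conj_exp_def field_simps)
 have vm [measurable]: "lm v" and vint: "\<And>K. compact K \<Longrightarrow> set_integrable lebesgue K v"
  and vpos: "AE x. v x > 0"
  using A by (auto simp: A_class_def is_weight_def locally_integrable_def)
 obtain C1 where C1: "\<And>Q. is_cube Q \<Longrightarrow> (AE x. x \<in> Q \<longrightarrow> v x \<le> C1 * avg v Q)"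
  using RH by (auto simp: RH_infty_def)
 have \<sigma>int: "\<And>Q. is_cube Q \<Longrightarrow> set_integrable lebesgue Q (\<lambda>x. v x powr - \<alpha>)"
  using A by (auto simp: A_class_def \<alpha>_def)
 obtain C0 where C0: "\<And>Q. is_cube Q \<Longrightarrow> avg v Q * (avg (\<lambda>x. v x powr - \<alpha>) Q) powr (q - 1) \<le> C0"
  using A by (auto simp: A_class_def \<alpha>_def)
 define w where "w x = (if v x > 0 then v x else 1)" for x
 have wm [measurable]: "lm w" unfolding w_def[abs_def] by measurable
 have wpos: "w x > 0" for x by (simp add: w_def)
 have wv: "AE x. w x = v x" using vpos by eventually_elim (simp add: w_def)
 define A where "A R = avg v R" for R
 define S where "S R = avg (\<lambda>x. v x powr - \<alpha>) R" for R
 let ?\<mu> = "measure lebesgue"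
 have IA: "(\<integral>y\<in>R. ennreal (w y)) = ennreal (A R * ?\<mu> R)" if R: "is_cube R" for R
 proof -
  note m = is_cube_measure[OF R]
  have "(\<integral>y\<in>R. ennreal (w y)) = (\<integral>y\<in>R. ennreal (v y))"
   using wv by (intro nn_integral_cong_AE) auto
  also have "\<dots> = ennreal (A R * ?\<mu> R)"
   using vpos m by (subst nn_set_integral[OF vint]) (auto simp: A_def avg_def)
  finally show ?thesis .
 qed
 have IS: "(\<integral>y\<in>R. ennreal (w y powr - \<alpha>)) = ennreal (S R * ?\<mu> R)" if R: "is_cube R" for R
 proof -
  note m = is_cube_measure[OF R]
  have "(\<integral>y\<in>R. ennreal (w y powr - \<alpha>)) = (\<integral>y\<in>R. ennreal (v y powr - \<alpha>))"
   using wv by (intro nn_integral_cong_AE) auto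
  also have "\<dots> = ennreal (S R * ?\<mu> R)"
   using m by (subst nn_set_integral[OF \<sigma>int[OF R]]) (auto simp: S_def avg_def)
  finally show ?thesis .
 qed
 have pos: "(\<integral>y\<in>R. ennreal (f y)) > 0" if R: "is_cube R" and f [measurable]: "lm f" and "\<And>y. f y > (0::real)" for R f
 proof (rule ccontr)
  note m [measurable] = is_cube_measure(2)[OF R]
  assume "\<not> ?thesis"
  then have "(\<integral>y\<in>R. ennreal (f y)) = 0" by simp
  then have "AE y. ennreal (f y) * indicator R y = 0" by (subst (asm) nn_integral_0_iff_AE) auto
  then have "AE y. y \<notin> R" by eventually_elim (use that(3) in \<open>auto simp: indicator_def ennreal_eq_0_iff not_le[symmetric] split: if_splits\<close>)
  then have "R \<in> null_sets lebesgue" using AE_iff_null_sets[OF is_cube_measure(2)[OF R]] by simp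
  then show False using is_cube_measure[OF R] by auto
 qed
 have Ap: "A R > 0" if R: "is_cube R" for R
  using pos[OF R wm wpos] IA[OF R] is_cube_measure(3)[OF R] by (simp add: zero_less_mult_iff)
 have Sp: "S R > 0" if R: "is_cube R" for R
  using pos[OF R, of "\<lambda>y. w y powr - \<alpha>"] IS[OF R] is_cube_measure(3)[OF R] wpos by (simp add: zero_less_mult_iff less_imp_neq[THEN not_sym])
 have jensen: "A R powr - \<alpha> \<le> S R" if R: "is_cube R" for R
 proof -
  note m [measurable] = is_cube_measure(2)[OF R]
  let ?A = "A R"
  have p: "?A > 0" by (rule Ap[OF R])
  have "ennreal ((1 + \<alpha>) * ?A powr - \<alpha> * ?\<mu> R) = (\<integral>y\<in>R. ennreal ((1 + \<alpha>) * ?A powr - \<alpha>))"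
   using is_cube_measure[OF R] \<alpha> by (subst nn_integral_cmult_indicator) (auto simp: ennreal_mult)
  also have "\<dots> \<le> (\<integral>y. ennreal (w y powr - \<alpha>) * indicator R y + ennreal (\<alpha> * ?A powr (- \<alpha> - 1)) * (ennreal (w y) * indicator R y))"
  proof (rule nn_integral_mono)
   fix y
   have "ennreal ((1 + \<alpha>) * ?A powr - \<alpha>) \<le> ennreal (w y powr - \<alpha> + \<alpha> * ?A powr (- \<alpha> - 1) * w y)"
    by (intro ennreal_leI powr_tangent wpos p \<alpha>)
   also have "\<dots> = ennreal (w y powr - \<alpha>) + ennreal (\<alpha> * ?A powr (- \<alpha> - 1)) * ennreal (w y)"
    using \<alpha> wpos[of y] by (simp add: ennreal_mult[symmetric])
   finally show "ennreal ((1 + \<alpha>) * ?A powr - \<alpha>) * indicator R y \<le> ennreal (w y powr - \<alpha>) * indicator R y + ennreal (\<alpha> * ?A powr (- \<alpha> - 1)) * (ennreal (w y) * indicator R y)"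
    by (auto simp: indicator_def)
  qed
  also have "\<dots> = ennreal (S R * ?\<mu> R) + ennreal (\<alpha> * ?A powr (- \<alpha> - 1)) * ennreal (A R * ?\<mu> R)"
   by (subst nn_integral_add) (auto simp: nn_integral_cmult IA[OF R] IS[OF R])
  also have "\<dots> = ennreal (S R * ?\<mu> R + \<alpha> * ?A powr (- \<alpha> - 1) * (A R * ?\<mu> R))"
   using \<alpha> Ap[OF R] Sp[OF R] by (simp add: ennreal_mult[symmetric] ennreal_plus[symmetric] del: ennreal_plus)
  finally have "(1 + \<alpha>) * ?A powr - \<alpha> * ?\<mu> R \<le> S R * ?\<mu> R + \<alpha> * ?A powr (- \<alpha> - 1) * (A R * ?\<mu> R)"
   using \<alpha> Ap[OF R] Sp[OF R] by (subst (asm) ennreal_le_iff) auto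
  also have "?A powr (- \<alpha> - 1) = ?A powr - \<alpha> / ?A" using p by (simp add: powr_diff)
  finally have "(?A powr - \<alpha>) * ?\<mu> R \<le> S R * ?\<mu> R" using p by (simp add: algebra_simps)
  then show ?thesis using is_cube_measure(3)[OF R] by simp
 qed
 have C0p: "C0 > 0"
 proof -
  have "A (dcl 0 0) * S (dcl 0 0) powr (q - 1) \<le> C0" using C0[OF is_cube_dcl] by (simp add: A_def S_def)
  moreover have "A (dcl 0 0) * S (dcl 0 0) powr (q - 1) > 0" using Ap[OF is_cube_dcl] Sp[OF is_cube_dcl] by (metis mult_pos_pos powr_gt_zero less_irrefl)
  ultimately show ?thesis by linarith
 qed
 have mono: "X R' \<le> K * X R" if "is_cube R" "is_cube R'" "R' \<subseteq> R" "?\<mu> R \<le> K * ?\<mu> R'"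
  and I: "\<And>R. is_cube R \<Longrightarrow> (\<integral>y\<in>R. g y) = ennreal (X R * ?\<mu> R)" "\<And>R. is_cube R \<Longrightarrow> X R > 0"
  for R R' K X g
 proof -
  have "ennreal (X R' * ?\<mu> R') \<le> ennreal (X R * ?\<mu> R)"
   unfolding I(1)[OF that(1), symmetric] I(1)[OF that(2), symmetric] using that(3) by (intro nn_integral_mono) (auto simp: indicator_def)
  then have "X R' * ?\<mu> R' \<le> X R * ?\<mu> R" using I(2)[OF that(1)] I(2)[OF that(2)] by (subst (asm) ennreal_le_iff) auto
  also have "\<dots> \<le> X R * (K * ?\<mu> R')" using I(2)[OF that(1)] that(4) by (intro mult_left_mono) auto
  finally have "X R' * ?\<mu> R' \<le> (K * X R) * ?\<mu> R'" by (simp add: mult_ac)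
  then show ?thesis using is_cube_measure(3)[OF that(2)] by simp
 qed
 \<comment> \<open>Jensen's inequality on \<open>R'\<close>, enlargement of the domain of the dual
   weight to \<open>R\<close>, and the A condition on \<open>R\<close>.\<close>
 have dbl: "A R \<le> C0 * K powr (q - 1) * A R'" if R: "is_cube R" "is_cube R'" "R' \<subseteq> R" "?\<mu> R \<le> K * ?\<mu> R'" and K: "K > 0" for R R' K
 proof -
  have "A R' powr - \<alpha> \<le> S R'" by (rule jensen[OF R(2)])
  also have "\<dots> \<le> K * S R" using R IS Sp by (rule mono)
  finally have "(A R' powr - \<alpha>) powr (q - 1) \<le> (K * S R) powr (q - 1)" using q by (intro powr_mono2) auto
  moreover have "(A R' powr - \<alpha>) powr (q - 1) = 1 / A R'"
   using \<alpha>(3) Ap[OF R(2)] by (simp only: powr_powr mult_minus_left) (simp add: powr_minus_divide)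
  ultimately have "1 / A R' \<le> K powr (q - 1) * S R powr (q - 1)"
   using K Sp[OF R(1)] by (simp add: powr_mult)
  then have "A R * (1 / A R') \<le> A R * (K powr (q - 1) * S R powr (q - 1))" using Ap[OF R(1)] by (intro mult_left_mono) auto
  also have "\<dots> = K powr (q - 1) * (A R * S R powr (q - 1))" by simp
  also have "\<dots> \<le> K powr (q - 1) * C0" using C0[OF R(1)] by (intro mult_left_mono) (auto simp: A_def S_def)
  finally show ?thesis using Ap[OF R(2)] by (simp add: field_simps)
 qed
 have SA: "S R \<le> (C0 / A R) powr \<alpha>" if R: "is_cube R" for R
 proof -
  have "S R powr (q - 1) \<le> C0 / A R" using C0[OF R] Ap[OF R] by (simp add: A_def S_def field_simps)
  then have "(S R powr (q - 1)) powr \<alpha> \<le> (C0 / A R) powr \<alpha>" using \<alpha> by (intro powr_mono2) auto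
  then show ?thesis using \<alpha>(3) Sp[OF R] by (simp add: powr_powr mult.commute)
 qed
 have V1: "AE y. y \<in> R \<longrightarrow> w y \<le> C1 * A R" if R: "is_cube R" for R
  using C1[OF R] wv by eventually_elim (simp add: A_def)
 \<comment> \<open>A constant \<open>C1\<close> that is not positive would force \<open>w\<close> to
   be nonpositive almost everywhere on a cube.\<close>
 have C1p: "C1 > 0"
 proof (rule ccontr)
  assume n: "\<not> ?thesis"
  note R = is_cube_dcl[of 0 "0::'a"]
  have n': "C1 * A (dcl 0 0) \<le> 0" using n Ap[OF R] by (simp add: mult_nonpos_nonneg)
  have "AE y. y \<notin> dcl 0 (0::'a)" using V1[OF R]
  proof eventually_elim
   case (elim y)
   then show ?case using n' wpos[of y] by linarith
  qed
  then have "dcl 0 (0::'a) \<in> null_sets lebesgue" using AE_iff_null_sets[OF is_cube_measure(2)[OF R]] by simp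
  then show False using is_cube_measure[OF R] by auto
 qed
 let ?n = "DIM('a)"
 \<comment> \<open>\<open>6 ^ ?n\<close> is the volume of the closed triple one level coarser
   relative to the cell, the larger of the ratios in \<open>At\<close> and
   \<open>At'\<close>.\<close>
 define D where "D = C0 * (6 ^ ?n) powr (q - 1)"
 have D: "D > 0" using C0p by (simp add: D_def)
 define a where "a k x = A (dcl k x)" for k x
 define s where "s k x = S (tcl k x)" for k x
 have m1: "?\<mu> (dcl k x) = dvol TYPE('a) k" for k and x :: 'a
  using emeasure_dcl[of k x] by (simp add: measure_def)
 have m2: "?\<mu> (tcl k x) = 3 ^ ?n * dvol TYPE('a) k" for k and x :: 'a
  using emeasure_tcl[of k x] by (simp add: measure_def)
 have At: "A (tcl k x) \<le> D * a k x" for k x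
  unfolding a_def D_def
 proof (rule dbl[OF is_cube_tcl is_cube_dcl])
  show "dcl k x \<subseteq> tcl k x" using dcl_trip trip_tcl by blast
  have "(3::real) ^ ?n \<le> 6 ^ ?n" by (intro power_mono) auto
  then show "?\<mu> (tcl k x) \<le> 6 ^ ?n * ?\<mu> (dcl k x)" by (simp add: m1 m2)
 qed simp
 have At': "A (tcl (k - 1) x) \<le> D * a k x" for k x
  unfolding a_def D_def
 proof (rule dbl[OF is_cube_tcl is_cube_dcl])
  show "dcl k x \<subseteq> tcl (k - 1) x" using dcl_trip trip_tcl trip_pred by blast
  have "(3::real) ^ ?n * 2 ^ ?n = 6 ^ ?n" by (simp add: power_mult_distrib[symmetric])
  then show "?\<mu> (tcl (k - 1) x) \<le> 6 ^ ?n * ?\<mu> (dcl k x)" by (simp add: m1 m2 dvol_pred mult.assoc[symmetric])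
 qed simp
 have ap: "a k x > 0" for k x unfolding a_def by (rule Ap[OF is_cube_dcl])
 have a1: "a (k - 1) x \<le> 3 ^ ?n * D * a k x" for k x
 proof -
  have "a (k - 1) x \<le> 3 ^ ?n * A (tcl (k - 1) x)"
   unfolding a_def
  proof (rule mono[OF is_cube_tcl is_cube_dcl _ _ IA Ap])
   show "dcl (k - 1) x \<subseteq> tcl (k - 1) x" using dcl_trip trip_tcl by blast
  qed (auto simp: m1 m2)
  also have "\<dots> \<le> 3 ^ ?n * (D * a k x)" by (intro mult_left_mono At') auto
  finally show ?thesis by (simp add: mult.assoc)
 qed
 have s1: "AE y. y \<in> trip k x \<longrightarrow> s k x \<le> (C0 * C1) powr \<alpha> * w y powr - \<alpha>" for k x
  using V1[OF is_cube_tcl[of k x]]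
 proof eventually_elim
  case (elim y)
  show ?case
  proof
   assume "y \<in> trip k x"
   then have le: "w y \<le> C1 * A (tcl k x)" using elim trip_tcl by blast
   have "s k x \<le> (C0 / A (tcl k x)) powr \<alpha>" unfolding s_def by (rule SA[OF is_cube_tcl])
   also have "\<dots> = (C0 * C1) powr \<alpha> * (C1 * A (tcl k x)) powr - \<alpha>"
    using C0p C1p Ap[OF is_cube_tcl, of k x] by (simp add: powr_minus powr_mult powr_divide field_simps)
   also have "\<dots> \<le> (C0 * C1) powr \<alpha> * w y powr - \<alpha>"
    using le wpos[of y] \<alpha> by (intro mult_left_mono powr_mono2') auto
   finally show "s k x \<le> (C0 * C1) powr \<alpha> * w y powr - \<alpha>" .
  qed
 qed
 define C where "C = max 1 (max (C1 * D) (max (3 ^ ?n * D) ((C0 * C1) powr \<alpha>)))"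
 have "muckenhoupt w \<alpha> a s C"
 proof
  show "(\<integral>y\<in>dc k x. ennreal (w y)) = ennreal (a k x * dvol TYPE('a) k)" for k x
   using IA[OF is_cube_dcl, of k x] by (simp add: a_def m1 nn_integral_dcl)
  show "(\<integral>y\<in>trip k x. ennreal (w y powr - \<alpha>)) = ennreal (s k x * (3 ^ DIM('a) * dvol TYPE('a) k))" for k x
   using IS[OF is_cube_tcl, of k x] by (simp add: s_def m2 nn_integral_tcl)
  show "AE y. y \<in> trip k x \<longrightarrow> w y \<le> C * a k x" for k x
   using V1[OF is_cube_tcl[of k x]]
  proof eventually_elim
   case (elim y)
   show ?case
   proof
    assume "y \<in> trip k x"
    then have "w y \<le> C1 * A (tcl k x)" using elim trip_tcl by blast
    also have "\<dots> \<le> C1 * (D * a k x)" using C1p by (intro mult_left_mono At) auto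
    also have "\<dots> \<le> C * a k x" unfolding mult.assoc[symmetric] using ap[of k x] by (intro mult_right_mono) (auto simp: C_def)
    finally show "w y \<le> C * a k x" .
   qed
  qed
  show "a (k - 1) x \<le> C * a k x" for k x
   by (rule order_trans[OF a1]) (use ap[of k x] in \<open>auto intro!: mult_right_mono simp: C_def\<close>)
  show "AE y. y \<in> trip k x \<longrightarrow> s k x \<le> C * w y powr - \<alpha>" for k x
   using s1[of k x]
  proof eventually_elim
   case (elim y)
   have "(C0 * C1) powr \<alpha> * w y powr - \<alpha> \<le> C * w y powr - \<alpha>" by (intro mult_right_mono) (auto simp: C_def)
   with elim show ?case by linarith
  qed
  show "s k x > 0" for k x unfolding s_def by (rule Sp[OF is_cube_tcl])
 qed (use wpos \<alpha> ap in \<open>auto simp: C_def\<close>)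
 with wv show ?thesis unfolding \<alpha>_def by blast
qed

section \<open>Luxemburg norms\<close>

lemma log_plus_mono: "x \<le> y \<Longrightarrow> log_plus x \<le> log_plus y"
 by (auto simp: log_plus_def)

lemma log_plus_mult: "x \<ge> 0 \<Longrightarrow> y \<ge> 0 \<Longrightarrow> log_plus (x * y) \<le> log_plus x + log_plus y"
proof (cases "x * y > 1")
 case True
 moreover assume "x \<ge> 0" "y \<ge> 0"
 ultimately have p: "x > 0" "y > 0" by (auto simp: less_le)
 have "ln x \<le> log_plus x" "ln y \<le> log_plus y" using p by (auto simp: log_plus_def)
 then show ?thesis using True p by (simp add: log_plus_def ln_mult)
qed (auto simp: log_plus_def)

lemma phi_mono: "0 \<le> x \<Longrightarrow> x \<le> y \<Longrightarrow> \<kappa> \<ge> 0 \<Longrightarrow> phi \<kappa> x \<le> phi \<kappa> y"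
 unfolding phi_def using log_plus_mono[of x y] log_plus_nonneg[of x] by (intro mult_mono powr_mono2) auto

lemma phi_ge: "x \<ge> 0 \<Longrightarrow> \<kappa> \<ge> 0 \<Longrightarrow> x \<le> phi \<kappa> x"
proof -
 assume *: "x \<ge> 0" "\<kappa> \<ge> 0"
 have "1 \<le> (1 + log_plus x) powr \<kappa>" using * log_plus_nonneg[of x] by (intro ge_one_powr_ge_zero) auto
 then show ?thesis using mult_left_mono[of 1 _ x] * by (simp add: phi_def)
qed

lemma phi_mult_le: assumes "x \<ge> 0" "y \<ge> 0" "\<kappa> \<ge> 0" shows "phi \<kappa> (x * y) \<le> phi \<kappa> x * phi \<kappa> y"
proof -
 have "1 + log_plus (x * y) \<le> (1 + log_plus x) * (1 + log_plus y)"
  using log_plus_mult[OF assms(1,2)] mult_nonneg_nonneg[OF log_plus_nonneg[of x] log_plus_nonneg[of y]] by (simp add: algebra_simps)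
 then have "(1 + log_plus (x * y)) powr \<kappa> \<le> ((1 + log_plus x) * (1 + log_plus y)) powr \<kappa>"
  using assms log_plus_nonneg[of "x * y"] by (intro powr_mono2) auto
 also have "\<dots> = (1 + log_plus x) powr \<kappa> * (1 + log_plus y) powr \<kappa>"
  using log_plus_nonneg[of x] log_plus_nonneg[of y] by (simp add: powr_mult)
 finally have "x * y * (1 + log_plus (x * y)) powr \<kappa> \<le> x * y * ((1 + log_plus x) powr \<kappa> * (1 + log_plus y) powr \<kappa>)"
  using assms by (intro mult_left_mono) auto
 then show ?thesis by (simp add: phi_def mult_ac)
qed

lemma phi_scale_le: assumes "x \<ge> 0" "B \<ge> 1" "\<kappa> \<ge> 0" shows "phi \<kappa> (x / B) \<le> phi \<kappa> x / B"
proof -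
 have "x / B \<le> x" using assms by (simp add: field_simps mult_le_cancel_right1)
 then have "(1 + log_plus (x / B)) powr \<kappa> \<le> (1 + log_plus x) powr \<kappa>"
  using assms log_plus_mono[of "x / B" x] log_plus_nonneg[of "x / B"] by (intro powr_mono2) auto
 then show ?thesis using mult_left_mono[of _ _ "x / B"] assms by (simp add: phi_def)
qed

text \<open>For large \<open>h\<close> the exponent \<open>t < 1\<close> leaves room for the
  logarithm. For small \<open>h\<close> the left side is at most a constant, and
  \<open>1 \<le> C * h\<close> lets a multiple of \<open>h\<close> dominate it.\<close>

lemma phi_powr_le:
 assumes "0 < t" "t < 1" "\<kappa> \<ge> 0" "C \<ge> 1"
 shows "\<exists>B\<ge>1. \<forall>h>0. 1 \<le> C * h \<longrightarrow> phi \<kappa> (h powr t / B) \<le> h"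
proof -
 define \<theta> where "\<theta> = (1 - t) / t"
 have \<theta>: "\<theta> > 0" using assms by (simp add: \<theta>_def)
 define A where "A = ((\<kappa> + 1) / \<theta>) powr \<kappa> * exp \<theta>"
 define B where "B = max C A"
 have B: "B \<ge> 1" "B \<ge> C" "B \<ge> A" using assms by (auto simp: B_def)
 have "phi \<kappa> (h powr t / B) \<le> h" if h: "h > 0" "1 \<le> C * h" for h
 proof -
  have "phi \<kappa> (h powr t) \<le> B * h"
  proof (cases "h \<le> 1")
   case True
   then have "h powr t \<le> 1" using h assms by (intro powr_le1) auto
   then have "phi \<kappa> (h powr t) \<le> 1" by (simp add: phi_def log_plus_def)
   also have "1 \<le> B * h" using h B(2) mult_right_mono[of C B h] by linarith
   finally show ?thesis .
  next
   case False
   then have h1: "h > 1" by simp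
   then have "h powr t > 1" using assms by (intro gr_one_powr) auto
   then have lp: "log_plus (h powr t) = t * ln h" using h by (simp add: log_plus_def ln_powr)
   have "(1 + t * ln h) powr \<kappa> \<le> ((\<kappa> + 1) / \<theta>) powr \<kappa> * exp (\<theta> * (1 + t * ln h))"
    using h1 assms \<theta> by (intro powr_le_exp) (auto intro!: add_nonneg_nonneg)
   also have "exp (\<theta> * (1 + t * ln h)) = exp \<theta> * h powr (1 - t)"
   proof -
    have "\<theta> * (1 + t * ln h) = \<theta> + (1 - t) * ln h" using assms by (simp add: \<theta>_def field_simps)
    then show ?thesis using h by (simp add: exp_add powr_def)
   qed
   finally have "h powr t * (1 + t * ln h) powr \<kappa> \<le> h powr t * (A * h powr (1 - t))"
    by (intro mult_left_mono) (auto simp: A_def mult.assoc)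
   also have "\<dots> = A * h" using h by (simp add: powr_add[symmetric])
   also have "\<dots> \<le> B * h" using h B by (intro mult_right_mono) auto
   finally show ?thesis using lp by (simp add: phi_def)
  qed
  then have "phi \<kappa> (h powr t) / B \<le> h" using B by (simp add: field_simps)
  then show ?thesis using phi_scale_le[of "h powr t" B \<kappa>] B assms by auto
 qed
 with B show ?thesis by blast
qed

context muckenhoupt
begin

definition \<sigma> :: "'a \<Rightarrow> real" where "\<sigma> y = v y powr - \<alpha>"

lemma \<sigma>_pos: "\<sigma> y > 0" using v_pos[of y] by (simp add: \<sigma>_def)

lemma \<sigma>_meas [measurable]: "lm \<sigma>" unfolding \<sigma>_def[abs_def] by measurable

definition lx :: "real \<Rightarrow> ('a \<Rightarrow> real) \<Rightarrow> int \<Rightarrow> 'a \<Rightarrow> ennreal" where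
 "lx \<kappa> h k x = lux_norm (phi \<kappa>) \<sigma> (tcl k x) h"

lemma \<sigma>_int: "ennreal (LINT y:tcl k x|lebesgue. \<sigma> y) = ennreal (s k x * (3 ^ DIM('a) * dvol TYPE('a) k))"
proof -
 have "(\<integral>y\<in>tcl k x. ennreal (\<sigma> y)) = ennreal (s k x * (3 ^ DIM('a) * dvol TYPE('a) k))"
  unfolding nn_integral_tcl \<sigma>_def by (rule \<sigma>_trip)
 moreover have "(\<integral>y\<in>tcl k x. ennreal (\<sigma> y)) = (\<integral>y. ennreal (indicator (tcl k x) y * \<sigma> y))"
  by (intro nn_integral_cong) (auto simp: indicator_def)
 moreover have "(LINT y:tcl k x|lebesgue. \<sigma> y) = enn2real (\<integral>y. ennreal (indicator (tcl k x) y * \<sigma> y))"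
  unfolding set_lebesgue_integral_def using \<sigma>_pos by (subst integral_eq_nn_integral) (auto simp: less_imp_le)
 ultimately show ?thesis by simp
qed

abbreviation lux_small :: "real \<Rightarrow> ('a \<Rightarrow> real) \<Rightarrow> int \<Rightarrow> 'a \<Rightarrow> real \<Rightarrow> bool" where
 "lux_small \<kappa> h k x t \<equiv> (\<integral>y\<in>trip k x. ennreal (phi \<kappa> (\<bar>h y\<bar> / t) * \<sigma> y)) \<le> ennreal (s k x * (3 ^ DIM('a) * dvol TYPE('a) k))"

lemma lx_eq: "lx \<kappa> h k x = Inf {ennreal t | t. t > 0 \<and>
 lux_small \<kappa> h k x t}"
 unfolding lx_def lux_norm_def \<sigma>_int nn_integral_tcl ..

lemma lx_le: "t > 0 \<Longrightarrow> lux_small \<kappa> h k x t \<Longrightarrow> lx \<kappa> h k x \<le> ennreal t"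
 unfolding lx_eq by (rule Inf_lower) blast

text \<open>Strictly above the infimum the defining inequality holds by monotonicity of
  \<open>phi\<close>; at the infimum itself it is not claimed. Later the norm is doubled for this
  reason.\<close>

lemma lx_less:
 assumes "lx \<kappa> h k x < ennreal t" "\<kappa> \<ge> 0"
 shows "lux_small \<kappa> h k x t"
proof -
 obtain t' where t': "ennreal t' < ennreal t" "t' > 0"
  "lux_small \<kappa> h k x t'"
  using assms(1) unfolding lx_eq Inf_less_iff by auto
 have "t' < t" using t' by (simp add: ennreal_less_iff)
 have "(\<integral>y\<in>trip k x. ennreal (phi \<kappa> (\<bar>h y\<bar> / t) * \<sigma> y)) \<le> (\<integral>y\<in>trip k x. ennreal (phi \<kappa> (\<bar>h y\<bar> / t') * \<sigma> y))"
 proof (rule nn_integral_mono)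
  fix y
  have "\<bar>h y\<bar> / t \<le> \<bar>h y\<bar> / t'" using t' \<open>t' < t\<close> by (intro divide_left_mono) auto
  then have "phi \<kappa> (\<bar>h y\<bar> / t) \<le> phi \<kappa> (\<bar>h y\<bar> / t')" using t' \<open>t' < t\<close> assms by (intro phi_mono) auto
  then show "ennreal (phi \<kappa> (\<bar>h y\<bar> / t) * \<sigma> y) * indicator (trip k x) y \<le> ennreal (phi \<kappa> (\<bar>h y\<bar> / t') * \<sigma> y) * indicator (trip k x) y"
   using \<sigma>_pos[of y] by (intro mult_right_mono ennreal_leI) auto
 qed
 with t'(3) show ?thesis by simp
qed

lemma lx_mono:
 assumes "\<And>y. \<bar>h y\<bar> \<le> \<bar>h' y\<bar>" "\<kappa> \<ge> 0" shows "lx \<kappa> h k x \<le> lx \<kappa> h' k x"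
proof (subst (2) lx_eq, rule Inf_greatest)
 fix z assume "z \<in> {ennreal t | t. t > 0 \<and>
 lux_small \<kappa> h' k x t}"
 then obtain t where t: "z = ennreal t" "t > 0" "lux_small \<kappa> h' k x t" by blast
 have "(\<integral>y\<in>trip k x. ennreal (phi \<kappa> (\<bar>h y\<bar> / t) * \<sigma> y)) \<le> (\<integral>y\<in>trip k x. ennreal (phi \<kappa> (\<bar>h' y\<bar> / t) * \<sigma> y))"
  using t(2) assms \<sigma>_pos by (intro nn_integral_mono mult_right_mono ennreal_leI phi_mono) (auto simp: divide_right_mono less_imp_le)
 with t(3) have "lux_small \<kappa> h k x t" by simp
 with t show "lx \<kappa> h k x \<le> z" using lx_le by blast
qed

lemma lx_zero:
 assumes "\<And>y. y \<in> trip k x \<Longrightarrow> h y = 0" shows "lx \<kappa> h k x = 0"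
proof -
 have "(\<integral>y\<in>trip k x. ennreal (phi \<kappa> (\<bar>h y\<bar> / t) * \<sigma> y)) = (\<integral>(y::'a). 0)" for t
  using assms by (intro nn_integral_cong) (auto simp: indicator_def phi_def)
 then have le: "lx \<kappa> h k x \<le> ennreal t" if "t > 0" for t using that by (intro lx_le) auto
 have "lx \<kappa> h k x \<le> 0" by (rule ennreal_le_epsilon) (simp add: le)
 then show ?thesis by simp
qed

text \<open>An average with respect to Lebesgue measure is bounded by a norm with respect to
  \<sigma>, because \<open>s_le\<close> bounds \<sigma> from below by its mean and
  \<open>phi\<close> lies above the identity.\<close>

lemma average_le_lx:
 assumes [measurable]: "lm h" and "\<kappa> \<ge> 0"
 shows "(\<integral>y\<in>trip k x. ennreal \<bar>h y\<bar>) / ennreal (C * (3 ^ DIM('a) * dvol TYPE('a) k)) \<le> lx \<kappa> h k x"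
 unfolding lx_eq
proof (rule Inf_greatest)
 let ?V = "3 ^ DIM('a) * dvol TYPE('a) k"
 fix z assume "z \<in> {ennreal t | t. t > 0 \<and>
 (\<integral>y\<in>trip k x. ennreal (phi \<kappa> (\<bar>h y\<bar> / t) * \<sigma> y)) \<le> ennreal (s k x * ?V)}"
 then obtain t where t: "z = ennreal t" "t > 0" "(\<integral>y\<in>trip k x. ennreal (phi \<kappa> (\<bar>h y\<bar> / t) * \<sigma> y)) \<le> ennreal (s k x * ?V)" by blast
 have s: "s k x > 0" by (rule s_pos)
 have "(\<integral>y\<in>trip k x. ennreal \<bar>h y\<bar>) \<le> (\<integral>y. ennreal (t * C / s k x) * (ennreal (phi \<kappa> (\<bar>h y\<bar> / t) * \<sigma> y) * indicator (trip k x) y))"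
  using s_le[of k x]
 proof (intro nn_integral_mono_AE, eventually_elim)
  case (elim y)
  show ?case
  proof (cases "y \<in> trip k x")
   case True
   then have "s k x \<le> C * \<sigma> y" using elim by (simp add: \<sigma>_def)
   then have "\<bar>h y\<bar> / t * s k x \<le> phi \<kappa> (\<bar>h y\<bar> / t) * (C * \<sigma> y)"
    using t s assms phi_ge[of "\<bar>h y\<bar> / t" \<kappa>] by (intro mult_mono) (auto intro: phi_nonneg)
   then have "\<bar>h y\<bar> \<le> t * C / s k x * (phi \<kappa> (\<bar>h y\<bar> / t) * \<sigma> y)" using t s by (simp add: field_simps)
   then show ?thesis using True t s C_ge by (simp add: ennreal_mult'[symmetric] ennreal_leI)
  qed simp
 qed
 also have "\<dots> = ennreal (t * C / s k x) * (\<integral>y\<in>trip k x. ennreal (phi \<kappa> (\<bar>h y\<bar> / t) * \<sigma> y))"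
  by (rule nn_integral_cmult) measurable
 also have "\<dots> \<le> ennreal (t * C / s k x) * ennreal (s k x * ?V)" by (intro mult_left_mono t) simp
 also have "\<dots> = z * ennreal (C * ?V)" using t s C_ge by (simp add: ennreal_mult[symmetric])
 finally show "(\<integral>y\<in>trip k x. ennreal \<bar>h y\<bar>) / ennreal (C * ?V) \<le> z"
  using C_ge by (subst ennreal_divide_le_iff) auto
qed

lemma trip_le_lx:
 assumes [measurable]: "lm h" and "\<kappa> \<ge> 0"
 shows "(\<integral>y\<in>trip k x. ennreal \<bar>h y\<bar>) \<le> lx \<kappa> h k x * ennreal (C * (3 ^ DIM('a) * dvol TYPE('a) k))"
 using average_le_lx[OF assms, of k x] C_ge by (subst (asm) ennreal_divide_le_iff) auto

lemma lx_zero_imp: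
 assumes [measurable]: "lm h" and "\<kappa> \<ge> 0" "lx \<kappa> h k x = 0"
 shows "AE y. y \<in> trip k x \<longrightarrow> h y = 0"
proof -
 have "(\<integral>y\<in>trip k x. ennreal \<bar>h y\<bar>) = 0" using trip_le_lx[OF assms(1,2), of k x] assms(3) by simp
 then have "AE y. ennreal \<bar>h y\<bar> * indicator (trip k x) y = 0" by (subst (asm) nn_integral_0_iff_AE) auto
 then show ?thesis by eventually_elim (auto simp: indicator_def split: if_splits)
qed

text \<open>\<open>phi\<close> is submultiplicative, which splits off the power
  \<open>(\<sigma> / s) powr t\<close>; by \<open>phi_powr_le\<close> its \<open>phi\<close> is at
  most \<sigma> / s, and the integral with respect to \<sigma> appears. The constant has the form
  \<open>1 + s\<close> because this dominates \<open>s powr t\<close> and is later majorised by a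
  multiple of \<open>1 + \<sigma>\<close>.\<close>

lemma weight_orlicz:
 assumes "0 < t" "t < 1" "\<kappa> \<ge> 0"
 shows "\<exists>B\<ge>1. \<forall>h k x \<tau>. lm h \<longrightarrow> (\<forall>y. h y \<ge> 0) \<longrightarrow> \<tau> > 0 \<longrightarrow>
  (\<integral>y\<in>trip k x. ennreal (phi \<kappa> (h y / \<tau>) * \<sigma> y)) \<le> ennreal (s k x * (3 ^ DIM('a) * dvol TYPE('a) k)) \<longrightarrow>
  (\<integral>y\<in>trip k x. ennreal (phi \<kappa> (h y * \<sigma> y powr t / (B * (1 + s k x) * \<tau>)))) \<le> ennreal (3 ^ DIM('a) * dvol TYPE('a) k)"
proof -
 obtain B where B: "B \<ge> 1" "\<And>h. h > 0 \<Longrightarrow> 1 \<le> C * h \<Longrightarrow> phi \<kappa> (h powr t / B) \<le> h"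
  using phi_powr_le[OF assms C_ge] by blast
 have "(\<integral>y\<in>trip k x. ennreal (phi \<kappa> (h y * \<sigma> y powr t / (B * (1 + s k x) * \<tau>)))) \<le> ennreal (3 ^ DIM('a) * dvol TYPE('a) k)"
  if [measurable]: "lm h" and h: "\<forall>y. h y \<ge> 0" and \<tau>: "\<tau> > 0"
  and le: "(\<integral>y\<in>trip k x. ennreal (phi \<kappa> (h y / \<tau>) * \<sigma> y)) \<le> ennreal (s k x * (3 ^ DIM('a) * dvol TYPE('a) k))" for h k x \<tau>
 proof -
  let ?s = "s k x"
  have s: "?s > 0" by (rule s_pos)
  have "(\<integral>y\<in>trip k x. ennreal (phi \<kappa> (h y * \<sigma> y powr t / (B * (1 + ?s) * \<tau>))))
   \<le> (\<integral>y. ennreal (1 / ?s) * (ennreal (phi \<kappa> (h y / \<tau>) * \<sigma> y) * indicator (trip k x) y))"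
   using s_le[of k x]
  proof (intro nn_integral_mono_AE, eventually_elim)
   case (elim y)
   show ?case
   proof (cases "y \<in> trip k x")
    case True
    let ?g = "\<sigma> y / ?s"
    have g: "?g > 0" "1 \<le> C * ?g" using elim True s \<sigma>_pos[of y] by (auto simp: \<sigma>_def field_simps)
    have "?s powr t \<le> 1 + ?s"
    proof (cases "?s \<le> 1")
     case True
     then have "?s powr t \<le> 1" using s assms by (intro powr_le1) auto
     then show ?thesis using s by simp
    next
     case False
     then have "?s powr t \<le> ?s powr 1" using assms by (intro powr_mono) auto
     then show ?thesis using s by simp
    qed
    then have "?s powr t / (1 + ?s) \<le> 1" using s by simp
    moreover have "\<sigma> y powr t = ?g powr t * ?s powr t" using s \<sigma>_pos[of y] by (simp add: powr_divide)
    ultimately have "\<sigma> y powr t / (1 + ?s) \<le> ?g powr t"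
     using mult_left_mono[of "?s powr t / (1 + ?s)" 1 "?g powr t"] by simp
    then have "h y / \<tau> / B * (\<sigma> y powr t / (1 + ?s)) \<le> h y / \<tau> / B * ?g powr t"
     using h \<tau> B by (intro mult_left_mono) auto
    then have "h y * \<sigma> y powr t / (B * (1 + ?s) * \<tau>) \<le> h y / \<tau> * (?g powr t / B)" by (simp add: mult_ac)
    then have "phi \<kappa> (h y * \<sigma> y powr t / (B * (1 + ?s) * \<tau>)) \<le> phi \<kappa> (h y / \<tau> * (?g powr t / B))"
     using h B s \<tau> assms by (intro phi_mono) auto
    also have "\<dots> \<le> phi \<kappa> (h y / \<tau>) * phi \<kappa> (?g powr t / B)" using h B \<tau> assms by (intro phi_mult_le) auto
    also have "\<dots> \<le> phi \<kappa> (h y / \<tau>) * ?g" using h \<tau> by (intro mult_left_mono B g phi_nonneg) auto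
    finally show ?thesis using True s by (simp add: ennreal_mult'[symmetric] ennreal_leI)
   qed simp
  qed
  also have "\<dots> = ennreal (1 / ?s) * (\<integral>y\<in>trip k x. ennreal (phi \<kappa> (h y / \<tau>) * \<sigma> y))"
   by (rule nn_integral_cmult) measurable
  also have "\<dots> \<le> ennreal (1 / ?s) * ennreal (?s * (3 ^ DIM('a) * dvol TYPE('a) k))" by (intro mult_left_mono le) simp
  also have "\<dots> = ennreal (3 ^ DIM('a) * dvol TYPE('a) k)" using s by (subst ennreal_mult[symmetric]) auto
  finally show ?thesis .
 qed
 with B(1) show ?thesis by blast
qed

text \<open>\<open>v\<close> is at most \<open>C\<close> times its mean on the larger cell;
  integrate over the smaller one. Read upwards, the means over coarse cells stay bounded below, so
  their mass tends to infinity.\<close>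

lemma a_le: assumes "k \<le> k'" shows "a k' x \<le> C * a k x"
proof -
 have "ennreal (a k' x * dvol TYPE('a) k') = (\<integral>y\<in>dc k' x. ennreal (v y))" by (rule v_dc[symmetric])
 also have "\<dots> \<le> (\<integral>y\<in>dc k' x. ennreal (C * a k x))"
  using v_le[of k x]
 proof (intro nn_integral_mono_AE, eventually_elim)
  case (elim y)
  have "dc k' x \<subseteq> trip k x" using dc_mono[OF assms] dc_subset_trip by blast
  then show ?case using elim by (auto simp: indicator_def intro: ennreal_leI)
 qed
 also have "\<dots> = ennreal (C * a k x) * ennreal (dvol TYPE('a) k')"
  unfolding emeasure_dc[symmetric, of _ x] by (rule nn_integral_cmult_indicator) simp
 also have "\<dots> = ennreal (C * a k x * dvol TYPE('a) k')" using C_ge a_pos[of k x] by (simp add: ennreal_mult)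
 finally show ?thesis using C_ge a_pos[of k x] by (subst (asm) ennreal_le_iff) auto
qed

end

text \<open>The duality of \<open>t (log t)^m\<close> with the exponential of an \<open>m\<close>-th
  root. The cases compare \<open>t\<close> with \<open>exp (\<theta> / 2 * X)\<close>: below it,
  half of the exponential pays for \<open>t\<close> and half for \<open>X^m\<close>; above it,
  \<open>X\<close> is bounded by the logarithm of \<open>t\<close>.\<close>

lemma pow_le_phi_exp:
 assumes "\<theta> > 0"
 shows "\<exists>A>0. \<forall>X t. X \<ge> 1 \<longrightarrow> t \<ge> 0 \<longrightarrow> X ^ m * t \<le> A * (phi (real m) t + exp (\<theta> * X))"
proof -
 define A1 where "A1 = ((real m + 1) / (\<theta> / 2)) powr real m"
 define A where "A = max A1 ((2 / \<theta>) ^ m)"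
 have A: "A > 0" "A1 \<le> A" "(2 / \<theta>) ^ m \<le> A" using assms by (auto simp: A_def less_max_iff_disj)
 have "X ^ m * t \<le> A * (phi (real m) t + exp (\<theta> * X))" if X: "X \<ge> 1" and t: "t \<ge> 0" for X t
 proof (cases "t \<le> exp (\<theta> / 2 * X)")
  case True
  have "X ^ m \<le> A1 * exp (\<theta> / 2 * X)" using powr_le_exp[of X "real m" "\<theta> / 2"] X assms by (simp add: A1_def powr_realpow)
  then have "X ^ m * t \<le> A1 * exp (\<theta> / 2 * X) * exp (\<theta> / 2 * X)" using True t X by (intro mult_mono) (auto simp: A1_def)
  also have "\<dots> = A1 * exp (\<theta> * X)" by (simp add: mult.assoc exp_add[symmetric])
  also have "\<dots> \<le> A * (phi (real m) t + exp (\<theta> * X))" using A phi_nonneg[OF t, of "real m"] by (intro mult_mono) auto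
  finally show ?thesis .
 next
  case False
  have "1 < exp (\<theta> / 2 * X)" using assms X by simp
  then have t1: "t > 1" using False by linarith
  have "ln t > \<theta> / 2 * X" using False t1 ln_less_cancel_iff[of "exp (\<theta> / 2 * X)" t] by simp
  then have "X \<le> 2 / \<theta> * (1 + log_plus t)" using assms t1 by (simp add: log_plus_def field_simps)
  then have "X ^ m \<le> (2 / \<theta> * (1 + log_plus t)) ^ m" using X by (intro power_mono) auto
  also have "\<dots> = (2 / \<theta>) ^ m * (1 + log_plus t) powr real m" using log_plus_nonneg[of t] by (subst power_mult_distrib) (simp add: powr_realpow add_pos_nonneg)
  finally have "X ^ m * t \<le> (2 / \<theta>) ^ m * (1 + log_plus t) powr real m * t" using t by (intro mult_right_mono) auto
  also have "\<dots> = (2 / \<theta>) ^ m * phi (real m) t" by (simp add: phi_def)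
  also have "\<dots> \<le> A * (phi (real m) t + exp (\<theta> * X))" using A phi_nonneg[OF t, of "real m"] assms by (intro mult_mono) auto
  finally show ?thesis .
 qed
 with A(1) show ?thesis by blast
qed

locale czo_weight = czo T K + bmo_data b c \<theta> J + muckenhoupt v \<alpha> a s C
 for T :: "('a::euclidean_space \<Rightarrow> complex) \<Rightarrow> 'a \<Rightarrow> complex" and K and b :: "'a \<Rightarrow> real" and c \<theta> J and v :: "'a \<Rightarrow> real" and \<alpha> a s C
begin

lemma exp_weight: "(\<integral>y\<in>dc k z. ennreal (exp (\<theta> * \<bar>b y - c k z\<bar>) * v y)) \<le> ennreal (C * J * (a k z * dvol TYPE('a) k))"
proof -
 have "(\<integral>y\<in>dc k z. ennreal (exp (\<theta> * \<bar>b y - c k z\<bar>) * v y))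
  \<le> (\<integral>y. ennreal (C * a k z) * (ennreal (exp (\<theta> * \<bar>b y - c k z\<bar>)) * indicator (trip k z) y))"
  using v_le[of k z]
 proof (intro nn_integral_mono_AE, eventually_elim)
  case (elim y)
  have "y \<in> dc k z \<Longrightarrow> y \<in> trip k z" using dc_subset_trip by blast
  then show ?case using elim C_ge a_pos[of k z] by (auto simp: indicator_def ennreal_mult'[symmetric] mult.commute[of "exp _"] intro!: ennreal_leI mult_right_mono)
 qed
 also have "\<dots> = ennreal (C * a k z) * (\<integral>y\<in>trip k z. ennreal (exp (\<theta> * \<bar>b y - c k z\<bar>)))"
  by (rule nn_integral_cmult) measurable
 also have "\<dots> \<le> ennreal (C * a k z) * ennreal (J * dvol TYPE('a) k)" by (intro mult_left_mono jn) simp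
 also have "\<dots> = ennreal (C * J * (a k z * dvol TYPE('a) k))" using C_ge a_pos[of k z] J by (simp add: ennreal_mult[symmetric] mult_ac)
 finally show ?thesis .
qed

abbreviation transfer_estimate :: "nat \<Rightarrow> real \<Rightarrow> real \<Rightarrow> bool" where
 "transfer_estimate m B C2 \<equiv> (\<forall>k z d h. lm h \<longrightarrow> (\<forall>y. h y \<ge> 0) \<longrightarrow>
  (\<integral>y\<in>dc k z. ennreal (phi (real m) (h y) * v y)) \<le> ennreal (B * (a k z * dvol TYPE('a) k)) \<longrightarrow>
  (\<integral>y\<in>dc k z. ennreal (bw m b d y) * ennreal (h y * v y)) \<le> ennreal C2 * (\<integral>y\<in>dc k z. ennreal (bw m b d y) * ennreal (v y)))"

text \<open>Up to powers of \<open>X = 1 + \<bar>b - c k z\<bar>\<close>, the weight centred at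
  \<open>d\<close> is the constant \<open>E\<close> on the cell. From above the powers are absorbed
  by \<open>phi\<close> and John-Nirenberg; from below, the set where \<open>X\<close> is large
  carries at most half of \<open>E\<close> times the mass of \<open>v\<close>. The constant is
  uniform in \<open>d\<close>, since \<open>d\<close> will be the centre of a larger cube.\<close>

lemma cell_transfer:
 "\<exists>C2>0. transfer_estimate m B C2"
proof -
 obtain A where A: "A > 0" "\<And>X t. X \<ge> 1 \<Longrightarrow> t \<ge> 0 \<Longrightarrow> X ^ m * t \<le> A * (phi (real m) t + exp (\<theta> * X))"
  using pow_le_phi_exp[OF \<theta>] by blast
 define CJ where "CJ = exp \<theta> * (C * J)"
 have CJ: "CJ > 0" using C_ge J by (simp add: CJ_def)
 \<comment> \<open>Chosen so that the exponential tail beyond \<open>L\<close> takes at most half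
   and can be absorbed.\<close>
 define L where "L = max 1 (ln (2 * CJ) / \<theta>)"
 have L: "L \<ge> 1" "exp (- (\<theta> * L)) * CJ \<le> 1 / 2"
 proof -
  have "ln (2 * CJ) \<le> \<theta> * L" using \<theta> by (simp add: L_def field_simps max_def)
  then have "2 * CJ \<le> exp (\<theta> * L)" using CJ exp_le_cancel_iff[of "ln (2 * CJ)" "\<theta> * L"] by (simp del: exp_le_cancel_iff)
  then show "exp (- (\<theta> * L)) * CJ \<le> 1 / 2" by (simp add: exp_minus field_simps)
 qed (simp add: L_def)
 define B' where "B' = max B 0"
 define C2 where "C2 = A * (B' + CJ) * (2 * L ^ m)"
 have C2: "C2 > 0" using A CJ L by (auto simp: C2_def B'_def intro!: mult_pos_pos add_nonneg_pos)
 have "(\<integral>y\<in>dc k z. ennreal (bw m b d y) * ennreal (h y * v y)) \<le> ennreal C2 * (\<integral>y\<in>dc k z. ennreal (bw m b d y) * ennreal (v y))"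
  if [measurable]: "lm h" and h: "\<forall>y. h y \<ge> 0"
   and le: "(\<integral>y\<in>dc k z. ennreal (phi (real m) (h y) * v y)) \<le> ennreal (B * (a k z * dvol TYPE('a) k))" for k z d h
 proof -
  let ?V = "a k z * dvol TYPE('a) k"
  have V: "?V > 0" using a_pos[of k z] by simp
  define E where "E = (1 + \<bar>c k z - d\<bar>) ^ m"
  have E: "E > 0" by (simp add: E_def)
  define X where "X y = 1 + \<bar>b y - c k z\<bar>" for y
  have X1: "X y \<ge> 1" for y by (simp add: X_def)
  define e where "e y = exp (\<theta> * \<bar>b y - c k z\<bar>)" for y
  have [measurable]: "lm e" unfolding e_def[abs_def] by measurable
  have eX: "exp (\<theta> * X y) = exp \<theta> * e y" for y by (simp add: X_def e_def distrib_left exp_add)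
  have ie: "(\<integral>y\<in>dc k z. ennreal (e y * v y)) \<le> ennreal (C * J * ?V)" unfolding e_def by (rule exp_weight)
  \<comment> \<open>Both bounds are the inequality \<open>1 + \<bar>x + y\<bar> \<le> (1 +
    \<bar>x\<bar>) * (1 + \<bar>y\<bar>)\<close>, with the roles of the centres exchanged.\<close>
  have up: "bw m b d y \<le> E * X y ^ m" for y
  proof -
   have "1 + \<bar>b y - d\<bar> \<le> (1 + \<bar>c k z - d\<bar>) * X y"
    proof -
    have "0 \<le> \<bar>c k z - d\<bar> * \<bar>b y - c k z\<bar>" by simp
    then show ?thesis unfolding X_def distrib_right distrib_left mult_1_left mult_1_right by linarith
   qed
   then show ?thesis unfolding bw_def E_def power_mult_distrib[symmetric] by (intro power_mono) auto
  qed
  have lo: "E \<le> bw m b d y * X y ^ m" for y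
  proof -
   have "1 + \<bar>c k z - d\<bar> \<le> (1 + \<bar>b y - d\<bar>) * X y"
    proof -
    have "0 \<le> \<bar>b y - d\<bar> * \<bar>b y - c k z\<bar>" by simp
    then show ?thesis unfolding X_def distrib_right distrib_left mult_1_left mult_1_right by linarith
   qed
   then show ?thesis unfolding bw_def E_def power_mult_distrib[symmetric] by (intro power_mono) auto
  qed
  have "(\<integral>y\<in>dc k z. ennreal (bw m b d y) * ennreal (h y * v y))
   \<le> (\<integral>y. ennreal (E * A) * (ennreal (phi (real m) (h y) * v y) * indicator (dc k z) y + ennreal (exp \<theta>) * (ennreal (e y * v y) * indicator (dc k z) y)))"
  proof (rule nn_integral_mono)
   fix y
   have "bw m b d y * (h y * v y) \<le> E * X y ^ m * (h y * v y)"
    using up h v_pos[of y] by (intro mult_right_mono) (auto simp: less_imp_le)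
   also have "\<dots> = E * v y * (X y ^ m * h y)" by simp
   also have "\<dots> \<le> E * v y * (A * (phi (real m) (h y) + exp (\<theta> * X y)))"
    using E v_pos[of y] X1 h by (intro mult_left_mono A(2)) auto
   also have "\<dots> = E * A * (phi (real m) (h y) * v y + exp \<theta> * (e y * v y))" by (simp add: eX algebra_simps)
   finally have "ennreal (bw m b d y) * ennreal (h y * v y) \<le> ennreal (E * A * (phi (real m) (h y) * v y + exp \<theta> * (e y * v y)))"
    by (subst ennreal_mult'[symmetric]) (auto simp: bw_pos intro: ennreal_leI)
   also have "\<dots> = ennreal (E * A) * (ennreal (phi (real m) (h y) * v y) + ennreal (exp \<theta>) * ennreal (e y * v y))"
    using E A(1) h v_pos[of y] phi_nonneg[of "h y" "real m"] by (simp add: ennreal_mult ennreal_plus e_def)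
   finally show "ennreal (bw m b d y) * ennreal (h y * v y) * indicator (dc k z) y \<le> ennreal (E * A) * (ennreal (phi (real m) (h y) * v y) * indicator (dc k z) y + ennreal (exp \<theta>) * (ennreal (e y * v y) * indicator (dc k z) y))"
    by (auto simp: indicator_def)
  qed
  also have "\<dots> = ennreal (E * A) * ((\<integral>y\<in>dc k z. ennreal (phi (real m) (h y) * v y)) + ennreal (exp \<theta>) * (\<integral>y\<in>dc k z. ennreal (e y * v y)))"
   by (subst nn_integral_cmult, measurable, subst nn_integral_add) (auto simp: nn_integral_cmult)
  also have "\<dots> \<le> ennreal (E * A) * (ennreal (B' * ?V) + ennreal (exp \<theta>) * ennreal (C * J * ?V))"
  proof (intro mult_left_mono add_mono ie)
   show "(\<integral>y\<in>dc k z. ennreal (phi (real m) (h y) * v y)) \<le> ennreal (B' * ?V)"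
    by (rule order_trans[OF le]) (use V in \<open>auto simp: B'_def intro!: ennreal_leI mult_right_mono\<close>)
  qed auto
  also have "\<dots> = ennreal (A * (B' + CJ)) * ennreal (E * ?V)"
   using E A(1) V C_ge J by (simp add: ennreal_mult[symmetric] ennreal_plus[symmetric] CJ_def B'_def algebra_simps del: ennreal_plus)
  finally have 1: "(\<integral>y\<in>dc k z. ennreal (bw m b d y) * ennreal (h y * v y)) \<le> ennreal (A * (B' + CJ)) * ennreal (E * ?V)" .
  let ?I = "\<integral>\<^sup>+y\<in>dc k z. ennreal (bw m b d y) * ennreal (v y) \<partial>lebesgue"
  have "ennreal (E * ?V) = ennreal E * (\<integral>y\<in>dc k z. ennreal (v y))"
   unfolding v_dc using E by (simp add: ennreal_mult')
  also have "\<dots> = (\<integral>y\<in>dc k z. ennreal E * ennreal (v y))"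
   by (subst nn_integral_cmult[symmetric]) (auto simp: mult.assoc)
  also have "\<dots> \<le> (\<integral>y. ennreal (L ^ m) * (ennreal (bw m b d y) * ennreal (v y) * indicator (dc k z) y) + ennreal (E * (exp (- (\<theta> * L)) * exp \<theta>)) * (ennreal (e y * v y) * indicator (dc k z) y))"
  proof (rule nn_integral_mono)
   fix y
   \<comment> \<open>Where \<open>X\<close> is at most \<open>L\<close> the lower bound
     \<open>lo\<close> applies; elsewhere the exponential, normalised at \<open>L\<close>, exceeds
     1.\<close>
   have "E \<le> L ^ m * bw m b d y + E * (exp (- (\<theta> * L)) * exp \<theta>) * e y"
   proof (cases "X y \<le> L")
    case True
    have "E \<le> bw m b d y * X y ^ m" by (rule lo)
    also have "\<dots> \<le> bw m b d y * L ^ m" using True X1[of y] bw_pos by (intro mult_left_mono power_mono) auto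
    finally show ?thesis using E by (simp add: e_def mult.commute add_increasing2)
   next
    case False
    have "exp (- (\<theta> * L)) * exp \<theta> * e y = exp (\<theta> * (X y - L))"
     unfolding mult.assoc unfolding eX[symmetric] exp_add[symmetric] by (simp add: algebra_simps)
    also have "\<dots> \<ge> 1" using False \<theta> by simp
    finally have "E * 1 \<le> E * (exp (- (\<theta> * L)) * exp \<theta> * e y)" using E by (intro mult_left_mono) auto
    moreover have "L ^ m * bw m b d y \<ge> 0" using L(1) by (intro mult_nonneg_nonneg bw_pos) auto
    ultimately show ?thesis by (simp add: mult.assoc)
   qed
   then have "E * v y \<le> (L ^ m * bw m b d y + E * (exp (- (\<theta> * L)) * exp \<theta>) * e y) * v y" using v_pos[of y] by (intro mult_right_mono) auto
   then have "ennreal (E * v y) \<le> ennreal (L ^ m * (bw m b d y * v y) + E * (exp (- (\<theta> * L)) * exp \<theta>) * (e y * v y))"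
    by (intro ennreal_leI) (simp add: algebra_simps)
   also have "\<dots> = ennreal (L ^ m) * (ennreal (bw m b d y) * ennreal (v y)) + ennreal (E * (exp (- (\<theta> * L)) * exp \<theta>)) * ennreal (e y * v y)"
    using L E v_pos[of y] bw_pos[of m b d y] by (simp add: ennreal_mult ennreal_plus e_def)
   finally show "ennreal E * ennreal (v y) * indicator (dc k z) y \<le> ennreal (L ^ m) * (ennreal (bw m b d y) * ennreal (v y) * indicator (dc k z) y) + ennreal (E * (exp (- (\<theta> * L)) * exp \<theta>)) * (ennreal (e y * v y) * indicator (dc k z) y)"
    using E v_pos[of y] by (auto simp: indicator_def ennreal_mult)
  qed
  also have "\<dots> = ennreal (L ^ m) * ?I + ennreal (E * (exp (- (\<theta> * L)) * exp \<theta>)) * (\<integral>y\<in>dc k z. ennreal (e y * v y))"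
   by (subst nn_integral_add) (auto simp: nn_integral_cmult)
  also have "\<dots> \<le> ennreal (L ^ m) * ?I + ennreal (E * (exp (- (\<theta> * L)) * exp \<theta>)) * ennreal (C * J * ?V)"
   by (intro add_mono mult_left_mono ie) auto
  also have "ennreal (E * (exp (- (\<theta> * L)) * exp \<theta>)) * ennreal (C * J * ?V) = ennreal (exp (- (\<theta> * L)) * CJ) * ennreal (E * ?V)"
   using E V C_ge J by (simp add: ennreal_mult[symmetric] CJ_def mult_ac)
  also have "\<dots> \<le> ennreal (1 / 2) * ennreal (E * ?V)" by (intro mult_right_mono ennreal_leI L) simp
  finally have "ennreal (E * ?V) \<le> ennreal 2 * (ennreal (L ^ m) * ?I)"
   by (intro ennreal_absorb) auto
  then have "ennreal (A * (B' + CJ)) * ennreal (E * ?V) \<le> ennreal (A * (B' + CJ)) * (ennreal 2 * (ennreal (L ^ m) * ?I))" by (intro mult_left_mono) auto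
  also have "\<dots> = ennreal C2 * ?I" using A(1) CJ L by (simp add: C2_def B'_def ennreal_mult mult_ac)
  finally show ?thesis using 1 by simp
 qed
 with C2 show ?thesis by blast
qed

end

section \<open>The weak type estimate\<close>

text \<open>\<open>dHL\<close> and \<open>OM\<close> are measurable dyadic minorants of the maximal functions in the theorem.\<close>

definition dHL :: "('a::euclidean_space \<Rightarrow> real) \<Rightarrow> 'a \<Rightarrow> ennreal" where
 "dHL P y = (SUP k. (\<integral>z\<in>dc k y. ennreal (P z)) / ennreal (dvol TYPE('a) k))"

lemma dHL_measurable [measurable]: "lm (dHL P)"
 unfolding dHL_def[abs_def]
proof (rule borel_measurable_SUP)
 fix k :: int
 show "lm (\<lambda>y. (\<integral>z\<in>dc k y. ennreal (P z)) / ennreal (dvol TYPE('a) k))"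
  by (rule cell_const_measurable[of k]) (simp add: dc_eq)
qed simp

lemma le_dHL: "y \<in> dc k x \<Longrightarrow> (\<integral>z\<in>dc k x. ennreal (P z)) / ennreal (dvol TYPE('a) k) \<le> dHL P y"
 for y :: "'a::euclidean_space"
 unfolding dHL_def by (rule SUP_upper2[of k]) (auto simp: dc_eq)

text \<open>\<open>dHL\<close> itself need not have finite integrals over cells, as
  \<open>dyadic_differentiation\<close> would demand. It is therefore replaced by rational constants
  on its sublevel sets, which also keeps the null sets countable.\<close>

lemma AE_le_dHL:
 fixes P :: "'a::euclidean_space \<Rightarrow> real"
 assumes [measurable]: "lm P"
 shows "AE y. ennreal (P y) \<le> dHL P y"
proof -
 have "AE y. y \<in> {y. dHL P y \<le> ennreal (real_of_rat c)} \<longrightarrow> ennreal (P y) \<le> ennreal (real_of_rat c)" for c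
 proof (rule dyadic_differentiation[where ?k0.0 = 0])
  have "{y \<in> space lebesgue. dHL P y \<le> ennreal (real_of_rat c)} \<in> sets lebesgue" by measurable
  then show "{y. dHL P y \<le> ennreal (real_of_rat c)} \<in> sets lebesgue" by simp
  have I: "(\<integral>y\<in>dc k x. ennreal (real_of_rat c)) = ennreal (real_of_rat c) * ennreal (dvol TYPE('a) k)" for k and x :: 'a
   unfolding emeasure_dc[symmetric, of _ x] by (rule nn_integral_cmult_indicator) simp
  show "(\<integral>y\<in>dc k x. ennreal (real_of_rat c)) < \<infinity>" for k and x :: 'a
   unfolding I by (simp add: ennreal_mult_less_top)
  show "(\<integral>y\<in>dc k x. ennreal (P y)) \<le> (\<integral>y\<in>dc k x. ennreal (real_of_rat c))"
   if "x \<in> {y. dHL P y \<le> ennreal (real_of_rat c)}" for k x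
   unfolding I using order_trans[OF le_dHL[where P=P and x=x and k=k, OF dc_self]] that by (subst (asm) ennreal_divide_le_iff) auto
 qed auto
 then have "AE y. \<forall>c. dHL P y \<le> ennreal (real_of_rat c) \<longrightarrow> ennreal (P y) \<le> ennreal (real_of_rat c)"
  by (subst AE_all_countable) auto
 then show ?thesis
 proof eventually_elim
  case (elim y)
  show ?case
  proof (rule ccontr)
   assume "\<not> ?thesis"
   then have "dHL P y < ennreal (P y)" by simp
   then obtain c where "dHL P y < ennreal (real_of_rat c)" "ennreal (real_of_rat c) < ennreal (P y)"
    using ennreal_rat_dense by blast
   then show False using elim by (metis less_imp_le not_le)
  qed
 qed
qed

context muckenhoupt
begin

definition OM :: "real \<Rightarrow> ('a \<Rightarrow> real) \<Rightarrow> 'a \<Rightarrow> ennreal" where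
 "OM \<kappa> h y = (SUP k. SUP q\<in>trip k y. lx \<kappa> h k q)"

lemma OM_measurable [measurable]: "OM \<kappa> h \<in> borel_measurable lebesgue"
 unfolding OM_def[abs_def]
proof (rule borel_measurable_SUP)
 fix k :: int
 show "lm (\<lambda>y. SUP q\<in>trip k y. lx \<kappa> h k q)"
  by (rule cell_const_measurable[of k]) (simp add: trip_eq)
qed simp

lemma lx_le_OM: "y \<in> trip k q \<Longrightarrow> lx \<kappa> h k q \<le> OM \<kappa> h y"
 unfolding OM_def by (rule SUP_upper2[of k], simp, rule SUP_upper) (simp add: trip_sym)

lemma OM_mono: "(\<And>y. \<bar>h y\<bar> \<le> \<bar>h' y\<bar>) \<Longrightarrow> \<kappa> \<ge> 0 \<Longrightarrow> OM \<kappa> h x \<le> OM \<kappa> h' x"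
 unfolding OM_def by (intro SUP_mono') (auto intro!: SUP_mono' lx_mono)

text \<open>A triple of level above \<open>k\<close> meeting the cell lies in the triple of the cell, where \<open>h\<close> vanishes.\<close>

lemma OM_const:
 assumes h: "\<And>x. x \<in> trip k z \<Longrightarrow> h x = 0" and y: "y \<in> dc k z"
 shows "OM \<kappa> h y = OM \<kappa> h z"
 unfolding OM_def
proof (rule SUP_cong)
 fix k'
 show "(SUP q\<in>trip k' y. lx \<kappa> h k' q) = (SUP q\<in>trip k' z. lx \<kappa> h k' q)"
 proof (cases "k' \<le> k")
  case True
  then have "y \<in> dc k' z" using y dc_mono by blast
  then show ?thesis by (simp add: trip_eq)
 next
  case False
  have 0: "(SUP q\<in>trip k' x. lx \<kappa> h k' q) = 0" if x: "x \<in> dc k z" for x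
  proof -
   have "lx \<kappa> h k' q = 0" if q: "q \<in> trip k' x" for q
   proof (rule lx_zero)
    fix x' assume "x' \<in> trip k' q"
    then have "x' \<in> trip (k' - 1) x" using q trip_sym trip_trip_pred by blast
    also have "\<dots> \<subseteq> trip k x" using False by (intro trip_mono) auto
    finally show "h x' = 0" using h trip_eq[OF x] by simp
   qed
   then have "(SUP q\<in>trip k' x. lx \<kappa> h k' q) \<le> 0" by (intro SUP_least) simp
   then show ?thesis by simp
  qed
  then show ?thesis using y by simp
 qed
qed simp

lemma dc_v_le:
 assumes [measurable]: "lm h" and h: "\<And>y. h y \<ge> 0" and A: "A \<subseteq> trip k z" "A \<in> sets lebesgue"
 shows "(\<integral>y\<in>A. ennreal (h y * v y)) \<le> ennreal (C * a k z) * (\<integral>y\<in>A. ennreal (h y))"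
proof -
 have [measurable]: "A \<in> sets lebesgue" by fact
 have "(\<integral>y\<in>A. ennreal (h y * v y)) \<le> (\<integral>y. ennreal (C * a k z) * (ennreal (h y) * indicator A y))"
  using v_le[of k z]
 proof (intro nn_integral_mono_AE, eventually_elim)
  case (elim y)
  show ?case
  proof (cases "y \<in> A")
   case True
   then have "h y * v y \<le> C * a k z * h y" using elim A(1) h[of y] by (subst mult.commute) (auto intro!: mult_right_mono)
   then show ?thesis using True C_ge a_pos[of k z] h[of y] by (simp add: ennreal_mult[symmetric] ennreal_leI)
  qed simp
 qed
 also have "\<dots> = ennreal (C * a k z) * (\<integral>y\<in>A. ennreal (h y))" by (rule nn_integral_cmult) measurable
 finally show ?thesis .
qed

text \<open>The averages are compared in the measure \<open>v\<close>. The upper bound comes from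
  the unselected parent and doubling; the lower bound becomes one in Lebesgue measure because
  \<open>v\<close> is at most a multiple of its mean; off the cells \<open>phi (f)\<close> is at
  most 1, and so is \<open>f\<close>.\<close>

lemma stopping_family:
 assumes [measurable]: "lm f" and f: "\<And>y. f y \<ge> 0"
  and fin: "(\<integral>y. ennreal (phi \<mu> (f y) * v y)) < \<infinity>" and \<mu>: "\<mu> \<ge> 0"
 obtains J :: "(int \<times> 'a) set" where "countable J" "disjoint_family_on cell J"
  "\<And>k z. (k, z) \<in> J \<Longrightarrow> (\<integral>y\<in>dc k z. ennreal (phi \<mu> (f y) * v y)) \<le> ennreal (2 ^ DIM('a) * C * (a k z * dvol TYPE('a) k))"
  "\<And>k z. (k, z) \<in> J \<Longrightarrow> ennreal (dvol TYPE('a) k) \<le> ennreal C * (\<integral>y\<in>dc k z. ennreal (phi \<mu> (f y)))"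
  "AE y. y \<notin> (\<Union>(cell ` J)) \<longrightarrow> f y \<le> 1"
proof -
 let ?I = "\<lambda>k x. \<integral>\<^sup>+y\<in>dc k x. ennreal (phi \<mu> (f y) * v y) \<partial>lebesgue"
 define P where "P k x \<longleftrightarrow> (\<integral>y\<in>dc k x. ennreal (v y)) < ?I k x" for k x
 have comp: "P k y = P k x" if "y \<in> dc k x" for k x y unfolding P_def dc_eq[OF that] ..
 have bnd: "\<exists>K. \<forall>k<K. \<not> P k x" for x
 proof -
  \<comment> \<open>By \<open>a_le\<close> the mean of \<open>v\<close> over any coarser cell is at
    least this number, so the \<open>v\<close>-mass of coarse cells exceeds the finite total
    integral.\<close>
  have "a 0 x / C > 0" using a_pos[of 0 x] C_ge by simp
  then obtain K where K: "\<And>k. k < K \<Longrightarrow> ennreal (a 0 x / C * dvol TYPE('a) k) > (\<integral>y. ennreal (phi \<mu> (f y) * v y))"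
   using cells_large[where 'a='a, OF fin[unfolded infinity_ennreal_def]] by blast
  have "\<not> P k x" if k: "k < min K 0" for k
  proof -
   have "?I k x \<le> (\<integral>y. ennreal (phi \<mu> (f y) * v y))"
    by (intro nn_integral_mono) (auto simp: indicator_def)
   also have "\<dots> \<le> ennreal (a 0 x / C * dvol TYPE('a) k)" using K[of k] k by simp
   also have "\<dots> \<le> ennreal (a k x * dvol TYPE('a) k)"
    using a_le[of k 0 x] k C_ge by (intro ennreal_leI mult_right_mono) (auto simp: field_simps)
   finally show ?thesis by (simp add: P_def v_dc not_less)
  qed
  then show ?thesis by blast
 qed
 obtain J where J: "countable J" "\<And>k z. (k, z) \<in> J \<Longrightarrow> P k z" "\<And>k z k'. (k, z) \<in> J \<Longrightarrow> k' < k \<Longrightarrow> \<not> P k' z"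
  "disjoint_family_on cell J" "(\<Union>(cell ` J)) = {x. \<exists>k. P k x}"
  by (rule stopping_cubes[where P=P], rule comp, assumption, rule bnd, rule that) (assumption | blast)+
 show ?thesis
 proof (rule that[of J])
  fix k z assume j: "(k, z) \<in> J"
  have "\<not> P (k - 1) z" using J(3)[OF j] by simp
  have "?I k z \<le> ?I (k - 1) z"
   using dc_pred[of k z] by (intro nn_integral_mono) (auto simp: indicator_def)
  also have "\<dots> \<le> ennreal (a (k - 1) z * dvol TYPE('a) (k - 1))" using \<open>\<not> P (k - 1) z\<close> by (simp add: P_def v_dc not_less)
  also have "\<dots> \<le> ennreal (C * a k z * dvol TYPE('a) (k - 1))"
   by (intro ennreal_leI mult_right_mono a_pred) auto
  finally show "?I k z \<le> ennreal (2 ^ DIM('a) * C * (a k z * dvol TYPE('a) k))"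
   by (simp add: dvol_pred mult_ac)
  let ?F = "\<integral>\<^sup>+y\<in>dc k z. ennreal (phi \<mu> (f y)) \<partial>lebesgue"
  have ap: "a k z > 0" by (rule a_pos)
  have "ennreal (a k z * dvol TYPE('a) k) \<le> ?I k z" using J(2)[OF j] by (simp add: P_def v_dc)
  also have "\<dots> \<le> ennreal (C * a k z) * ?F"
   using f by (intro dc_v_le dc_subset_trip phi_nonneg) auto
  finally have "ennreal (1 / a k z) * ennreal (a k z * dvol TYPE('a) k) \<le> ennreal (1 / a k z) * (ennreal (C * a k z) * ?F)"
   by (intro mult_left_mono) auto
  moreover have "ennreal (1 / a k z) * ennreal (a k z * dvol TYPE('a) k) = ennreal (dvol TYPE('a) k)"
   using ap by (subst ennreal_mult[symmetric]) auto
  moreover have "ennreal (1 / a k z) * (ennreal (C * a k z) * ?F) = ennreal C * ?F"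
   unfolding mult.assoc[symmetric] using ap C_ge by (subst ennreal_mult[symmetric]) auto
  ultimately show "ennreal (dvol TYPE('a) k) \<le> ennreal C * ?F" by simp
 next
  let ?D = "\<Union>(cell ` J)"
  have "AE y. y \<in> - ?D \<longrightarrow> ennreal (phi \<mu> (f y) * v y) \<le> ennreal (v y)"
  proof (rule dyadic_differentiation[where ?k0.0 = 0])
   show "- ?D \<in> sets lebesgue" using sets.compl_sets[OF J_union_sets[OF J(1)]] unfolding Compl_eq_Diff_UNIV by simp
   show "(\<integral>y\<in>dc k x. ennreal (v y)) < \<infinity>" for k x by (simp add: v_dc)
   show "?I k x \<le> (\<integral>y\<in>dc k x. ennreal (v y))" if "x \<in> - ?D" for k x
   proof -
    have "\<not> P k x" using that unfolding J(5) by blast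
    then show ?thesis by (simp add: P_def)
   qed
  qed auto
  then show "AE y. y \<notin> ?D \<longrightarrow> f y \<le> 1"
  proof eventually_elim
   case (elim y)
   show ?case
   proof
    assume "y \<notin> ?D"
    then have "ennreal (phi \<mu> (f y) * v y) \<le> ennreal (v y)" using elim by blast
    then have "phi \<mu> (f y) * v y \<le> 1 * v y" using v_pos[of y] by (simp add: ennreal_le_iff)
    then have "phi \<mu> (f y) \<le> 1" using v_pos[of y] by (simp only: mult_le_cancel_right_pos)
    then show "f y \<le> 1" using phi_ge[OF f \<mu>, of y] by linarith
   qed
  qed
 qed (use J in auto)
qed

end

context czo_weight
begin

abbreviation stopped_estimate :: "nat \<Rightarrow> real \<Rightarrow> real \<Rightarrow> bool" where
 "stopped_estimate m B CH \<equiv> (\<forall>J f F k x. countable J \<longrightarrow> disjoint_family_on cell J \<longrightarrow>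
  (\<forall>(k, z)\<in>J. (\<integral>y\<in>dc k z. ennreal (phi (real m) (f y) * v y)) \<le> ennreal (B * (a k z * dvol TYPE('a) k))) \<longrightarrow>
  f \<in> borel_measurable lebesgue \<longrightarrow> (\<forall>y. f y \<ge> 0) \<longrightarrow> (AE y. cmod (F y) = f y * v y) \<longrightarrow>
  \<not> dc k x \<subseteq> (\<Union>(k, z)\<in>J. trip k z) \<longrightarrow>
  (bmean m b c k x (\<lambda>y. enorm (F y)))
   \<le> ennreal CH * (\<integral>y\<in>trip k x. ennreal (bw m b (c k x) y) * ennreal ((if y \<in> (\<Union>(cell ` J)) then 1 else f y) * v y)))"

text \<open>\<open>cell_transfer\<close> on each stopping cell inside the triple, with
  \<open>d\<close> the centre of the large cube.\<close>

lemma stopped_average: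
 "\<exists>CH\<ge>1. stopped_estimate m B CH"
proof -
 from cell_transfer[of m B] obtain C2 where C2: "C2 > 0" and C2': "transfer_estimate m B C2"
  by (elim exE conjE) (rule that)
 define CH where "CH = max 1 C2"
 have "(bmean m b c k x (\<lambda>y. enorm (F y)))
   \<le> ennreal CH * (\<integral>y\<in>trip k x. ennreal (bw m b (c k x) y) * ennreal ((if y \<in> (\<Union>(cell ` J)) then 1 else f y) * v y))"
  if J: "countable J" "disjoint_family_on cell J"
   and le: "\<forall>(k, z)\<in>J. (\<integral>y\<in>dc k z. ennreal (phi (real m) (f y) * v y)) \<le> ennreal (B * (a k z * dvol TYPE('a) k))"
   and f [measurable]: "lm f" and f0: "\<forall>y. f y \<ge> 0" and F: "AE y. cmod (F y) = f y * v y"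
   and sub: "\<not> dc k x \<subseteq> (\<Union>(k, z)\<in>J. trip k z)" for J f F k x
 proof -
  let ?D = "\<Union>(cell ` J)"
  let ?g = "\<lambda>y. if y \<in> ?D then 1 else f y"
  let ?w = "\<lambda>y. ennreal (bw m b (c k x) y)"
  obtain y0 where y0: "y0 \<in> dc k x" "\<And>k' z. (k', z) \<in> J \<Longrightarrow> y0 \<notin> trip k' z" using sub by blast
  define J' where "J' = {(k', z) \<in> J. dc k' z \<inter> trip k x \<noteq> {}}"
  have J': "countable J'" "disjoint_family_on cell J'" "J' \<subseteq> J"
   using countable_subset[OF _ J(1), of J'] disjoint_family_on_mono[OF _ J(2), of J'] by (auto simp: J'_def)
  have in_trip: "dc k' z \<subseteq> trip k x" if j: "(k', z) \<in> J'" for k' z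
  proof -
   obtain y where y: "y \<in> dc k' z" "y \<in> trip k x" "(k', z) \<in> J" using j by (auto simp: J'_def)
   \<comment> \<open>The triple of a stopping cell that meets \<open>trip k x\<close> and is at
     least as coarse would contain all of \<open>dc k x\<close>, in particular
     \<open>y0\<close>.\<close>
   have "k < k'"
   proof (rule ccontr)
    assume "\<not> k < k'"
    then have "k' \<le> k" by simp
    have "x \<in> trip k y" using y(2) trip_sym by blast
    then have "y0 \<in> trip k y" using y0(1) trip_cell by blast
    then have "y0 \<in> trip k' y" using trip_mono[OF \<open>k' \<le> k\<close>] by blast
    then show False using y0(2)[OF y(3)] trip_eq[OF y(1)] by simp
   qed
   then have "dc k' y \<subseteq> trip k x" using y by (intro dc_trip_nested) auto
   then show ?thesis using dc_eq[OF y(1)] by simp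
  qed
  define D' where "D' = (\<Union>(k, z)\<in>J'. dc k z)"
  have [measurable]: "D' \<in> sets lebesgue" "?D \<in> sets lebesgue" using J_union_sets[OF J'(1)] J_union_sets[OF J(1)] by (auto simp: D'_def)
  have D': "y \<in> D' \<longleftrightarrow> y \<in> ?D" if "y \<in> trip k x" for y
   using that by (auto simp: D'_def J'_def)
  have D't: "D' \<subseteq> trip k x" using in_trip by (auto simp: D'_def)
  have gm [measurable]: "?g \<in> borel_measurable lebesgue" by measurable
  have dc0: "(cell j) \<in> sets lebesgue" for j :: "int \<times> 'a" by (rule countable_J_sets)
  have split: "(\<integral>y\<in>trip k x. h y) = (\<integral>y\<in>trip k x - D'. h y) + (\<integral>y\<in>D'. h y)"
   if [measurable]: "lm h" for h
   using D't by (subst nn_integral_add[symmetric]) (auto intro!: nn_integral_cong simp: indicator_def)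
  have "(\<integral>y\<in>D'. ?w y * ennreal (f y * v y)) = (\<Sum>\<^sup>+j\<in>J'. (\<integral>y\<in>cell j. ?w y * ennreal (f y * v y)))"
   unfolding D'_def by (rule nn_integral_UN_countable[OF J'(1,2) dc0]) measurable
  also have "\<dots> \<le> (\<Sum>\<^sup>+j\<in>J'. ennreal C2 * (\<integral>y\<in>cell j. ?w y * ennreal (v y)))"
  proof (rule nn_integral_mono)
   fix j assume "j \<in> space (count_space J')"
   then obtain k' z where j: "j = (k', z)" "(k', z) \<in> J" using J'(3) by (cases j) auto
   show "(\<integral>y\<in>cell j. ?w y * ennreal (f y * v y)) \<le> ennreal C2 * (\<integral>y\<in>cell j. ?w y * ennreal (v y))"
    unfolding j prod.case using le j(2) f0 by (intro C2'[rule_format]) auto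
  qed
  also have "\<dots> = ennreal C2 * (\<integral>y\<in>D'. ?w y * ennreal (v y))"
   unfolding D'_def by (subst nn_integral_UN_countable[OF J'(1,2) dc0]) (auto simp: nn_integral_cmult)
  finally have P2: "(\<integral>y\<in>D'. ?w y * ennreal (f y * v y)) \<le> ennreal C2 * (\<integral>y\<in>D'. ?w y * ennreal (v y))" .
  have "(\<integral>y\<in>trip k x. ?w y * enorm (F y)) = (\<integral>y\<in>trip k x. ?w y * ennreal (f y * v y))"
   using F by (intro nn_integral_cong_AE) auto
  also have "\<dots> = (\<integral>y\<in>trip k x - D'. ?w y * ennreal (f y * v y)) + (\<integral>y\<in>D'. ?w y * ennreal (f y * v y))"
   by (rule split) measurable
  also have "\<dots> \<le> (\<integral>y\<in>trip k x - D'. ?w y * ennreal (f y * v y)) + ennreal C2 * (\<integral>y\<in>D'. ?w y * ennreal (v y))"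
   by (intro add_left_mono P2)
  also have "(\<integral>y\<in>D'. ?w y * ennreal (v y)) = (\<integral>y\<in>D'. ?w y * ennreal (?g y * v y))"
   using D' D't by (intro nn_integral_cong) (auto simp: indicator_def simp del: UN_iff)
  also have "(\<integral>y\<in>trip k x - D'. ?w y * ennreal (f y * v y)) = (\<integral>y\<in>trip k x - D'. ?w y * ennreal (?g y * v y))"
   using D' by (intro nn_integral_cong) (auto simp: indicator_def simp del: UN_iff)
  also have "\<dots> + ennreal C2 * (\<integral>y\<in>D'. ?w y * ennreal (?g y * v y))
    \<le> ennreal CH * (\<integral>y\<in>trip k x - D'. ?w y * ennreal (?g y * v y)) + ennreal CH * (\<integral>y\<in>D'. ?w y * ennreal (?g y * v y))"
  proof (rule add_mono)
   have "1 * (\<integral>y\<in>trip k x - D'. ?w y * ennreal (?g y * v y)) \<le> ennreal CH * (\<integral>y\<in>trip k x - D'. ?w y * ennreal (?g y * v y))"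
    by (rule mult_right_mono) (auto simp: CH_def)
   then show "(\<integral>y\<in>trip k x - D'. ?w y * ennreal (?g y * v y)) \<le> ennreal CH * (\<integral>y\<in>trip k x - D'. ?w y * ennreal (?g y * v y))" by simp
  qed (auto simp: CH_def intro!: mult_right_mono ennreal_leI)
  also have "\<dots> = ennreal CH * (\<integral>y\<in>trip k x. ?w y * ennreal (?g y * v y))"
   unfolding distrib_left[symmetric] by (subst split[of "\<lambda>y. ?w y * ennreal (?g y * v y)"], measurable)
  finally show ?thesis .
 qed
 moreover have "CH \<ge> 1" by (simp add: CH_def)
 ultimately show ?thesis by (intro exI[of _ CH] conjI allI impI)
qed

end

context czo_weight
begin

abbreviation dyadic_estimate :: "nat \<Rightarrow> real \<Rightarrow> ('a \<Rightarrow> real) \<Rightarrow> ('a \<Rightarrow> real) \<Rightarrow> real \<Rightarrow> bool" where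
 "dyadic_estimate m \<kappa> u P K' \<equiv> (\<forall>F S f. adm b F \<longrightarrow> bounded S \<longrightarrow> (\<forall>x. x \<notin> S \<longrightarrow> F x = 0) \<longrightarrow>
  finite_means m b c F \<longrightarrow>
  f \<in> borel_measurable lebesgue \<longrightarrow> (\<forall>y. f y \<ge> 0) \<longrightarrow> (AE y. cmod (F y) = f y * v y) \<longrightarrow>
  (\<integral>y. ennreal (phi (real m) (f y) * v y)) < \<infinity> \<longrightarrow>
  (\<integral>x. ennreal (u x * v x) * indicator {x. cmod (commutator T b m F x) > v x} x)
   \<le> ennreal K' * (\<integral>x. ennreal (phi (real m) (f x)) * OM \<kappa> u x * dHL P x))"

text \<open>The mass of \<open>u v\<close> on \<open>E\<close>, the strong bound off the stopping
  cells and the strong bound on them all end in the integral of one function \<open>G\<close>. On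
  stopping cells this is possible because \<open>J2\<close> turns their volume into an integral of
  \<open>phi (f)\<close>, after which \<open>lx_le_OM\<close> and \<open>le_dHL\<close> insert the
  maximal functions.\<close>

lemma weak_dyadic:
 assumes r: "1 < r" "r < 2" "r - 1 < \<alpha>" and \<kappa>: "\<kappa> > (real m + 1) * r - 1"
  and u [measurable]: "lm u" and u0: "\<And>y. u y \<ge> 0" and P [measurable]: "lm P"
  and P1: "\<And>y. v y \<le> P y" and P2: "\<And>y. v y powr r * (1 + \<sigma> y) \<le> 2 * P y"
  and lxf: "\<And>k x. lx \<kappa> u k x < \<infinity>"
 shows "\<exists>K'>0. dyadic_estimate m \<kappa> u P K'"
proof -
 let ?n = "DIM('a)"
 have mr: "(real m + 1) * r \<ge> 1 * 1" using r by (intro mult_mono) auto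
 then have \<kappa>0: "\<kappa> \<ge> 0" using \<kappa> by simp
 \<comment> \<open>Then \<open>v powr (1 - r) = \<sigma> powr t\<close>, with \<open>t < 1\<close>
   because \<open>r - 1 < \<alpha>\<close>.\<close>
 define t where "t = (r - 1) / \<alpha>"
 have t: "0 < t" "t < 1" using r \<alpha>_pos by (auto simp: t_def)
 have vt: "v y powr (1 - r) = \<sigma> y powr t" for y using \<alpha>_pos by (simp add: \<sigma>_def t_def powr_powr)
 obtain B where B: "B \<ge> 1" "\<And>h k x \<tau>. lm h \<Longrightarrow> (\<forall>y. h y \<ge> 0) \<Longrightarrow> \<tau> > 0 \<Longrightarrow>
  (\<integral>y\<in>trip k x. ennreal (phi \<kappa> (h y / \<tau>) * \<sigma> y)) \<le> ennreal (s k x * (3 ^ ?n * dvol TYPE('a) k)) \<Longrightarrow>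
  (\<integral>y\<in>trip k x. ennreal (phi \<kappa> (h y * \<sigma> y powr t / (B * (1 + s k x) * \<tau>)))) \<le> ennreal (3 ^ ?n * dvol TYPE('a) k)"
  using weight_orlicz[OF t \<kappa>0] by blast
 from stopped_average[of m "2 ^ ?n * C"] obtain CH where CH: "CH \<ge> 1" and CH2: "stopped_estimate m (2 ^ ?n * C) CH"
  by (elim exE conjE) (rule that)
 have CH0: "CH > 0" using CH by simp
 from comm_strong[OF bmo_data_axioms r(1,2) \<kappa> CH0] obtain K1 where K1: "K1 > 0" and K12: "strong_estimate b c m r \<kappa> CH K1"
  by (elim exE conjE) (rule that)
 define K' where "K' = C ^ 3 * 3 ^ ?n + K1 * (4 * B * C * (1 + C))"
 have K': "K' > 0" using C_ge B(1) K1 by (auto simp: K'_def intro!: add_pos_nonneg)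
 have main: "(\<integral>x. ennreal (u x * v x) * indicator {x. cmod (commutator T b m F x) > v x} x)
   \<le> ennreal K' * (\<integral>x. ennreal (phi (real m) (f x)) * OM \<kappa> u x * dHL P x)"
  if ad: "adm b F" and S: "bounded S" "\<forall>x. x \<notin> S \<longrightarrow> F x = 0"
   and fin: "finite_means m b c F"
   and f [measurable]: "lm f" and f0: "\<forall>y. f y \<ge> 0" and Ff: "AE y. cmod (F y) = f y * v y"
   and fv: "(\<integral>y. ennreal (phi (real m) (f y) * v y)) < \<infinity>" for F S f
 proof -
  obtain J :: "(int \<times> 'a) set" where J: "countable J" "disjoint_family_on cell J"
   and J1: "\<And>k z. (k, z) \<in> J \<Longrightarrow> (\<integral>y\<in>dc k z. ennreal (phi (real m) (f y) * v y)) \<le> ennreal (2 ^ ?n * C * (a k z * dvol TYPE('a) k))"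
   and J2: "\<And>k z. (k, z) \<in> J \<Longrightarrow> ennreal (dvol TYPE('a) k) \<le> ennreal C * (\<integral>y\<in>dc k z. ennreal (phi (real m) (f y)))"
   and J3: "AE y. y \<notin> (\<Union>(cell ` J)) \<longrightarrow> f y \<le> 1"
   by (rule stopping_family[OF f _ fv]) (use f0 in auto)
  have dc0: "(cell j) \<in> sets lebesgue" for j :: "int \<times> 'a" by (rule countable_J_sets)
  have trip0: "(case j of (k, z) \<Rightarrow> trip k z) \<in> sets lebesgue" for j :: "int \<times> 'a" by (cases j) simp
  define D where "D = (\<Union>(cell ` J))"
  define E where "E = (\<Union>(k, z)\<in>J. trip k z)"
  have [measurable]: "D \<in> sets lebesgue" unfolding D_def by (rule J_union_sets[OF J(1)])
  have [measurable]: "E \<in> sets lebesgue" unfolding E_def by (rule sets.countable_UN'') (use J(1) trip0 in auto)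
  \<comment> \<open>A cell inside \<open>E\<close> carries no mass of the truncated weight, so
    \<open>stopped_average\<close> is needed only for cells that leave \<open>E\<close>.\<close>
  define us where "us y = (if y \<in> E then 0 else u y)" for y
  have us [measurable]: "lm us" unfolding us_def[abs_def] by measurable
  have us0: "us y \<ge> 0" "us y \<le> u y" for y using u0[of y] by (auto simp: us_def)
  have lxu: "lx \<kappa> us k x \<le> lx \<kappa> u k x" for k x using us0 u0 by (intro lx_mono \<kappa>0) auto
  have lxs: "lx \<kappa> us k x < \<infinity>" for k x using le_less_trans[OF lxu lxf] .
  \<comment> \<open>The maximal function of the truncated weight, not of \<open>u\<close>: by
    \<open>OM_const\<close> it is constant on each stopping cell, and \<open>partD\<close> can take
    it out of the integral of \<open>P\<close>.\<close>
  define N where "N = OM \<kappa> us"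
  have Nm [measurable]: "lm N" by (simp add: N_def)
  have NO: "N y \<le> OM \<kappa> u y" for y unfolding N_def using us0 u0 by (intro OM_mono \<kappa>0) auto
  have Nc: "N y = N z" if "(k, z) \<in> J" "y \<in> dc k z" for k z y
   unfolding N_def by (rule OM_const[OF _ that(2)]) (use that(1) in \<open>auto simp: us_def E_def\<close>)
  define w where "w y = us y * v y powr (1 - r)" for y
  have wm [measurable]: "lm w" unfolding w_def[abs_def] by measurable
  define W where "W y = ennreal (2 * B * C * (1 + \<sigma> y)) * N y" for y
  have Wm [measurable]: "lm W" unfolding W_def[abs_def] by measurable
  define g where "g y = (if y \<in> D then 1 else f y)" for y
  have gm [measurable]: "lm g" unfolding g_def[abs_def] by measurable
  have g0: "g y \<ge> 0" for y using f0 by (simp add: g_def)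
  define H where "H y = ennreal (g y * v y)" for y
  have Hm [measurable]: "lm H" unfolding H_def[abs_def] by measurable
  \<comment> \<open>Twice the norm, so that the strict inequality demanded by \<open>lx_less\<close>
    holds whenever the norm is not 0.\<close>
  define \<tau> where "\<tau> k x = 2 * enn2real (lx \<kappa> us k x)" for k x
  have \<tau>: "\<tau> k x \<ge> 0" for k x by (simp add: \<tau>_def)
  have \<tau>lx: "ennreal (\<tau> k x) = 2 * lx \<kappa> us k x" for k x using lxs[of k x] by (simp add: \<tau>_def ennreal_mult')
  define Wq where "Wq k x = B * (1 + s k x) * \<tau> k x" for k x
  have Wq0: "Wq k x \<ge> 0" for k x using B(1) s_pos[of k x] \<tau> by (auto simp: Wq_def intro!: mult_nonneg_nonneg)
  have Wq1: "Wq k x > 0 \<longleftrightarrow> \<tau> k x > 0" for k x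
  proof -
   have "B * (1 + s k x) > 0" using B(1) s_pos[of k x] by (intro mult_pos_pos) auto
   then show ?thesis unfolding Wq_def by (metis mult_pos_pos zero_less_mult_pos)
  qed
  have st: "(\<integral>x. ennreal (cmod (commutator T b m F x) powr r * w x)) \<le> ennreal K1 * (\<integral>y. epow (H y) r * W y)"
  proof (rule K12[rule_format, OF ad S(1), where Wq = Wq])
   fix k x
   show "AE y. y \<in> trip k x \<longrightarrow> ennreal (Wq k x) \<le> W y"
    using s_le[of k x]
   proof eventually_elim
    case (elim y)
    show ?case
    proof
     assume y: "y \<in> trip k x"
     then have "s k x \<le> C * \<sigma> y" using elim by (simp add: \<sigma>_def)
     then have "1 + s k x \<le> C * (1 + \<sigma> y)" using C_ge by (simp add: distrib_left)
     then have "B * (1 + s k x) \<le> B * (C * (1 + \<sigma> y))" using B(1) by (intro mult_left_mono) auto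
     have "ennreal (Wq k x) = ennreal (B * (1 + s k x)) * (2 * lx \<kappa> us k x)"
      unfolding Wq_def \<tau>lx[symmetric] using B(1) s_pos[of k x] \<tau> by (intro ennreal_mult) auto
     also have "\<dots> \<le> ennreal (B * (C * (1 + \<sigma> y))) * (2 * N y)"
      unfolding N_def using \<open>B * (1 + s k x) \<le> B * (C * (1 + \<sigma> y))\<close> lx_le_OM[OF y]
      by (intro mult_mono[OF ennreal_leI mult_left_mono]) auto
     also have "\<dots> = W y"
     proof -
      have "ennreal (2 * B * C * (1 + \<sigma> y)) = 2 * ennreal (B * (C * (1 + \<sigma> y)))"
       using ennreal_mult'[of 2 "B * (C * (1 + \<sigma> y))"] by (simp add: mult_ac)
      then show ?thesis by (simp add: W_def mult_ac)
     qed
     finally show "ennreal (Wq k x) \<le> W y" .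
    qed
   qed
   show "(\<integral>y\<in>trip k x. ennreal (phi \<kappa> (w y / Wq k x))) \<le> ennreal (3 ^ ?n * dvol TYPE('a) k)" if "Wq k x > 0"
   proof -
    have tp: "\<tau> k x > 0" using that Wq1 by simp
    have "lx \<kappa> us k x < ennreal (\<tau> k x)"
     using lxs[of k x] tp by (cases "lx \<kappa> us k x") (auto simp: \<tau>_def ennreal_less_iff)
    then have "(\<integral>y\<in>trip k x. ennreal (phi \<kappa> (us y / \<tau> k x) * \<sigma> y)) \<le> ennreal (s k x * (3 ^ ?n * dvol TYPE('a) k))"
     using lx_less[OF _ \<kappa>0] us0(1) by fastforce
    then show ?thesis unfolding w_def vt Wq_def using us0(1) tp by (intro B(2)) auto
   qed
   show "AE y. y \<in> dc k x \<longrightarrow> w y = 0" if "Wq k x = 0"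
   proof -
    have "\<tau> k x = 0" using that Wq1[of k x] \<tau>[of k x] by linarith
    then have "lx \<kappa> us k x = 0" using \<tau>lx[of k x] by simp
    from lx_zero_imp[OF us \<kappa>0 this] show ?thesis
     by eventually_elim (use dc_subset_trip in \<open>auto simp: w_def\<close>)
   qed
   show "(bmean m b c k x (\<lambda>y. enorm (F y))) \<le> ennreal CH * (bmean m b c k x H)"
    if nz: "\<not> (AE y. y \<in> dc k x \<longrightarrow> w y = 0)"
   proof -
    have "\<not> dc k x \<subseteq> E"
    proof
     assume "dc k x \<subseteq> E"
     then have "\<And>y. y \<in> dc k x \<longrightarrow> w y = 0" by (auto simp: w_def us_def)
     then show False using nz by simp
    qed
    then show ?thesis unfolding H_def g_def D_def E_def
     by (intro CH2[rule_format, OF J _ f _ Ff]) (use J1 f0 in auto)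
   qed
  qed (use S(2) fin Wq0 us0 in \<open>auto simp: w_def\<close>)
  define G where "G y = ennreal (phi (real m) (f y)) * OM \<kappa> u y * dHL P y" for y
  have Gm [measurable]: "lm G" unfolding G_def[abs_def] by measurable
  let ?h = "\<lambda>k z. (\<integral>y\<in>dc k z. ennreal (P y)) / ennreal (dvol TYPE('a) k)"
  \<comment> \<open>The volume of a stopping cell is replaced by the integral of
    \<open>phi (f)\<close>; the factor \<open>X\<close> must then lie below the maximal function on
    the whole cell.\<close>
  have cell: "ennreal (dvol TYPE('a) k) * (X * ?h k z) \<le> ennreal C * (\<integral>y\<in>dc k z. G y)"
   if j: "(k, z) \<in> J" and X: "\<And>y. y \<in> dc k z \<Longrightarrow> X \<le> OM \<kappa> u y" for k z X
  proof -
   have "ennreal (dvol TYPE('a) k) * (X * ?h k z) \<le> ennreal C * (\<integral>y\<in>dc k z. ennreal (phi (real m) (f y))) * (X * ?h k z)"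
    by (intro mult_right_mono J2[OF j]) simp
   also have "\<dots> = ennreal C * (\<integral>y. ennreal (phi (real m) (f y)) * indicator (dc k z) y * (X * ?h k z))"
    by (subst nn_integral_multc) (auto simp: mult.assoc)
   also have "\<dots> \<le> ennreal C * (\<integral>y\<in>dc k z. G y)"
   proof (intro mult_left_mono nn_integral_mono)
    fix y
    show "ennreal (phi (real m) (f y)) * indicator (dc k z) y * (X * ?h k z) \<le> G y * indicator (dc k z) y"
    proof (cases "y \<in> dc k z")
     case True
     then have "X * ?h k z \<le> OM \<kappa> u y * dHL P y" by (intro mult_mono X le_dHL) auto
     then show ?thesis using True by (simp add: G_def mult.assoc mult_left_mono)
    qed simp
   qed simp
   finally show ?thesis .
  qed
  have sumJ: "(\<Sum>\<^sup>+j\<in>J. (\<integral>y\<in>cell j. G y)) \<le> (\<integral>y. G y)"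
   unfolding nn_integral_UN_countable[OF J dc0 Gm, symmetric] by (intro nn_integral_mono) (auto simp: indicator_def)
  have partE: "(\<integral>y\<in>E. ennreal (u y * v y)) \<le> ennreal (C ^ 3 * 3 ^ ?n) * (\<integral>y. G y)"
  proof -
   let ?M = "density lebesgue (\<lambda>y. ennreal (u y * v y))"
   have dens: "emeasure ?M A = (\<integral>y\<in>A. ennreal (u y * v y))" if "A \<in> sets lebesgue" for A
    using that by (intro emeasure_density) auto
   have "(\<integral>y\<in>E. ennreal (u y * v y)) = emeasure ?M (\<Union>j\<in>J. case j of (k, z) \<Rightarrow> trip k z)"
    unfolding E_def[symmetric] by (rule dens[symmetric]) measurable
   also have "\<dots> \<le> (\<Sum>\<^sup>+j\<in>J. emeasure ?M (case j of (k, z) \<Rightarrow> trip k z))"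
    by (rule emeasure_UN_le_count_space[OF J(1)]) (use trip0 in simp)
   also have "\<dots> \<le> (\<Sum>\<^sup>+j\<in>J. ennreal (C ^ 3 * 3 ^ ?n) * (\<integral>y\<in>cell j. G y))"
   proof (rule nn_integral_mono)
    fix j assume "j \<in> space (count_space J)"
    then obtain k z where j: "j = (k, z)" "(k, z) \<in> J" by (cases j) auto
    have ap: "a k z > 0" by (rule a_pos)
    have ah: "ennreal (a k z) \<le> ?h k z"
    proof -
     have "ennreal (a k z) = ennreal (a k z * dvol TYPE('a) k) / ennreal (dvol TYPE('a) k)" using ap by (simp add: divide_ennreal)
     also have "\<dots> \<le> ?h k z"
      unfolding v_dc[symmetric] using P1 by (intro divide_right_mono_ennreal nn_integral_mono mult_right_mono ennreal_leI) auto
     finally show ?thesis .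
    qed
    have "emeasure ?M (trip k z) = (\<integral>y\<in>trip k z. ennreal (u y * v y))" by (rule dens) simp
    also have "\<dots> \<le> ennreal (C * a k z) * (\<integral>y\<in>trip k z. ennreal (u y))"
     by (rule dc_v_le[OF u u0]) auto
    also have "\<dots> \<le> ennreal (C * a k z) * (lx \<kappa> u k z * ennreal (C * (3 ^ ?n * dvol TYPE('a) k)))"
     using trip_le_lx[OF u \<kappa>0, of k z] u0 by (intro mult_left_mono) auto
    also have "\<dots> = ennreal (C ^ 2 * 3 ^ ?n) * (ennreal (dvol TYPE('a) k) * (lx \<kappa> u k z * ennreal (a k z)))"
     using C_ge ap by (simp add: ennreal_mult power2_eq_square mult_ac)
    also have "\<dots> \<le> ennreal (C ^ 2 * 3 ^ ?n) * (ennreal (dvol TYPE('a) k) * (lx \<kappa> u k z * ?h k z))"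
     by (intro mult_left_mono ah) auto
    also have "\<dots> \<le> ennreal (C ^ 2 * 3 ^ ?n) * (ennreal C * (\<integral>y\<in>dc k z. G y))"
     by (intro mult_left_mono cell j(2) lx_le_OM) (use dc_subset_trip in auto)
    also have "\<dots> = ennreal (C ^ 3 * 3 ^ ?n) * (\<integral>y\<in>dc k z. G y)"
     unfolding mult.assoc[symmetric] using C_ge by (subst ennreal_mult[symmetric]) (auto simp: power2_eq_square power3_eq_cube mult_ac)
    finally show "emeasure ?M (case j of (k, z) \<Rightarrow> trip k z) \<le> ennreal (C ^ 3 * 3 ^ ?n) * (\<integral>y\<in>cell j. G y)"
     by (simp add: j)
   qed
   also have "\<dots> = ennreal (C ^ 3 * 3 ^ ?n) * (\<Sum>\<^sup>+j\<in>J. (\<integral>y\<in>cell j. G y))"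
    by (rule nn_integral_cmult) simp
   also have "\<dots> \<le> ennreal (C ^ 3 * 3 ^ ?n) * (\<integral>y. G y)" by (intro mult_left_mono sumJ) simp
   finally show ?thesis .
  qed
  have partD: "(\<integral>y\<in>D. ennreal (P y) * N y) \<le> ennreal C * (\<integral>y. G y)"
  proof -
   have "(\<integral>y\<in>D. ennreal (P y) * N y) = (\<Sum>\<^sup>+j\<in>J. (\<integral>y\<in>cell j. ennreal (P y) * N y))"
    unfolding D_def by (rule nn_integral_UN_countable[OF J dc0]) measurable
   also have "\<dots> \<le> (\<Sum>\<^sup>+j\<in>J. ennreal C * (\<integral>y\<in>cell j. G y))"
   proof (rule nn_integral_mono)
    fix j assume "j \<in> space (count_space J)"
    then obtain k z where j: "j = (k, z)" "(k, z) \<in> J" by (cases j) auto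
    have "(\<integral>y\<in>dc k z. ennreal (P y) * N y) = (\<integral>y. N z * (ennreal (P y) * indicator (dc k z) y))"
    proof (rule nn_integral_cong)
     fix y
     show "ennreal (P y) * N y * indicator (dc k z) y = N z * (ennreal (P y) * indicator (dc k z) y)"
      by (cases "y \<in> dc k z") (simp_all add: Nc[OF j(2), of y] mult.commute)
    qed
    also have "\<dots> = N z * (\<integral>y\<in>dc k z. ennreal (P y))" by (rule nn_integral_cmult) measurable
    also have "\<dots> = ennreal (dvol TYPE('a) k) * (N z * ?h k z)"
    proof -
     have "?h k z * ennreal (dvol TYPE('a) k) = (\<integral>y\<in>dc k z. ennreal (P y))" by (rule ennreal_divide_mult_cancel) auto
     then show ?thesis by (metis mult.assoc mult.commute)
    qed
    also have "\<dots> \<le> ennreal C * (\<integral>y\<in>dc k z. G y)"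
     by (rule cell[OF j(2)]) (use Nc[OF j(2)] NO in metis)
    finally show "(\<integral>y\<in>cell j. ennreal (P y) * N y) \<le> ennreal C * (\<integral>y\<in>cell j. G y)"
     by (simp add: j)
   qed
   also have "\<dots> = ennreal C * (\<Sum>\<^sup>+j\<in>J. (\<integral>y\<in>cell j. G y))"
    by (rule nn_integral_cmult) simp
   also have "\<dots> \<le> ennreal C * (\<integral>y. G y)" by (intro mult_left_mono sumJ) simp
   finally show ?thesis .
  qed
  have partW: "(\<integral>y. epow (H y) r * W y) \<le> ennreal (4 * B * C * (1 + C)) * (\<integral>y. G y)"
  proof -
   have pw: "epow (H y) r * W y \<le> ennreal (4 * B * C) * (ennreal (g y powr r) * (ennreal (P y) * N y))" for y
   proof -
    have vp: "v y > 0" by (rule v_pos)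
    have "g y powr r * v y powr r * (2 * B * C * (1 + \<sigma> y)) = 2 * B * C * (g y powr r) * (v y powr r * (1 + \<sigma> y))" by simp
    also have "\<dots> \<le> 2 * B * C * (g y powr r) * (2 * P y)" using B(1) C_ge by (intro mult_left_mono P2) auto
    finally have le: "g y powr r * v y powr r * (2 * B * C * (1 + \<sigma> y)) \<le> 4 * B * C * (g y powr r * P y)" by simp
    have "epow (H y) r * W y = ennreal (g y powr r * v y powr r * (2 * B * C * (1 + \<sigma> y))) * N y"
     using g0[of y] vp B(1) C_ge \<sigma>_pos[of y] by (simp add: H_def W_def epow_ennreal powr_mult ennreal_mult[symmetric] mult.assoc[symmetric])
    also have "\<dots> \<le> ennreal (4 * B * C * (g y powr r * P y)) * N y" by (intro mult_right_mono ennreal_leI le) simp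
    also have "\<dots> = ennreal (4 * B * C) * (ennreal (g y powr r) * (ennreal (P y) * N y))"
     using B(1) C_ge P1[of y] vp by (simp add: ennreal_mult mult.assoc)
    finally show ?thesis .
   qed
   have "(\<integral>y. epow (H y) r * W y) \<le> (\<integral>y. ennreal (4 * B * C) * (ennreal (g y powr r) * (ennreal (P y) * N y)))"
    by (intro nn_integral_mono pw)
   also have "\<dots> \<le> (\<integral>y. ennreal (4 * B * C) * (G y + ennreal (P y) * N y * indicator D y))"
   proof (rule nn_integral_mono_AE)
    show "AE y. ennreal (4 * B * C) * (ennreal (g y powr r) * (ennreal (P y) * N y)) \<le> ennreal (4 * B * C) * (G y + ennreal (P y) * N y * indicator D y)"
     using J3 AE_le_dHL[OF P]
    proof eventually_elim
    case (elim y)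
    show ?case
    proof (rule mult_left_mono)
     show "ennreal (g y powr r) * (ennreal (P y) * N y) \<le> G y + ennreal (P y) * N y * indicator D y"
     proof (cases "y \<in> D")
      case True
      then show ?thesis by (simp add: g_def)
     next
      case False
      then have f1: "f y \<le> 1" using elim(1) by (simp add: D_def)
      \<comment> \<open>Off \<open>D\<close> the function is at most 1, so the power
        \<open>r\<close> only decreases it.\<close>
      have "f y powr r \<le> f y powr 1" using f1 f0 r by (intro powr_mono') auto
      also have "\<dots> = f y" using f0 by simp
      also have "\<dots> \<le> phi (real m) (f y)" using f0 by (intro phi_ge) auto
      finally have "ennreal (f y powr r) \<le> ennreal (phi (real m) (f y))" by (rule ennreal_leI)
      then have "ennreal (f y powr r) * (ennreal (P y) * N y) \<le> ennreal (phi (real m) (f y)) * (dHL P y * OM \<kappa> u y)"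
       using elim(2) NO by (intro mult_mono) auto
      then show ?thesis using False by (simp add: g_def G_def mult_ac)
     qed
    qed simp
   qed
   qed
   also have "\<dots> = ennreal (4 * B * C) * ((\<integral>y. G y) + (\<integral>y\<in>D. ennreal (P y) * N y))"
    by (subst nn_integral_cmult, measurable, subst nn_integral_add) auto
   also have "\<dots> \<le> ennreal (4 * B * C) * ((\<integral>y. G y) + ennreal C * (\<integral>y. G y))"
    by (intro mult_left_mono add_left_mono partD) simp
   also have "\<dots> = ennreal (4 * B * C * (1 + C)) * (\<integral>y. G y)"
    using B(1) C_ge by (simp add: ennreal_mult ennreal_plus distrib_left distrib_right mult_ac)
   finally show ?thesis .
  qed
  have "(\<integral>x. ennreal (u x * v x) * indicator {x. cmod (commutator T b m F x) > v x} x)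
   \<le> (\<integral>x. ennreal (u x * v x) * indicator E x + ennreal (cmod (commutator T b m F x) powr r * w x))"
  proof (rule nn_integral_mono)
   fix x
   show "ennreal (u x * v x) * indicator {x. cmod (commutator T b m F x) > v x} x \<le> ennreal (u x * v x) * indicator E x + ennreal (cmod (commutator T b m F x) powr r * w x)"
   proof (cases "x \<notin> E \<and> cmod (commutator T b m F x) > v x")
    case True
    have vp: "v x > 0" by (rule v_pos)
    \<comment> \<open>Chebyshev's inequality with exponent \<open>r\<close>: on the level set
      \<open>v x\<close> is below the commutator.\<close>
    have "u x * v x = u x * (v x powr r * v x powr (1 - r))" using vp by (simp add: powr_add[symmetric])
    also have "\<dots> \<le> u x * (cmod (commutator T b m F x) powr r * v x powr (1 - r))"
     using True vp r u0[of x] by (intro mult_left_mono mult_right_mono powr_mono2) auto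
    also have "\<dots> = cmod (commutator T b m F x) powr r * w x" using True by (simp add: w_def us_def)
    finally show ?thesis using True by (simp add: ennreal_leI)
   qed (auto simp: indicator_def)
  qed
  also have "\<dots> = (\<integral>x\<in>E. ennreal (u x * v x)) + (\<integral>x. ennreal (cmod (commutator T b m F x) powr r * w x))"
  proof (rule nn_integral_add)
   have [measurable]: "commutator T b m F \<in> borel_measurable lebesgue" by (rule comm_measurable[OF ad b_meas])
   show "lm (\<lambda>x. ennreal (cmod (commutator T b m F x) powr r * w x))" by measurable
  qed measurable
  also have "\<dots> \<le> ennreal (C ^ 3 * 3 ^ ?n) * (\<integral>y. G y) + ennreal K1 * (ennreal (4 * B * C * (1 + C)) * (\<integral>y. G y))"
   by (intro add_mono partE order_trans[OF st] mult_left_mono partW) simp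
  also have "\<dots> = ennreal K' * (\<integral>y. G y)"
   unfolding K'_def using B(1) C_ge K1 by (subst ennreal_plus) (auto simp: distrib_right mult.assoc[symmetric] ennreal_mult)
  finally show ?thesis unfolding G_def .
 qed
 show ?thesis by (rule exI[of _ K'], rule conjI[OF K'], intro allI impI, rule main) assumption+
qed

end

section \<open>Reduction of the theorem to the dyadic estimate\<close>

lemma tcl_eq: "y \<in> dc k x \<Longrightarrow> tcl k y = tcl k x"
 by (simp add: tcl_def cn_eq)

lemma measure_tcl: "measure lebesgue (tcl k (x::'a::euclidean_space)) = 3 ^ DIM('a) * dvol TYPE('a) k"
 using emeasure_tcl[of k x] by (simp add: measure_def)

lemma measure_dcl: "measure lebesgue (dcl k (x::'a::euclidean_space)) = dvol TYPE('a) k"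
 using emeasure_dcl[of k x] by (simp add: measure_def)

lemma oscillation_nn_integral:
 fixes b :: "'a::euclidean_space \<Rightarrow> real"
 assumes b: "locally_integrable b"
 shows "(\<integral>y\<in>trip k x. ennreal \<bar>b y - avg b (tcl k x)\<bar>)
  = ennreal (avg (\<lambda>y. \<bar>b y - avg b (tcl k x)\<bar>) (tcl k x) * (3 ^ DIM('a) * dvol TYPE('a) k))"
proof -
 let ?c = "avg b (tcl k x)"
 have comp: "compact (tcl k x)" by (rule is_cube_measure(1)[OF is_cube_tcl])
 have "set_integrable lebesgue (tcl k x) (\<lambda>y. b y - ?c)"
  using b comp emeasure_tcl[of k x]
  by (intro set_integral_diff) (auto simp: locally_integrable_def set_integrable_def)
 then have i: "set_integrable lebesgue (tcl k x) (\<lambda>y. \<bar>b y - ?c\<bar>)" by (rule set_integrable_abs)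
 have "(\<integral>y\<in>tcl k x. ennreal \<bar>b y - ?c\<bar>) = ennreal (LINT y:tcl k x|lebesgue. \<bar>b y - ?c\<bar>)"
  by (rule nn_set_integral[OF i]) auto
 then show ?thesis by (simp add: nn_integral_tcl avg_def measure_tcl)
qed

text \<open>BMO means are taken over the volume of the triple, which is \<open>3^n\<close> times
  \<open>dvol\<close>; hence the oscillation bound \<open>3^n\<close> fed into
  \<open>john_nirenberg\<close>.\<close>

lemma oscillation_bmo_data:
 fixes b :: "'a::euclidean_space \<Rightarrow> real"
 assumes b: "locally_integrable b" and osc: "\<And>Q. is_cube Q \<Longrightarrow> avg (\<lambda>x. \<bar>b x - avg b Q\<bar>) Q \<le> 1"
 shows "\<exists>\<theta>. bmo_data b (\<lambda>k x. avg b (tcl k x)) \<theta> (9 * 3 ^ DIM('a))"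
proof -
 have bm: "lm b" using b by (simp add: locally_integrable_def)
 have "(\<integral>y\<in>trip k x. ennreal \<bar>b y - avg b (tcl k x)\<bar>) \<le> ennreal (3 ^ DIM('a) * dvol TYPE('a) k)" for k x
  unfolding oscillation_nn_integral[OF b]
  by (intro ennreal_leI mult_left_le_one_le osc is_cube_tcl) (auto simp: avg_def set_lebesgue_integral_def intro!: divide_nonneg_nonneg integral_nonneg_AE)
 then obtain \<theta> where \<theta>: "\<theta> > 0" "\<And>k x. (\<integral>y\<in>trip k x. ennreal (exp (\<theta> * \<bar>b y - avg b (tcl k x)\<bar>))) \<le> ennreal (9 * 3 ^ DIM('a) * dvol TYPE('a) k)"
  using john_nirenberg[OF bm, of "3 ^ DIM('a)" "\<lambda>k x. avg b (tcl k x)"] by auto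
 have "(1::real) \<le> 3 ^ DIM('a)" by simp
 then have "(1::real) \<le> 9 * 3 ^ DIM('a)" by linarith
 then have "bmo_data b (\<lambda>k x. avg b (tcl k x)) \<theta> (9 * 3 ^ DIM('a))"
  using bm \<theta> by unfold_locales (auto simp: tcl_eq)
 then show ?thesis by blast
qed

lemma bounded_subset_trip:
 assumes "bounded S" obtains k where "S \<subseteq> trip k x"
 using bounded_in_trip[of "insert x S"] assms by auto

context bmo_data
begin

lemma bw_trip_finite: "(\<integral>y\<in>trip k x. ennreal (bw m b (c k x) y)) < \<infinity>"
proof -
 let ?A = "((real m + 1) / \<theta>) powr real m * exp \<theta>"
 have le: "bw m b (c k x) y \<le> ?A * exp (\<theta> * \<bar>b y - c k x\<bar>)" for y
  using powr_le_exp[of "1 + \<bar>b y - c k x\<bar>" "real m" \<theta>] \<theta> by (simp add: bw_def powr_realpow add_pos_nonneg distrib_left exp_add mult.assoc)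
 have "(\<integral>y\<in>trip k x. ennreal (bw m b (c k x) y)) \<le> (\<integral>y. ennreal ?A * (ennreal (exp (\<theta> * \<bar>b y - c k x\<bar>)) * indicator (trip k x) y))"
  using le by (intro nn_integral_mono) (auto simp: indicator_def ennreal_mult[symmetric] intro!: ennreal_leI)
 also have "\<dots> = ennreal ?A * (\<integral>y\<in>trip k x. ennreal (exp (\<theta> * \<bar>b y - c k x\<bar>)))"
  by (rule nn_integral_cmult) measurable
 also have "\<dots> \<le> ennreal ?A * ennreal (J * dvol TYPE('a) k)" by (intro mult_left_mono jn) simp
 also have "\<dots> < \<infinity>" by (simp add: ennreal_mult_less_top)
 finally show ?thesis .
qed

text \<open>All powers of \<open>b\<close> are integrable over triples by exponential integrability.
  One triple contains the support, and there \<open>b\<close> is compared with a single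
  centre.\<close>

lemma bounded_adm:
 assumes F [measurable]: "lm F" and M: "AE y. cmod (F y) \<le> M" and S: "bounded S" "\<And>y. y \<notin> S \<Longrightarrow> F y = 0"
 shows "adm b F" "(bmean m b c k x (\<lambda>y. enorm (F y))) < \<infinity>"
proof -
 show "(bmean m b c k x (\<lambda>y. enorm (F y))) < \<infinity>"
 proof -
  have "(bmean m b c k x (\<lambda>y. enorm (F y))) \<le> (\<integral>y. ennreal M * (ennreal (bw m b (c k x) y) * indicator (trip k x) y))"
  proof (rule nn_integral_mono_AE)
   show "AE y. ennreal (bw m b (c k x) y) * enorm (F y) * indicator (trip k x) y \<le> ennreal M * (ennreal (bw m b (c k x) y) * indicator (trip k x) y)"
    using M by eventually_elim (auto simp: indicator_def mult.commute[of "ennreal M"] intro!: mult_left_mono ennreal_leI)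
  qed
  also have "\<dots> = ennreal M * (\<integral>y\<in>trip k x. ennreal (bw m b (c k x) y))"
   by (rule nn_integral_cmult) measurable
  also have "\<dots> < \<infinity>" using bw_trip_finite[of m k x] by (simp add: ennreal_mult_less_top)
  finally show ?thesis .
 qed
 show "adm b F"
  unfolding adm_def
 proof
  fix j
  obtain k where k: "S \<subseteq> trip k (0::'a)" using bounded_subset_trip[OF S(1)] .
  let ?c = "c k 0"
  let ?A = "(1 + \<bar>?c\<bar>) ^ (2 * j) * M\<^sup>2"
  have "(\<integral>y. ennreal ((cmod (of_real (b y) ^ j * F y))\<^sup>2)) \<le> (\<integral>y. ennreal ?A * (ennreal (bw (2 * j) b ?c y) * indicator (trip k 0) y))"
  proof (rule nn_integral_mono_AE)
   show "AE y. ennreal ((cmod (of_real (b y) ^ j * F y))\<^sup>2) \<le> ennreal ?A * (ennreal (bw (2 * j) b ?c y) * indicator (trip k 0) y)"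
    using M
   proof eventually_elim
    case (elim y)
    show ?case
    proof (cases "y \<in> trip k 0")
     case True
     have "\<bar>b y\<bar> \<le> (1 + \<bar>?c\<bar>) * (1 + \<bar>b y - ?c\<bar>)"
     proof -
      have "0 \<le> \<bar>?c\<bar> * \<bar>b y - ?c\<bar>" by simp
      then show ?thesis unfolding distrib_right distrib_left mult_1_left mult_1_right by linarith
     qed
     then have "\<bar>b y\<bar> ^ (2 * j) \<le> ((1 + \<bar>?c\<bar>) * (1 + \<bar>b y - ?c\<bar>)) ^ (2 * j)" by (intro power_mono) auto
     then have 1: "\<bar>b y\<bar> ^ (2 * j) \<le> (1 + \<bar>?c\<bar>) ^ (2 * j) * bw (2 * j) b ?c y" by (simp add: bw_def power_mult_distrib)
     have 2: "(cmod (F y))\<^sup>2 \<le> M\<^sup>2" using elim by (intro power_mono) auto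
     have "(cmod (of_real (b y) ^ j * F y))\<^sup>2 = \<bar>b y\<bar> ^ (2 * j) * (cmod (F y))\<^sup>2"
      by (simp add: norm_mult norm_power power_mult_distrib power_mult[symmetric] mult.commute del: power_even_abs)
     also have "\<dots> \<le> ((1 + \<bar>?c\<bar>) ^ (2 * j) * bw (2 * j) b ?c y) * M\<^sup>2" using 1 2 by (intro mult_mono) (auto intro!: mult_nonneg_nonneg bw_pos)
     finally have "(cmod (of_real (b y) ^ j * F y))\<^sup>2 \<le> ?A * bw (2 * j) b ?c y" by (simp add: mult_ac)
     then show ?thesis using True bw_pos[of "2 * j" b ?c y] by (simp add: ennreal_mult[symmetric] ennreal_leI)
    next
     case False
     then show ?thesis using k S(2)[of y] by auto
    qed
   qed
  qed
  also have "\<dots> = ennreal ?A * (\<integral>y\<in>trip k 0. ennreal (bw (2 * j) b ?c y))"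
   by (rule nn_integral_cmult) measurable
  also have "\<dots> < \<infinity>" using bw_trip_finite[of "2 * j" k 0] by (simp add: ennreal_mult_less_top)
  finally show "L2 (\<lambda>x. of_real (b x) ^ j * F x)"
   unfolding L2_iff using b_meas by (auto intro!: borel_measurable_times borel_measurable_power)
 qed
qed

end

lemma RH_bounded:
 fixes v :: "'a::euclidean_space \<Rightarrow> real"
 assumes RH: "v \<in> RH_infty" and S: "bounded S"
 shows "\<exists>M. AE y. y \<in> S \<longrightarrow> \<bar>v y\<bar> \<le> M"
proof -
 obtain k where k: "S \<subseteq> trip k (0::'a)" using bounded_subset_trip[OF S] .
 obtain C1 where C1: "\<And>Q. is_cube Q \<Longrightarrow> (AE x. x \<in> Q \<longrightarrow> v x \<le> C1 * avg v Q)" and pos: "AE x. v x > 0"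
  using RH by (auto simp: RH_infty_def is_weight_def)
 have "AE y. y \<in> S \<longrightarrow> \<bar>v y\<bar> \<le> C1 * avg v (tcl k 0)"
  using C1[OF is_cube_tcl[of k 0]] pos
 proof eventually_elim
  case (elim y)
  then show ?case using k trip_tcl[of k 0] by auto
 qed
 then show ?thesis by blast
qed

text \<open>All functions \<open>b^i F\<close> are null, hence so are their images by
  \<open>T_null\<close>, and \<open>comm_bound\<close> concludes at each remaining point.\<close>

lemma (in czo) comm_null:
 assumes F: "adm b F" and 0: "AE x. F x = 0"
 shows "AE x. commutator T b m F x = 0"
proof -
 have "AE x. of_real (b x) ^ i * F x = 0" for i
  using 0 by eventually_elim simp
 then have "AE x. T (\<lambda>y. of_real (b y) ^ i * F y) x = 0" for i
  by (intro T_null admD F)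
 then have "AE x. \<forall>i. T (\<lambda>y. of_real (b y) ^ i * F y) x = 0" by (simp add: AE_all_countable)
 then show ?thesis
 proof eventually_elim
  case (elim x)
  then have "cmod (commutator T b m F x) \<le> (1 + \<bar>b x\<bar>) ^ m * 0" by (intro comm_bound) auto
  then show ?case by simp
 qed
qed

section \<open>Comparison of the dyadic quantities with those of the theorem\<close>

lemma dHL_le_HL_max:
 fixes P :: "'a::euclidean_space \<Rightarrow> real"
 assumes "\<And>y. P y \<ge> 0" "AE y. P y = P' y"
 shows "dHL P x \<le> HL_max P' x"
 unfolding dHL_def
proof (rule SUP_least)
 fix k
 have "(\<integral>z\<in>dc k x. ennreal (P z)) = (\<integral>z\<in>dcl k x. ennreal \<bar>P' z\<bar>)"
  unfolding nn_integral_dcl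
 proof (rule nn_integral_cong_AE)
  show "AE z. ennreal (P z) * indicator (dc k x) z = ennreal \<bar>P' z\<bar> * indicator (dc k x) z"
   using assms(2)
  proof eventually_elim
   case (elim z)
   then show ?case using assms(1)[of z] by simp
  qed
 qed
 then have "(\<integral>z\<in>dc k x. ennreal (P z)) / ennreal (dvol TYPE('a) k) = (\<integral>z\<in>dcl k x. ennreal \<bar>P' z\<bar>) / ennreal (measure lebesgue (dcl k x))"
  by (simp add: measure_dcl)
 also have "\<dots> \<le> HL_max P' x"
  unfolding HL_max_def using dc_dcl[of k x] by (intro SUP_upper) (auto simp: is_cube_dcl)
 finally show "(\<integral>z\<in>dc k x. ennreal (P z)) / ennreal (dvol TYPE('a) k) \<le> HL_max P' x" .
qed

lemma lux_norm_cong: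
 assumes Q: "is_cube Q" and [measurable]: "lm w" "lm w'" and ae: "AE y. w y = w' y"
 shows "lux_norm \<phi> w Q f = lux_norm \<phi> w' Q f"
proof -
 note [measurable] = is_cube_measure(2)[OF Q]
 have "(\<integral>x\<in>Q. ennreal (\<phi> (\<bar>f x\<bar> / s) * w x)) = (\<integral>x\<in>Q. ennreal (\<phi> (\<bar>f x\<bar> / s) * w' x))" for s
  using ae by (intro nn_integral_cong_AE) auto
 moreover have "(LINT x:Q|lebesgue. w x) = (LINT x:Q|lebesgue. w' x)"
  unfolding set_lebesgue_integral_def using ae by (intro integral_cong_AE) auto
 ultimately show ?thesis by (simp add: lux_norm_def)
qed

context muckenhoupt
begin

lemma OM_le_orlicz_max:
 assumes [measurable]: "lm w'" and "AE y. \<sigma> y = w' y"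
 shows "OM \<kappa> u x \<le> orlicz_max (phi \<kappa>) w' u x"
 unfolding OM_def orlicz_max_def
proof (intro SUP_least)
 fix k q assume q: "q \<in> trip k x"
 have "lx \<kappa> u k q = lux_norm (phi \<kappa>) w' (tcl k q) u"
  unfolding lx_def by (rule lux_norm_cong[OF is_cube_tcl]) (use assms in auto)
 also have "\<dots> \<le> (SUP Q\<in>{Q. is_cube Q \<and> x \<in> Q}. lux_norm (phi \<kappa>) w' Q u)"
  using q trip_tcl[of k q] by (intro SUP_upper) (auto simp: is_cube_tcl trip_sym)
 finally show "lx \<kappa> u k q \<le> (SUP Q\<in>{Q. is_cube Q \<and> x \<in> Q}. lux_norm (phi \<kappa>) w' Q u)" .
qed

text \<open>An infinite norm means that the integral is infinite for every \<open>t\<close>: a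
  finite one would fall below the bound after dividing by a large constant, by
  \<open>phi_scale_le\<close>. It stays infinite on every larger triple, and some triple reaches
  \<open>x\<close>.\<close>

lemma OM_infinite:
 assumes [measurable]: "lm u" and "\<kappa> \<ge> 0" and inf: "lx \<kappa> u k0 x0 = \<infinity>"
 shows "OM \<kappa> u x = \<infinity>"
proof -
 obtain k where k: "insert x (trip k0 x0) \<subseteq> trip k x"
  using bounded_subset_trip[of "insert x (trip k0 x0)" x] trip_bounded[of k0 x0] by auto
 let ?V = "s k0 x0 * (3 ^ DIM('a) * dvol TYPE('a) k0)"
 have V: "?V > 0" using s_pos[of k0 x0] by simp
 have I: "(\<integral>y\<in>trip k0 x0. ennreal (phi \<kappa> (\<bar>u y\<bar> / t) * \<sigma> y)) = \<infinity>" if t: "t > 0" for t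
 proof (rule ccontr)
  assume "\<not> ?thesis"
  then obtain i where i: "(\<integral>y\<in>trip k0 x0. ennreal (phi \<kappa> (\<bar>u y\<bar> / t) * \<sigma> y)) = ennreal i" "i \<ge> 0"
   by (cases "\<integral>\<^sup>+y\<in>trip k0 x0. ennreal (phi \<kappa> (\<bar>u y\<bar> / t) * \<sigma> y) \<partial>lebesgue") auto
  define B where "B = max 1 (i / ?V)"
  have B: "B \<ge> 1" "i \<le> B * ?V" using V by (auto simp: B_def max_def field_simps)
  have "(\<integral>y\<in>trip k0 x0. ennreal (phi \<kappa> (\<bar>u y\<bar> / (t * B)) * \<sigma> y)) \<le> (\<integral>y. ennreal (1 / B) * (ennreal (phi \<kappa> (\<bar>u y\<bar> / t) * \<sigma> y) * indicator (trip k0 x0) y))"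
  proof (rule nn_integral_mono)
   fix y
   have "phi \<kappa> (\<bar>u y\<bar> / t / B) * \<sigma> y \<le> phi \<kappa> (\<bar>u y\<bar> / t) / B * \<sigma> y"
    using t B assms(2) \<sigma>_pos[of y] by (intro mult_right_mono phi_scale_le) auto
   then show "ennreal (phi \<kappa> (\<bar>u y\<bar> / (t * B)) * \<sigma> y) * indicator (trip k0 x0) y \<le> ennreal (1 / B) * (ennreal (phi \<kappa> (\<bar>u y\<bar> / t) * \<sigma> y) * indicator (trip k0 x0) y)"
    using B(1) by (auto simp: indicator_def ennreal_mult'[symmetric] intro!: ennreal_leI)
  qed
  also have "\<dots> = ennreal (1 / B) * ennreal i" unfolding i(1)[symmetric] by (rule nn_integral_cmult) measurable
  also have "\<dots> \<le> ennreal ?V" using B i(2) by (subst ennreal_mult[symmetric]) (auto simp: field_simps intro!: ennreal_leI)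
  finally have "lx \<kappa> u k0 x0 \<le> ennreal (t * B)" using t B by (intro lx_le) auto
  then show False using inf ennreal_neq_top[of "t * B"] by (simp add: top_unique del: ennreal_neq_top)
 qed
 have "\<not> (\<integral>y\<in>trip k x. ennreal (phi \<kappa> (\<bar>u y\<bar> / t) * \<sigma> y)) \<le> ennreal (s k x * (3 ^ DIM('a) * dvol TYPE('a) k))" if "t > 0" for t
 proof -
  have "(\<integral>y\<in>trip k0 x0. ennreal (phi \<kappa> (\<bar>u y\<bar> / t) * \<sigma> y)) \<le> (\<integral>y\<in>trip k x. ennreal (phi \<kappa> (\<bar>u y\<bar> / t) * \<sigma> y))"
   using k by (intro nn_integral_mono) (auto simp: indicator_def)
  then have "(\<integral>y\<in>trip k x. ennreal (phi \<kappa> (\<bar>u y\<bar> / t) * \<sigma> y)) = \<infinity>" using I[OF that] by (simp add: top_unique)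
  then show ?thesis by (simp add: top_unique)
 qed
 then have "{ennreal t |t. t > 0 \<and> (\<integral>y\<in>trip k x. ennreal (phi \<kappa> (\<bar>u y\<bar> / t) * \<sigma> y)) \<le> ennreal (s k x * (3 ^ DIM('a) * dvol TYPE('a) k))} = {}" by blast
 then have "lx \<kappa> u k x = \<infinity>" unfolding lx_eq by (simp only: Inf_empty infinity_ennreal_def)
 then show ?thesis using lx_le_OM[of x k x \<kappa> u] by (simp add: top_unique)
qed

lemma trip_v_finite: "(\<integral>y\<in>trip k x. ennreal (v y)) < \<infinity>"
proof -
 have "(\<integral>y\<in>trip k x. ennreal (1 * v y)) \<le> ennreal (C * a k x) * (\<integral>y\<in>trip k x. ennreal 1)"
  by (rule dc_v_le) auto
 also have "\<dots> < \<infinity>" using emeasure_trip[of k x] by (simp add: ennreal_mult_less_top)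
 finally show ?thesis by simp
qed

lemma dHL_pos: assumes "\<And>y. v y \<le> P y" shows "dHL P x > 0"
proof -
 have "ennreal (a 0 x * dvol TYPE('a) 0) / ennreal (dvol TYPE('a) 0) \<le> (\<integral>z\<in>dc 0 x. ennreal (P z)) / ennreal (dvol TYPE('a) 0)"
  unfolding v_dc[symmetric] using assms by (intro divide_right_mono_ennreal nn_integral_mono mult_right_mono ennreal_leI) auto
 also have "\<dots> \<le> dHL P x" by (rule le_dHL) simp
 finally have "ennreal (a 0 x) \<le> dHL P x" using a_pos[of 0 x] by (simp add: divide_ennreal)
 moreover have "ennreal (a 0 x) > 0" using a_pos[of 0 x] by simp
 ultimately show ?thesis by (rule less_le_trans[rotated])
qed

end

text \<open>The branches of \<open>Psi\<close> are the dominant terms of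
  \<open>t powr p' * (1 + t powr (1 - q'))\<close> for \<open>t < 1\<close> and
  \<open>t \<ge> 1\<close>; this is where \<open>Psi\<close> comes from.\<close>

lemma Psi_ge:
 assumes t: "t > 0" and pq: "conj_exp p > 1" "conj_exp p \<le> conj_exp q"
 shows "t \<le> Psi p q t" "t powr conj_exp p * (1 + t powr (1 - conj_exp q)) \<le> 2 * Psi p q t"
proof -
 let ?p = "conj_exp p" and ?q = "conj_exp q"
 show "t \<le> Psi p q t"
 proof (cases "t < 1")
  case True
  have "t powr 1 \<le> t powr (?p + 1 - ?q)" using True t pq by (intro powr_mono') auto
  then show ?thesis using True t by (simp add: Psi_def)
 next
  case False
  have "t powr 1 \<le> t powr ?p" using False pq by (intro powr_mono) auto
  then show ?thesis using False t by (simp add: Psi_def)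
 qed
 have e: "t powr ?p * (1 + t powr (1 - ?q)) = t powr ?p + t powr (?p + 1 - ?q)"
  using t by (simp add: distrib_left powr_add[symmetric] algebra_simps)
 show "t powr ?p * (1 + t powr (1 - ?q)) \<le> 2 * Psi p q t"
 proof (cases "t < 1")
  case True
  have "t powr ?p \<le> t powr (?p + 1 - ?q)" using True t pq by (intro powr_mono') auto
  then show ?thesis using True unfolding e by (simp add: Psi_def)
 next
  case False
  have "t powr (?p + 1 - ?q) \<le> t powr ?p" using False pq by (intro powr_mono) auto
  then show ?thesis using False unfolding e by (simp add: Psi_def)
 qed
qed

lemma Psi_measurable [measurable]: "Psi p q \<in> borel_measurable borel"
 unfolding Psi_def[abs_def] by measurable

lemma bounded_range_norm: "bounded (range f) \<Longrightarrow> \<exists>M. \<forall>y. norm (f y) \<le> M"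
 unfolding bounded_iff by blast

lemma weighted_bounded_adm:
 assumes bd: "bmo_data b c \<theta> J" and RH: "v \<in> RH_infty" and f [measurable]: "lm f"
  and bf: "bounded (range f)" and S: "compact S" "\<And>x. x \<notin> S \<Longrightarrow> f x = 0"
 shows "adm b (\<lambda>y. f y * of_real (v y))"
  "(\<integral>y\<in>trip k x. ennreal (bw m b (c k x) y) * enorm (f y * of_real (v y))) < \<infinity>"
proof -
 have [measurable]: "lm v" using RH by (simp add: RH_infty_def is_weight_def locally_integrable_def)
 obtain M where M: "\<And>y. cmod (f y) \<le> M" using bounded_range_norm[OF bf] by blast
 obtain M' where M': "AE y. y \<in> S \<longrightarrow> \<bar>v y\<bar> \<le> M'" using RH_bounded[OF RH compact_imp_bounded[OF S(1)]] by blast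
 have "AE y. cmod (f y * of_real (v y)) \<le> M * \<bar>M'\<bar>"
  using M'
 proof eventually_elim
  case (elim y)
  show ?case
  proof (cases "y \<in> S")
   case True
   then have "\<bar>v y\<bar> \<le> \<bar>M'\<bar>" using elim by linarith
   then have "cmod (f y) * \<bar>v y\<bar> \<le> M * \<bar>M'\<bar>" using order_trans[OF norm_ge_zero M[of y]] by (intro mult_mono M) auto
   then show ?thesis by (simp add: norm_mult)
  next
   case False
   then show ?thesis using S(2) order_trans[OF norm_ge_zero M[of y]] by simp
  qed
 qed
 note * = bmo_data.bounded_adm[OF bd _ this compact_imp_bounded[OF S(1)]]
 show "adm b (\<lambda>y. f y * of_real (v y))" using S(2) by (intro *) auto
 show "(\<integral>y\<in>trip k x. ennreal (bw m b (c k x) y) * enorm (f y * of_real (v y))) < \<infinity>" using S(2) by (intro *) auto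
qed

section \<open>The normalised weak type estimate and the removal of the normalisation\<close>

abbreviation weak_estimate :: "(('a::euclidean_space \<Rightarrow> complex) \<Rightarrow> 'a \<Rightarrow> complex) \<Rightarrow> ('a \<Rightarrow> real) \<Rightarrow> ('a \<Rightarrow> real) \<Rightarrow> ('a \<Rightarrow> real) \<Rightarrow> nat \<Rightarrow> real \<Rightarrow> real \<Rightarrow> real \<Rightarrow> real \<Rightarrow> bool" where
 "weak_estimate T u v b m \<epsilon> p q C \<equiv> (\<forall>f S. lm f \<longrightarrow> bounded (range f) \<longrightarrow> compact S \<longrightarrow> (\<forall>x. x \<notin> S \<longrightarrow> f x = 0) \<longrightarrow>
   (\<integral>x. ennreal (u x * v x) *
     indicator {x. cmod (commutator T b m (\<lambda>y. f y * of_real (v y)) x) / v x > 1} x)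
   \<le> ennreal C * (\<integral>x. ennreal (Phi m 0 (cmod (f x)))
      * orlicz_max (Phi m \<epsilon>) (\<lambda>y. v y powr (1 - conj_exp q)) u x
      * HL_max (\<lambda>y. Psi p q (v y)) x))"

lemma weak_normalized:
 fixes u v b :: "'a::euclidean_space \<Rightarrow> real"
 assumes u_nonneg: "\<forall>x. 0 \<le> u x" and u_loc: "locally_integrable u"
  and q2: "q > 2" and vRH: "v \<in> RH_infty" and vA: "v \<in> A_class q"
  and b: "locally_integrable b" and osc: "\<forall>Q. is_cube Q \<longrightarrow> avg (\<lambda>x. \<bar>b x - avg b Q\<bar>) Q \<le> 1"
  and eps: "\<epsilon> > 0" and CZ: "CZO T K" and p: "p > max q (1 + (real m + 1) / \<epsilon>)"
 shows "\<exists>C>0. weak_estimate T u v b m \<epsilon> p q C"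
proof -
 define \<kappa> where "\<kappa> = real m + \<epsilon>"
 \<comment> \<open>The strong estimate is used at the conjugate exponent of \<open>p\<close>:
   \<open>p > 2\<close> gives \<open>r < 2\<close>, \<open>p > q\<close> gives
   \<open>r - 1 < conj_exp q - 1\<close>, and the bound on \<open>p\<close> by \<epsilon> is the
   condition on \<kappa>.\<close>
 define r where "r = conj_exp p"
 have p1: "p > 2" "p > q" "p - 1 > (real m + 1) / \<epsilon>" using p q2 by auto
 have r: "1 < r" "r < 2" using p1 by (auto simp: r_def conj_exp_def field_simps)
 have rq: "r < conj_exp q" using p1 q2 by (simp add: r_def conj_exp_def field_simps)
 have \<kappa>: "\<kappa> > (real m + 1) * r - 1"
 proof -
  have "r = 1 + 1 / (p - 1)" using p1 by (simp add: r_def conj_exp_def field_simps)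
  then have "(real m + 1) * r - 1 = real m + (real m + 1) / (p - 1)" by (simp add: distrib_left)
  also have "(real m + 1) / (p - 1) < \<epsilon>" using p1 eps by (simp add: field_simps)
  finally show ?thesis by (simp add: \<kappa>_def)
 qed
 have \<kappa>0: "\<kappa> \<ge> 0" using eps by (simp add: \<kappa>_def)
 obtain w a s C where mu: "muckenhoupt w (conj_exp q - 1) a s C" and wv: "AE y. w y = v y"
  using RH_A_muckenhoupt[OF vRH vA] q2 by auto
 obtain \<theta> where bd: "bmo_data b (\<lambda>k x. avg b (tcl k x)) \<theta> (9 * 3 ^ DIM('a))"
  using oscillation_bmo_data[OF b] osc by blast
 let ?c = "\<lambda>k x. avg b (tcl k x)"
 interpret cz: czo T K using CZ by unfold_locales
 interpret czo_weight T K b ?c \<theta> "9 * 3 ^ DIM('a)" w "conj_exp q - 1" a s C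
  using cz.czo_axioms bd mu by (rule czo_weight.intro)
 have um [measurable]: "lm u" using u_loc by (simp add: locally_integrable_def)
 have vm [measurable]: "lm v" using vRH by (simp add: RH_infty_def is_weight_def locally_integrable_def)
 define P where "P y = Psi p q (w y)" for y
 have Pm [measurable]: "lm P" unfolding P_def[abs_def] by measurable
 have P1: "w y \<le> P y" for y unfolding P_def using v_pos r rq by (intro Psi_ge) (auto simp: r_def)
 have P2: "w y powr r * (1 + \<sigma> y) \<le> 2 * P y" for y
  using Psi_ge(2)[OF v_pos, of p q y] r rq by (simp add: P_def \<sigma>_def r_def)
 define G where "G f x = ennreal (phi (real m) (cmod (f x))) * OM \<kappa> u x * dHL P x" for f :: "'a \<Rightarrow> complex" and x
 define R where "R f = (\<integral>x. ennreal (Phi m 0 (cmod (f x)))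
      * orlicz_max (Phi m \<epsilon>) (\<lambda>y. v y powr (1 - conj_exp q)) u x
      * HL_max (\<lambda>y. Psi p q (v y)) x)" for f :: "'a \<Rightarrow> complex"
 have GR: "(\<integral>x. G f x) \<le> R f" for f
  unfolding R_def G_def
 proof (intro nn_integral_mono mult_mono)
  fix x
  show "OM \<kappa> u x \<le> orlicz_max (Phi m \<epsilon>) (\<lambda>y. v y powr (1 - conj_exp q)) u x"
   unfolding Phi_phi \<kappa>_def by (rule OM_le_orlicz_max) (use wv in \<open>auto simp: \<sigma>_def\<close>)
  have "P y \<ge> 0" for y using P1[of y] v_pos[of y] by linarith
  then show "dHL P x \<le> HL_max (\<lambda>y. Psi p q (v y)) x"
   by (intro dHL_le_HL_max) (use wv in \<open>auto simp: P_def\<close>)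
 qed (auto simp: Phi_phi)
 have adm: "adm b (\<lambda>y. f y * of_real (v y))"
   "(\<integral>y\<in>trip k x. ennreal (bw m b (?c k x) y) * enorm (f y * of_real (v y))) < \<infinity>"
  if "lm f" "bounded (range f)" "compact S" "\<forall>x. x \<notin> S \<longrightarrow> f x = 0" for f S k x
  using weighted_bounded_adm[OF bd vRH that(1-3)] that(4) by auto
 have cmw: "AE y. cmod (f y * of_real (v y)) = cmod (f y) * w y" for f :: "'a \<Rightarrow> complex"
  using wv
 proof eventually_elim
  case (elim y)
  then show ?case using v_pos[of y] by (simp add: norm_mult)
 qed
 show ?thesis
 proof (cases "\<forall>k x. lx \<kappa> u k x < \<infinity>")
  case True
  have rq': "r - 1 < conj_exp q - 1" using rq by simp
  from weak_dyadic[OF r rq' \<kappa> um u_nonneg[rule_format] Pm P1 P2 True[rule_format]] obtain K' where K': "K' > 0" and K'2: "dyadic_estimate m \<kappa> u P K'"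
   by (elim exE conjE) (rule that)
  have "(\<integral>x. ennreal (u x * v x) * indicator {x. cmod (commutator T b m (\<lambda>y. f y * of_real (v y)) x) / v x > 1} x) \<le> ennreal K' * R f"
   if f [measurable]: "lm f" and bf: "bounded (range f)" and S: "compact S" "\<forall>x. x \<notin> S \<longrightarrow> f x = 0" for f S
  proof -
   let ?F = "\<lambda>y. f y * of_real (v y)"
   obtain M where M: "\<And>y. cmod (f y) \<le> M" using bounded_range_norm[OF bf] by blast
   obtain k where k: "S \<subseteq> trip k (0::'a)" using bounded_subset_trip[OF compact_imp_bounded[OF S(1)]] .
   have "(\<integral>y. ennreal (phi (real m) (cmod (f y)) * w y)) \<le> (\<integral>y. ennreal (phi (real m) M) * (ennreal (w y) * indicator (trip k 0) y))"
   proof (rule nn_integral_mono)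
    fix y
    show "ennreal (phi (real m) (cmod (f y)) * w y) \<le> ennreal (phi (real m) M) * (ennreal (w y) * indicator (trip k 0) y)"
    proof (cases "y \<in> trip k 0")
     case True
     have "phi (real m) (cmod (f y)) \<le> phi (real m) M" by (intro phi_mono M) auto
     then show ?thesis using True v_pos[of y] by (auto simp: ennreal_mult''[symmetric] intro!: ennreal_leI mult_right_mono)
    next
     case False
     then have "f y = 0" using S(2) k by blast
     then show ?thesis by (simp add: phi_def)
    qed
   qed
   also have "\<dots> = ennreal (phi (real m) M) * (\<integral>y\<in>trip k 0. ennreal (w y))" by (rule nn_integral_cmult) measurable
   also have "\<dots> < \<infinity>" using trip_v_finite[of k 0] by (simp add: ennreal_mult_less_top)
   finally have fin: "(\<integral>y. ennreal (phi (real m) (cmod (f y)) * w y)) < \<infinity>" .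
   have "(\<integral>x. ennreal (u x * v x) * indicator {x. cmod (commutator T b m ?F x) / v x > 1} x)
    \<le> (\<integral>x. ennreal (u x * w x) * indicator {x. cmod (commutator T b m ?F x) > w x} x)"
   proof (rule nn_integral_mono_AE)
    show "AE x. ennreal (u x * v x) * indicator {x. cmod (commutator T b m ?F x) / v x > 1} x \<le> ennreal (u x * w x) * indicator {x. cmod (commutator T b m ?F x) > w x} x"
     using wv
    proof eventually_elim
     case (elim x)
     then have "v x > 0" using v_pos[of x] by simp
     then have "(cmod (commutator T b m ?F x) / v x > 1) = (cmod (commutator T b m ?F x) > w x)" using elim by (simp add: field_simps)
     then show ?case using elim by (simp add: indicator_def)
    qed
   qed
   also have "\<dots> \<le> ennreal K' * (\<integral>x. G f x)"
    unfolding G_def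
    by (rule K'2[rule_format, OF adm(1)[OF f bf S] compact_imp_bounded[OF S(1)] _ adm(2)[OF f bf S] _ _ cmw fin]) (use S in auto)
   also have "\<dots> \<le> ennreal K' * R f" by (intro mult_left_mono GR) simp
   finally show ?thesis .
  qed
  with K' show ?thesis unfolding R_def by blast
 next
  case False
  then obtain k0 x0 where inf: "lx \<kappa> u k0 x0 = \<infinity>" by (auto simp: not_less top_unique)
  have OMi: "OM \<kappa> u x = \<infinity>" for x by (rule OM_infinite[OF um \<kappa>0 inf])
  have "(\<integral>x. ennreal (u x * v x) * indicator {x. cmod (commutator T b m (\<lambda>y. f y * of_real (v y)) x) / v x > 1} x) \<le> ennreal 1 * R f"
   if f [measurable]: "lm f" and bf: "bounded (range f)" and S: "compact S" "\<forall>x. x \<notin> S \<longrightarrow> f x = 0" for f S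
  proof (cases "R f = \<infinity>")
   case False
   have Gm: "lm (G f)" unfolding G_def[abs_def] by measurable
   \<comment> \<open>\<open>G f\<close> is a product with one infinite and one positive factor, so
     where it is finite the factor \<open>phi (|f|)\<close> is 0.\<close>
   have "(\<integral>x. G f x) \<noteq> \<infinity>" using GR[of f] False by (auto simp: top_unique)
   then have "AE x. G f x \<noteq> \<infinity>" by (rule nn_integral_PInf_AE[OF Gm])
   then have "AE x. f x * of_real (v x) = 0"
   proof eventually_elim
    case (elim x)
    have "dHL P x \<noteq> 0" using dHL_pos[of P x] P1 by auto
    then have "ennreal (phi (real m) (cmod (f x))) = 0" using elim OMi[of x] by (auto simp: G_def ennreal_mult_eq_top_iff)
    then have "phi (real m) (cmod (f x)) \<le> 0" by (simp add: ennreal_eq_0_iff)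
    then have "cmod (f x) \<le> 0" using phi_ge[of "cmod (f x)" "real m"] by linarith
    then show ?case by simp
   qed
   then have "AE x. commutator T b m (\<lambda>y. f y * of_real (v y)) x = 0"
    by (intro cz.comm_null adm(1)[OF f bf S])
   then have "AE x. ennreal (u x * v x) * indicator {x. cmod (commutator T b m (\<lambda>y. f y * of_real (v y)) x) / v x > 1} x = 0"
    by eventually_elim simp
   then have "(\<integral>x. ennreal (u x * v x) * indicator {x. cmod (commutator T b m (\<lambda>y. f y * of_real (v y)) x) / v x > 1} x) = (\<integral>(x::'a). 0)"
    by (rule nn_integral_cong_AE)
   then show ?thesis by simp
  qed simp
  then show ?thesis unfolding R_def by (intro exI[of _ 1] conjI allI impI) auto
 qed
qed

text \<open>\<open>b\<close> is constant on each of the triples around 0. These constants agree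
  because the triples share a set of positive measure, and the triples exhaust the space.\<close>

lemma oscillation_zero_const:
 fixes b :: "'a::euclidean_space \<Rightarrow> real"
 assumes b: "locally_integrable b" and osc: "\<And>Q. is_cube Q \<Longrightarrow> avg (\<lambda>x. \<bar>b x - avg b Q\<bar>) Q \<le> 0"
 shows "\<exists>d. AE y. b y = d"
proof -
 define c where "c l = avg b (tcl (- int l) (0::'a))" for l
 have [measurable]: "lm b" using b by (simp add: locally_integrable_def)
 have ae: "AE y. y \<in> trip (- int l) 0 \<longrightarrow> b y = c l" for l
 proof -
  let ?k = "- int l"
  have "(\<integral>y\<in>trip ?k 0. ennreal \<bar>b y - c l\<bar>) = 0"
   unfolding c_def oscillation_nn_integral[OF b] using osc[OF is_cube_tcl[of ?k 0]] by (intro ennreal_neg mult_nonpos_nonneg) auto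
  then have "AE y. ennreal \<bar>b y - c l\<bar> * indicator (trip ?k 0) y = 0" by (subst (asm) nn_integral_0_iff_AE) auto
  then show ?thesis by eventually_elim (auto simp: indicator_def split: if_splits)
 qed
 have cc: "c l = c 0" for l
 proof (rule ccontr)
  assume ne: "c l \<noteq> c 0"
  have sub: "trip 0 (0::'a) \<subseteq> trip (- int l) 0" by (rule trip_mono) simp
  have "AE y. y \<notin> trip 0 (0::'a)"
   using ae[of l] ae[of 0]
  proof eventually_elim
   case (elim y)
   then show ?case using ne sub by auto
  qed
  then have "trip 0 (0::'a) \<in> null_sets lebesgue" using AE_iff_null_sets[of "trip 0 (0::'a)" lebesgue] by simp
  then have "leb (trip 0 (0::'a)) = 0" by blast
  then show False unfolding emeasure_trip by simp
 qed
 have "AE y. \<forall>l. y \<in> trip (- int l) 0 \<longrightarrow> b y = c l" using ae by (simp add: AE_all_countable)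
 then have "AE y. b y = c 0"
 proof eventually_elim
  case (elim y)
  have "y \<in> (\<Union>l. trip (0 - int l) 0)" unfolding UN_trip by simp
  then show ?case using elim cc by auto
 qed
 then show ?thesis by blast
qed

text \<open>Centred at \<open>d\<close>, the symbol is null, and so are both terms of the
  recursion.\<close>

lemma (in czo) comm_const:
 assumes ad: "adm b F" and d: "AE y. b y = d"
 shows "AE x. commutator T b (Suc k) F x = 0"
proof -
 let ?b = "\<lambda>x. b x - d"
 have ad': "adm ?b F" by (rule adm_shift[OF ad])
 have "AE x. of_real (?b x) * F x = 0" using d by eventually_elim simp
 then have "AE x. commutator T ?b k (\<lambda>y. of_real (?b y) * F y) x = 0"
  by (rule comm_null[OF adm_mult[OF ad']])
 then have "AE x. commutator T ?b (Suc k) F x = 0"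
  using d by eventually_elim simp
 then show ?thesis using comm_shift[OF ad, of d "Suc k"] by eventually_elim (simp del: commutator.simps)
qed

text \<open>The commutator is homogeneous of degree \<open>m\<close> in \<open>b\<close> and linear
  in \<open>f\<close>. Scaling \<open>b\<close> to mean oscillation at most 1 and multiplying
  \<open>f\<close> by \<open>\<beta> ^ m / t\<close> removes both parameters, except when \<beta> =
  0 and \<open>m > 0\<close>.\<close>

theorem theorem1p1:
  fixes u v b :: "'a::euclidean_space \<Rightarrow> real"
    and T :: "('a \<Rightarrow> complex) \<Rightarrow> 'a \<Rightarrow> complex"
    and K :: "'a \<Rightarrow> complex"
    and q p \<epsilon> :: real and m :: nat
  assumes u_nonneg: "\<forall>x. 0 \<le> u x" and u_loc: "locally_integrable u"
    and q2: "q > 2"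
    and vRH: "v \<in> RH_infty" and vA: "v \<in> A_class q"
    and bBMO: "b \<in> BMO"
    and eps: "\<epsilon> > 0"
    and CZ: "CZO T K"
    and p: "p > max q (1 + (real m + 1) / \<epsilon>)"
  shows "\<exists>C>0. \<forall>t>0. \<forall>f::'a \<Rightarrow> complex.
      f \<in> borel_measurable lebesgue \<longrightarrow> bounded (range f) \<longrightarrow>
      (\<exists>S. compact S \<and> (\<forall>x. x \<notin> S \<longrightarrow> f x = 0)) \<longrightarrow>
      (\<integral>\<^sup>+x. ennreal (u x * v x) *
          indicator {x. cmod (commutator T b m (\<lambda>y. f y * of_real (v y)) x) / v x > t} x \<partial>lebesgue)
      \<le> ennreal C * (\<integral>\<^sup>+x. ennreal (Phi m 0 (bmo_norm b ^ m * cmod (f x) / t))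
            * orlicz_max (Phi m \<epsilon>) (\<lambda>y. v y powr (1 - conj_exp q)) u x
            * HL_max (\<lambda>y. Psi p q (v y)) x \<partial>lebesgue)"
proof -
 interpret czo T K using CZ by unfold_locales
 define \<beta> where "\<beta> = bmo_norm b"
 have b: "locally_integrable b" using bBMO by (simp add: BMO_def)
 have osc: "avg (\<lambda>x. \<bar>b x - avg b Q\<bar>) Q \<le> \<beta>" if "is_cube Q" for Q
  unfolding \<beta>_def bmo_norm_def using bBMO that by (intro cSup_upper) (auto simp: BMO_def)
 have avg_ge: "avg (\<lambda>x. \<bar>b x - avg b Q\<bar>) Q \<ge> 0" for Q
  by (auto simp: avg_def set_lebesgue_integral_def intro!: divide_nonneg_nonneg integral_nonneg_AE)
 have \<beta>0: "\<beta> \<ge> 0" using order_trans[OF avg_ge osc[OF is_cube_tcl[of 0 0]]] .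
 \<comment> \<open>The default 1 is used only for \<beta> = 0; outside the degenerate case this
   leaves \<open>m = 0\<close>, and \<open>s ^ m * \<beta> ^ m = 1\<close> still holds.\<close>
 define s where "s = (if \<beta> > 0 then 1 / \<beta> else 1)"
 have s: "s > 0" by (simp add: s_def)
 let ?b = "\<lambda>x. s * b x"
 have sb: "locally_integrable ?b" using b by (auto simp: locally_integrable_def intro!: set_integrable_mult_right)
 have avs: "avg ?b Q = s * avg b Q" for Q by (simp add: avg_def)
 have sosc: "avg (\<lambda>x. \<bar>?b x - avg ?b Q\<bar>) Q \<le> 1" if Q: "is_cube Q" for Q
 proof -
  have "avg (\<lambda>x. \<bar>?b x - avg ?b Q\<bar>) Q = avg (\<lambda>x. s * \<bar>b x - avg b Q\<bar>) Q"
   unfolding avs right_diff_distrib[symmetric] abs_mult using s by simp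
  also have "\<dots> = s * avg (\<lambda>x. \<bar>b x - avg b Q\<bar>) Q" by (simp add: avg_def)
  also have "\<dots> \<le> s * \<beta>" using osc[OF Q] s by (intro mult_left_mono) auto
  also have "\<dots> \<le> 1" using \<beta>0 by (simp add: s_def)
  finally show ?thesis .
 qed
 then have sosc': "\<forall>Q. is_cube Q \<longrightarrow> avg (\<lambda>x. \<bar>?b x - avg ?b Q\<bar>) Q \<le> 1" by blast
 obtain \<theta> where bd: "bmo_data ?b (\<lambda>k x. avg ?b (tcl k x)) \<theta> (9 * 3 ^ DIM('a))"
  using oscillation_bmo_data[OF sb sosc] by blast
 have ad: "adm b (\<lambda>y. f y * of_real (v y))"
  if "lm f" "bounded (range f)" "compact S" "\<forall>x. x \<notin> S \<longrightarrow> f x = 0" for f S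
 proof -
  have "adm ?b (\<lambda>y. f y * of_real (v y))" using weighted_bounded_adm(1)[OF bd vRH that(1-3)] that(4) by blast
  from adm_dilate[OF this, of "1 / s"] show ?thesis using s by simp
 qed
 show ?thesis
 proof (cases "\<beta> = 0 \<and> m > 0")
  \<comment> \<open>The right-hand side is 0 because \<open>bmo_norm b ^ m = 0\<close>; the
    left-hand side is 0 as well, since \<open>b\<close> is constant almost everywhere.\<close>
  case True
  obtain k where k: "m = Suc k" using True by (cases m) auto
  obtain d where d: "AE y. b y = d" using oscillation_zero_const[OF b] osc True by auto
  have "(\<integral>x. ennreal (u x * v x) * indicator {x. cmod (commutator T b m (\<lambda>y. f y * of_real (v y)) x) / v x > t} x) = 0"
   if t: "t > 0" and f: "lm f" "bounded (range f)" "compact S" "\<forall>x. x \<notin> S \<longrightarrow> f x = 0" for t f S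
  proof -
   have "AE x. commutator T b m (\<lambda>y. f y * of_real (v y)) x = 0"
    unfolding k by (rule comm_const[OF ad[OF f] d])
   then have "AE x. ennreal (u x * v x) * indicator {x. cmod (commutator T b m (\<lambda>y. f y * of_real (v y)) x) / v x > t} x = 0"
    by eventually_elim (use t in simp)
   then have "(\<integral>x. ennreal (u x * v x) * indicator {x. cmod (commutator T b m (\<lambda>y. f y * of_real (v y)) x) / v x > t} x) = (\<integral>(x::'a). 0)"
    by (rule nn_integral_cong_AE)
   then show ?thesis by simp
  qed
  then show ?thesis by (intro exI[of _ 1] conjI allI impI) auto
 next
  case False
  have s\<beta>: "s ^ m * \<beta> ^ m = 1" using False \<beta>0 by (cases "\<beta> = 0") (auto simp: s_def power_mult_distrib[symmetric])
  from weak_normalized[OF u_nonneg u_loc q2 vRH vA sb sosc' eps CZ p] obtain C where C: "C > 0" and C2: "weak_estimate T u v ?b m \<epsilon> p q C"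
   by (elim exE conjE) (rule that)
  have "(\<integral>x. ennreal (u x * v x) *
     indicator {x. cmod (commutator T b m (\<lambda>y. f y * of_real (v y)) x) / v x > t} x)
   \<le> ennreal C * (\<integral>x. ennreal (Phi m 0 (bmo_norm b ^ m * cmod (f x) / t))
      * orlicz_max (Phi m \<epsilon>) (\<lambda>y. v y powr (1 - conj_exp q)) u x
      * HL_max (\<lambda>y. Psi p q (v y)) x)"
   if t: "t > 0" and f: "lm f" "bounded (range f)" "compact S" "\<forall>x. x \<notin> S \<longrightarrow> f x = 0" for t f S
  proof -
   let ?F = "\<lambda>y. f y * of_real (v y)"
   \<comment> \<open>With this factor \<open>s ^ m * z = 1 / t\<close>, so the rescaled commutator
     is the original one divided by \<open>t\<close>.\<close>
   define z where "z = complex_of_real (\<beta> ^ m / t)"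
   define f' where "f' y = z * f y" for y
   have f'm: "lm f'" unfolding f'_def[abs_def] using f(1) by measurable
   have f'b: "bounded (range f')"
   proof -
    obtain M where M: "\<And>y. cmod (f y) \<le> M" using bounded_range_norm[OF f(2)] by blast
    have "norm (f' y) \<le> cmod z * M" for y unfolding f'_def norm_mult by (intro mult_left_mono M) simp
    then show ?thesis unfolding bounded_iff by blast
   qed
   have f's: "\<forall>x. x \<notin> S \<longrightarrow> f' x = 0" using f(4) by (simp add: f'_def)
   have "AE x. commutator T ?b m (\<lambda>y. f' y * of_real (v y)) x = commutator T b m ?F x / of_real t"
    using comm_dilate[OF adm_scale[OF ad[OF f], of z], of s m] comm_scale[OF ad[OF f], of m z]
   proof eventually_elim
    case (elim x)
    have "of_real (s ^ m) * z = 1 / complex_of_real t" unfolding z_def of_real_mult[symmetric] using s\<beta> by simp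
    then have "of_real s ^ m * (z * commutator T b m ?F x) = commutator T b m ?F x / of_real t"
     by (simp add: mult.assoc[symmetric])
    then show ?case using elim by (simp add: f'_def mult.assoc)
   qed
   then have "AE x. ennreal (u x * v x) * indicator {x. cmod (commutator T b m ?F x) / v x > t} x
     = ennreal (u x * v x) * indicator {x. cmod (commutator T ?b m (\<lambda>y. f' y * of_real (v y)) x) / v x > 1} x"
   proof eventually_elim
    case (elim x)
    have "(cmod (commutator T b m ?F x) / v x > t) = (cmod (commutator T ?b m (\<lambda>y. f' y * of_real (v y)) x) / v x > 1)"
    proof -
     have e: "cmod (commutator T b m ?F x / of_real t) / v x = cmod (commutator T b m ?F x) / v x / t" using t by (simp add: norm_divide)
     have "(X > t) = (X / t > 1)" for X using t by (simp add: field_simps)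
     then show ?thesis unfolding elim e .
    qed
    then show ?case by (simp add: indicator_def)
   qed
   then have "(\<integral>x. ennreal (u x * v x) * indicator {x. cmod (commutator T b m ?F x) / v x > t} x)
     = (\<integral>x. ennreal (u x * v x) * indicator {x. cmod (commutator T ?b m (\<lambda>y. f' y * of_real (v y)) x) / v x > 1} x)"
    by (rule nn_integral_cong_AE)
   also have "\<dots> \<le> ennreal C * (\<integral>x. ennreal (Phi m 0 (cmod (f' x)))
      * orlicz_max (Phi m \<epsilon>) (\<lambda>y. v y powr (1 - conj_exp q)) u x
      * HL_max (\<lambda>y. Psi p q (v y)) x)"
    by (rule C2[rule_format, OF f'm f'b f(3)]) (use f's in blast)
   also have "\<dots> = ennreal C * (\<integral>x. ennreal (Phi m 0 (bmo_norm b ^ m * cmod (f x) / t))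
      * orlicz_max (Phi m \<epsilon>) (\<lambda>y. v y powr (1 - conj_exp q)) u x
      * HL_max (\<lambda>y. Psi p q (v y)) x)"
   proof -
    have "cmod (f' x) = bmo_norm b ^ m * cmod (f x) / t" for x
     using t \<beta>0 by (simp add: f'_def z_def norm_mult norm_divide norm_power \<beta>_def)
    then show ?thesis by simp
   qed
   finally show ?thesis .
  qed
  with C show ?thesis by blast
 qed
qed

end
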